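(* Let $\Bbbk$ be a perfect field and let $K$ be an $n$-dimensional topological local field over $\Bbbk$. The ring $\mathrm{E}(K)$ of local Beilinson-Tate operators satisfies \[ \mathcal{D}^{\mathrm{cont}}_{K/\Bbbk} \subset \mathrm{E}(K) \subset \operatorname{End}^{\mathrm{cont}}_{\Bbbk}(K). \]
   Context: **Continuous operators.** $\operatorname{End}^{\mathrm{cont}}_{\Bbbk}(K)$ is the ring of continuous $\Bbbk$-linear operators $K\to K$. The ring of continuous differential operators $\mathcal{D}^{\mathrm{cont}}_{K/\Bbbk}\subset\operatorname{End}^{\mathrm{cont}}_{\Bbbk}(K)$ is $\bigcup_iF_i$, where $F_i:=0$ for $i\le-1$ and, for $i\ge0$, $F_i$ is the set of $\phi\in\operatorname{End}^{\mathrm{cont}}_{\Bbbk}(K)$ such that $a\circ\phi-\phi\circ a\in F_{i-1}$ for all $a\in K$ (acting by multiplication). **Semi-topological (ST) rings and modules.** $\Bbbk$ is a perfect field with the discrete topology. A $\Bbbk$-linear topology on a $\Bbbk$-module is a module topology in which $0$ has a basis of open neighborhoods consisting of $\Bbbk$-submodules. A commutative ST $\Bbbk$-ring is a commutative $\Bbbk$-ring $A$ with a $\Bbbk$-linear topology such that for every $a \in A$ the map $A \to A$, $b \mapsto ab$, is continuous; homomorphisms of ST $\Bbbk$-rings are the continuous $\Bbbk$-ring homomorphisms. A ST $A$-module is an $A$-module $M$ with a $\Bbbk$-linear topology such that for every $a \in A$ and $m \in M$ the maps $M \to M$, $m' \mapsto a m'$, and $A \to M$, $a' \mapsto a' m$,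 are continuous. The fine $A$-module topology on an $A$-module is the finest $\Bbbk$-linear topology making it a ST $A$-module (it exists). **Laurent series.** For a commutative ST $\Bbbk$-ring $A$: give $A[t]/(t^{i+1})$ the fine $A$-module topology, $A[[t]] = \lim_{\leftarrow i} A[t]/(t^{i+1})$ the inverse limit topology, and $A((t)) = A[[t]][t^{-1}]$ the fine $A[[t]]$-module topology. Recursively $A((t_1,\ldots,t_n)) := A((t_2,\ldots,t_n))((t_1))$. **Local fields.** An $n$-dimensional local field is a field $K$ with complete discrete valuation rings $\mathcal{O}_1(K),\ldots,\mathcal{O}_n(K)$ such that $K$ is the fraction field of $\mathcal{O}_1(K)$ and for $1\le i\le n-1$ the residue field of $\mathcal{O}_i(K)$ is the fraction field of $\mathcal{O}_{i+1}(K)$. Let $\boldsymbol{k}_i(K)$ be the residue field of $\mathcal{O}_i(K)$, and $\boldsymbol{k}_0(K):=K$. The ring of integers $\mathcal{O}(K) := \mathcal{O}_1(K)\times_{\boldsymbol{k}_1(K)}\mathcal{O}_2(K)\cdots\times_{\boldsymbol{k}_{n-1}(K)}\mathcal{O}_n(K)$ is a subring of $K$ ($\mathcal{O}(K)=K$ if $n=0$). For a finite field extension $\Bbbk'$ of $\Bbbk$ (discrete topology), the standard $n$-dimensional topological local field is $\Bbbk'((t_1,\ldots,t_n))$ with the iterated Laurent series topology (obtained from the discrete topology on $\Bbbk'$ by the recursion $\Bbbk'((t_1,\ldots,t_n)) = \Bbbk'((t_2,\ldots,t_n))((t_1))$, where $A((t))$ has the fine $A[[t]]$-module topology) and with $\mathcal{O}_i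 = \Bbbk'((t_{i+1},\ldots,t_n))[[t_i]]$. An $n$-dimensional topological local field (TLF) over $\Bbbk$ is an $n$-dimensional local field $K$ with a ring homomorphism $\Bbbk\to\mathcal{O}(K)$ such that $\Bbbk\to\boldsymbol{k}_n(K)$ is finite, and a topology making $K$ a ST $\Bbbk$-ring, for which there exists a $\Bbbk$-ring isomorphism $\Bbbk'((t_1,\ldots,t_n)) \to K$, $\Bbbk' := \boldsymbol{k}_n(K)$, that is a homeomorphism and respects the valuation rings (it maps $\mathcal{O}_1$ onto $\mathcal{O}_1$, the induced map on residue fields maps $\mathcal{O}_2$ onto $\mathcal{O}_2$, etc.). Each $\mathcal{O}_i(K)\subset\boldsymbol{k}_{i-1}(K)$ has the subspace topology and each $\boldsymbol{k}_i(K)$ has the quotient topology from $\mathcal{O}_i(K)$; then $\boldsymbol{k}_i(K)$ is an $(n-i)$-dimensional TLF. **Systems of liftings.** A system of liftings for $K$ is a sequence $\boldsymbol{\sigma}=(\sigma_1,\ldots,\sigma_n)$, where each $\sigma_i:\boldsymbol{k}_i(K)\to\mathcal{O}_i(K)$ is a continuous $\Bbbk$-ring homomorphism splitting the canonical surjection $\mathcal{O}_i(K)\to\boldsymbol{k}_i(K)$ (the empty sequence if $n=0$). If $n \geq 1$, $\mathrm{d}_1(\boldsymbol{\sigma}) := (\sigma_2,\ldots,\sigma_n)$, a system of liftings for $\boldsymbol{k}_1(K)$. **Lattices.** "Finite module" means finitely generated. For $n \ge 1$ and a finite $K$-module $M$, an $\mathcal{O}_1(K)$-lattice in $M$ is a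 finite $\mathcal{O}_1(K)$-submodule $L$ with $M = K\cdot L$; $\operatorname{Lat}(M)$ is the set of lattices, and $\operatorname{Lat}(M_1,M_2):=\operatorname{Lat}(M_1)\times\operatorname{Lat}(M_2)$. For lattices $L\subset L'$, $L'/L$ has finite length over $\mathcal{O}_1(K)$, and $\operatorname{rest}_{\sigma_1}(L'/L)$ denotes it as a finite $\boldsymbol{k}_1(K)$-module via $\sigma_1$. For a $\Bbbk$-linear $\phi:M_1\to M_2$ and $(L_1,L_2),(L'_1,L'_2)\in\operatorname{Lat}(M_1,M_2)$, $(L'_1,L'_2)$ is a $\phi$-refinement of $(L_1,L_2)$, written $(L'_1,L'_2)\prec_\phi(L_1,L_2)$, if $L'_1\subset L_1$, $L_2\subset L'_2$, $\phi(L'_1)\subset L_2$ and $\phi(L_1)\subset L'_2$; then there is an induced $\bar\phi:L_1/L'_1\to L'_2/L_2$. **BT operators.** For finite $K$-modules $M_1,M_2$ define $\mathrm{E}^K_{\boldsymbol{\sigma}}(M_1,M_2)\subset\operatorname{Hom}_{\Bbbk}(M_1,M_2)$ recursively. If $n=0$ it is all of $\operatorname{Hom}_{\Bbbk}(M_1,M_2)$. If $n\ge1$, $\phi$ belongs to it iff: (i) every $(L_1,L_2)\in\operatorname{Lat}(M_1,M_2)$ has some $\phi$-refinement; and (ii) for every $\phi$-refinement $(L'_1,L'_2)\prec_\phi(L_1,L_2)$ the induced $\bar\phi$ belongs to $\mathrm{E}^{\boldsymbol{k}_1(K)}_{\mathrm{d}_1(\boldsymbol{\sigma})}(\operatorname{rest}_{\sigma_1}(L_1/L'_1),\operatorname{rest}_{\sigma_1}(L'_2/L_2))$.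 **The ring of local Beilinson-Tate operators.** $\mathrm{E}(K):=\mathrm{E}^K_{\boldsymbol{\sigma}}(K,K)$, where $\boldsymbol{\sigma}$ is any system of liftings for $K$ (such systems exist, and this set does not depend on the choice of $\boldsymbol{\sigma}$). *)

theory Defs
  imports "HOL-Analysis.Analysis" "HOL-Algebra.Algebra"
begin

text \<open>
  Fields, rings and modules are records in the style of HOL-Algebra. The base field is a record
  \<open>k\<close>, and a \<open>k\<close>-ring is a ring record \<open>A\<close> together with its structure map \<open>\<iota> : k \<rightarrow> A\<close>.
  As usual in HOL-Algebra, a map is only meaningful on the carrier of its domain.
\<close>

section \<open>Modules\<close>

definition perfect_field :: "'k ring \<Rightarrow> bool" where
  "perfect_field k \<longleftrightarrow> field k \<and>
     (\<forall>p::nat. Factorial_Ring.prime p \<and> add_pow k p \<one>\<^bsub>k\<^esub> = \<zero>\<^bsub>k\<^esub> \<longrightarrow>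
        (\<forall>a\<in>carrier k. \<exists>b\<in>carrier k. b [^]\<^bsub>k\<^esub> p = a))"

definition with_smult :: "('m, 'e) ring_scheme \<Rightarrow> ('r \<Rightarrow> 'm \<Rightarrow> 'm) \<Rightarrow> ('r, 'm) module" where
  "with_smult R s =
     \<lparr>carrier = carrier R, monoid.mult = monoid.mult R, one = \<one>\<^bsub>R\<^esub>,
      ring.zero = \<zero>\<^bsub>R\<^esub>, add = add R, module.smult = s\<rparr>"

definition self_module :: "'a ring \<Rightarrow> ('a, 'a) module" where
  "self_module A = with_smult A (monoid.mult A)"

definition restrict_scalars :: "('k \<Rightarrow> 'r) \<Rightarrow> ('r, 'm) module \<Rightarrow> ('k, 'm) module" where
  "restrict_scalars f M = with_smult M (\<lambda>c x. f c \<odot>\<^bsub>M\<^esub> x)"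

definition mspan :: "'r ring \<Rightarrow> ('r, 'm) module \<Rightarrow> 'm set \<Rightarrow> 'm set" where
  "mspan R M S = \<Inter>{N. submodule N R M \<and> S \<subseteq> N}"

definition fg_submodule :: "'m set \<Rightarrow> 'r ring \<Rightarrow> ('r, 'm) module \<Rightarrow> bool" where
  "fg_submodule L R M \<longleftrightarrow> (\<exists>S. finite S \<and> S \<subseteq> carrier M \<and> L = mspan R M S)"

definition linear_maps :: "'k ring \<Rightarrow> ('k, 'm) module \<Rightarrow> ('k, 'n) module \<Rightarrow> ('m \<Rightarrow> 'n) set" where
  "linear_maps k M N = {\<phi> \<in> hom (add_monoid M) (add_monoid N).
     \<forall>c\<in>carrier k. \<forall>x\<in>carrier M. \<phi> (c \<odot>\<^bsub>M\<^esub> x) = c \<odot>\<^bsub>N\<^esub> \<phi> x}"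

section \<open>Semi-topological rings and modules\<close>

definition linear_topology :: "'k ring \<Rightarrow> ('k, 'm) module \<Rightarrow> 'm topology \<Rightarrow> bool" where
  "linear_topology k M Y \<longleftrightarrow>
     topspace Y = carrier M \<and>
     continuous_map (prod_topology Y Y) Y (\<lambda>(x, y). x \<oplus>\<^bsub>M\<^esub> y) \<and>
     continuous_map Y Y (\<lambda>x. \<ominus>\<^bsub>M\<^esub> x) \<and>
     continuous_map (prod_topology (discrete_topology (carrier k)) Y) Y (\<lambda>(c, x). c \<odot>\<^bsub>M\<^esub> x) \<and>
     (\<forall>U. openin Y U \<and> \<zero>\<^bsub>M\<^esub> \<in> U \<longrightarrow> (\<exists>N. submodule N k M \<and> openin Y N \<and> N \<subseteq> U))"

definition st_ring :: "'k ring \<Rightarrow> ('k \<Rightarrow> 'a) \<Rightarrow> 'a ring \<Rightarrow> 'a topology \<Rightarrow> bool" where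
  "st_ring k \<iota> A T \<longleftrightarrow>
     cring A \<and> \<iota> \<in> ring_hom k A \<and>
     linear_topology k (restrict_scalars \<iota> (self_module A)) T \<and>
     (\<forall>a\<in>carrier A. continuous_map T T (\<lambda>b. a \<otimes>\<^bsub>A\<^esub> b))"

definition st_module ::
  "'k ring \<Rightarrow> ('k \<Rightarrow> 'a) \<Rightarrow> 'a ring \<Rightarrow> 'a topology \<Rightarrow> ('a, 'm) module \<Rightarrow> 'm topology \<Rightarrow> bool" where
  "st_module k \<iota> A T M Y \<longleftrightarrow>
     module A M \<and>
     linear_topology k (restrict_scalars \<iota> M) Y \<and>
     (\<forall>a\<in>carrier A. continuous_map Y Y (\<lambda>m. a \<odot>\<^bsub>M\<^esub> m)) \<and>
     (\<forall>m\<in>carrier M. continuous_map T Y (\<lambda>a. a \<odot>\<^bsub>M\<^esub> m))"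

definition fine_topology ::
  "'k ring \<Rightarrow> ('k \<Rightarrow> 'a) \<Rightarrow> 'a ring \<Rightarrow> 'a topology \<Rightarrow> ('a, 'm) module \<Rightarrow> 'm topology" where
  "fine_topology k \<iota> A T M = (THE Y. st_module k \<iota> A T M Y \<and>
     (\<forall>Y'. st_module k \<iota> A T M Y' \<longrightarrow> (\<forall>U. openin Y' U \<longrightarrow> openin Y U)))"

text \<open>The quotient topology on the image of \<open>f\<close>. For injective \<open>f\<close> this merely transports \<open>T\<close>.\<close>

definition quotient_topology :: "('a \<Rightarrow> 'b) \<Rightarrow> 'a topology \<Rightarrow> 'b topology" where
  "quotient_topology f T = topology (\<lambda>U. U \<subseteq> f ` topspace T \<and> openin T {x \<in> topspace T. f x \<in> U})"

lemma openin_quotient_topology: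
  "openin (quotient_topology f T) U \<longleftrightarrow>
     U \<subseteq> f ` topspace T \<and> openin T {x \<in> topspace T. f x \<in> U}"
proof -
  let ?P = "\<lambda>U. U \<subseteq> f ` topspace T \<and> openin T {x \<in> topspace T. f x \<in> U}"
  have "istopology ?P"
    unfolding istopology_def
  proof (intro conjI allI impI)
    fix S V assume S: "?P S" and V: "?P V"
    have "{x \<in> topspace T. f x \<in> S \<inter> V} =
          {x \<in> topspace T. f x \<in> S} \<inter> {x \<in> topspace T. f x \<in> V}" by auto
    then show "openin T {x \<in> topspace T. f x \<in> S \<inter> V}" using S V by auto
    show "S \<inter> V \<subseteq> f ` topspace T" using S by auto
  next
    fix \<K> assume K: "\<forall>S\<in>\<K>. ?P S"
    have "{x \<in> topspace T. f x \<in> \<Union>\<K>} = \<Union>((\<lambda>S. {x \<in> topspace T. f x \<in> S}) ` \<K>)" by auto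
    then show "openin T {x \<in> topspace T. f x \<in> \<Union>\<K>}" using K by auto
    show "\<Union>\<K> \<subseteq> f ` topspace T" using K by blast
  qed
  then show ?thesis
    unfolding quotient_topology_def by simp
qed

section \<open>Laurent series\<close>

text \<open>A Laurent series is given by its coefficient function \<open>int \<Rightarrow> 'a\<close>.\<close>

definition laurent :: "'a ring \<Rightarrow> (int \<Rightarrow> 'a) ring" where
  "laurent A =
     \<lparr>carrier = {f. (\<forall>j. f j \<in> carrier A) \<and> (\<exists>N. \<forall>j<N. f j = \<zero>\<^bsub>A\<^esub>)},
      monoid.mult = (\<lambda>f g j. \<Oplus>\<^bsub>A\<^esub>i\<in>{i. f i \<noteq> \<zero>\<^bsub>A\<^esub> \<and> g (j - i) \<noteq> \<zero>\<^bsub>A\<^esub>}. f i \<otimes>\<^bsub>A\<^esub> g (j - i)),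
      one = (\<lambda>j. if j = 0 then \<one>\<^bsub>A\<^esub> else \<zero>\<^bsub>A\<^esub>),
      ring.zero = (\<lambda>j. \<zero>\<^bsub>A\<^esub>),
      add = (\<lambda>f g j. f j \<oplus>\<^bsub>A\<^esub> g j)\<rparr>"

definition const_series :: "'a ring \<Rightarrow> 'a \<Rightarrow> int \<Rightarrow> 'a" where
  "const_series A a = (\<lambda>j. if j = 0 then a else \<zero>\<^bsub>A\<^esub>)"

definition power_series :: "'a ring \<Rightarrow> (int \<Rightarrow> 'a) set" where
  "power_series A = {f \<in> carrier (laurent A). \<forall>j<0. f j = \<zero>\<^bsub>A\<^esub>}"

text \<open>
  The \<open>A\<close>-module \<open>A[t]/(t^(i+1))\<close>, each class being represented by its unique member of
  degree at most \<open>i\<close>, and the projection of \<open>A[[t]]\<close> onto it.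
\<close>

definition truncated_polys :: "'a ring \<Rightarrow> nat \<Rightarrow> ('a, int \<Rightarrow> 'a) module" where
  "truncated_polys A i = with_smult
     ((laurent A)\<lparr>carrier := {f \<in> power_series A. \<forall>j>int i. f j = \<zero>\<^bsub>A\<^esub>}\<rparr>)
     (\<lambda>a f j. a \<otimes>\<^bsub>A\<^esub> f j)"

definition truncate_series :: "'a ring \<Rightarrow> nat \<Rightarrow> (int \<Rightarrow> 'a) \<Rightarrow> int \<Rightarrow> 'a" where
  "truncate_series A i f = (\<lambda>j. if j \<le> int i then f j else \<zero>\<^bsub>A\<^esub>)"

definition power_series_topology ::
  "'k ring \<Rightarrow> ('k \<Rightarrow> 'a) \<Rightarrow> 'a ring \<Rightarrow> 'a topology \<Rightarrow> (int \<Rightarrow> 'a) topology" where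
  "power_series_topology k \<iota> A T = topology_generated_by
     {{f \<in> power_series A. truncate_series A i f \<in> U} |i U.
        openin (fine_topology k \<iota> A T (truncated_polys A i)) U}"

definition laurent_topology ::
  "'k ring \<Rightarrow> ('k \<Rightarrow> 'a) \<Rightarrow> 'a ring \<Rightarrow> 'a topology \<Rightarrow> (int \<Rightarrow> 'a) topology" where
  "laurent_topology k \<iota> A T =
     fine_topology k (\<lambda>c. const_series A (\<iota> c))
       ((laurent A)\<lparr>carrier := power_series A\<rparr>) (power_series_topology k \<iota> A T)
       (self_module (laurent A))"

text \<open>
  A single type that accommodates iterated Laurent series of every depth: an element of
  \<open>F((t_1,\<dots>,t_n))\<close> is an \<open>int\<close>-indexed family (in the outermost variable \<open>t_1\<close>) of elements of
  \<open>F((t_2,\<dots>,t_n))\<close>. The constructors only serve to transport the structures defined above.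
\<close>

datatype 'a iterated = Coeff 'a | Series "int \<Rightarrow> 'a iterated"

primrec std_field :: "nat \<Rightarrow> 'a ring \<Rightarrow> 'a iterated ring" where
  "std_field 0 F = image_ring Coeff F"
| "std_field (Suc n) F = image_ring Series (laurent (std_field n F))"

primrec std_structure :: "nat \<Rightarrow> 'a ring \<Rightarrow> ('k \<Rightarrow> 'a) \<Rightarrow> 'k \<Rightarrow> 'a iterated" where
  "std_structure 0 F \<iota> = (\<lambda>c. Coeff (\<iota> c))"
| "std_structure (Suc n) F \<iota> =
     (\<lambda>c. Series (const_series (std_field n F) (std_structure n F \<iota> c)))"

primrec std_topology :: "nat \<Rightarrow> 'k ring \<Rightarrow> 'a ring \<Rightarrow> ('k \<Rightarrow> 'a) \<Rightarrow> 'a iterated topology" where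
  "std_topology 0 k F \<iota> = quotient_topology Coeff (discrete_topology (carrier F))"
| "std_topology (Suc n) k F \<iota> = quotient_topology Series
     (laurent_topology k (std_structure n F \<iota>) (std_field n F) (std_topology n k F \<iota>))"

section \<open>Local fields\<close>

definition dvr :: "'a ring \<Rightarrow> bool" where
  "dvr R \<longleftrightarrow> principal_domain R \<and> \<not> field R \<and> (\<exists>!m. maximalideal m R)"

definition max_ideal :: "'a ring \<Rightarrow> 'a set" where
  "max_ideal R = (THE m. maximalideal m R)"

primrec ideal_power :: "'a ring \<Rightarrow> 'a set \<Rightarrow> nat \<Rightarrow> 'a set" where
  "ideal_power R I 0 = carrier R"
| "ideal_power R I (Suc i) = ideal_prod R I (ideal_power R I i)"

text \<open>
  \<open>R \<rightarrow> lim R/I^i\<close> is bijective; an element of the inverse limit is given by a sequence of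
  representatives.
\<close>

definition adically_complete :: "'a ring \<Rightarrow> 'a set \<Rightarrow> bool" where
  "adically_complete R I \<longleftrightarrow>
     (\<forall>x. (\<forall>i::nat. x i \<in> carrier R) \<and> (\<forall>i. x (Suc i) \<ominus>\<^bsub>R\<^esub> x i \<in> ideal_power R I i) \<longrightarrow>
        (\<exists>!y. y \<in> carrier R \<and> (\<forall>i. y \<ominus>\<^bsub>R\<^esub> x i \<in> ideal_power R I i)))"

definition complete_dvr :: "'a ring \<Rightarrow> bool" where
  "complete_dvr R \<longleftrightarrow> dvr R \<and> adically_complete R (max_ideal R)"

definition is_fraction_field :: "'a ring \<Rightarrow> 'a set \<Rightarrow> bool" where
  "is_fraction_field K D \<longleftrightarrow> field K \<and> subring D K \<and>
     (\<forall>x\<in>carrier K. \<exists>a\<in>D. \<exists>b\<in>D - {\<zero>\<^bsub>K\<^esub>}. x = a \<otimes>\<^bsub>K\<^esub> inv\<^bsub>K\<^esub> b)"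

text \<open>
  The iterated constructions below pass repeatedly to residue fields and to quotient modules.
  To stay inside one type, a coset is replaced by a chosen representative: \<open>residue_field K D\<close>
  is the quotient of the local ring \<open>D \<subseteq> K\<close> by its maximal ideal, transported along this
  injection of the cosets into the ambient type, and \<open>residue_map K D\<close> is the canonical
  surjection \<open>D \<rightarrow> residue_field K D\<close>.
\<close>

definition coset_rep :: "'a set \<Rightarrow> 'a" where
  "coset_rep C = (SOME x. x \<in> C)"

definition residue_field :: "'a ring \<Rightarrow> 'a set \<Rightarrow> 'a ring" where
  "residue_field K D = image_ring coset_rep
     (K\<lparr>carrier := D\<rparr> Quot max_ideal (K\<lparr>carrier := D\<rparr>))"

definition residue_map :: "'a ring \<Rightarrow> 'a set \<Rightarrow> 'a \<Rightarrow> 'a" where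
  "residue_map K D x = coset_rep (max_ideal (K\<lparr>carrier := D\<rparr>) +>\<^bsub>K\<lparr>carrier := D\<rparr>\<^esub> x)"

definition residue_topology :: "'a ring \<Rightarrow> 'a set \<Rightarrow> 'a topology \<Rightarrow> 'a topology" where
  "residue_topology K D T = quotient_topology (residue_map K D) (subtopology T D)"

text \<open>
  An \<open>n\<close>-dimensional local field is a field \<open>K\<close> with the list \<open>[O_1,\<dots>,O_n]\<close> of its valuation
  rings, where \<open>O_(i+1)\<close> is a subring of the residue field of \<open>O_i\<close>; thus \<open>[O_2,\<dots>,O_n]\<close> makes
  the first residue field an \<open>(n-1)\<close>-dimensional local field.
\<close>

primrec local_field :: "'a set list \<Rightarrow> 'a ring \<Rightarrow> bool" where
  "local_field [] K \<longleftrightarrow> field K"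
| "local_field (D # Ds) K \<longleftrightarrow>
     is_fraction_field K D \<and> complete_dvr (K\<lparr>carrier := D\<rparr>) \<and> local_field Ds (residue_field K D)"

primrec ring_of_integers :: "'a set list \<Rightarrow> 'a ring \<Rightarrow> 'a set" where
  "ring_of_integers [] K = carrier K"
| "ring_of_integers (D # Ds) K =
     {x \<in> D. residue_map K D x \<in> ring_of_integers Ds (residue_field K D)}"

text \<open>The field \<open>k_n(K)\<close> and the structure map \<open>k \<rightarrow> k_n(K)\<close>.\<close>

primrec last_residue_field :: "'a set list \<Rightarrow> 'a ring \<Rightarrow> 'a ring" where
  "last_residue_field [] K = K"
| "last_residue_field (D # Ds) K = last_residue_field Ds (residue_field K D)"

primrec last_residue_structure :: "'a set list \<Rightarrow> 'a ring \<Rightarrow> ('k \<Rightarrow> 'a) \<Rightarrow> 'k \<Rightarrow> 'a" where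
  "last_residue_structure [] K \<iota> = \<iota>"
| "last_residue_structure (D # Ds) K \<iota> =
     last_residue_structure Ds (residue_field K D) (residue_map K D \<circ> \<iota>)"

text \<open>
  A map \<open>f : F((t_1,\<dots>,t_n)) \<rightarrow> K\<close> respects the valuation rings if it maps
  \<open>F((t_2,\<dots>,t_n))[[t_1]]\<close> onto \<open>O_1\<close> and the induced map on residue fields does so recursively.
  The residue field of \<open>A[[t]]\<close> is identified with \<open>A\<close> through the constant series.
\<close>

primrec respects_valuation_rings ::
  "'a set list \<Rightarrow> 'c ring \<Rightarrow> 'a ring \<Rightarrow> ('c iterated \<Rightarrow> 'a) \<Rightarrow> bool" where
  "respects_valuation_rings [] F K f \<longleftrightarrow> True"
| "respects_valuation_rings (D # Ds) F K f \<longleftrightarrow>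
     (let A = std_field (length Ds) F in
        f ` Series ` power_series A = D \<and>
        respects_valuation_rings Ds F (residue_field K D)
          (\<lambda>a. residue_map K D (f (Series (const_series A a)))))"

definition topological_local_field ::
  "nat \<Rightarrow> 'k ring \<Rightarrow> ('k \<Rightarrow> 'a) \<Rightarrow> 'a ring \<Rightarrow> 'a set list \<Rightarrow> 'a topology \<Rightarrow> bool" where
  "topological_local_field n k \<iota> K Ds T \<longleftrightarrow>
     length Ds = n \<and> local_field Ds K \<and>
     \<iota> \<in> ring_hom k (K\<lparr>carrier := ring_of_integers Ds K\<rparr>) \<and>
     st_ring k \<iota> K T \<and>
     (let F = last_residue_field Ds K; \<iota>' = last_residue_structure Ds K \<iota> in
        fg_submodule (carrier F) k (restrict_scalars \<iota>' (self_module F)) \<and>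
        (\<exists>f \<in> ring_iso (std_field n F) K.
           (\<forall>c\<in>carrier k. f (std_structure n F \<iota>' c) = \<iota> c) \<and>
           homeomorphic_map (std_topology n k F \<iota>') T f \<and>
           respects_valuation_rings Ds F K f))"

section \<open>Beilinson-Tate operators\<close>

fun system_of_liftings ::
  "'k ring \<Rightarrow> ('k \<Rightarrow> 'a) \<Rightarrow> 'a ring \<Rightarrow> 'a set list \<Rightarrow> 'a topology \<Rightarrow> ('a \<Rightarrow> 'a) list \<Rightarrow> bool" where
  "system_of_liftings k \<iota> K [] T [] \<longleftrightarrow> True"
| "system_of_liftings k \<iota> K (D # Ds) T (\<sigma> # \<sigma>s) \<longleftrightarrow>
     \<sigma> \<in> ring_hom (residue_field K D) (K\<lparr>carrier := D\<rparr>) \<and>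
     (\<forall>c\<in>carrier k. \<sigma> (residue_map K D (\<iota> c)) = \<iota> c) \<and>
     continuous_map (residue_topology K D T) (subtopology T D) \<sigma> \<and>
     (\<forall>x\<in>carrier (residue_field K D). residue_map K D (\<sigma> x) = x) \<and>
     system_of_liftings k (residue_map K D \<circ> \<iota>) (residue_field K D) Ds (residue_topology K D T) \<sigma>s"
| "system_of_liftings k \<iota> K _ T _ \<longleftrightarrow> False"

definition lattices :: "'a ring \<Rightarrow> 'a set \<Rightarrow> ('a, 'm) module \<Rightarrow> 'm set set" where
  "lattices K D M =
     {L. submodule L (K\<lparr>carrier := D\<rparr>) M \<and> fg_submodule L (K\<lparr>carrier := D\<rparr>) M \<and>
         mspan K M L = carrier M}"

text \<open>
  For lattices \<open>L' \<subseteq> L\<close> in \<open>M\<close>, the quotient \<open>L/L'\<close> with scalars acting through \<open>\<sigma>\<close>; again a coset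
  is replaced by a chosen representative. The fields \<open>mult\<close> and \<open>one\<close> play no role in a module.
\<close>

definition quot_map :: "('a, 'm) module \<Rightarrow> 'm set \<Rightarrow> 'm \<Rightarrow> 'm" where
  "quot_map M L' x = coset_rep (L' +>\<^bsub>M\<^esub> x)"

definition rest_quot ::
  "('a \<Rightarrow> 'a) \<Rightarrow> ('a, 'm) module \<Rightarrow> 'm set \<Rightarrow> 'm set \<Rightarrow> ('a, 'm) module" where
  "rest_quot \<sigma> M L L' =
     \<lparr>carrier = quot_map M L' ` L, monoid.mult = undefined, one = undefined,
      ring.zero = quot_map M L' \<zero>\<^bsub>M\<^esub>,
      add = (\<lambda>x y. quot_map M L' (x \<oplus>\<^bsub>M\<^esub> y)),
      module.smult = (\<lambda>a x. quot_map M L' (\<sigma> a \<odot>\<^bsub>M\<^esub> x))\<rparr>"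

text \<open>\<open>refinement \<phi> (L1', L2') (L1, L2)\<close> is \<open>(L1', L2') \<prec>\<^sub>\<phi> (L1, L2)\<close> for pairs of lattices.\<close>

definition refinement ::
  "('m \<Rightarrow> 'n) \<Rightarrow> 'm set \<times> 'n set \<Rightarrow> 'm set \<times> 'n set \<Rightarrow> bool" where
  "refinement \<phi> P' P \<longleftrightarrow>
     (case (P', P) of ((L1', L2'), (L1, L2)) \<Rightarrow>
        L1' \<subseteq> L1 \<and> L2 \<subseteq> L2' \<and> \<phi> ` L1' \<subseteq> L2 \<and> \<phi> ` L1 \<subseteq> L2')"

text \<open>
  In the recursion, \<open>\<lambda>x. quot_map M2 L2 (\<phi> x)\<close> is the induced map \<open>L1/L1' \<rightarrow> L2'/L2\<close>: its argument
  is the chosen representative of a class in \<open>L1/L1'\<close>.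
\<close>

fun BT_operators ::
  "'k ring \<Rightarrow> ('k \<Rightarrow> 'a) \<Rightarrow> 'a ring \<Rightarrow> 'a set list \<Rightarrow> ('a \<Rightarrow> 'a) list \<Rightarrow>
     ('a, 'm) module \<Rightarrow> ('a, 'n) module \<Rightarrow> ('m \<Rightarrow> 'n) set" where
  "BT_operators k \<iota> K [] \<sigma>s M1 M2 =
     linear_maps k (restrict_scalars \<iota> M1) (restrict_scalars \<iota> M2)"
| "BT_operators k \<iota> K (D # Ds) (\<sigma> # \<sigma>s) M1 M2 =
     {\<phi> \<in> linear_maps k (restrict_scalars \<iota> M1) (restrict_scalars \<iota> M2).
        (\<forall>P \<in> lattices K D M1 \<times> lattices K D M2.
           \<exists>P' \<in> lattices K D M1 \<times> lattices K D M2. refinement \<phi> P' P) \<and>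
        (\<forall>L1 \<in> lattices K D M1. \<forall>L2 \<in> lattices K D M2.
         \<forall>L1' \<in> lattices K D M1. \<forall>L2' \<in> lattices K D M2.
           refinement \<phi> (L1', L2') (L1, L2) \<longrightarrow>
             (\<lambda>x. quot_map M2 L2 (\<phi> x)) \<in>
               BT_operators k (residue_map K D \<circ> \<iota>) (residue_field K D) Ds \<sigma>s
                 (rest_quot \<sigma> M1 L1 L1') (rest_quot \<sigma> M2 L2' L2))}"
| "BT_operators k \<iota> K (D # Ds) [] M1 M2 = {}"

text \<open>\<open>E(K)\<close>, computed with the system of liftings \<open>\<sigma>s\<close>.\<close>

definition BT_ring ::
  "'k ring \<Rightarrow> ('k \<Rightarrow> 'a) \<Rightarrow> 'a ring \<Rightarrow> 'a set list \<Rightarrow> ('a \<Rightarrow> 'a) list \<Rightarrow> ('a \<Rightarrow> 'a) set" where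
  "BT_ring k \<iota> K Ds \<sigma>s = BT_operators k \<iota> K Ds \<sigma>s (self_module K) (self_module K)"

section \<open>Continuous differential operators\<close>

definition End_cont :: "'k ring \<Rightarrow> ('k \<Rightarrow> 'a) \<Rightarrow> 'a ring \<Rightarrow> 'a topology \<Rightarrow> ('a \<Rightarrow> 'a) set" where
  "End_cont k \<iota> K T =
     {\<phi> \<in> linear_maps k (restrict_scalars \<iota> (self_module K)) (restrict_scalars \<iota> (self_module K)).
        continuous_map T T \<phi>}"

text \<open>\<open>diff_filtration k \<iota> K T i\<close> is \<open>F_(i-1)\<close>, so that the value at \<open>0\<close> is \<open>F_(-1) = 0\<close>.\<close>

primrec diff_filtration ::
  "'k ring \<Rightarrow> ('k \<Rightarrow> 'a) \<Rightarrow> 'a ring \<Rightarrow> 'a topology \<Rightarrow> nat \<Rightarrow> ('a \<Rightarrow> 'a) set" where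
  "diff_filtration k \<iota> K T 0 = {\<phi>. \<forall>x\<in>carrier K. \<phi> x = \<zero>\<^bsub>K\<^esub>}"
| "diff_filtration k \<iota> K T (Suc i) =
     {\<phi> \<in> End_cont k \<iota> K T. \<forall>a\<in>carrier K.
        (\<lambda>x. (a \<otimes>\<^bsub>K\<^esub> \<phi> x) \<ominus>\<^bsub>K\<^esub> \<phi> (a \<otimes>\<^bsub>K\<^esub> x)) \<in> diff_filtration k \<iota> K T i}"

definition D_cont :: "'k ring \<Rightarrow> ('k \<Rightarrow> 'a) \<Rightarrow> 'a ring \<Rightarrow> 'a topology \<Rightarrow> ('a \<Rightarrow> 'a) set" where
  "D_cont k \<iota> K T = (\<Union>i. diff_filtration k \<iota> K T i)"

end

theory Submission
  imports Defs
begin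

text \<open>
  Let \<open>D\<close> be the first valuation ring, \<open>p\<close> a uniformizer and \<open>s\<close> the first lifting. Call an additive
  subgroup \<open>W\<close> of \<open>K\<close> good if for every \<open>g\<close> it contains \<open>c D g\<close> for some \<open>c \<noteq> 0\<close> and the
  subgroup \<open>{b. s(b) g \<in> W}\<close> of the residue field is good again. The good \<open>k\<close>-subspaces of \<open>K\<close>
  are precisely the open ones: for the standard field with the standard lifting this is a
  computation with Laurent series, and any other continuous lifting is reached by successive
  approximation. So a \<open>k\<close>-linear map is continuous if and only if it pulls good subspaces back to
  good ones.

  A Beilinson-Tate operator pulls good subgroups back to good ones, by induction on the dimension:
  a refinement of a lattice contained in the good subgroup provides the \<open>c\<close>, and the induced maps
  provide the residual condition. Conversely let \<open>\<phi>\<close> be a differential operator with this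
  property. If \<open>\<phi>\<close> sent no \<open>p\<^sup>rL\<close> into a \<open>p\<^sup>-\<^sup>rL'\<close>, a good subgroup could be built that avoids the
  values of \<open>\<phi>\<close> at a sequence tending to zero; induction on the order extends the bound to all
  \<open>p\<^sup>mL\<close>, which gives the refinements. The induced maps are differential operators over the residue
  field and inherit the property, because a good subgroup of a quotient of lattices contains the
  trace of a good subgroup of the module.
\<close>

section \<open>Expansions in powers of a uniformizer\<close>

text \<open>The recursion for Beilinson-Tate operators leaves \<open>K\<close> for quotients of
  lattices, which carry no topology of their own, so continuity cannot serve as induction
  hypothesis. Goodness can: it mentions only the liftings. Its test runs over every \<open>g\<close>
  so that it passes to the sets of all \<open>a\<close> with \<open>a m\<close> in \<open>W\<close>,
  and thereby from the field to modules, which are tested line by line exactly as in the fine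
  topology.

  As soon as the residue field is not discrete, a lattice is not open, and no norm is available to
  bound a continuous operator. What replaces it is the freedom to constrain the coefficients of
  negative powers of \<open>p\<close> independently of one another: if the poles of a sequence grow,
  each index meets only finitely many of its members, so one open subspace can exclude them all.

  The resulting bound has the same exponent \<open>r\<close> before and after the operator. A
  refinement asks for \<open>\<phi>(p^n L1) \<subseteq> L2\<close> and
  \<open>\<phi>(L1) \<subseteq> p^(-n) L2\<close>, that is, for bounds at other exponents. The
  commutator with \<open>p\<close> is what changes the exponent, and for a differential operator it
  has smaller order.\<close>

locale lifted_dvr = field K for K :: "'a ring" (structure) +
  fixes D :: "'a set" and p :: 'a and k1 :: "'a ring" and rm s :: "'a \<Rightarrow> 'a"
  assumes D_subring: "subring D K"
    and p_in_D: "p \<in> D" and p_nonzero: "p \<noteq> \<zero>"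
    and fraction: "x \<in> carrier K \<Longrightarrow> \<exists>N::nat. p [^] N \<otimes> x \<in> D"
    and uniformizer: "x \<in> D \<Longrightarrow> x \<noteq> \<zero> \<Longrightarrow> \<exists>i::nat. \<exists>u\<in>D. u \<noteq> \<zero> \<and> inv u \<in> D \<and> x = p [^] i \<otimes> u"
    and residue_is_field: "field k1"
    and rm_hom: "rm \<in> ring_hom (K\<lparr>carrier := D\<rparr>) k1"
    and rm_kernel: "x \<in> D \<Longrightarrow> rm x = \<zero>\<^bsub>k1\<^esub> \<longleftrightarrow> (\<exists>y\<in>D. x = p \<otimes> y)"
    and s_hom: "s \<in> ring_hom k1 (K\<lparr>carrier := D\<rparr>)"
    and s_section: "b \<in> carrier k1 \<Longrightarrow> rm (s b) = b"
begin

interpretation k1: field k1 by (rule residue_is_field)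

lemma D_sub: "x \<in> D \<Longrightarrow> x \<in> carrier K" using subringE(1)[OF D_subring] by auto
lemma D_zero [simp]: "\<zero> \<in> D" using subringE(2)[OF D_subring] .
lemma D_one [simp]: "\<one> \<in> D" using subringE(3)[OF D_subring] .
lemma D_minus: "x \<in> D \<Longrightarrow> \<ominus> x \<in> D" using subringE(5)[OF D_subring] .
lemma D_mult: "x \<in> D \<Longrightarrow> y \<in> D \<Longrightarrow> x \<otimes> y \<in> D" using subringE(6)[OF D_subring] .
lemma D_add: "x \<in> D \<Longrightarrow> y \<in> D \<Longrightarrow> x \<oplus> y \<in> D" using subringE(7)[OF D_subring] .
lemma D_diff: "x \<in> D \<Longrightarrow> y \<in> D \<Longrightarrow> x \<ominus> y \<in> D" by (simp add: a_minus_def D_minus D_add)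
lemmas D_closed = D_minus D_mult D_add D_diff

lemma p_carrier [simp]: "p \<in> carrier K" using p_in_D D_sub by blast

lemma s_D: "b \<in> carrier k1 \<Longrightarrow> s b \<in> D" using s_hom by (auto simp: ring_hom_def)
lemma s_carrier [simp]: "b \<in> carrier k1 \<Longrightarrow> s b \<in> carrier K" using s_D D_sub by blast
lemma s_add: "a \<in> carrier k1 \<Longrightarrow> b \<in> carrier k1 \<Longrightarrow> s (a \<oplus>\<^bsub>k1\<^esub> b) = s a \<oplus> s b"
  using s_hom by (auto simp: ring_hom_def)
lemma s_mult: "a \<in> carrier k1 \<Longrightarrow> b \<in> carrier k1 \<Longrightarrow> s (a \<otimes>\<^bsub>k1\<^esub> b) = s a \<otimes> s b"
  using s_hom by (auto simp: ring_hom_def)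
lemma s_one: "s \<one>\<^bsub>k1\<^esub> = \<one>"
  using s_hom by (auto simp: ring_hom_def)
lemma s_zero: "s \<zero>\<^bsub>k1\<^esub> = \<zero>"
  using s_add[of "\<zero>\<^bsub>k1\<^esub>" "\<zero>\<^bsub>k1\<^esub>"] by simp

lemma rm_closed: "x \<in> D \<Longrightarrow> rm x \<in> carrier k1" using rm_hom by (auto simp: ring_hom_def)
lemma rm_add: "x \<in> D \<Longrightarrow> y \<in> D \<Longrightarrow> rm (x \<oplus> y) = rm x \<oplus>\<^bsub>k1\<^esub> rm y"
  using rm_hom by (auto simp: ring_hom_def)
lemma rm_mult: "x \<in> D \<Longrightarrow> y \<in> D \<Longrightarrow> rm (x \<otimes> y) = rm x \<otimes>\<^bsub>k1\<^esub> rm y"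
  using rm_hom by (auto simp: ring_hom_def)
lemma rm_one: "rm \<one> = \<one>\<^bsub>k1\<^esub>"
  using rm_hom by (auto simp: ring_hom_def)
lemma rm_zero: "rm \<zero> = \<zero>\<^bsub>k1\<^esub>"
  proof -
  have "\<zero> = p \<otimes> \<zero>" by simp
  then show ?thesis using rm_kernel[OF D_zero] D_zero by blast
qed
lemma rm_p_mult: "x \<in> D \<Longrightarrow> rm (p \<otimes> x) = \<zero>\<^bsub>k1\<^esub>"
  using rm_kernel[of "p \<otimes> x"] p_in_D D_mult by auto

lemma rm_minus: "x \<in> D \<Longrightarrow> rm (\<ominus> x) = \<ominus>\<^bsub>k1\<^esub> rm x"
  using rm_add[of x "\<ominus> x"] rm_closed[of x] rm_closed[of "\<ominus> x"] rm_zero D_minus[of x]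
  by (metis D_sub k1.sum_zero_eq_neg k1.add.m_comm r_neg)

lemma rm_unit: "u \<in> D \<Longrightarrow> u \<noteq> \<zero> \<Longrightarrow> inv u \<in> D \<Longrightarrow> rm u \<noteq> \<zero>\<^bsub>k1\<^esub>"
proof
  assume u: "u \<in> D" "u \<noteq> \<zero>" "inv u \<in> D" and z: "rm u = \<zero>\<^bsub>k1\<^esub>"
  have "u \<otimes> inv u = \<one>" using u D_sub field_Units by auto
  then have "rm u \<otimes>\<^bsub>k1\<^esub> rm (inv u) = \<one>\<^bsub>k1\<^esub>" using rm_mult u rm_one by metis
  then show False using z u rm_closed k1.one_not_zero by auto
qed

definition zp :: "int \<Rightarrow> 'a" where "zp m = p [^]\<^bsub>Multiplicative_Group.mult_of K\<^esub> m"

interpretation mg: group "Multiplicative_Group.mult_of K" by (rule field_mult_group)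

lemma p_mg: "p \<in> carrier (Multiplicative_Group.mult_of K)" using p_nonzero by simp

lemma zp_mg: "zp m \<in> carrier (Multiplicative_Group.mult_of K)"
  unfolding zp_def by (rule mg.int_pow_closed[OF p_mg])

lemma zp_closed [simp]: "zp m \<in> carrier K" using zp_mg[of m] by simp
lemma zp_nonzero [simp]: "zp m \<noteq> \<zero>" using zp_mg[of m] by simp
lemma zp_add: "zp (m + n) = zp m \<otimes> zp n"
  using mg.int_pow_mult[OF p_mg, of m n] by (simp add: zp_def)
lemma zp_int: "zp (int n) = p [^] n"
  by (simp add: zp_def int_pow_int Multiplicative_Group.nat_pow_mult_of)
lemma zp_0 [simp]: "zp 0 = \<one>" using zp_int[of 0] by simp
lemma zp_1: "zp 1 = p" using zp_int[of 1] by simp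

lemma zp_mult: "x \<in> carrier K \<Longrightarrow> zp m \<otimes> (zp n \<otimes> x) = zp (m + n) \<otimes> x"
  by (simp add: zp_add m_assoc)

lemma zp_cancel [simp]: "x \<in> carrier K \<Longrightarrow> zp m \<otimes> (zp (- m) \<otimes> x) = x"
  "x \<in> carrier K \<Longrightarrow> zp (- m) \<otimes> (zp m \<otimes> x) = x"
  by (simp_all add: zp_mult)

lemma p_pow_D: "p [^] (n::nat) \<in> D"
  by (induction n) (auto intro: D_mult p_in_D)

lemma zp_D: "0 \<le> m \<Longrightarrow> zp m \<in> D" for m :: int
  using zp_int[of "nat m"] p_pow_D[of "nat m"] by (metis int_nat_eq)

lemma zp_D_mono: "x \<in> carrier K \<Longrightarrow> zp m \<otimes> x \<in> D \<Longrightarrow> m \<le> n \<Longrightarrow> zp n \<otimes> x \<in> D"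
  using zp_mult[of x "n - m" m] D_mult[OF zp_D, of "n - m" "zp m \<otimes> x"] by simp

lemma bounded: "x \<in> carrier K \<Longrightarrow> \<exists>N. zp N \<otimes> x \<in> D"
  using fraction zp_int by metis

text \<open>The integer \<open>v\<close> is the valuation of \<open>x\<close>: the denominator is
  cleared first, then the decomposition in \<open>D\<close> is scaled back.\<close>

lemma unit_decomp:
  assumes "x \<in> carrier K" "x \<noteq> \<zero>"
  shows "\<exists>v. \<exists>u\<in>D. u \<noteq> \<zero> \<and> inv u \<in> D \<and> x = zp v \<otimes> u"
proof -
  obtain N where N: "zp N \<otimes> x \<in> D" using bounded assms by blast
  have "zp N \<otimes> x \<noteq> \<zero>" using assms integral[of "zp N" x] by auto
  then obtain i u where u: "u \<in> D" "u \<noteq> \<zero>" "inv u \<in> D" "zp N \<otimes> x = p [^] (i::nat) \<otimes> u"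
    using uniformizer[OF N] by blast
  have "x = zp (- N) \<otimes> (zp N \<otimes> x)" using assms by simp
  also have "\<dots> = zp (- N + int i) \<otimes> u"
    using u D_sub by (simp add: zp_int[symmetric] zp_mult)
  finally show ?thesis using u by blast
qed

lemma rm_nonunit: "x \<in> D \<Longrightarrow> rm x = \<zero>\<^bsub>k1\<^esub> \<Longrightarrow> zp (-1) \<otimes> x \<in> D"
  using rm_kernel[of x] D_sub zp_cancel(2)[of _ 1] by (auto simp: zp_1)

text \<open>Division by \<open>p\<close> with remainder: \<open>shift u\<close> forgets the leading
  digit of \<open>u\<close> and moves the others down one place. Digits are read off one at a time,
  so no infinite sum has to converge.\<close>

definition shift :: "'a \<Rightarrow> 'a" where "shift u = zp (-1) \<otimes> (u \<ominus> s (rm u))"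

primrec digit :: "nat \<Rightarrow> 'a \<Rightarrow> 'a" where
  "digit 0 u = rm u"
| "digit (Suc i) u = digit i (shift u)"

lemma shift_D: "u \<in> D \<Longrightarrow> shift u \<in> D"
  unfolding shift_def
proof (rule rm_nonunit)
  assume u: "u \<in> D"
  then show "u \<ominus> s (rm u) \<in> D" using s_D rm_closed D_diff by blast
  show "rm (u \<ominus> s (rm u)) = \<zero>\<^bsub>k1\<^esub>"
    using u s_D[of "rm u"] rm_closed[of u]
    by (simp add: a_minus_def rm_add rm_minus D_minus s_section k1.r_neg)
qed

lemma digit_closed: "u \<in> D \<Longrightarrow> digit i u \<in> carrier k1"
  by (induction i arbitrary: u) (auto simp: rm_closed shift_D)

lemma digit_expand: "u \<in> D \<Longrightarrow> u = s (rm u) \<oplus> p \<otimes> shift u"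
proof -
  assume u: "u \<in> D"
  have c: "s (rm u) \<in> carrier K" "u \<in> carrier K" using u rm_closed D_sub by auto
  have "p \<otimes> shift u = u \<ominus> s (rm u)"
    unfolding shift_def using zp_cancel(1)[of "u \<ominus> s (rm u)" 1] c by (simp add: zp_1)
  then show ?thesis using c by algebra
qed

text \<open>There are no carries: \<open>s\<close> is a ring homomorphism, so lifted residues add up
  to the lifted residue of the sum. This is what makes the digits additive, and linear over
  \<open>k1\<close> through \<open>s\<close>.\<close>

lemma shift_add: "u \<in> D \<Longrightarrow> v \<in> D \<Longrightarrow> shift (u \<oplus> v) = shift u \<oplus> shift v"
proof -
  assume uv: "u \<in> D" "v \<in> D"
  have c: "s (rm u) \<in> carrier K" "u \<in> carrier K" "s (rm v) \<in> carrier K" "v \<in> carrier K" "zp (-1) \<in> carrier K"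
    using uv rm_closed D_sub by auto
  have "s (rm (u \<oplus> v)) = s (rm u) \<oplus> s (rm v)" using uv by (simp add: rm_add s_add rm_closed)
  then show ?thesis unfolding shift_def using c by algebra
qed

lemma shift_smult: "u \<in> D \<Longrightarrow> b \<in> carrier k1 \<Longrightarrow> shift (s b \<otimes> u) = s b \<otimes> shift u"
proof -
  assume uv: "u \<in> D" "b \<in> carrier k1"
  have c: "s (rm u) \<in> carrier K" "u \<in> carrier K" "s b \<in> carrier K" "zp (-1) \<in> carrier K"
    using uv rm_closed D_sub by auto
  have "s (rm (s b \<otimes> u)) = s b \<otimes> s (rm u)"
    using uv by (simp add: rm_mult s_mult rm_closed s_D s_section)
  then show ?thesis unfolding shift_def using c by algebra
qed

lemma shift_p: "u \<in> D \<Longrightarrow> shift (p \<otimes> u) = u"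
  using D_sub[of u] zp_cancel(2)[of u 1]
  by (simp add: shift_def rm_p_mult s_zero a_minus_def zp_1)

lemma digit_add: "u \<in> D \<Longrightarrow> v \<in> D \<Longrightarrow> digit i (u \<oplus> v) = digit i u \<oplus>\<^bsub>k1\<^esub> digit i v"
  by (induction i arbitrary: u v) (auto simp: rm_add shift_add shift_D)

lemma digit_smult: "u \<in> D \<Longrightarrow> b \<in> carrier k1 \<Longrightarrow> digit i (s b \<otimes> u) = b \<otimes>\<^bsub>k1\<^esub> digit i u"
  by (induction i arbitrary: u) (auto simp: rm_mult s_D s_section shift_smult shift_D)

lemma digit_p: "u \<in> D \<Longrightarrow> digit (Suc i) (p \<otimes> u) = digit i u"
  by (simp add: shift_p)

lemma digit_p_pow: "u \<in> D \<Longrightarrow> digit (n + i) (zp (int n) \<otimes> u) = digit i u"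
proof (induction n)
  case 0 then show ?case using D_sub by simp
next
  case (Suc n)
  have "zp (int (Suc n)) \<otimes> u = p \<otimes> (zp (int n) \<otimes> u)"
    using D_sub[OF Suc.prems] zp_mult[of u 1 "int n"] by (simp add: zp_1)
  moreover have "zp (int n) \<otimes> u \<in> D" using Suc.prems D_mult zp_D by simp
  ultimately show ?case using Suc digit_p by simp
qed

lemma digit_low: "u \<in> D \<Longrightarrow> i < n \<Longrightarrow> digit i (zp (int n) \<otimes> u) = \<zero>\<^bsub>k1\<^esub>"
proof (induction n arbitrary: i)
  case 0 then show ?case by simp
next
  case (Suc n)
  have e: "zp (int (Suc n)) \<otimes> u = p \<otimes> (zp (int n) \<otimes> u)"
    using D_sub[OF Suc.prems(1)] zp_mult[of u 1 "int n"] by (simp add: zp_1)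
  have d: "zp (int n) \<otimes> u \<in> D" using Suc.prems D_mult zp_D by simp
  show ?case
  proof (cases i)
    case 0 then show ?thesis using e d by (simp add: rm_p_mult)
  next
    case (Suc j) then show ?thesis using e d digit_p Suc.IH Suc.prems by simp
  qed
qed

text \<open>The coefficient of \<open>x = \<Sum>\<^sub>j s (coef j x) p\<^sup>j\<close>, read off after scaling \<open>x\<close> into \<open>D\<close>.\<close>

definition coef :: "int \<Rightarrow> 'a \<Rightarrow> 'a" where
  "coef j x = (let N = (SOME N. zp N \<otimes> x \<in> D \<and> 0 \<le> j + N) in digit (nat (j + N)) (zp N \<otimes> x))"

text \<open>The choice made in \<open>coef\<close> is harmless. Raising the exponent from
  \<open>N\<close> to \<open>M\<close> multiplies by \<open>p^(M - N)\<close>, which puts that many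
  zero digits in front, and the index moves by the same amount.\<close>

lemma coef_exp:
  assumes x: "x \<in> carrier K" and N: "zp N \<otimes> x \<in> D" "0 \<le> j + N"
  shows "coef j x = digit (nat (j + N)) (zp N \<otimes> x)"
proof -
  have *: "digit (nat (j + M)) (zp M \<otimes> x) = digit (nat (j + N)) (zp N \<otimes> x)"
    if "N \<le> M" "zp N \<otimes> x \<in> D" "0 \<le> j + N" for M N
  proof -
    have "zp M \<otimes> x = zp (int (nat (M - N))) \<otimes> (zp N \<otimes> x)" using x that by (simp add: zp_mult)
    moreover have "nat (j + M) = nat (M - N) + nat (j + N)" using that by simp
    ultimately show ?thesis using digit_p_pow[OF that(2), of "nat (M - N)" "nat (j + N)"] by simp
  qed
  define M where "M = (SOME N. zp N \<otimes> x \<in> D \<and> 0 \<le> j + N)"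
  have M: "zp M \<otimes> x \<in> D \<and> 0 \<le> j + M"
    unfolding M_def by (rule someI[of _ N]) (use N in auto)
  have "digit (nat (j + M)) (zp M \<otimes> x) = digit (nat (j + N)) (zp N \<otimes> x)"
    using *[of M N] *[of N M] M N by (cases "N \<le> M") auto
  then show ?thesis unfolding coef_def Let_def M_def .
qed

lemma common_exponent:
  assumes "x \<in> carrier K" "y \<in> carrier K"
  obtains N where "zp N \<otimes> x \<in> D" "zp N \<otimes> y \<in> D" "0 \<le> j + N"
proof -
  obtain N1 N2 where "zp N1 \<otimes> x \<in> D" "zp N2 \<otimes> y \<in> D" using bounded assms by blast
  then have "zp (max (max N1 N2) (- j)) \<otimes> x \<in> D" "zp (max (max N1 N2) (- j)) \<otimes> y \<in> D"
    by (auto intro: zp_D_mono[OF assms(1), of N1] zp_D_mono[OF assms(2), of N2])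
  then show ?thesis using that by fastforce
qed

lemma coef_closed: "x \<in> carrier K \<Longrightarrow> coef j x \<in> carrier k1"
proof -
  assume x: "x \<in> carrier K"
  obtain N where N: "zp N \<otimes> x \<in> D" "0 \<le> j + N" using common_exponent[OF x x] by metis
  show ?thesis using coef_exp[OF x N] digit_closed[OF N(1)] by simp
qed

lemma coef_add:
  assumes "x \<in> carrier K" "y \<in> carrier K"
  shows "coef j (x \<oplus> y) = coef j x \<oplus>\<^bsub>k1\<^esub> coef j y"
proof -
  obtain N where N: "zp N \<otimes> x \<in> D" "zp N \<otimes> y \<in> D" "0 \<le> j + N"
    using common_exponent[OF assms] by metis
  have e: "zp N \<otimes> (x \<oplus> y) = zp N \<otimes> x \<oplus> zp N \<otimes> y" using assms by (simp add: r_distr)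
  have "coef j (x \<oplus> y) = digit (nat (j + N)) (zp N \<otimes> x \<oplus> zp N \<otimes> y)"
    using coef_exp[of "x \<oplus> y" N j] N(3) assms D_add[OF N(1,2)] by (simp only: e a_closed)
  then show ?thesis
    by (simp only: digit_add[OF N(1,2)] coef_exp[OF assms(1) N(1,3)] coef_exp[OF assms(2) N(2,3)])
qed

lemma coef_smult:
  assumes "x \<in> carrier K" "b \<in> carrier k1"
  shows "coef j (s b \<otimes> x) = b \<otimes>\<^bsub>k1\<^esub> coef j x"
proof -
  obtain N where N: "zp N \<otimes> x \<in> D" "0 \<le> j + N" using common_exponent[OF assms(1,1)] by metis
  have e: "zp N \<otimes> (s b \<otimes> x) = s b \<otimes> (zp N \<otimes> x)" using assms by (simp add: m_lcomm)
  have "coef j (s b \<otimes> x) = digit (nat (j + N)) (s b \<otimes> (zp N \<otimes> x))"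
    using coef_exp[of "s b \<otimes> x" N j] N(2) assms D_mult[OF s_D[OF assms(2)] N(1)] e by simp
  then show ?thesis
    by (simp only: digit_smult[OF N(1) assms(2)] coef_exp[OF assms(1) N])
qed

lemma coef_zero: "coef j \<zero> = \<zero>\<^bsub>k1\<^esub>"
  using coef_smult[of \<zero> "\<zero>\<^bsub>k1\<^esub>" j] coef_closed[of \<zero> j] by (simp add: s_zero)

lemma coef_low:
  assumes x: "x \<in> carrier K" and N: "zp N \<otimes> x \<in> D" and j: "j + N < 0"
  shows "coef j x = \<zero>\<^bsub>k1\<^esub>"
proof -
  define M where "M = - j"
  have "zp M \<otimes> x \<in> D" using zp_D_mono[OF x N] j M_def by simp
  then have "coef j x = digit 0 (zp M \<otimes> x)" using coef_exp[OF x, of M j] M_def by simp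
  also have "zp M \<otimes> x = zp (int (nat (M - N))) \<otimes> (zp N \<otimes> x)" using x j M_def by (simp add: zp_mult)
  finally show ?thesis using digit_low[OF N, of 0 "nat (M - N)"] j M_def by simp
qed

text \<open>The witness is the leading coefficient: its index is the valuation \<open>v\<close> of
  \<open>x\<close> and its value is the residue of a unit. If \<open>v + N\<close> were nonnegative,
  \<open>p^N x\<close> would lie in \<open>D\<close>.\<close>

lemma coef_nonzero:
  assumes x: "x \<in> carrier K" and N: "zp N \<otimes> x \<notin> D"
  shows "\<exists>j. j + N < 0 \<and> coef j x \<noteq> \<zero>\<^bsub>k1\<^esub>"
proof -
  have "x \<noteq> \<zero>" using N by auto
  then obtain v u where u: "u \<in> D" "u \<noteq> \<zero>" "inv u \<in> D" "x = zp v \<otimes> u" using unit_decomp x by blast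
  have e: "zp (- v) \<otimes> x = u" using u D_sub by simp
  then have "coef v x = rm u" using coef_exp[OF x, of "- v" v] u by simp
  moreover have "v + N < 0"
  proof (rule ccontr)
    assume "\<not> v + N < 0"
    then have "zp N \<otimes> x \<in> D" using zp_D_mono[OF x, of "- v" N] e u(1) by (simp only:)
    then show False using N by simp
  qed
  ultimately show ?thesis using rm_unit[OF u(1-3)] by metis
qed

text \<open>Finitely many digits decide, because all multiples of \<open>p^(m + r)\<close> are in
  \<open>V\<close> already. The offset \<open>m\<close> is there for the induction: removing the
  leading digit turns \<open>(m, r)\<close> into \<open>(m + 1, r - 1)\<close>.\<close>

lemma digit_rebuild:
  assumes add: "\<And>x y. x \<in> V \<Longrightarrow> y \<in> V \<Longrightarrow> x \<oplus> y \<in> V"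
    and high: "\<And>d. d \<in> D \<Longrightarrow> zp (int m + int r) \<otimes> d \<in> V"
    and u: "u \<in> D" and low: "\<And>i. i < r \<Longrightarrow> s (digit i u) \<otimes> zp (int m + int i) \<in> V"
  shows "zp (int m) \<otimes> u \<in> V"
  using high u low
proof (induction r arbitrary: u m)
  case 0 then show ?case by simp
next
  case (Suc r)
  have e: "zp (int m) \<otimes> u = s (rm u) \<otimes> zp (int m) \<oplus> zp (int (Suc m)) \<otimes> shift u"
  proof -
    have c: "s (rm u) \<in> carrier K" "u \<in> carrier K" "shift u \<in> carrier K" "zp (int m) \<in> carrier K"
      using Suc.prems(2) rm_closed D_sub shift_D by auto
    have "zp (int (Suc m)) = zp (int m) \<otimes> p" using zp_add[of "int m" 1] zp_1 by (simp add: add.commute)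
    then have "zp (int m) \<otimes> (s (rm u) \<oplus> p \<otimes> shift u)
        = s (rm u) \<otimes> zp (int m) \<oplus> zp (int (Suc m)) \<otimes> shift u"
      using c p_carrier by algebra
    then show ?thesis by (simp only: digit_expand[OF Suc.prems(2), symmetric])
  qed
  have "zp (int (Suc m)) \<otimes> shift u \<in> V"
  proof (rule Suc.IH)
    show "zp (int (Suc m) + int r) \<otimes> d \<in> V" if "d \<in> D" for d
      using Suc.prems(1)[OF that] by (simp add: algebra_simps)
    show "shift u \<in> D" using shift_D Suc.prems by blast
    show "s (digit i (shift u)) \<otimes> zp (int (Suc m) + int i) \<in> V" if "i < r" for i
      using Suc.prems(3)[of "Suc i"] that by (simp add: algebra_simps)
  qed
  moreover have "s (rm u) \<otimes> zp (int m) \<in> V" using Suc.prems(3)[of 0] by simp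
  ultimately show ?case using add e by simp
qed

end

section \<open>Good subgroups\<close>

text \<open>What is kept of a local field with a system of liftings once the topologies are
  forgotten. The equation for \<open>s\<close> on the image of \<open>k\<close> makes each lifting
  linear over \<open>k\<close>, so that taking digits respects the action of
  \<open>k\<close>.\<close>

fun lifted :: "'k ring \<Rightarrow> ('k \<Rightarrow> 'a) \<Rightarrow> 'a ring \<Rightarrow> 'a set list \<Rightarrow> ('a \<Rightarrow> 'a) list \<Rightarrow> bool" where
  "lifted k \<iota> K [] [] \<longleftrightarrow> cring k \<and> field K \<and> \<iota> \<in> ring_hom k K"
| "lifted k \<iota> K (D # Ds) (s # ss) \<longleftrightarrow>
     cring k \<and> \<iota> \<in> ring_hom k (K\<lparr>carrier := D\<rparr>) \<and>
     (\<exists>p. lifted_dvr K D p (residue_field K D) (residue_map K D) s) \<and>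
     (\<forall>c\<in>carrier k. s (residue_map K D (\<iota> c)) = \<iota> c) \<and>
     lifted k (residue_map K D \<circ> \<iota>) (residue_field K D) Ds ss"
| "lifted k \<iota> K _ _ \<longleftrightarrow> False"

text \<open>
  A recursive description of the open additive subgroups of \<open>K\<close> that refers to the liftings
  only, so that it makes sense without a topology.
\<close>

fun good :: "'a ring \<Rightarrow> 'a set list \<Rightarrow> ('a \<Rightarrow> 'a) list \<Rightarrow> 'a set \<Rightarrow> bool" where
  "good K (D # Ds) (s # ss) W \<longleftrightarrow>
     (\<forall>g\<in>carrier K. (\<exists>c\<in>D - {\<zero>\<^bsub>K\<^esub>}. \<forall>x\<in>D. c \<otimes>\<^bsub>K\<^esub> x \<otimes>\<^bsub>K\<^esub> g \<in> W) \<and>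
        good (residue_field K D) Ds ss {b \<in> carrier (residue_field K D). s b \<otimes>\<^bsub>K\<^esub> g \<in> W})"
| "good K _ _ W \<longleftrightarrow> True"

text \<open>The test along each line \<open>a |-> a m\<close> imitates the fine module topology, in
  which a subspace is open when its preimage under every such map is. No basis and no topology of
  \<open>M\<close> enter.\<close>

definition mgood ::
  "'a ring \<Rightarrow> 'a set list \<Rightarrow> ('a \<Rightarrow> 'a) list \<Rightarrow> ('a, 'm) module \<Rightarrow> 'm set \<Rightarrow> bool" where
  "mgood K Ds ss M W \<longleftrightarrow> (\<forall>m\<in>carrier M. good K Ds ss {a \<in> carrier K. a \<odot>\<^bsub>M\<^esub> m \<in> W})"

definition additive :: "('a, 'm) module \<Rightarrow> 'm set \<Rightarrow> bool" where
  "additive M W \<longleftrightarrow> W \<subseteq> carrier M \<and> \<zero>\<^bsub>M\<^esub> \<in> W \<and> (\<forall>x\<in>W. \<forall>y\<in>W. x \<oplus>\<^bsub>M\<^esub> y \<in> W) \<and>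
     (\<forall>x\<in>W. \<ominus>\<^bsub>M\<^esub> x \<in> W)"

definition subspace :: "'k ring \<Rightarrow> ('k \<Rightarrow> 'a) \<Rightarrow> ('a, 'm) module \<Rightarrow> 'm set \<Rightarrow> bool" where
  "subspace k \<iota> M W \<longleftrightarrow> additive M W \<and> (\<forall>c\<in>carrier k. \<forall>x\<in>W. \<iota> c \<odot>\<^bsub>M\<^esub> x \<in> W)"

lemma self_module_simps [simp]:
  "carrier (self_module K) = carrier K" "\<zero>\<^bsub>self_module K\<^esub> = \<zero>\<^bsub>K\<^esub>"
  "add (self_module K) = add K" "smult (self_module K) = monoid.mult K"
  "a_inv (self_module K) = a_inv K" "a_minus (self_module K) = a_minus K"
  by (auto simp: self_module_def with_smult_def a_inv_def a_minus_def fun_eq_iff m_inv_def)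

lemma module_self:
  assumes "cring K" shows "module K (self_module K)"
proof -
  interpret cring K by fact
  have "abelian_group (self_module K)"
    by (rule abelian_groupI) (auto simp: a_assoc intro: a_comm intro!: bexI[of _ "\<ominus>\<^bsub>K\<^esub> x" for x] l_neg)
  then show ?thesis
    by (intro moduleI) (auto simp: m_assoc l_distr r_distr assms)
qed

lemma lifted_field:
  assumes "lifted k \<iota> K Ds ss"
  shows "field K" "\<iota> \<in> ring_hom k K" "cring k"
proof -
  have "field K \<and> \<iota> \<in> ring_hom k K \<and> cring k"
  proof (cases "(k, \<iota>, K, Ds, ss)" rule: lifted.cases)
    case (2 k' i K' D Ds' s ss')
    then obtain p where "lifted_dvr K D p (residue_field K D) (residue_map K D) s"
      and i: "\<iota> \<in> ring_hom k (K\<lparr>carrier := D\<rparr>)" "cring k" using assms by auto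
    then interpret lifted_dvr K D p "residue_field K D" "residue_map K D" s by simp
    have "\<iota> \<in> ring_hom k K" using i(1) D_sub by (auto simp: ring_hom_def)
    then show ?thesis using i field_axioms by blast
  qed (use assms in auto)
  then show "field K" "\<iota> \<in> ring_hom k K" "cring k" by auto
qed

text \<open>Goodness only demands that enough elements be present. Later identifications of
  preimages therefore need just one inclusion.\<close>

lemma good_mono: "good K Ds ss W \<Longrightarrow> W \<subseteq> W' \<Longrightarrow> good K Ds ss W'"
proof (induction K Ds ss W arbitrary: W' rule: good.induct)
  case (1 K D Ds s ss W)
  have "good (residue_field K D) Ds ss {b \<in> carrier (residue_field K D). s b \<otimes>\<^bsub>K\<^esub> g \<in> W'}"
    if g: "g \<in> carrier K" for g
  proof -
    have "good (residue_field K D) Ds ss {b \<in> carrier (residue_field K D). s b \<otimes>\<^bsub>K\<^esub> g \<in> W}"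
      using "1.prems"(1) g by simp
    then show ?thesis by (rule "1.IH"[OF g]) (use "1.prems"(2) in blast)
  qed
  moreover have "\<exists>c\<in>D - {\<zero>\<^bsub>K\<^esub>}. \<forall>x\<in>D. c \<otimes>\<^bsub>K\<^esub> x \<otimes>\<^bsub>K\<^esub> g \<in> W'" if "g \<in> carrier K" for g
    using 1(2,3) that unfolding good.simps by blast
  ultimately show ?case unfolding good.simps by blast
qed auto

lemma good_carrier:
  "lifted k \<iota> K Ds ss \<Longrightarrow> carrier K \<subseteq> W \<Longrightarrow> good K Ds ss W"
proof (induction k \<iota> K Ds ss arbitrary: W rule: lifted.induct)
  case (2 k \<iota> K D Ds s ss)
  obtain p where "lifted_dvr K D p (residue_field K D) (residue_map K D) s" using "2.prems" by auto
  then interpret lifted_dvr K D p "residue_field K D" "residue_map K D" s .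
  have lift: "lifted k (residue_map K D \<circ> \<iota>) (residue_field K D) Ds ss" using "2.prems" by simp
  have "good (residue_field K D) Ds ss {b \<in> carrier (residue_field K D). s b \<otimes>\<^bsub>K\<^esub> g \<in> W}"
    if "g \<in> carrier K" for g
    using "2.prems" that by (intro "2.IH"[OF lift]) auto
  moreover have "\<exists>c\<in>D - {\<zero>\<^bsub>K\<^esub>}. \<forall>x\<in>D. c \<otimes>\<^bsub>K\<^esub> x \<otimes>\<^bsub>K\<^esub> g \<in> W" if "g \<in> carrier K" for g
    using that "2.prems" D_sub by (intro bexI[of _ "\<one>\<^bsub>K\<^esub>"]) auto
  ultimately show ?case by simp
qed auto

lemma good_Int:
  "lifted k \<iota> K Ds ss \<Longrightarrow> good K Ds ss W \<Longrightarrow> good K Ds ss W' \<Longrightarrow> good K Ds ss (W \<inter> W')"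
proof (induction k \<iota> K Ds ss arbitrary: W W' rule: lifted.induct)
  case (2 k \<iota> K D Ds s ss)
  obtain p where "lifted_dvr K D p (residue_field K D) (residue_map K D) s" using "2.prems" by auto
  then interpret lifted_dvr K D p "residue_field K D" "residue_map K D" s .
  have lift: "lifted k (residue_map K D \<circ> \<iota>) (residue_field K D) Ds ss" using "2.prems" by simp
  show ?case unfolding good.simps
  proof (intro ballI conjI)
    fix g assume g: "g \<in> carrier K"
    have "good (residue_field K D) Ds ss ({b \<in> carrier (residue_field K D). s b \<otimes>\<^bsub>K\<^esub> g \<in> W}
        \<inter> {b \<in> carrier (residue_field K D). s b \<otimes>\<^bsub>K\<^esub> g \<in> W'})"
      using "2.prems" g by (intro "2.IH"[OF lift]) auto
    then show "good (residue_field K D) Ds ss {b \<in> carrier (residue_field K D). s b \<otimes>\<^bsub>K\<^esub> g \<in> W \<inter> W'}"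
      by (rule good_mono) auto
    obtain c where c: "c \<in> D - {\<zero>\<^bsub>K\<^esub>}" "\<And>x. x \<in> D \<Longrightarrow> c \<otimes>\<^bsub>K\<^esub> x \<otimes>\<^bsub>K\<^esub> g \<in> W"
      using "2.prems"(2) g by force
    obtain c' where c': "c' \<in> D - {\<zero>\<^bsub>K\<^esub>}" "\<And>x. x \<in> D \<Longrightarrow> c' \<otimes>\<^bsub>K\<^esub> x \<otimes>\<^bsub>K\<^esub> g \<in> W'"
      using "2.prems"(3) g by force
    have cD: "c \<in> carrier K" "c' \<in> carrier K" using c c' D_sub by auto
    show "\<exists>c\<in>D - {\<zero>\<^bsub>K\<^esub>}. \<forall>x\<in>D. c \<otimes>\<^bsub>K\<^esub> x \<otimes>\<^bsub>K\<^esub> g \<in> W \<inter> W'"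
    proof (intro bexI ballI)
      \<comment> \<open>The product serves both sets: in \<open>c c' x\<close> either of the two
        scalars may be absorbed into \<open>x\<close>, which stays in \<open>D\<close>.\<close>
      show "c \<otimes>\<^bsub>K\<^esub> c' \<in> D - {\<zero>\<^bsub>K\<^esub>}"
        using c c' cD integral D_mult by auto
      fix x assume x: "x \<in> D"
      have "c \<otimes>\<^bsub>K\<^esub> c' \<otimes>\<^bsub>K\<^esub> x = c \<otimes>\<^bsub>K\<^esub> (c' \<otimes>\<^bsub>K\<^esub> x)" "c \<otimes>\<^bsub>K\<^esub> c' \<otimes>\<^bsub>K\<^esub> x = c' \<otimes>\<^bsub>K\<^esub> (c \<otimes>\<^bsub>K\<^esub> x)"
        using x cD D_sub by (auto simp: m_ac)
      then show "c \<otimes>\<^bsub>K\<^esub> c' \<otimes>\<^bsub>K\<^esub> x \<otimes>\<^bsub>K\<^esub> g \<in> W \<inter> W'"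
        using c(2)[of "c' \<otimes>\<^bsub>K\<^esub> x"] c'(2)[of "c \<otimes>\<^bsub>K\<^esub> x"] c c' x D_mult by auto
    qed
  qed
qed auto

lemma good_finite_Inter:
  assumes "lifted k \<iota> K Ds ss" "finite I" "\<And>i. i \<in> I \<Longrightarrow> good K Ds ss (W i)"
  shows "good K Ds ss {x \<in> carrier K. \<forall>i\<in>I. x \<in> W i}"
  using assms(2,3)
proof (induction I)
  case empty then show ?case using good_carrier[OF assms(1)] by simp
next
  case (insert i I)
  have "good K Ds ss (W i \<inter> {x \<in> carrier K. \<forall>i\<in>I. x \<in> W i})"
    using insert by (intro good_Int[OF assms(1)]) auto
  then show ?case by (rule good_mono) auto
qed

text \<open>This is what the quantifier over \<open>g\<close> in \<open>good\<close> buys: the test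
  of the new set at \<open>g\<close> is the test of \<open>W\<close> at \<open>g h\<close>.\<close>

lemma good_scale:
  assumes "lifted k \<iota> K Ds ss" "good K Ds ss W" "h \<in> carrier K"
  shows "good K Ds ss {a \<in> carrier K. a \<otimes>\<^bsub>K\<^esub> h \<in> W}"
proof (cases "(k, \<iota>, K, Ds, ss)" rule: lifted.cases)
  case (2 k' i K' D Ds' s ss')
  then obtain p where "lifted_dvr K D p (residue_field K D) (residue_map K D) s"
    using assms by auto
  then interpret lifted_dvr K D p "residue_field K D" "residue_map K D" s by simp
  have e: "Ds = D # Ds'" "ss = s # ss'" using 2 by auto
  show ?thesis unfolding e good.simps
  proof (intro ballI conjI)
    fix g assume g: "g \<in> carrier K"
    then have gh: "g \<otimes>\<^bsub>K\<^esub> h \<in> carrier K" using assms by simp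
    obtain c where c: "c \<in> D - {\<zero>\<^bsub>K\<^esub>}" "\<And>x. x \<in> D \<Longrightarrow> c \<otimes>\<^bsub>K\<^esub> x \<otimes>\<^bsub>K\<^esub> (g \<otimes>\<^bsub>K\<^esub> h) \<in> W"
      using assms(2) gh unfolding e by force
    then show "\<exists>c\<in>D - {\<zero>\<^bsub>K\<^esub>}. \<forall>x\<in>D. c \<otimes>\<^bsub>K\<^esub> x \<otimes>\<^bsub>K\<^esub> g \<in> {a \<in> carrier K. a \<otimes>\<^bsub>K\<^esub> h \<in> W}"
      using g assms(3) D_sub by (intro bexI[of _ c]) (auto simp: m_assoc)
    have "good (residue_field K D) Ds' ss' {b \<in> carrier (residue_field K D). s b \<otimes>\<^bsub>K\<^esub> (g \<otimes>\<^bsub>K\<^esub> h) \<in> W}"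
      using assms(2) gh unfolding e by simp
    then show "good (residue_field K D) Ds' ss'
        {b \<in> carrier (residue_field K D). s b \<otimes>\<^bsub>K\<^esub> g \<in> {a \<in> carrier K. a \<otimes>\<^bsub>K\<^esub> h \<in> W}}"
      by (rule good_mono) (use g assms(3) in \<open>auto simp: m_assoc\<close>)
  qed
qed (use assms in auto)

text \<open>On the field itself the line through \<open>1\<close> suffices, since
  \<open>good_scale\<close> supplies the other lines.\<close>

lemma mgood_self:
  assumes "lifted k \<iota> K Ds ss"
  shows "mgood K Ds ss (self_module K) W \<longleftrightarrow> good K Ds ss W"
proof
  interpret field K using lifted_field assms by blast
  assume "mgood K Ds ss (self_module K) W"
  then have "good K Ds ss {a \<in> carrier K. a \<otimes>\<^bsub>K\<^esub> \<one>\<^bsub>K\<^esub> \<in> W}" unfolding mgood_def by force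
  then show "good K Ds ss W" by (rule good_mono) auto
next
  assume "good K Ds ss W"
  then show "mgood K Ds ss (self_module K) W" unfolding mgood_def using good_scale[OF assms] by auto
qed

lemma mgood_mono: "mgood K Ds ss M W \<Longrightarrow> W \<subseteq> W' \<Longrightarrow> mgood K Ds ss M W'"
  unfolding mgood_def by (blast intro: good_mono)

lemma mgood_Int:
  assumes "lifted k \<iota> K Ds ss" "mgood K Ds ss M W" "mgood K Ds ss M W'"
  shows "mgood K Ds ss M (W \<inter> W')"
  unfolding mgood_def
proof
  fix m assume m: "m \<in> carrier M"
  have "good K Ds ss ({a \<in> carrier K. a \<odot>\<^bsub>M\<^esub> m \<in> W} \<inter> {a \<in> carrier K. a \<odot>\<^bsub>M\<^esub> m \<in> W'})"
    using assms m unfolding mgood_def by (intro good_Int[OF assms(1)]) auto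
  then show "good K Ds ss {a \<in> carrier K. a \<odot>\<^bsub>M\<^esub> m \<in> W \<inter> W'}" by (rule good_mono) auto
qed

context lifted_dvr
begin

text \<open>The typical neighbourhood of zero in \<open>k1((t))\<close>: one condition for each
  power of \<open>p\<close>, the conditions being independent of one another. All good subspaces
  constructed in this development arise from boxes.\<close>

definition box :: "(int \<Rightarrow> 'a set) \<Rightarrow> 'a set" where
  "box U = {x \<in> carrier K. \<forall>j. coef j x \<in> U j}"

text \<open>For fixed \<open>g\<close> with pole order at most \<open>N\<close>, the coefficients of
  \<open>s(b) g\<close> are the products of \<open>b\<close> with those of \<open>g\<close>. They
  vanish below \<open>-N\<close> and are unrestricted from \<open>r\<close> on, so only the finitely
  many indices in between impose a condition on \<open>b\<close>.\<close>

lemma good_box: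
  assumes k1: "k1 = residue_field K D" and lift: "lifted k \<iota> k1 Ds ss"
    and U: "\<And>j. good k1 Ds ss (U j)" "\<And>j. \<zero>\<^bsub>k1\<^esub> \<in> U j" and top: "\<And>j. r \<le> j \<Longrightarrow> U j = carrier k1"
  shows "good K (D # Ds) (s # ss) (box U)"
  unfolding good.simps k1[symmetric]
proof (intro ballI conjI)
  interpret k1: field k1 by (rule residue_is_field)
  fix g assume g: "g \<in> carrier K"
  obtain N where N: "zp N \<otimes> g \<in> D" using bounded g by blast
  \<comment> \<open>The exponent is large enough to push \<open>D g\<close> into
    \<open>p^r D\<close>: coefficients below \<open>r\<close> then vanish, and the box is
    unconstrained above. The maximum with \<open>0\<close> keeps the scalar in
    \<open>D\<close>.\<close>
  define m where "m = max 0 (N + r)"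
  show "\<exists>c\<in>D - {\<zero>}. \<forall>x\<in>D. c \<otimes> x \<otimes> g \<in> box U"
  proof (intro bexI ballI)
    show "zp m \<in> D - {\<zero>}" using zp_D m_def by simp
    fix x assume x: "x \<in> D"
    have xK: "x \<in> carrier K" using x D_sub by simp
    have "zp (- r) \<otimes> (zp m \<otimes> x \<otimes> g) = zp (m - r - N) \<otimes> (x \<otimes> (zp N \<otimes> g))"
    proof -
      have "zp (m - r - N) \<otimes> (x \<otimes> (zp N \<otimes> g)) = x \<otimes> (zp (m - r - N) \<otimes> (zp N \<otimes> g))"
        using xK g by (simp add: m_lcomm)
      also have "\<dots> = x \<otimes> (zp (- r) \<otimes> (zp m \<otimes> g))"
        using g zp_mult[of g "m - r - N" N] zp_mult[of g "- r" m] by (simp add: add.commute)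
      also have "\<dots> = zp (- r) \<otimes> (zp m \<otimes> x \<otimes> g)" using xK g by (simp add: m_ac)
      finally show ?thesis by simp
    qed
    also have "\<dots> \<in> D" using D_mult[OF zp_D D_mult[OF x N], of "m - r - N"] m_def by simp
    finally have *: "zp (- r) \<otimes> (zp m \<otimes> x \<otimes> g) \<in> D" .
    have "coef j (zp m \<otimes> x \<otimes> g) \<in> U j" for j
    proof (cases "r \<le> j")
      case True then show ?thesis using top coef_closed xK g by simp
    next
      case False
      then show ?thesis using coef_low[OF _ *, of j] xK g U(2) by simp
    qed
    then show "zp m \<otimes> x \<otimes> g \<in> box U" unfolding box_def using xK g by simp
  qed
  have "good k1 Ds ss {b \<in> carrier k1. \<forall>j\<in>{-N..<r}. b \<in> {b \<in> carrier k1. b \<otimes>\<^bsub>k1\<^esub> coef j g \<in> U j}}"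
    by (intro good_finite_Inter[OF lift] good_scale[OF lift] U coef_closed g) auto
  then show "good k1 Ds ss {b \<in> carrier k1. s b \<otimes> g \<in> box U}"
  proof (rule good_mono, safe)
    fix b assume b: "b \<in> carrier k1"
      and h: "\<forall>j\<in>{-N..<r}. b \<in> {b \<in> carrier k1. b \<otimes>\<^bsub>k1\<^esub> coef j g \<in> U j}"
    have "b \<otimes>\<^bsub>k1\<^esub> coef j g \<in> U j" for j
    proof -
      consider "j < - N" | "j \<in> {-N..<r}" | "r \<le> j" by force
      then show ?thesis
        using h b top U(2) coef_closed[OF g] coef_low[OF g N, of j] by cases auto
    qed
    then show "s b \<otimes> g \<in> box U" unfolding box_def using b g coef_smult by simp
  qed
qed

text \<open>The equation \<open>s (rm (\<iota> c)) = \<iota> c\<close> lets \<open>k\<close> act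
  coefficientwise: a scalar from \<open>k\<close> is the lift of its own residue.\<close>

lemma subspace_box:
  assumes U: "\<And>j. subspace k (rm \<circ> \<iota>) (self_module k1) (U j)"
    and \<iota>: "\<iota> \<in> carrier k \<rightarrow> D" "\<And>c. c \<in> carrier k \<Longrightarrow> s (rm (\<iota> c)) = \<iota> c"
  shows "subspace k \<iota> (self_module K) (box U)"
proof -
  interpret k1: field k1 by (rule residue_is_field)
  have Uj: "\<zero>\<^bsub>k1\<^esub> \<in> U j" "\<And>x y. x \<in> U j \<Longrightarrow> y \<in> U j \<Longrightarrow> x \<oplus>\<^bsub>k1\<^esub> y \<in> U j"
    "\<And>x. x \<in> U j \<Longrightarrow> \<ominus>\<^bsub>k1\<^esub> x \<in> U j" "\<And>x c. x \<in> U j \<Longrightarrow> c \<in> carrier k \<Longrightarrow> rm (\<iota> c) \<otimes>\<^bsub>k1\<^esub> x \<in> U j" for j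
    using U[of j] by (auto simp: subspace_def additive_def)
  have neg: "coef j (\<ominus> x) = \<ominus>\<^bsub>k1\<^esub> coef j x" if "x \<in> carrier K" for j x
    using coef_add[of x "\<ominus> x" j] that coef_closed[of _ j] coef_zero
    by (metis a_inv_closed k1.minus_equality k1.a_comm r_neg)
  have sm: "coef j (\<iota> c \<otimes> x) = rm (\<iota> c) \<otimes>\<^bsub>k1\<^esub> coef j x" if "x \<in> carrier K" "c \<in> carrier k" for j x c
    using coef_smult[of x "rm (\<iota> c)" j] that \<iota> rm_closed by force
  have iK: "\<iota> c \<in> carrier K" if "c \<in> carrier k" for c using \<iota>(1) that D_sub by auto
  show ?thesis
    unfolding subspace_def additive_def box_def
    using Uj iK by (auto simp: coef_zero coef_add neg sm)
qed

end

lemma subspace_carrier: "lifted k \<iota> K Ds ss \<Longrightarrow> subspace k \<iota> (self_module K) (carrier K)"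
proof -
  assume l: "lifted k \<iota> K Ds ss"
  interpret field K using lifted_field l by blast
  have "\<iota> c \<in> carrier K" if "c \<in> carrier k" for c
    using lifted_field(2)[OF l] that by (auto simp: ring_hom_def)
  then show ?thesis by (auto simp: subspace_def additive_def)
qed

text \<open>The good subspaces are Hausdorff. A nonzero \<open>b\<close> is told apart from zero by
  its leading coefficient, so a box constrained at the single index \<open>v\<close> is enough, and
  the constraint comes from the residue field by induction. In dimension zero every subspace is
  good, in particular the zero space.\<close>

lemma good_separates:
  assumes "lifted k \<iota> K Ds ss" "b \<in> carrier K" "b \<noteq> \<zero>\<^bsub>K\<^esub>"
  shows "\<exists>W. subspace k \<iota> (self_module K) W \<and> good K Ds ss W \<and> b \<notin> W"
  using assms
proof (induction k \<iota> K Ds ss arbitrary: b rule: lifted.induct)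
  case (1 k \<iota> K)
  then interpret field K by simp
  have "\<iota> c \<in> carrier K" if "c \<in> carrier k" for c using 1 that by (auto simp: ring_hom_def)
  then have "subspace k \<iota> (self_module K) {\<zero>\<^bsub>K\<^esub>}" by (auto simp: subspace_def additive_def)
  then show ?case using 1 by (intro exI[of _ "{\<zero>\<^bsub>K\<^esub>}"]) auto
next
  case (2 k \<iota> K D Ds s ss)
  let ?k1 = "residue_field K D" let ?rm = "residue_map K D"
  obtain p where "lifted_dvr K D p ?k1 ?rm s" using "2.prems" by auto
  then interpret lifted_dvr K D p ?k1 ?rm s .
  have lift: "lifted k (?rm \<circ> \<iota>) ?k1 Ds ss" using "2.prems" by simp
  obtain N where N: "zp N \<otimes>\<^bsub>K\<^esub> b \<in> D" using bounded "2.prems" by blast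
  obtain v u where u: "u \<in> D" "u \<noteq> \<zero>\<^bsub>K\<^esub>" "inv\<^bsub>K\<^esub> u \<in> D" "b = zp v \<otimes>\<^bsub>K\<^esub> u"
    using unit_decomp[OF "2.prems"(2,3)] by blast
  have "zp (- v) \<otimes>\<^bsub>K\<^esub> b = u" using u D_sub by simp
  then have cv: "coef v b = ?rm u" using coef_exp[OF "2.prems"(2), of "- v" v] u by simp
  then have "coef v b \<noteq> \<zero>\<^bsub>?k1\<^esub>" using rm_unit[OF u(1-3)] by simp
  then obtain H where H: "subspace k (?rm \<circ> \<iota>) (self_module ?k1) H" "good ?k1 Ds ss H" "coef v b \<notin> H"
    using "2.IH"[OF lift] coef_closed "2.prems" by blast
  define U where "U j = (if j = v then H else carrier ?k1)" for j
  have U: "subspace k (?rm \<circ> \<iota>) (self_module ?k1) (U j)" "good ?k1 Ds ss (U j)" for j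
    using H subspace_carrier[OF lift] good_carrier[OF lift] by (auto simp: U_def)
  have "good K (D # Ds) (s # ss) (box U)"
    by (rule good_box[OF refl lift U(2), where r = "v + 1"]) (use U(1) in \<open>auto simp: U_def subspace_def additive_def\<close>)
  moreover have "subspace k \<iota> (self_module K) (box U)"
    by (rule subspace_box[OF U(1)]) (use "2.prems" in \<open>auto simp: ring_hom_def\<close>)
  moreover have "b \<notin> box U" using H(3) by (auto simp: box_def U_def)
  ultimately show ?case by blast
qed auto

text \<open>The pole of \<open>y r\<close> has order greater than \<open>r\<close>, so
  \<open>y r\<close> has a nonzero coefficient at some index below \<open>-r\<close>. At each index
  a subspace of the residue field is chosen that excludes the coefficients in question; only
  finitely many of the \<open>y r\<close> compete for the same index.\<close>

lemma good_avoids_sequence: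
  assumes l: "lifted k \<iota> K (D # Ds) (s # ss)"
    and p: "lifted_dvr K D p (residue_field K D) (residue_map K D) s"
    and y: "\<And>r::nat. y r \<in> carrier K" "\<And>r. lifted_dvr.zp K p (int r) \<otimes>\<^bsub>K\<^esub> y r \<notin> D"
  shows "\<exists>W. subspace k \<iota> (self_module K) W \<and> good K (D # Ds) (s # ss) W \<and> (\<forall>r. y r \<notin> W)"
proof -
  let ?k1 = "residue_field K D" let ?rm = "residue_map K D"
  interpret lifted_dvr K D p ?k1 ?rm s by fact
  have lift: "lifted k (?rm \<circ> \<iota>) ?k1 Ds ss" using l by simp
  define H where "H b = (SOME W. subspace k (?rm \<circ> \<iota>) (self_module ?k1) W \<and> good ?k1 Ds ss W \<and> b \<notin> W)" for b
  have H: "subspace k (?rm \<circ> \<iota>) (self_module ?k1) (H b)" "good ?k1 Ds ss (H b)" "b \<notin> H b"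
    if "b \<in> carrier ?k1" "b \<noteq> \<zero>\<^bsub>?k1\<^esub>" for b
    using someI_ex[OF good_separates[OF lift that]] unfolding H_def by auto
  \<comment> \<open>The clause \<open>int r < - j\<close> makes \<open>I j\<close> finite, and empty
    for nonnegative \<open>j\<close>. This is why \<open>good_box\<close> applies below with
    threshold \<open>0\<close>.\<close>
  define I where "I j = {r. int r < - j \<and> coef j (y r) \<noteq> \<zero>\<^bsub>?k1\<^esub>}" for j
  define U where "U j = {b \<in> carrier ?k1. \<forall>r\<in>I j. b \<in> H (coef j (y r))}" for j
  have Hr: "subspace k (?rm \<circ> \<iota>) (self_module ?k1) (H (coef j (y r)))" "good ?k1 Ds ss (H (coef j (y r)))"
    "coef j (y r) \<notin> H (coef j (y r))" if "r \<in> I j" for j r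
    using H[of "coef j (y r)"] that coef_closed[OF y(1)] by (auto simp: I_def)
  have fin: "finite (I j)" for j
    by (rule finite_subset[of _ "{..<nat (- j)}"]) (auto simp: I_def)
  have Ug: "good ?k1 Ds ss (U j)" for j
    unfolding U_def by (rule good_finite_Inter[OF lift fin Hr(2)])
  have Us: "subspace k (?rm \<circ> \<iota>) (self_module ?k1) (U j)" for j
    using subspace_carrier[OF lift] Hr(1)[of _ j]
    unfolding U_def subspace_def additive_def by simp
  have "good K (D # Ds) (s # ss) (box U)"
  proof (rule good_box[OF refl lift Ug, where r = 0])
    show "\<zero>\<^bsub>?k1\<^esub> \<in> U j" for j using Us[of j] by (simp add: subspace_def additive_def)
    show "U j = carrier ?k1" if "0 \<le> j" for j using that by (auto simp: U_def I_def)
  qed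
  moreover have "subspace k \<iota> (self_module K) (box U)"
    by (rule subspace_box[OF Us]) (use l in \<open>auto simp: ring_hom_def\<close>)
  moreover have "y r \<notin> box U" for r
  proof -
    obtain j where "j + int r < 0" "coef j (y r) \<noteq> \<zero>\<^bsub>?k1\<^esub>" using coef_nonzero[OF y] by blast
    then have "r \<in> I j" by (simp add: I_def)
    then have "coef j (y r) \<notin> U j" using Hr(3) unfolding U_def by blast
    then show ?thesis unfolding box_def by blast
  qed
  ultimately show ?thesis by blast
qed

text \<open>Needed where a subspace is known on \<open>D\<close> alone and a good subspace of all of
  \<open>K\<close> is wanted whose trace on \<open>D\<close> lies inside it. The digits
  \<open>0, ..., r - 1\<close> are constrained by \<open>V\<close> itself and all other coefficients
  are left free; an element of \<open>D\<close> in this box is rebuilt from those digits up to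
  \<open>p^r D\<close>, which \<open>V\<close> contains.\<close>

lemma good_extension:
  assumes l: "lifted k \<iota> K (D # Ds) (s # ss)"
    and p: "lifted_dvr K D p (residue_field K D) (residue_map K D) s"
    and V: "subspace k \<iota> (self_module K) V"
    and r: "\<And>d. d \<in> D \<Longrightarrow> lifted_dvr.zp K p (int r) \<otimes>\<^bsub>K\<^esub> d \<in> V"
    and V_good: "\<And>i. i < r \<Longrightarrow> good (residue_field K D) Ds ss
        {b \<in> carrier (residue_field K D). s b \<otimes>\<^bsub>K\<^esub> lifted_dvr.zp K p (int i) \<in> V}"
  shows "\<exists>W. subspace k \<iota> (self_module K) W \<and> good K (D # Ds) (s # ss) W \<and> W \<inter> D \<subseteq> V"
proof -
  let ?k1 = "residue_field K D" let ?rm = "residue_map K D"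
  interpret lifted_dvr K D p ?k1 ?rm s by fact
  interpret k1: field ?k1 by (rule residue_is_field)
  have lift: "lifted k (?rm \<circ> \<iota>) ?k1 Ds ss" using l by simp
  have i: "\<iota> c \<in> D" "s (?rm (\<iota> c)) = \<iota> c" if "c \<in> carrier k" for c
    using l that by (auto simp: ring_hom_def)
  have Vc: "\<zero>\<^bsub>K\<^esub> \<in> V" "\<And>x y. x \<in> V \<Longrightarrow> y \<in> V \<Longrightarrow> x \<oplus>\<^bsub>K\<^esub> y \<in> V" "\<And>x. x \<in> V \<Longrightarrow> \<ominus>\<^bsub>K\<^esub> x \<in> V"
    "\<And>x c. x \<in> V \<Longrightarrow> c \<in> carrier k \<Longrightarrow> \<iota> c \<otimes>\<^bsub>K\<^esub> x \<in> V"
    using V by (auto simp: subspace_def additive_def)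
  define U where "U j = (if 0 \<le> j \<and> j < int r
    then {b \<in> carrier ?k1. s b \<otimes>\<^bsub>K\<^esub> zp j \<in> V} else carrier ?k1)" for j
  have Ug: "good ?k1 Ds ss (U j)" for j
    using V_good[of "nat j"] good_carrier[OF lift] by (auto simp: U_def)
  have neg: "s (\<ominus>\<^bsub>?k1\<^esub> b) = \<ominus>\<^bsub>K\<^esub> s b" if "b \<in> carrier ?k1" for b
    using s_add[of b "\<ominus>\<^bsub>?k1\<^esub> b"] that s_zero
    by (metis a_comm k1.add.inv_closed k1.r_neg minus_equality s_carrier)
  have Us: "subspace k (?rm \<circ> \<iota>) (self_module ?k1) (U j)" for j
  proof -
    have "?rm (\<iota> c) \<in> carrier ?k1" if "c \<in> carrier k" for c using i rm_closed that by blast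
    then have "subspace k (?rm \<circ> \<iota>) (self_module ?k1) {b \<in> carrier ?k1. s b \<otimes>\<^bsub>K\<^esub> zp j \<in> V}"
      using Vc i D_sub[OF i(1)] by (auto simp: subspace_def additive_def s_zero s_add s_mult l_distr neg l_minus m_assoc
          rm_closed)
    then show ?thesis using subspace_carrier[OF lift] by (simp add: U_def)
  qed
  have "good K (D # Ds) (s # ss) (box U)"
    by (rule good_box[OF refl lift Ug, where r = "int r"]) (use Us in \<open>auto simp: U_def subspace_def additive_def\<close>)
  moreover have "subspace k \<iota> (self_module K) (box U)"
    by (rule subspace_box[OF Us]) (use i in auto)
  moreover have "box U \<inter> D \<subseteq> V"
  proof
    fix u assume u: "u \<in> box U \<inter> D"
    have "zp (int 0) \<otimes>\<^bsub>K\<^esub> u \<in> V"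
    proof (rule digit_rebuild[of V 0 r u])
      show "s (digit i u) \<otimes>\<^bsub>K\<^esub> zp (int 0 + int i) \<in> V" if "i < r" for i
      proof -
        have uK: "u \<in> carrier K" using u D_sub by blast
        have "coef (int i) u = digit i u" using coef_exp[OF uK, of 0 "int i"] u uK by simp
        moreover have "coef (int i) u \<in> U (int i)" using u by (auto simp: box_def)
        ultimately show ?thesis using that by (auto simp: U_def)
      qed
    qed (use Vc r u in auto)
    then show "u \<in> V" using u D_sub by simp
  qed
  ultimately show ?thesis by blast
qed

section \<open>Lattices and Beilinson-Tate operators\<close>

lemma restrict_scalars_simps [simp]:
  "carrier (restrict_scalars f M) = carrier M" "\<zero>\<^bsub>restrict_scalars f M\<^esub> = \<zero>\<^bsub>M\<^esub>"
  "add (restrict_scalars f M) = add M" "smult (restrict_scalars f M) = (\<lambda>c x. f c \<odot>\<^bsub>M\<^esub> x)"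
  "a_inv (restrict_scalars f M) = a_inv M" "a_minus (restrict_scalars f M) = a_minus M"
  by (auto simp: restrict_scalars_def with_smult_def a_inv_def a_minus_def fun_eq_iff m_inv_def)

lemma linear_maps_iff:
  "\<phi> \<in> linear_maps k (restrict_scalars \<iota> M1) (restrict_scalars \<iota> M2) \<longleftrightarrow>
     (\<forall>x\<in>carrier M1. \<phi> x \<in> carrier M2) \<and>
     (\<forall>x\<in>carrier M1. \<forall>y\<in>carrier M1. \<phi> (x \<oplus>\<^bsub>M1\<^esub> y) = \<phi> x \<oplus>\<^bsub>M2\<^esub> \<phi> y) \<and>
     (\<forall>c\<in>carrier k. \<forall>x\<in>carrier M1. \<phi> (\<iota> c \<odot>\<^bsub>M1\<^esub> x) = \<iota> c \<odot>\<^bsub>M2\<^esub> \<phi> x)"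
  by (auto simp: linear_maps_def hom_def)

lemma submodule_iff:
  assumes "module R M"
  shows "submodule N R M \<longleftrightarrow> additive M N \<and> (\<forall>a\<in>carrier R. \<forall>x\<in>N. a \<odot>\<^bsub>M\<^esub> x \<in> N)"
proof -
  interpret module R M by fact
  show ?thesis
  proof
    assume h: "submodule N R M"
    then have "\<zero>\<^bsub>M\<^esub> \<in> N" using subgroup.one_closed[OF submodule.axioms(1)[OF h]] by simp
    then show "additive M N \<and> (\<forall>a\<in>carrier R. \<forall>x\<in>N. a \<odot>\<^bsub>M\<^esub> x \<in> N)"
      using submoduleE[OF h] by (auto simp: additive_def)
  next
    assume "additive M N \<and> (\<forall>a\<in>carrier R. \<forall>x\<in>N. a \<odot>\<^bsub>M\<^esub> x \<in> N)"
    then show "submodule N R M" by (intro submoduleI) (auto simp: additive_def)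
  qed
qed

lemma mspan_submodule:
  assumes "module R M" "S \<subseteq> carrier M"
  shows "submodule (mspan R M S) R M"
proof -
  interpret module R M by fact
  have "additive M (carrier M)" by (auto simp: additive_def)
  then show ?thesis
    using assms(2) unfolding submodule_iff[OF assms(1)] mspan_def additive_def by auto
qed

lemma mspan_superset: "S \<subseteq> mspan R M S"
  unfolding mspan_def by auto

lemma mspan_least: "submodule N R M \<Longrightarrow> S \<subseteq> N \<Longrightarrow> mspan R M S \<subseteq> N"
  unfolding mspan_def by auto

lemma mspan_mono: "S \<subseteq> S' \<Longrightarrow> mspan R M S \<subseteq> mspan R M S'"
  unfolding mspan_def by auto

lemma additiveD:
  assumes "additive M W"
  shows "x \<in> W \<Longrightarrow> x \<in> carrier M" "\<zero>\<^bsub>M\<^esub> \<in> W" "x \<in> W \<Longrightarrow> y \<in> W \<Longrightarrow> x \<oplus>\<^bsub>M\<^esub> y \<in> W"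
    "x \<in> W \<Longrightarrow> \<ominus>\<^bsub>M\<^esub> x \<in> W" "x \<in> W \<Longrightarrow> y \<in> W \<Longrightarrow> x \<ominus>\<^bsub>M\<^esub> y \<in> W"
  using assms by (auto simp: additive_def a_minus_def)

lemma additive_vimage:
  assumes "abelian_group M1" "abelian_group M2"
    and "\<And>x. x \<in> carrier M1 \<Longrightarrow> \<phi> x \<in> carrier M2"
    and "\<And>x y. x \<in> carrier M1 \<Longrightarrow> y \<in> carrier M1 \<Longrightarrow> \<phi> (x \<oplus>\<^bsub>M1\<^esub> y) = \<phi> x \<oplus>\<^bsub>M2\<^esub> \<phi> y"
  shows additive_map_zero: "\<phi> \<zero>\<^bsub>M1\<^esub> = \<zero>\<^bsub>M2\<^esub>"
    and additive_map_minus: "x \<in> carrier M1 \<Longrightarrow> \<phi> (\<ominus>\<^bsub>M1\<^esub> x) = \<ominus>\<^bsub>M2\<^esub> \<phi> x"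
    and additive_map_diff: "x \<in> carrier M1 \<Longrightarrow> y \<in> carrier M1 \<Longrightarrow> \<phi> (x \<ominus>\<^bsub>M1\<^esub> y) = \<phi> x \<ominus>\<^bsub>M2\<^esub> \<phi> y"
    and "additive M2 W \<Longrightarrow> additive M1 {x \<in> carrier M1. \<phi> x \<in> W}"
proof -
  interpret M1: abelian_group M1 by fact
  interpret M2: abelian_group M2 by fact
  show z: "\<phi> \<zero>\<^bsub>M1\<^esub> = \<zero>\<^bsub>M2\<^esub>"
    using assms(4)[of "\<zero>\<^bsub>M1\<^esub>" "\<zero>\<^bsub>M1\<^esub>"] assms(3)[of "\<zero>\<^bsub>M1\<^esub>"] by simp
  show m: "\<phi> (\<ominus>\<^bsub>M1\<^esub> x) = \<ominus>\<^bsub>M2\<^esub> \<phi> x" if "x \<in> carrier M1" for x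
    using assms(4)[of "\<ominus>\<^bsub>M1\<^esub> x" x] assms(3)[of x] assms(3)[of "\<ominus>\<^bsub>M1\<^esub> x"] that z
    by (simp add: M1.l_neg M2.minus_equality)
  show "\<phi> (x \<ominus>\<^bsub>M1\<^esub> y) = \<phi> x \<ominus>\<^bsub>M2\<^esub> \<phi> y" if "x \<in> carrier M1" "y \<in> carrier M1" for x y
    using that assms(4) m by (simp add: a_minus_def)
  show "additive M2 W \<Longrightarrow> additive M1 {x \<in> carrier M1. \<phi> x \<in> W}"
    using assms(4) m z by (auto simp: additive_def)
qed

lemma quot_map_coset:
  assumes "abelian_group M" "additive M L" "x \<in> carrier M"
  shows "\<exists>l\<in>L. quot_map M L x = l \<oplus>\<^bsub>M\<^esub> x"
proof -
  interpret abelian_group M by fact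
  have "x \<in> L +>\<^bsub>M\<^esub> x"
    using assms(2,3) by (auto simp: a_r_coset_def' additive_def intro!: bexI[of _ "\<zero>\<^bsub>M\<^esub>"])
  then have "quot_map M L x \<in> L +>\<^bsub>M\<^esub> x" unfolding quot_map_def coset_rep_def by (rule someI)
  then show ?thesis by (auto simp: a_r_coset_def')
qed

lemma quot_map_eq_iff:
  assumes "abelian_group M" "additive M L" "x \<in> carrier M" "y \<in> carrier M"
  shows "quot_map M L x = quot_map M L y \<longleftrightarrow> x \<ominus>\<^bsub>M\<^esub> y \<in> L"
proof -
  interpret abelian_group M by fact
  note L = additiveD[OF assms(2)]
  show ?thesis
  proof
    assume h: "quot_map M L x = quot_map M L y"
    obtain l l' where l: "l \<in> L" "l' \<in> L" "l \<oplus>\<^bsub>M\<^esub> x = l' \<oplus>\<^bsub>M\<^esub> y"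
      using quot_map_coset[OF assms(1,2,3)] quot_map_coset[OF assms(1,2,4)] h by metis
    have c: "l \<in> carrier M" "l' \<in> carrier M" using l L by auto
    have "x = \<ominus>\<^bsub>M\<^esub> l \<oplus>\<^bsub>M\<^esub> (l' \<oplus>\<^bsub>M\<^esub> y)"
      using l(3) c assms r_neg2[of l x] r_neg1[of l x] by metis
    then have "x \<ominus>\<^bsub>M\<^esub> y = \<ominus>\<^bsub>M\<^esub> l \<oplus>\<^bsub>M\<^esub> l'"
      using c assms by (simp add: a_minus_def a_assoc r_neg)
    then show "x \<ominus>\<^bsub>M\<^esub> y \<in> L" using L l by simp
  next
    assume h: "x \<ominus>\<^bsub>M\<^esub> y \<in> L"
    have hc: "x \<ominus>\<^bsub>M\<^esub> y \<in> carrier M" using L h by blast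
    have xy: "x = (x \<ominus>\<^bsub>M\<^esub> y) \<oplus>\<^bsub>M\<^esub> y" using assms by (simp add: a_minus_def a_assoc l_neg)
    have yx: "y = \<ominus>\<^bsub>M\<^esub> (x \<ominus>\<^bsub>M\<^esub> y) \<oplus>\<^bsub>M\<^esub> x" using xy r_neg1[OF hc, of y] assms by metis
    have "L +>\<^bsub>M\<^esub> x = L +>\<^bsub>M\<^esub> y"
    proof (rule Set.set_eqI, rule iffI)
      fix z assume "z \<in> L +>\<^bsub>M\<^esub> x"
      then obtain l where l: "l \<in> L" "z = l \<oplus>\<^bsub>M\<^esub> x" by (auto simp: a_r_coset_def')
      then have "z = (l \<oplus>\<^bsub>M\<^esub> (x \<ominus>\<^bsub>M\<^esub> y)) \<oplus>\<^bsub>M\<^esub> y" using xy L(1) hc assms a_assoc by metis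
      then show "z \<in> L +>\<^bsub>M\<^esub> y" using L l h by (auto simp: a_r_coset_def')
    next
      fix z assume "z \<in> L +>\<^bsub>M\<^esub> y"
      then obtain l where l: "l \<in> L" "z = l \<oplus>\<^bsub>M\<^esub> y" by (auto simp: a_r_coset_def')
      then have "z = (l \<oplus>\<^bsub>M\<^esub> \<ominus>\<^bsub>M\<^esub> (x \<ominus>\<^bsub>M\<^esub> y)) \<oplus>\<^bsub>M\<^esub> x" using yx L(1) hc assms a_assoc a_inv_closed by metis
      then show "z \<in> L +>\<^bsub>M\<^esub> x" using L l h by (auto simp: a_r_coset_def')
    qed
    then show "quot_map M L x = quot_map M L y" unfolding quot_map_def by simp
  qed
qed

section \<open>Commensurability and rescaling of lattices\<close>

locale dvr_module = lifted_dvr K D p k1 rm s + M: module K M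
  for K :: "'a ring" (structure) and D p k1 rm s and M :: "('a, 'm) module"
begin

lemma D_module: "module (K\<lparr>carrier := D\<rparr>) M"
proof -
  have "subcring D K" by (rule subcringI'[OF D_subring])
  then have "cring (K\<lparr>carrier := D\<rparr>)" using subcring_iff[OF subringE(1)[OF D_subring]] by blast
  then show ?thesis
    by (intro moduleI)
      (auto simp: D_sub M.smult_l_distr M.smult_r_distr M.smult_assoc1 M.M.abelian_group_axioms)
qed

abbreviation D_span :: "'m set \<Rightarrow> 'm set" where "D_span \<equiv> mspan (K\<lparr>carrier := D\<rparr>) M"

abbreviation Lat :: "'m set set" where "Lat \<equiv> lattices K D M"

lemma D_submodule_iff:
  "submodule N (K\<lparr>carrier := D\<rparr>) M \<longleftrightarrow> additive M N \<and> (\<forall>a\<in>D. \<forall>x\<in>N. a \<odot>\<^bsub>M\<^esub> x \<in> N)"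
  unfolding submodule_iff[OF D_module] by simp

lemma K_submodule_iff:
  "submodule N K M \<longleftrightarrow> additive M N \<and> (\<forall>a\<in>carrier K. \<forall>x\<in>N. a \<odot>\<^bsub>M\<^esub> x \<in> N)"
  by (rule submodule_iff[OF M.module_axioms])

lemma lattice_additive: "L \<in> Lat \<Longrightarrow> additive M L"
  and lattice_smult: "L \<in> Lat \<Longrightarrow> a \<in> D \<Longrightarrow> x \<in> L \<Longrightarrow> a \<odot>\<^bsub>M\<^esub> x \<in> L"
  unfolding lattices_def by (simp_all add: D_submodule_iff)

lemma lattice_sub: "L \<in> Lat \<Longrightarrow> x \<in> L \<Longrightarrow> x \<in> carrier M"
  by (rule additiveD(1)[OF lattice_additive])

lemma lattice_span:
  assumes "finite S" "S \<subseteq> carrier M" "mspan K M S = carrier M"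
  shows "D_span S \<in> Lat"
proof -
  have sub: "submodule (D_span S) (K\<lparr>carrier := D\<rparr>) M" by (rule mspan_submodule[OF D_module assms(2)])
  have "D_span S \<subseteq> carrier M" using sub unfolding D_submodule_iff additive_def by blast
  then have "mspan K M (D_span S) \<subseteq> carrier M"
    by (rule mspan_least[OF M.carrier_is_submodule])
  moreover have "carrier M \<subseteq> mspan K M (D_span S)"
    using mspan_mono[OF mspan_superset, of K M S "K\<lparr>carrier := D\<rparr>" M] assms(3) by auto
  ultimately show ?thesis
    using sub assms unfolding lattices_def fg_submodule_def by auto
qed

lemma zp_smult: "x \<in> carrier M \<Longrightarrow> zp m \<odot>\<^bsub>M\<^esub> (zp n \<odot>\<^bsub>M\<^esub> x) = zp (m + n) \<odot>\<^bsub>M\<^esub> x"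
  by (simp add: zp_add M.smult_assoc1)

lemma zp_smult_mono:
  assumes "\<And>a x. a \<in> D \<Longrightarrow> x \<in> L \<Longrightarrow> a \<odot>\<^bsub>M\<^esub> x \<in> L" "x \<in> carrier M" "zp m \<odot>\<^bsub>M\<^esub> x \<in> L" "m \<le> n"
  shows "zp n \<odot>\<^bsub>M\<^esub> x \<in> L"
  using assms(1)[OF zp_D assms(3), of "n - m"] zp_smult[OF assms(2), of "n - m" m] assms(4) by simp

text \<open>The elements with some multiple \<open>p^N x\<close> in \<open>L\<close> form a
  \<open>K\<close>-submodule. It contains \<open>L\<close>, hence also the \<open>K\<close>-span of
  \<open>L\<close>, which is everything.\<close>

lemma lattice_absorbs:
  assumes L: "L \<in> Lat" and x: "x \<in> carrier M"
  shows "\<exists>N. zp N \<odot>\<^bsub>M\<^esub> x \<in> L"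
proof -
  note add = additiveD[OF lattice_additive[OF L]]
  note mono = zp_smult_mono[of L, OF lattice_smult[OF L]]
  let ?A = "{x \<in> carrier M. \<exists>N. zp N \<odot>\<^bsub>M\<^esub> x \<in> L}"
  have "submodule ?A K M"
    unfolding K_submodule_iff additive_def
  proof (intro conjI ballI)
    show "\<zero>\<^bsub>M\<^esub> \<in> ?A" using add by auto
    fix x assume x: "x \<in> ?A"
    then obtain N where N: "zp N \<odot>\<^bsub>M\<^esub> x \<in> L" by blast
    show "\<ominus>\<^bsub>M\<^esub> x \<in> ?A" using x add(4)[OF N] by (auto simp: M.smult_r_minus)
    fix y assume y: "y \<in> ?A"
    then obtain N' where N': "zp N' \<odot>\<^bsub>M\<^esub> y \<in> L" by blast
    have "zp (max N N') \<odot>\<^bsub>M\<^esub> x \<in> L" "zp (max N N') \<odot>\<^bsub>M\<^esub> y \<in> L"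
      using mono[of x N "max N N'"] mono[of y N' "max N N'"] x y N N' by auto
    then show "x \<oplus>\<^bsub>M\<^esub> y \<in> ?A" using x y add(3) by (auto simp: M.smult_r_distr)
  next
    fix a x assume a: "a \<in> carrier K" and x: "x \<in> ?A"
    then obtain N where N: "zp N \<odot>\<^bsub>M\<^esub> x \<in> L" by blast
    obtain A where A: "zp A \<otimes> a \<in> D" using bounded a by blast
    have "(zp A \<otimes> a) \<odot>\<^bsub>M\<^esub> (zp N \<odot>\<^bsub>M\<^esub> x) = zp (A + N) \<odot>\<^bsub>M\<^esub> (a \<odot>\<^bsub>M\<^esub> x)"
    proof -
      have "(zp A \<otimes> a) \<odot>\<^bsub>M\<^esub> (zp N \<odot>\<^bsub>M\<^esub> x) = (zp A \<otimes> a \<otimes> zp N) \<odot>\<^bsub>M\<^esub> x"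
        using a x by (simp add: M.smult_assoc1)
      also have "zp A \<otimes> a \<otimes> zp N = zp (A + N) \<otimes> a" using a by (simp add: zp_add m_ac)
      finally show ?thesis using a x by (simp add: M.smult_assoc1)
    qed
    then show "a \<odot>\<^bsub>M\<^esub> x \<in> ?A" using lattice_smult[OF L A N] a x by auto
  qed auto
  moreover have "L \<subseteq> ?A" using add(1) by (auto intro!: exI[of _ 0])
  ultimately have "mspan K M L \<subseteq> ?A" by (rule mspan_least)
  then show ?thesis using L x unfolding lattices_def by auto
qed

text \<open>One exponent is found for the finitely many generators by taking maxima; the elements
  that it moves into \<open>L'\<close> form a \<open>D\<close>-submodule and therefore include the
  whole span.\<close>

lemma span_bounded:
  assumes L': "L' \<in> Lat" and S: "finite S" "S \<subseteq> carrier M"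
  shows "\<exists>N. \<forall>x\<in>D_span S. zp N \<odot>\<^bsub>M\<^esub> x \<in> L'"
proof -
  note add = additiveD[OF lattice_additive[OF L']]
  have "\<exists>N. \<forall>x\<in>S. zp N \<odot>\<^bsub>M\<^esub> x \<in> L'"
    using S
  proof (induction S)
    case (insert y S)
    obtain N N' where N: "\<forall>x\<in>S. zp N \<odot>\<^bsub>M\<^esub> x \<in> L'" "zp N' \<odot>\<^bsub>M\<^esub> y \<in> L'"
      using insert lattice_absorbs[OF L', of y] by auto
    have "zp (max N N') \<odot>\<^bsub>M\<^esub> x \<in> L'" if "x \<in> insert y S" for x
      using zp_smult_mono[OF lattice_smult[OF L'], of x N "max N N'"]
        zp_smult_mono[OF lattice_smult[OF L'], of x N' "max N N'"] N insert.prems that by auto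
    then show ?case by blast
  qed auto
  then obtain N where N: "\<forall>x\<in>S. zp N \<odot>\<^bsub>M\<^esub> x \<in> L'" by blast
  let ?A = "{x \<in> carrier M. zp N \<odot>\<^bsub>M\<^esub> x \<in> L'}"
  have "submodule ?A (K\<lparr>carrier := D\<rparr>) M"
    unfolding D_submodule_iff additive_def
  proof (intro conjI ballI)
    fix a x assume a: "a \<in> D" and x: "x \<in> ?A"
    have "zp N \<odot>\<^bsub>M\<^esub> (a \<odot>\<^bsub>M\<^esub> x) = a \<odot>\<^bsub>M\<^esub> (zp N \<odot>\<^bsub>M\<^esub> x)"
      using a x D_sub by (simp add: M.smult_assoc1[symmetric] m_comm)
    then show "a \<odot>\<^bsub>M\<^esub> x \<in> ?A" using lattice_smult[OF L' a, of "zp N \<odot>\<^bsub>M\<^esub> x"] a x D_sub by auto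
  qed (use add in \<open>auto simp: M.smult_r_distr M.smult_r_minus\<close>)
  then have "D_span S \<subseteq> ?A" by (rule mspan_least) (use N S in auto)
  then show ?thesis by blast
qed

lemma lattice_bounded:
  assumes "L \<in> Lat" "L' \<in> Lat"
  shows "\<exists>N. \<forall>x\<in>L. zp N \<odot>\<^bsub>M\<^esub> x \<in> L'"
  using assms(1) span_bounded[OF assms(2)] unfolding lattices_def fg_submodule_def by auto

text \<open>This is \<open>p^m L\<close>, written as a preimage under \<open>p^(-m)\<close> so that
  membership is a condition on \<open>x\<close>.\<close>

definition scale :: "int \<Rightarrow> 'm set \<Rightarrow> 'm set" where
  "scale m L = {x \<in> carrier M. zp (- m) \<odot>\<^bsub>M\<^esub> x \<in> L}"

lemma zp_smult_cancel:
  "x \<in> carrier M \<Longrightarrow> zp (- m) \<odot>\<^bsub>M\<^esub> (zp m \<odot>\<^bsub>M\<^esub> x) = x"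
  "x \<in> carrier M \<Longrightarrow> zp m \<odot>\<^bsub>M\<^esub> (zp (- m) \<odot>\<^bsub>M\<^esub> x) = x"
  by (simp_all add: zp_smult)

lemma lattice_scale:
  assumes L: "L \<in> Lat"
  shows "scale m L \<in> Lat"
proof -
  obtain S where S: "finite S" "S \<subseteq> carrier M" "L = D_span S"
    using L unfolding lattices_def fg_submodule_def by auto
  let ?T = "(\<lambda>x. zp m \<odot>\<^bsub>M\<^esub> x) ` S"
  have T: "finite ?T" "?T \<subseteq> carrier M" using S by auto
  have sub: "submodule (D_span ?T) (K\<lparr>carrier := D\<rparr>) M" by (rule mspan_submodule[OF D_module T(2)])
  have comm: "zp j \<odot>\<^bsub>M\<^esub> (a \<odot>\<^bsub>M\<^esub> x) = a \<odot>\<^bsub>M\<^esub> (zp j \<odot>\<^bsub>M\<^esub> x)"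
    if "a \<in> carrier K" "x \<in> carrier M" for a x j
    using that by (simp add: M.smult_assoc1[symmetric] m_comm)
  note add = additiveD[OF lattice_additive[OF L]]
  have scaled: "submodule {x \<in> carrier M. zp j \<odot>\<^bsub>M\<^esub> x \<in> N} (K\<lparr>carrier := D\<rparr>) M"
    if "submodule N (K\<lparr>carrier := D\<rparr>) M" for N j
    using that unfolding D_submodule_iff additive_def
    by (auto simp: M.smult_r_distr M.smult_r_minus comm D_sub)
  have LD: "submodule L (K\<lparr>carrier := D\<rparr>) M" using L unfolding lattices_def by simp
  have "D_span ?T \<subseteq> scale m L"
    unfolding scale_def
    by (rule mspan_least[OF scaled[OF LD]])
      (use S mspan_superset[of S "K\<lparr>carrier := D\<rparr>" M] in \<open>auto simp: zp_smult_cancel subset_eq\<close>)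
  moreover have "scale m L \<subseteq> D_span ?T"
  proof
    fix x assume x: "x \<in> scale m L"
    have "L \<subseteq> {x \<in> carrier M. zp m \<odot>\<^bsub>M\<^esub> x \<in> D_span ?T}"
      unfolding S(3)
      by (rule mspan_least[OF scaled[OF sub]])
        (use S mspan_superset[of ?T "K\<lparr>carrier := D\<rparr>" M] in auto)
    then show "x \<in> D_span ?T" using x zp_smult_cancel(2)[of x m] unfolding scale_def by force
  qed
  ultimately have e: "scale m L = D_span ?T" by blast
  have "mspan K M ?T = carrier M"
  proof
    show "mspan K M ?T \<subseteq> carrier M" by (rule mspan_least[OF M.carrier_is_submodule T(2)])
    have K: "submodule (mspan K M ?T) K M" by (rule mspan_submodule[OF M.module_axioms T(2)])
    have "submodule (mspan K M ?T) (K\<lparr>carrier := D\<rparr>) M"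
      using K unfolding D_submodule_iff K_submodule_iff using D_sub by blast
    moreover have "S \<subseteq> mspan K M ?T"
    proof
      fix x assume x: "x \<in> S"
      then have "zp m \<odot>\<^bsub>M\<^esub> x \<in> mspan K M ?T" using mspan_superset[of ?T K M] by blast
      then have "zp (- m) \<odot>\<^bsub>M\<^esub> (zp m \<odot>\<^bsub>M\<^esub> x) \<in> mspan K M ?T" using K unfolding K_submodule_iff by simp
      then show "x \<in> mspan K M ?T" using x S zp_smult_cancel by auto
    qed
    ultimately have "L \<subseteq> mspan K M ?T" unfolding S(3) by (rule mspan_least)
    then have "mspan K M L \<subseteq> mspan K M ?T" by (rule mspan_least[OF K])
    then show "carrier M \<subseteq> mspan K M ?T" using L unfolding lattices_def by auto
  qed
  then show ?thesis unfolding e using lattice_span[OF T] by blast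
qed

lemma lattice_containing:
  assumes "fg_submodule (carrier M) K M" "m \<in> carrier M"
  shows "\<exists>L\<in>Lat. m \<in> L"
proof -
  obtain S where S: "finite S" "S \<subseteq> carrier M" "carrier M = mspan K M S"
    using assms unfolding fg_submodule_def by auto
  have "mspan K M (insert m S) \<subseteq> carrier M"
    by (rule mspan_least[OF M.carrier_is_submodule]) (use S assms in auto)
  moreover have "carrier M \<subseteq> mspan K M (insert m S)"
    using S(3) mspan_mono[of S "insert m S" K M] by blast
  ultimately have "D_span (insert m S) \<in> Lat"
    by (intro lattice_span) (use S assms in auto)
  moreover have "m \<in> D_span (insert m S)" using mspan_superset[of "insert m S" "K\<lparr>carrier := D\<rparr>" M] by blast
  ultimately show ?thesis by blast
qed

text \<open>The scalar clause of \<open>good\<close> at \<open>g = 1\<close> puts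
  \<open>c_m D m\<close> into \<open>W\<close> for each generator \<open>m\<close>. The elements
  \<open>c_m m\<close> still generate \<open>M\<close> over \<open>K\<close> because
  \<open>c_m\<close> is invertible there, so their \<open>D\<close>-span is a lattice.\<close>

lemma good_contains_lattice:
  assumes fg: "fg_submodule (carrier M) K M" and W: "additive M W" "mgood K (D # Ds) (s # ss) M W"
  shows "\<exists>L\<in>Lat. L \<subseteq> W"
proof -
  obtain S where S: "finite S" "S \<subseteq> carrier M" "carrier M = mspan K M S"
    using fg unfolding fg_submodule_def by auto
  have "\<exists>c\<in>D - {\<zero>}. \<forall>x\<in>D. (c \<otimes> x) \<odot>\<^bsub>M\<^esub> m \<in> W" if "m \<in> S" for m
  proof -
    have "good K (D # Ds) (s # ss) {a \<in> carrier K. a \<odot>\<^bsub>M\<^esub> m \<in> W}" using W that S unfolding mgood_def by auto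
    then have "\<exists>c\<in>D - {\<zero>}. \<forall>x\<in>D. c \<otimes> x \<otimes> \<one> \<in> {a \<in> carrier K. a \<odot>\<^bsub>M\<^esub> m \<in> W}"
      unfolding good.simps using one_closed by blast
    then show ?thesis using D_sub by auto
  qed
  then obtain c where c: "\<And>m. m \<in> S \<Longrightarrow> c m \<in> D" "\<And>m. m \<in> S \<Longrightarrow> c m \<noteq> \<zero>"
    "\<And>m x. m \<in> S \<Longrightarrow> x \<in> D \<Longrightarrow> (c m \<otimes> x) \<odot>\<^bsub>M\<^esub> m \<in> W"
    by (metis Diff_iff insertI1)
  let ?T = "(\<lambda>m. c m \<odot>\<^bsub>M\<^esub> m) ` S"
  have T: "finite ?T" "?T \<subseteq> carrier M" using S(1) M.smult_closed c(1) D_sub S(2) by blast+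
  have KT: "submodule (mspan K M ?T) K M" by (rule mspan_submodule[OF M.module_axioms T(2)])
  have "S \<subseteq> mspan K M ?T"
  proof
    fix m assume m: "m \<in> S"
    then have "c m \<odot>\<^bsub>M\<^esub> m \<in> mspan K M ?T" using mspan_superset[of ?T K M] by blast
    moreover have "inv (c m) \<in> carrier K" "inv (c m) \<otimes> c m = \<one>" using c m D_sub field_Units by auto
    ultimately have "inv (c m) \<odot>\<^bsub>M\<^esub> (c m \<odot>\<^bsub>M\<^esub> m) \<in> mspan K M ?T" using KT unfolding K_submodule_iff by blast
    moreover have "inv (c m) \<odot>\<^bsub>M\<^esub> (c m \<odot>\<^bsub>M\<^esub> m) = m"
      using \<open>inv (c m) \<otimes> c m = \<one>\<close> \<open>inv (c m) \<in> carrier K\<close> c(1)[OF m] D_sub m S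
      by (simp add: M.smult_assoc1[symmetric] subset_eq)
    ultimately show "m \<in> mspan K M ?T" by simp
  qed
  then have "carrier M \<subseteq> mspan K M ?T" unfolding S(3) by (rule mspan_least[OF KT])
  moreover have "mspan K M ?T \<subseteq> carrier M" by (rule mspan_least[OF M.carrier_is_submodule T(2)])
  ultimately have "D_span ?T \<in> Lat" using lattice_span[OF T] by blast
  moreover have "D_span ?T \<subseteq> W"
  proof -
    note add = additiveD[OF W(1)]
    \<comment> \<open>The largest \<open>D\<close>-submodule inside \<open>W\<close>; the additive
      subgroup \<open>W\<close> need not be stable under \<open>D\<close>.\<close>
    let ?A = "{x \<in> carrier M. \<forall>d\<in>D. d \<odot>\<^bsub>M\<^esub> x \<in> W}"
    have "submodule ?A (K\<lparr>carrier := D\<rparr>) M"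
      unfolding D_submodule_iff additive_def
      by (auto simp: M.smult_r_distr M.smult_r_minus D_sub add D_mult M.smult_assoc1[symmetric])
    moreover have "?T \<subseteq> ?A"
    proof clarsimp
      fix m assume m: "m \<in> S"
      show "c m \<odot>\<^bsub>M\<^esub> m \<in> carrier M \<and> (\<forall>d\<in>D. d \<odot>\<^bsub>M\<^esub> (c m \<odot>\<^bsub>M\<^esub> m) \<in> W)"
      proof (intro conjI ballI)
        have mc: "m \<in> carrier M" "c m \<in> carrier K" using m S(2) c(1) D_sub by blast+
        then show "c m \<odot>\<^bsub>M\<^esub> m \<in> carrier M" by (rule M.smult_closed[rotated])
        show "d \<odot>\<^bsub>M\<^esub> (c m \<odot>\<^bsub>M\<^esub> m) \<in> W" if "d \<in> D" for d
          using c(3)[OF m that] mc D_sub[OF that] M.smult_assoc1[of d "c m" m] m_comm[of d "c m"] by simp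
      qed
    qed
    ultimately have "D_span ?T \<subseteq> ?A" by (rule mspan_least)
    moreover have "?A \<subseteq> W"
    proof
      fix x assume "x \<in> ?A"
      then have "x \<in> carrier M" "\<one> \<odot>\<^bsub>M\<^esub> x \<in> W" using D_one by blast+
      then show "x \<in> W" by simp
    qed
    ultimately show ?thesis by blast
  qed
  ultimately show ?thesis by blast
qed

end

lemma rest_quot_simps [simp]:
  "carrier (rest_quot \<sigma> M L L') = quot_map M L' ` L"
  "\<zero>\<^bsub>rest_quot \<sigma> M L L'\<^esub> = quot_map M L' \<zero>\<^bsub>M\<^esub>"
  "x \<oplus>\<^bsub>rest_quot \<sigma> M L L'\<^esub> y = quot_map M L' (x \<oplus>\<^bsub>M\<^esub> y)"
  "a \<odot>\<^bsub>rest_quot \<sigma> M L L'\<^esub> x = quot_map M L' (\<sigma> a \<odot>\<^bsub>M\<^esub> x)"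
  by (simp_all add: rest_quot_def)

section \<open>The quotient of two lattices as a module over the residue field\<close>

locale lattice_pair = dvr_module +
  fixes L L'
  assumes L: "L \<in> lattices K D M" and L': "L' \<in> lattices K D M" and incl: "L' \<subseteq> L"
begin

interpretation k1: field k1 by (rule residue_is_field)

abbreviation q where "q \<equiv> quot_map M L'"
abbreviation Q where "Q \<equiv> rest_quot s M L L'"

lemmas L_add = additiveD[OF lattice_additive[OF L]]
lemmas L'_add = additiveD[OF lattice_additive[OF L']]

lemma q_eq_iff: "x \<in> L \<Longrightarrow> y \<in> L \<Longrightarrow> q x = q y \<longleftrightarrow> x \<ominus>\<^bsub>M\<^esub> y \<in> L'"
  using quot_map_eq_iff[OF M.M.abelian_group_axioms lattice_additive[OF L']] L_add(1) by blast

lemma q_coset: "x \<in> L \<Longrightarrow> \<exists>l\<in>L'. q x = l \<oplus>\<^bsub>M\<^esub> x"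
  using quot_map_coset[OF M.M.abelian_group_axioms lattice_additive[OF L']] L_add(1) by blast

text \<open>The chosen representative of a class stays in \<open>L\<close>. This allows a map given
  on \<open>L\<close> to be evaluated at elements of \<open>Q\<close>, as the definition of the
  induced map does.\<close>

lemma q_in: "x \<in> L \<Longrightarrow> q x \<in> L"
  using q_coset[of x] L_add(3) incl by auto

lemma q_absorb: "l \<in> L' \<Longrightarrow> x \<in> L \<Longrightarrow> q (l \<oplus>\<^bsub>M\<^esub> x) = q x"
proof -
  assume h: "l \<in> L'" "x \<in> L"
  then have c: "l \<in> carrier M" "x \<in> carrier M" "l \<in> L" using L_add(1) incl by auto
  then have "(l \<oplus>\<^bsub>M\<^esub> x) \<ominus>\<^bsub>M\<^esub> x = l" by (simp add: a_minus_def M.M.a_assoc M.M.r_neg)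
  then show ?thesis using q_eq_iff[of "l \<oplus>\<^bsub>M\<^esub> x" x] h c L_add(3) by simp
qed

lemma q_add_left: "x \<in> L \<Longrightarrow> y \<in> L \<Longrightarrow> q (q x \<oplus>\<^bsub>M\<^esub> y) = q (x \<oplus>\<^bsub>M\<^esub> y)"
proof -
  assume h: "x \<in> L" "y \<in> L"
  obtain l where l: "l \<in> L'" "q x = l \<oplus>\<^bsub>M\<^esub> x" using q_coset h by blast
  then have "q x \<oplus>\<^bsub>M\<^esub> y = l \<oplus>\<^bsub>M\<^esub> (x \<oplus>\<^bsub>M\<^esub> y)" using h L_add(1) incl by (auto simp: M.M.a_assoc)
  then show ?thesis using q_absorb l h L_add(3) by simp
qed

lemma q_add_right: "x \<in> L \<Longrightarrow> y \<in> L \<Longrightarrow> q (x \<oplus>\<^bsub>M\<^esub> q y) = q (x \<oplus>\<^bsub>M\<^esub> y)"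
  using q_add_left[of y x] M.M.a_comm[of x "q y"] M.M.a_comm[of x y] L_add(1) q_in by metis

lemma q_smult: "b \<in> carrier k1 \<Longrightarrow> x \<in> L \<Longrightarrow> q (s b \<odot>\<^bsub>M\<^esub> q x) = q (s b \<odot>\<^bsub>M\<^esub> x)"
proof -
  assume h: "b \<in> carrier k1" "x \<in> L"
  obtain l where l: "l \<in> L'" "q x = l \<oplus>\<^bsub>M\<^esub> x" using q_coset h by blast
  then have "s b \<odot>\<^bsub>M\<^esub> q x = s b \<odot>\<^bsub>M\<^esub> l \<oplus>\<^bsub>M\<^esub> s b \<odot>\<^bsub>M\<^esub> x"
    using h L_add(1) incl by (auto simp: M.smult_r_distr)
  then show ?thesis
    using q_absorb lattice_smult[OF L' s_D[OF h(1)] l(1)] lattice_smult[OF L s_D[OF h(1)] h(2)] by simp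
qed

lemma s_smult_L: "b \<in> carrier k1 \<Longrightarrow> x \<in> L \<Longrightarrow> s b \<odot>\<^bsub>M\<^esub> x \<in> L"
  using lattice_smult[OF L s_D] by blast

lemma Q_smult: "b \<in> carrier k1 \<Longrightarrow> x \<in> L \<Longrightarrow> b \<odot>\<^bsub>Q\<^esub> q x = q (s b \<odot>\<^bsub>M\<^esub> x)"
  by (simp add: q_smult)

lemma Q_add: "x \<in> L \<Longrightarrow> y \<in> L \<Longrightarrow> q x \<oplus>\<^bsub>Q\<^esub> q y = q (x \<oplus>\<^bsub>M\<^esub> y)"
  by (simp add: q_add_left q_add_right q_in)

lemma Q_abelian: "abelian_group Q"
proof (rule abelian_groupI)
  fix x y z assume "x \<in> carrier Q" "y \<in> carrier Q" "z \<in> carrier Q"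
  then obtain a b c where e: "a \<in> L" "b \<in> L" "c \<in> L" "x = q a" "y = q b" "z = q c" by auto
  have c: "a \<in> carrier M" "b \<in> carrier M" "c \<in> carrier M" using e L_add(1) by auto
  note e2 = e L_add(3) Q_add
  have ab: "a \<oplus>\<^bsub>M\<^esub> b \<in> L" "b \<oplus>\<^bsub>M\<^esub> c \<in> L" using e L_add(3) by auto
  show "x \<oplus>\<^bsub>Q\<^esub> y \<in> carrier Q" using Q_add[OF e(1,2)] e ab by auto
  show "x \<oplus>\<^bsub>Q\<^esub> y = y \<oplus>\<^bsub>Q\<^esub> x"
    using Q_add[OF e(1,2)] Q_add[OF e(2,1)] M.M.a_comm[OF c(1,2)] e(4,5) by simp
  show "x \<oplus>\<^bsub>Q\<^esub> y \<oplus>\<^bsub>Q\<^esub> z = x \<oplus>\<^bsub>Q\<^esub> (y \<oplus>\<^bsub>Q\<^esub> z)"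
    using Q_add[OF e(1,2)] Q_add[OF e(2,3)] Q_add[OF ab(1) e(3)] Q_add[OF e(1) ab(2)]
      M.M.a_assoc[OF c] e(4-6) by (simp del: rest_quot_simps)
next
  show "\<zero>\<^bsub>Q\<^esub> \<in> carrier Q" using L_add(2) by simp
  fix x assume "x \<in> carrier Q"
  then obtain a where a: "a \<in> L" "x = q a" by auto
  have ac: "a \<in> carrier M" using a L_add(1) by auto
  show "\<zero>\<^bsub>Q\<^esub> \<oplus>\<^bsub>Q\<^esub> x = x"
    using Q_add[OF L_add(2) a(1)] a ac by simp
  have "q (\<ominus>\<^bsub>M\<^esub> a) \<oplus>\<^bsub>Q\<^esub> x = \<zero>\<^bsub>Q\<^esub>"
    using Q_add[OF L_add(4)[OF a(1)] a(1)] a ac by (simp add: M.M.l_neg)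
  moreover have "q (\<ominus>\<^bsub>M\<^esub> a) \<in> carrier Q" using L_add(4)[OF a(1)] by simp
  ultimately show "\<exists>y\<in>carrier Q. y \<oplus>\<^bsub>Q\<^esub> x = \<zero>\<^bsub>Q\<^esub>" by blast
qed

lemma Q_module: "module k1 Q"
proof (rule moduleI)
  show "cring k1" by (rule k1.is_cring)
  show "abelian_group Q" by (rule Q_abelian)
next
  fix a x assume a: "a \<in> carrier k1" and "x \<in> carrier Q"
  then obtain u where u: "u \<in> L" "x = q u" by auto
  have uM: "u \<in> carrier M" using u L_add(1) by auto
  show "a \<odot>\<^bsub>Q\<^esub> x \<in> carrier Q" using Q_smult[OF a u(1)] u s_smult_L[OF a u(1)] by simp
  fix b assume b: "b \<in> carrier k1"
  show "(a \<otimes>\<^bsub>k1\<^esub> b) \<odot>\<^bsub>Q\<^esub> x = a \<odot>\<^bsub>Q\<^esub> (b \<odot>\<^bsub>Q\<^esub> x)"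
    using Q_smult[OF a s_smult_L[OF b u(1)]] Q_smult[OF b u(1)] Q_smult[OF k1.m_closed[OF a b] u(1)] u uM a b
    by (simp add: s_mult M.smult_assoc1 del: rest_quot_simps)
  show "(a \<oplus>\<^bsub>k1\<^esub> b) \<odot>\<^bsub>Q\<^esub> x = a \<odot>\<^bsub>Q\<^esub> x \<oplus>\<^bsub>Q\<^esub> b \<odot>\<^bsub>Q\<^esub> x"
    using Q_smult[OF k1.a_closed[OF a b] u(1)] Q_smult[OF a u(1)] Q_smult[OF b u(1)]
      Q_add[OF s_smult_L[OF a u(1)] s_smult_L[OF b u(1)]] u uM a b
    by (simp add: s_add M.smult_l_distr del: rest_quot_simps)
next
  fix x assume "x \<in> carrier Q"
  then obtain u where u: "u \<in> L" "x = q u" by auto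
  then show "\<one>\<^bsub>k1\<^esub> \<odot>\<^bsub>Q\<^esub> x = x" using Q_smult[OF k1.one_closed u(1)] L_add(1) by (simp add: s_one)
next
  fix a x y assume a: "a \<in> carrier k1" and "x \<in> carrier Q" "y \<in> carrier Q"
  then obtain u v where u: "u \<in> L" "x = q u" and v: "v \<in> L" "y = q v" by auto
  have uM: "u \<in> carrier M" "v \<in> carrier M" using u v L_add(1) by auto
  show "a \<odot>\<^bsub>Q\<^esub> (x \<oplus>\<^bsub>Q\<^esub> y) = a \<odot>\<^bsub>Q\<^esub> x \<oplus>\<^bsub>Q\<^esub> a \<odot>\<^bsub>Q\<^esub> y"
    using Q_add[OF u(1) v(1)] Q_smult[OF a L_add(3)[OF u(1) v(1)]] Q_smult[OF a u(1)] Q_smult[OF a v(1)]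
      Q_add[OF s_smult_L[OF a u(1)] s_smult_L[OF a v(1)]] u v uM a
    by (simp add: M.smult_r_distr del: rest_quot_simps)
qed

text \<open>Choose \<open>r\<close> with \<open>p^r L \<subseteq> L'\<close> and a finite set
  \<open>S\<close> generating \<open>L\<close> over \<open>D\<close>. Modulo \<open>p^r\<close>
  every element of \<open>D\<close> is a combination of \<open>1, p, ..., p^(r-1)\<close> with
  coefficients lifted from \<open>k1\<close>, so the classes of \<open>p^i x\<close> with
  \<open>i < r\<close> and \<open>x\<close> in \<open>S\<close> generate the quotient over
  \<open>k1\<close>.\<close>

lemma Q_finite: "fg_submodule (carrier Q) k1 Q"
proof -
  obtain S where S: "finite S" "S \<subseteq> carrier M" "L = D_span S"
    using L unfolding lattices_def fg_submodule_def by auto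
  have SL: "S \<subseteq> L" using S mspan_superset[of S] by simp
  obtain N where N: "\<forall>x\<in>L. zp N \<odot>\<^bsub>M\<^esub> x \<in> L'" using lattice_bounded[OF L L'] by blast
  define r where "r = nat N"
  have r: "zp (int r) \<odot>\<^bsub>M\<^esub> x \<in> L'" if "x \<in> L" for x
    using zp_smult_mono[of L' x N "int r"] lattice_smult[OF L'] N that L_add(1) r_def by auto
  let ?T = "(\<lambda>(i, x). q (zp (int i) \<odot>\<^bsub>M\<^esub> x)) ` ({..<r} \<times> S)"
  have iL: "zp (int i) \<odot>\<^bsub>M\<^esub> x \<in> L" if "x \<in> L" for i x
    using lattice_smult[OF L zp_D that] by simp
  have T: "finite ?T" "?T \<subseteq> carrier Q" using S iL SL by auto
  have Tsub: "submodule (mspan k1 Q ?T) k1 Q" by (rule mspan_submodule[OF Q_module T(2)])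
  have "carrier Q \<subseteq> N" if N: "submodule N k1 Q" "?T \<subseteq> N" for N
  proof -
    have Nadd: "additive Q N" and Nsm: "\<And>a x. a \<in> carrier k1 \<Longrightarrow> x \<in> N \<Longrightarrow> a \<odot>\<^bsub>Q\<^esub> x \<in> N"
      using N(1) unfolding submodule_iff[OF Q_module] by auto
    note Nd = additiveD[OF Nadd]
    have qN_add: "q (x \<oplus>\<^bsub>M\<^esub> y) \<in> N" if "q x \<in> N" "q y \<in> N" "x \<in> L" "y \<in> L" for x y
      using Nd(3)[OF that(1,2)] Q_add[OF that(3,4)] by simp
    have qN_L': "q x \<in> N" if "x \<in> L'" for x
      using q_absorb[OF that L_add(2)] Nd(2) that L'_add(1) by simp
    \<comment> \<open>A descending induction on the exponent \<open>r - j\<close>. At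
      \<open>j = 0\<close> the elements already lie in \<open>L'\<close>; each further step splits
      off the leading digit of \<open>d\<close>, which is handled by the generator with that
      exponent, and passes to \<open>shift d\<close> one exponent higher.\<close>
    have key: "\<forall>d\<in>D. q (d \<odot>\<^bsub>M\<^esub> (zp (int (r - j)) \<odot>\<^bsub>M\<^esub> x)) \<in> N" if x: "x \<in> S" and j: "j \<le> r" for j x
      using j
    proof (induction j)
      case 0
      show ?case using r x SL lattice_smult[OF L'] qN_L' by simp (meson subsetD)
    next
      case (Suc j)
      show ?case
      proof
        fix d assume d: "d \<in> D"
        let ?i = "r - Suc j"
        have xM: "x \<in> carrier M" "x \<in> L" using x S SL by auto
        have rm: "rm d \<in> carrier k1" using rm_closed d by blast
        have sh: "shift d \<in> D" using shift_D d by blast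
        have ij: "int (r - j) = int ?i + 1" using Suc.prems by simp
        have dec: "d \<odot>\<^bsub>M\<^esub> (zp (int ?i) \<odot>\<^bsub>M\<^esub> x)
          = s (rm d) \<odot>\<^bsub>M\<^esub> (zp (int ?i) \<odot>\<^bsub>M\<^esub> x) \<oplus>\<^bsub>M\<^esub> shift d \<odot>\<^bsub>M\<^esub> (zp (int (r - j)) \<odot>\<^bsub>M\<^esub> x)"
        proof -
          have "d \<odot>\<^bsub>M\<^esub> (zp (int ?i) \<odot>\<^bsub>M\<^esub> x) = (s (rm d) \<oplus> p \<otimes> shift d) \<odot>\<^bsub>M\<^esub> (zp (int ?i) \<odot>\<^bsub>M\<^esub> x)"
            using digit_expand[OF d] by simp
          also have "\<dots> = s (rm d) \<odot>\<^bsub>M\<^esub> (zp (int ?i) \<odot>\<^bsub>M\<^esub> x)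
              \<oplus>\<^bsub>M\<^esub> (p \<otimes> shift d) \<odot>\<^bsub>M\<^esub> (zp (int ?i) \<odot>\<^bsub>M\<^esub> x)"
            using rm sh D_sub xM by (simp add: M.smult_l_distr)
          also have "(p \<otimes> shift d) \<odot>\<^bsub>M\<^esub> (zp (int ?i) \<odot>\<^bsub>M\<^esub> x) = (p \<otimes> shift d \<otimes> zp (int ?i)) \<odot>\<^bsub>M\<^esub> x"
            using sh D_sub xM by (simp add: M.smult_assoc1)
          also have "p \<otimes> shift d \<otimes> zp (int ?i) = shift d \<otimes> zp (int (r - j))"
            using sh D_sub by (simp add: ij zp_add zp_1 m_ac)
          also have "(shift d \<otimes> zp (int (r - j))) \<odot>\<^bsub>M\<^esub> x = shift d \<odot>\<^bsub>M\<^esub> (zp (int (r - j)) \<odot>\<^bsub>M\<^esub> x)"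
            using sh D_sub xM by (simp add: M.smult_assoc1)
          finally show ?thesis .
        qed
        have "?i < r" using Suc.prems by simp
        then have "q (zp (int ?i) \<odot>\<^bsub>M\<^esub> x) \<in> N" using N(2) x by auto
        then have "rm d \<odot>\<^bsub>Q\<^esub> q (zp (int ?i) \<odot>\<^bsub>M\<^esub> x) \<in> N" by (rule Nsm[OF rm])
        then have 1: "q (s (rm d) \<odot>\<^bsub>M\<^esub> (zp (int ?i) \<odot>\<^bsub>M\<^esub> x)) \<in> N"
          using Q_smult[OF rm iL[OF xM(2)]] by simp
        have 2: "q (shift d \<odot>\<^bsub>M\<^esub> (zp (int (r - j)) \<odot>\<^bsub>M\<^esub> x)) \<in> N" using Suc sh by simp
        show "q (d \<odot>\<^bsub>M\<^esub> (zp (int ?i) \<odot>\<^bsub>M\<^esub> x)) \<in> N"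
          unfolding dec
          by (rule qN_add[OF 1 2 s_smult_L[OF rm iL[OF xM(2)]] lattice_smult[OF L sh iL[OF xM(2)]]])
      qed
    qed
    have gen: "q (d \<odot>\<^bsub>M\<^esub> x) \<in> N" if "x \<in> S" "d \<in> D" for x d
      using key[OF that(1), of r] that S by auto
    \<comment> \<open>Since \<open>N\<close> is merely a \<open>k1\<close>-submodule, stability
      under all of \<open>D\<close> is imposed here, so that the minimality of the
      \<open>D\<close>-span of \<open>S\<close> can be applied.\<close>
    let ?A = "{x \<in> L. \<forall>d\<in>D. q (d \<odot>\<^bsub>M\<^esub> x) \<in> N}"
    have "submodule ?A (K\<lparr>carrier := D\<rparr>) M"
      unfolding D_submodule_iff additive_def
    proof (intro conjI ballI)
      show "?A \<subseteq> carrier M" using L_add(1) by auto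
      show "\<zero>\<^bsub>M\<^esub> \<in> ?A" using L_add(2) qN_L'[OF L'_add(2)] D_sub by simp
      fix x assume x: "x \<in> ?A"
      then have xM: "x \<in> carrier M" using L_add(1) by auto
      have "q (d \<odot>\<^bsub>M\<^esub> (\<ominus>\<^bsub>M\<^esub> x)) \<in> N" if d: "d \<in> D" for d
      proof -
        have "d \<odot>\<^bsub>M\<^esub> (\<ominus>\<^bsub>M\<^esub> x) = (\<ominus> d) \<odot>\<^bsub>M\<^esub> x" using xM d D_sub by (simp add: M.smult_r_minus M.smult_l_minus)
        then show ?thesis using x D_minus[OF d] by auto
      qed
      then show "\<ominus>\<^bsub>M\<^esub> x \<in> ?A" using x L_add(4) by auto
      fix y assume y: "y \<in> ?A"
      then have yM: "y \<in> carrier M" using L_add(1) by auto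
      have "q (d \<odot>\<^bsub>M\<^esub> (x \<oplus>\<^bsub>M\<^esub> y)) \<in> N" if d: "d \<in> D" for d
      proof -
        have "d \<odot>\<^bsub>M\<^esub> (x \<oplus>\<^bsub>M\<^esub> y) = d \<odot>\<^bsub>M\<^esub> x \<oplus>\<^bsub>M\<^esub> d \<odot>\<^bsub>M\<^esub> y" using xM yM d D_sub by (simp add: M.smult_r_distr)
        then show ?thesis using x y d lattice_smult[OF L d] qN_add by auto
      qed
      then show "x \<oplus>\<^bsub>M\<^esub> y \<in> ?A" using x y L_add(3) by auto
    next
      fix a x assume a: "a \<in> D" and x: "x \<in> ?A"
      then have xM: "x \<in> carrier M" using L_add(1) by auto
      have "q (d \<odot>\<^bsub>M\<^esub> (a \<odot>\<^bsub>M\<^esub> x)) \<in> N" if d: "d \<in> D" for d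
        using x D_mult[OF d a] M.smult_assoc1[OF D_sub[OF d] D_sub[OF a] xM] by auto
      then show "a \<odot>\<^bsub>M\<^esub> x \<in> ?A" using x lattice_smult[OF L a] by auto
    qed
    then have "D_span S \<subseteq> ?A" by (rule mspan_least) (use gen SL S(3) in auto)
    then have "L \<subseteq> ?A" using S(3) by simp
    show ?thesis
    proof
      fix y assume "y \<in> carrier Q"
      then obtain x where x: "x \<in> L" "y = q x" by auto
      then have "q (\<one> \<odot>\<^bsub>M\<^esub> x) \<in> N" using \<open>L \<subseteq> ?A\<close> D_one by blast
      then show "y \<in> N" using x L_add(1) by simp
    qed
  qed
  then have "carrier Q \<subseteq> mspan k1 Q ?T" unfolding mspan_def by blast
  moreover have "mspan k1 Q ?T \<subseteq> carrier Q"
    by (rule mspan_least[OF module.carrier_is_submodule[OF Q_module] T(2)])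
  ultimately show ?thesis unfolding fg_submodule_def using T by blast
qed

lemma Q_minus: "x \<in> L \<Longrightarrow> \<ominus>\<^bsub>Q\<^esub> q x = q (\<ominus>\<^bsub>M\<^esub> x)"
proof -
  interpret Q: abelian_group Q by (rule Q_abelian)
  assume x: "x \<in> L"
  have "q (\<ominus>\<^bsub>M\<^esub> x) \<oplus>\<^bsub>Q\<^esub> q x = \<zero>\<^bsub>Q\<^esub>"
    using Q_add[OF L_add(4)[OF x] x] x L_add(1) by (simp add: M.M.l_neg)
  then show ?thesis using Q.minus_equality x L_add(4) by simp
qed

lemma additive_image: "additive M W \<Longrightarrow> additive Q (q ` (W \<inter> L))"
  unfolding additive_def
proof (intro conjI ballI)
  assume W: "W \<subseteq> carrier M \<and> \<zero>\<^bsub>M\<^esub> \<in> W \<and> (\<forall>x\<in>W. \<forall>y\<in>W. x \<oplus>\<^bsub>M\<^esub> y \<in> W) \<and> (\<forall>x\<in>W. \<ominus>\<^bsub>M\<^esub> x \<in> W)"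
  show "q ` (W \<inter> L) \<subseteq> carrier Q" by auto
  show "\<zero>\<^bsub>Q\<^esub> \<in> q ` (W \<inter> L)" using W L_add(2) by simp
  fix x assume "x \<in> q ` (W \<inter> L)"
  then obtain u where u: "u \<in> W" "u \<in> L" "x = q u" by auto
  show "\<ominus>\<^bsub>Q\<^esub> x \<in> q ` (W \<inter> L)" using Q_minus[OF u(2)] u W L_add(4) by auto
  fix y assume "y \<in> q ` (W \<inter> L)"
  then obtain v where v: "v \<in> W" "v \<in> L" "y = q v" by auto
  show "x \<oplus>\<^bsub>Q\<^esub> y \<in> q ` (W \<inter> L)" using Q_add[OF u(2) v(2)] u v W L_add(3) by auto
qed

text \<open>The inclusion \<open>L' \<subseteq> W\<close> makes \<open>W\<close> a union of classes,
  so nothing is lost by passing to the quotient.\<close>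

lemma mem_image_iff:
  assumes "additive M W" "L' \<subseteq> W" "x \<in> L"
  shows "q x \<in> q ` (W \<inter> L) \<longleftrightarrow> x \<in> W"
proof
  assume "q x \<in> q ` (W \<inter> L)"
  then obtain w where w: "w \<in> W" "w \<in> L" "q x = q w" by auto
  have d: "x \<ominus>\<^bsub>M\<^esub> w \<in> W" using q_eq_iff assms w by blast
  have "x = (x \<ominus>\<^bsub>M\<^esub> w) \<oplus>\<^bsub>M\<^esub> w"
    using L_add(1)[OF assms(3)] L_add(1)[OF w(2)] by (simp add: a_minus_def M.M.a_assoc M.M.l_neg)
  then show "x \<in> W" using additiveD(3)[OF assms(1) d w(1)] by simp
qed (use assms in auto)

text \<open>The residual clause of \<open>good\<close> at \<open>g = 1\<close>, applied to the line
  through \<open>x\<close>, is the goodness over \<open>k1\<close> of the line through the class of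
  \<open>x\<close>, because \<open>k1\<close> acts on the quotient through \<open>s\<close>.\<close>

lemma mgood_image:
  assumes k1: "k1 = residue_field K D" and W: "mgood K (D # Ds) (s # ss) M W"
  shows "mgood k1 Ds ss Q (q ` (W \<inter> L))"
  unfolding mgood_def
proof
  fix y assume "y \<in> carrier Q"
  then obtain x where x: "x \<in> L" "y = q x" by auto
  have "good K (D # Ds) (s # ss) {a \<in> carrier K. a \<odot>\<^bsub>M\<^esub> x \<in> W}"
    using W L_add(1)[OF x(1)] unfolding mgood_def by blast
  then have "good k1 Ds ss {b \<in> carrier k1. s b \<otimes> \<one> \<in> {a \<in> carrier K. a \<odot>\<^bsub>M\<^esub> x \<in> W}}"
    unfolding good.simps k1 using one_closed by blast
  then show "good k1 Ds ss {b \<in> carrier k1. b \<odot>\<^bsub>Q\<^esub> y \<in> q ` (W \<inter> L)}"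
  proof (rule good_mono, safe)
    fix b assume b: "b \<in> carrier k1" "s b \<otimes> \<one> \<in> carrier K" "s b \<otimes> \<one> \<odot>\<^bsub>M\<^esub> x \<in> W"
    then have "s b \<odot>\<^bsub>M\<^esub> x \<in> W" by simp
    then have "q (s b \<odot>\<^bsub>M\<^esub> x) \<in> q ` (W \<inter> L)" using s_smult_L[OF b(1) x(1)] by blast
    then show "b \<odot>\<^bsub>Q\<^esub> y \<in> q ` (W \<inter> L)" using Q_smult[OF b(1) x(1)] x(2) by (simp only:)
  qed
qed

end

section \<open>Beilinson-Tate operators pull good subgroups back\<close>

lemma linear_map_zero:
  assumes "abelian_group M1" "abelian_group M2"
    "\<phi> \<in> linear_maps k (restrict_scalars \<iota> M1) (restrict_scalars \<iota> M2)"
  shows "\<phi> \<zero>\<^bsub>M1\<^esub> = \<zero>\<^bsub>M2\<^esub>"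
  using additive_map_zero[OF assms(1,2), of \<phi>] assms(3) unfolding linear_maps_iff by blast

theorem BT_operators_good:
  assumes "lifted k \<iota> K Ds ss" "module K M1" "module K M2"
    "fg_submodule (carrier M1) K M1" "fg_submodule (carrier M2) K M2"
    "\<phi> \<in> BT_operators k \<iota> K Ds ss M1 M2" "additive M2 W" "mgood K Ds ss M2 W"
  shows "mgood K Ds ss M1 {x \<in> carrier M1. \<phi> x \<in> W}"
  using assms
proof (induction k \<iota> K Ds ss arbitrary: M1 M2 \<phi> W rule: lifted.induct)
  case (1 k \<iota> K)
  then show ?case by (simp add: mgood_def)
next
  case (2 k \<iota> K D Ds s ss)
  let ?k1 = "residue_field K D" let ?rm = "residue_map K D"
  obtain p where p: "lifted_dvr K D p ?k1 ?rm s" using "2.prems"(1) by auto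
  interpret M1: dvr_module K D p ?k1 ?rm s M1 using p "2.prems"(2) by (simp add: dvr_module_def)
  interpret M2: dvr_module K D p ?k1 ?rm s M2 using p "2.prems"(3) by (simp add: dvr_module_def)
  have lift: "lifted k (?rm \<circ> \<iota>) ?k1 Ds ss" using "2.prems"(1) by simp
  have lin: "\<phi> \<in> linear_maps k (restrict_scalars \<iota> M1) (restrict_scalars \<iota> M2)"
    using "2.prems"(6) by simp
  note lin' = lin[unfolded linear_maps_iff]
  have ref: "\<exists>P'\<in>lattices K D M1 \<times> lattices K D M2. refinement \<phi> P' (L1, L2)"
    if "L1 \<in> lattices K D M1" "L2 \<in> lattices K D M2" for L1 L2
    using "2.prems"(6) that by simp
  have ind: "(\<lambda>x. quot_map M2 L2 (\<phi> x)) \<in> BT_operators k (?rm \<circ> \<iota>) ?k1 Ds ss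
      (rest_quot s M1 L1 L1') (rest_quot s M2 L2' L2)"
    if "L1 \<in> lattices K D M1" "L2 \<in> lattices K D M2" "L1' \<in> lattices K D M1" "L2' \<in> lattices K D M2"
      "refinement \<phi> (L1', L2') (L1, L2)" for L1 L2 L1' L2'
    using "2.prems"(6) that by simp
  note W = additiveD[OF "2.prems"(7)]
  obtain L2 where L2: "L2 \<in> lattices K D M2" "L2 \<subseteq> W"
    using M2.good_contains_lattice[OF "2.prems"(5,7,8)] by blast
  \<comment> \<open>Both clauses of \<open>good\<close> at \<open>g = 1\<close>. The clauses at a
    general \<open>g\<close> are obtained at the end by replacing \<open>m\<close> with
    \<open>g m\<close>.\<close>
  have *: "(\<exists>N. \<forall>x\<in>D. \<phi> (x \<odot>\<^bsub>M1\<^esub> (M1.zp N \<odot>\<^bsub>M1\<^esub> m)) \<in> W \<and> 0 \<le> N) \<and>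
      good ?k1 Ds ss {b \<in> carrier ?k1. \<phi> (s b \<odot>\<^bsub>M1\<^esub> m) \<in> W}" if m: "m \<in> carrier M1" for m
  proof -
    \<comment> \<open>The lattice is chosen around \<open>m\<close> so that \<open>m\<close> has a
      class in \<open>L1/L1'\<close>, on whose line the induction hypothesis is then read.\<close>
    obtain L1 where L1: "L1 \<in> lattices K D M1" "m \<in> L1" using M1.lattice_containing[OF "2.prems"(4) m] by blast
    obtain L1' L2' where R: "L1' \<in> lattices K D M1" "L2' \<in> lattices K D M2" "refinement \<phi> (L1', L2') (L1, L2)"
      using ref[OF L1(1) L2(1)] by auto
    have r: "L1' \<subseteq> L1" "L2 \<subseteq> L2'" "\<And>x. x \<in> L1' \<Longrightarrow> \<phi> x \<in> L2" "\<And>x. x \<in> L1 \<Longrightarrow> \<phi> x \<in> L2'"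
      using R(3) by (auto simp: refinement_def)
    interpret Q1: lattice_pair K D p ?k1 ?rm s M1 L1 L1'
      by unfold_locales (use L1 R r in auto)
    interpret Q2: lattice_pair K D p ?k1 ?rm s M2 L2' L2
      by unfold_locales (use L2 R r in auto)
    obtain N where N: "M1.zp N \<odot>\<^bsub>M1\<^esub> m \<in> L1'" using M1.lattice_absorbs[OF R(1) m] by blast
    have N': "M1.zp (max N 0) \<odot>\<^bsub>M1\<^esub> m \<in> L1'"
      using M1.zp_smult_mono[OF M1.lattice_smult[OF R(1)] m N, of "max N 0"] by simp
    have 1: "\<exists>N. \<forall>x\<in>D. \<phi> (x \<odot>\<^bsub>M1\<^esub> (M1.zp N \<odot>\<^bsub>M1\<^esub> m)) \<in> W \<and> 0 \<le> N"
      using M1.lattice_smult[OF R(1) _ N'] r(3) L2(2) by (intro exI[of _ "max N 0"]) auto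
    \<comment> \<open>The image of \<open>W\<close> in \<open>L2'/L2\<close>. As \<open>L2\<close>
      lies inside \<open>W\<close>, membership of \<open>\<phi> (s b m)\<close> in \<open>W\<close>
      can be recovered from it.\<close>
    let ?V = "quot_map M2 L2 ` (W \<inter> L2')"
    have "mgood ?k1 Ds ss Q1.Q {x \<in> carrier Q1.Q. quot_map M2 L2 (\<phi> x) \<in> ?V}"
      by (rule "2.IH"[OF lift Q1.Q_module Q2.Q_module Q1.Q_finite Q2.Q_finite
            ind[OF L1(1) L2(1) R] Q2.additive_image[OF "2.prems"(7)] Q2.mgood_image[OF refl "2.prems"(8)]])
    then have "good ?k1 Ds ss {b \<in> carrier ?k1. b \<odot>\<^bsub>Q1.Q\<^esub> Q1.q m \<in>
        {x \<in> carrier Q1.Q. quot_map M2 L2 (\<phi> x) \<in> ?V}}"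
      unfolding mgood_def using L1(2) by simp
    then have 2: "good ?k1 Ds ss {b \<in> carrier ?k1. \<phi> (s b \<odot>\<^bsub>M1\<^esub> m) \<in> W}"
    proof (rule good_mono, intro subsetI)
      fix b assume "b \<in> {b \<in> carrier ?k1. b \<odot>\<^bsub>Q1.Q\<^esub> Q1.q m \<in> {x \<in> carrier Q1.Q. quot_map M2 L2 (\<phi> x) \<in> ?V}}"
      then have b: "b \<in> carrier ?k1" and h: "quot_map M2 L2 (\<phi> (b \<odot>\<^bsub>Q1.Q\<^esub> Q1.q m)) \<in> ?V" by blast+
      let ?z = "s b \<odot>\<^bsub>M1\<^esub> m"
      have z: "?z \<in> L1" by (rule Q1.s_smult_L[OF b L1(2)])
      obtain l where l: "l \<in> L1'" "Q1.q ?z = l \<oplus>\<^bsub>M1\<^esub> ?z" using Q1.q_coset[OF z] by blast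
      have "\<phi> (Q1.q ?z) = \<phi> l \<oplus>\<^bsub>M2\<^esub> \<phi> ?z"
        using l lin' Q1.L_add(1)[OF z] Q1.L'_add(1) by simp
      then have "quot_map M2 L2 (\<phi> (b \<odot>\<^bsub>Q1.Q\<^esub> Q1.q m)) = quot_map M2 L2 (\<phi> ?z)"
        using Q1.Q_smult[OF b L1(2)] Q2.q_absorb[OF r(3)[OF l(1)] r(4)[OF z]] by simp
      then show "b \<in> {b \<in> carrier ?k1. \<phi> (s b \<odot>\<^bsub>M1\<^esub> m) \<in> W}"
        using b h Q2.mem_image_iff[OF "2.prems"(7) L2(2) r(4)[OF z]] by simp
    qed
    show ?thesis using 1 2 by blast
  qed
  show ?case unfolding mgood_def good.simps
  proof (intro ballI conjI)
    fix m g assume m: "m \<in> carrier M1" and g: "g \<in> carrier K"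
    have gm: "g \<odot>\<^bsub>M1\<^esub> m \<in> carrier M1" using m g by simp
    have e: "(s b \<otimes>\<^bsub>K\<^esub> g) \<odot>\<^bsub>M1\<^esub> m = s b \<odot>\<^bsub>M1\<^esub> (g \<odot>\<^bsub>M1\<^esub> m)" if "b \<in> carrier ?k1" for b
      using that m g by (simp add: M1.M.smult_assoc1)
    show "good ?k1 Ds ss {b \<in> carrier ?k1. s b \<otimes>\<^bsub>K\<^esub> g \<in>
        {a \<in> carrier K. a \<odot>\<^bsub>M1\<^esub> m \<in> {x \<in> carrier M1. \<phi> x \<in> W}}}"
      by (rule good_mono[OF conjunct2[OF *[OF gm]]]) (use m g e in auto)
    obtain N where N: "\<And>x. x \<in> D \<Longrightarrow> \<phi> (x \<odot>\<^bsub>M1\<^esub> (M1.zp N \<odot>\<^bsub>M1\<^esub> (g \<odot>\<^bsub>M1\<^esub> m))) \<in> W" "0 \<le> N"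
      using *[OF gm] M1.D_one by blast
    have "\<phi> ((M1.zp N \<otimes>\<^bsub>K\<^esub> x \<otimes>\<^bsub>K\<^esub> g) \<odot>\<^bsub>M1\<^esub> m) \<in> W" if x: "x \<in> D" for x
    proof -
      have "M1.zp N \<otimes>\<^bsub>K\<^esub> x \<otimes>\<^bsub>K\<^esub> g = x \<otimes>\<^bsub>K\<^esub> M1.zp N \<otimes>\<^bsub>K\<^esub> g"
        using M1.m_comm[of "M1.zp N" x] M1.D_sub[OF x] by simp
      then have "(M1.zp N \<otimes>\<^bsub>K\<^esub> x \<otimes>\<^bsub>K\<^esub> g) \<odot>\<^bsub>M1\<^esub> m = x \<odot>\<^bsub>M1\<^esub> (M1.zp N \<odot>\<^bsub>M1\<^esub> (g \<odot>\<^bsub>M1\<^esub> m))"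
        using M1.D_sub[OF x] m g by (simp add: M1.M.smult_assoc1)
      then show ?thesis using N(1)[OF x] by simp
    qed
    then show "\<exists>c\<in>D - {\<zero>\<^bsub>K\<^esub>}. \<forall>x\<in>D. c \<otimes>\<^bsub>K\<^esub> x \<otimes>\<^bsub>K\<^esub> g \<in>
        {a \<in> carrier K. a \<odot>\<^bsub>M1\<^esub> m \<in> {x \<in> carrier M1. \<phi> x \<in> W}}"
      using M1.zp_D[OF N(2)] m g M1.D_sub by (intro bexI[of _ "M1.zp N"]) auto
  qed
qed auto

section \<open>Coordinates on a lattice\<close>

lemma finsum_in_additive:
  assumes "abelian_group M" "additive M V" "finite A" "\<And>x. x \<in> A \<Longrightarrow> f x \<in> V"
  shows "finsum M f A \<in> V"
  using assms(3,4)
proof (induction A)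
  case empty
  interpret abelian_group M by fact
  show ?case using additiveD(2)[OF assms(2)] by simp
next
  case (insert a A)
  interpret abelian_group M by fact
  have "f \<in> A \<rightarrow> carrier M" "f a \<in> carrier M" using insert additiveD(1)[OF assms(2)] by auto
  then show ?case using insert additiveD(3)[OF assms(2)] by simp
qed

lemma mspan_eq_combinations:
  assumes "module R M" "finite S" "S \<subseteq> carrier M"
  shows "mspan R M S = {(\<Oplus>\<^bsub>M\<^esub>x\<in>S. c x \<odot>\<^bsub>M\<^esub> x) |c. c \<in> S \<rightarrow> carrier R}" (is "_ = ?C")
proof
  interpret module R M by fact
  have f: "(\<lambda>x. c x \<odot>\<^bsub>M\<^esub> x) \<in> S \<rightarrow> carrier M" if "c \<in> S \<rightarrow> carrier R" for c
    using that assms(3) by (auto simp: Pi_def)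
  have smult: "a \<odot>\<^bsub>M\<^esub> (\<Oplus>\<^bsub>M\<^esub>x\<in>S. c x \<odot>\<^bsub>M\<^esub> x) = (\<Oplus>\<^bsub>M\<^esub>x\<in>S. (a \<otimes>\<^bsub>R\<^esub> c x) \<odot>\<^bsub>M\<^esub> x)"
    if "a \<in> carrier R" "c \<in> S \<rightarrow> carrier R" for a c
  proof -
    have "a \<odot>\<^bsub>M\<^esub> (\<Oplus>\<^bsub>M\<^esub>x\<in>S. c x \<odot>\<^bsub>M\<^esub> x) = (\<Oplus>\<^bsub>M\<^esub>x\<in>S. a \<odot>\<^bsub>M\<^esub> (c x \<odot>\<^bsub>M\<^esub> x))"
      by (rule finsum_smult_ldistr[OF assms(2) that(1) f[OF that(2)]])
    also have "\<dots> = (\<Oplus>\<^bsub>M\<^esub>x\<in>S. (a \<otimes>\<^bsub>R\<^esub> c x) \<odot>\<^bsub>M\<^esub> x)"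
      by (rule M.finsum_cong') (use that assms(3) in \<open>auto simp: smult_assoc1 Pi_def subset_eq\<close>)
    finally show ?thesis .
  qed
  have sm: "a \<odot>\<^bsub>M\<^esub> x \<in> ?C" if a: "a \<in> carrier R" and x: "x \<in> ?C" for a x
  proof -
    obtain c where c: "c \<in> S \<rightarrow> carrier R" "x = (\<Oplus>\<^bsub>M\<^esub>x\<in>S. c x \<odot>\<^bsub>M\<^esub> x)"
      using x by (elim CollectE exE conjE) (rule that)
    show ?thesis using smult[OF a c(1)] c a by (auto intro!: exI[of _ "\<lambda>x. a \<otimes>\<^bsub>R\<^esub> c x"])
  qed
  have CM: "?C \<subseteq> carrier M" using f by (auto intro!: M.finsum_closed)
  have "submodule ?C R M"
  proof (rule submoduleI)
    show "?C \<subseteq> carrier M" by (rule CM)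
    have "(\<Oplus>\<^bsub>M\<^esub>x\<in>S. \<zero>\<^bsub>R\<^esub> \<odot>\<^bsub>M\<^esub> x) = (\<Oplus>\<^bsub>M\<^esub>x\<in>S. \<zero>\<^bsub>M\<^esub>)"
      by (rule M.finsum_cong') (use assms(3) in auto)
    then have "\<zero>\<^bsub>M\<^esub> = (\<Oplus>\<^bsub>M\<^esub>x\<in>S. \<zero>\<^bsub>R\<^esub> \<odot>\<^bsub>M\<^esub> x)" by simp
    then show "\<zero>\<^bsub>M\<^esub> \<in> ?C" by (auto intro!: exI[of _ "\<lambda>x. \<zero>\<^bsub>R\<^esub>"])
    show "a \<odot>\<^bsub>M\<^esub> x \<in> ?C" if "a \<in> carrier R" "x \<in> ?C" for a x using sm that .
    show "\<ominus>\<^bsub>M\<^esub> a \<in> ?C" if a: "a \<in> ?C" for a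
    proof -
      have aM: "a \<in> carrier M" by (rule subsetD[OF CM a])
      have "(\<ominus>\<^bsub>R\<^esub> \<one>\<^bsub>R\<^esub>) \<odot>\<^bsub>M\<^esub> a = \<ominus>\<^bsub>M\<^esub> a"
        using smult_l_minus[OF R.one_closed aM] smult_one[OF aM] by simp
      then show ?thesis using sm[OF _ a, of "\<ominus>\<^bsub>R\<^esub> \<one>\<^bsub>R\<^esub>"] by simp
    qed
    fix a b assume "a \<in> ?C" "b \<in> ?C"
    then obtain c d where c: "c \<in> S \<rightarrow> carrier R" "a = (\<Oplus>\<^bsub>M\<^esub>x\<in>S. c x \<odot>\<^bsub>M\<^esub> x)"
      and d: "d \<in> S \<rightarrow> carrier R" "b = (\<Oplus>\<^bsub>M\<^esub>x\<in>S. d x \<odot>\<^bsub>M\<^esub> x)" by blast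
    have "a \<oplus>\<^bsub>M\<^esub> b = (\<Oplus>\<^bsub>M\<^esub>x\<in>S. c x \<odot>\<^bsub>M\<^esub> x \<oplus>\<^bsub>M\<^esub> d x \<odot>\<^bsub>M\<^esub> x)"
      unfolding c d by (rule M.finsum_addf[OF f f, symmetric]) (rule c d)+
    also have "\<dots> = (\<Oplus>\<^bsub>M\<^esub>x\<in>S. (c x \<oplus>\<^bsub>R\<^esub> d x) \<odot>\<^bsub>M\<^esub> x)"
      by (rule M.finsum_cong') (use c d assms(3) in \<open>auto simp: smult_l_distr Pi_def subset_eq\<close>)
    finally show "a \<oplus>\<^bsub>M\<^esub> b \<in> ?C" using c d by (auto intro!: exI[of _ "\<lambda>x. c x \<oplus>\<^bsub>R\<^esub> d x"])
  qed
  moreover have "S \<subseteq> ?C"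
  proof
    fix x assume x: "x \<in> S"
    have "(\<Oplus>\<^bsub>M\<^esub>y\<in>S. (if x = y then \<one>\<^bsub>R\<^esub> else \<zero>\<^bsub>R\<^esub>) \<odot>\<^bsub>M\<^esub> y) = (\<Oplus>\<^bsub>M\<^esub>y\<in>S. if x = y then y else \<zero>\<^bsub>M\<^esub>)"
      by (rule M.finsum_cong') (use assms(3) in auto)
    also have "\<dots> = x" by (rule M.finsum_singleton[OF x assms(2)]) (use assms(3) in auto)
    finally show "x \<in> ?C" by (auto intro!: exI[of _ "\<lambda>y. if x = y then \<one>\<^bsub>R\<^esub> else \<zero>\<^bsub>R\<^esub>"])
  qed
  ultimately show "mspan R M S \<subseteq> ?C" by (rule mspan_least)
next
  have sub: "submodule (mspan R M S) R M" by (rule mspan_submodule[OF assms(1,3)])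
  then have s: "additive M (mspan R M S)" "\<And>a x. a \<in> carrier R \<Longrightarrow> x \<in> mspan R M S \<Longrightarrow> a \<odot>\<^bsub>M\<^esub> x \<in> mspan R M S"
    unfolding submodule_iff[OF assms(1)] by auto
  have "abelian_group M" using assms(1) by (simp add: module_def)
  then show "?C \<subseteq> mspan R M S"
    using s(2) mspan_superset[of S R M] by (auto intro!: finsum_in_additive[OF _ s(1) assms(2)] simp: Pi_def)
qed

context lifted_dvr
begin

text \<open>The sign of the valuation of \<open>inv x y\<close> decides which of the two elements
  divides the other in \<open>D\<close>.\<close>

lemma valuation_total:
  assumes "x \<in> carrier K" "x \<noteq> \<zero>" "y \<in> carrier K" "y \<noteq> \<zero>"
  shows "inv x \<otimes> y \<in> D \<or> inv y \<otimes> x \<in> D"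
proof -
  have ix: "inv x \<in> carrier K" "inv x \<otimes> x = \<one>" "inv y \<in> carrier K" "inv y \<otimes> y = \<one>"
    using assms field_Units by auto
  have nz: "inv x \<otimes> y \<noteq> \<zero>"
  proof
    assume "inv x \<otimes> y = \<zero>"
    then have "x \<otimes> (inv x \<otimes> y) = \<zero>" using assms by simp
    moreover have "x \<otimes> (inv x \<otimes> y) = inv x \<otimes> x \<otimes> y"
      using ix(1) assms m_assoc[of x "inv x" y] m_comm[of x "inv x"] by simp
    ultimately show False using ix assms by simp
  qed
  obtain v u where u: "u \<in> D" "u \<noteq> \<zero>" "inv u \<in> D" "inv x \<otimes> y = zp v \<otimes> u"
    using unit_decomp[OF _ nz] ix assms by blast
  show ?thesis
  proof (cases "0 \<le> v")
    case True then show ?thesis using u D_mult zp_D by simp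
  next
    case False
    have uK: "u \<in> carrier K" "inv u \<in> carrier K" "inv u \<otimes> u = \<one>" using u D_sub field_Units by auto
    have "inv y \<otimes> x = inv y \<otimes> x \<otimes> (zp (- v) \<otimes> (zp v \<otimes> (inv u \<otimes> u)))"
    proof -
      have "zp (- v) \<otimes> zp v = \<one>" using zp_add[of "- v" v] by simp
      then show ?thesis using uK ix assms by simp
    qed
    also have "\<dots> = zp (- v) \<otimes> inv u \<otimes> (inv y \<otimes> x \<otimes> (zp v \<otimes> u))"
      using uK(1,2) ix(1,3) assms by (simp add: m_ac)
    also have "inv y \<otimes> x \<otimes> (zp v \<otimes> u) = inv y \<otimes> y \<otimes> (inv x \<otimes> x)"
      unfolding u(4)[symmetric] using ix(1,3) assms by (simp add: m_ac)
    finally have "inv y \<otimes> x = zp (- v) \<otimes> inv u" using ix uK by simp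
    then show ?thesis using False u D_mult zp_D by simp
  qed
qed

text \<open>The \<open>c\<close> found here has least valuation in \<open>C\<close>. Dividing a
  linear relation by such a coefficient makes that coefficient \<open>1\<close> and keeps the others
  in \<open>D\<close>.\<close>

lemma valuation_dominant:
  assumes "finite C" "C \<noteq> {}" "C \<subseteq> carrier K - {\<zero>}"
  shows "\<exists>c\<in>C. \<forall>x\<in>C. inv c \<otimes> x \<in> D"
  using assms
proof (induction C rule: finite_ne_induct)
  case (singleton x)
  then have "inv x \<otimes> x = \<one>" using field_Units by auto
  then show ?case by simp
next
  case (insert y C)
  then obtain c where c: "c \<in> C" "\<forall>x\<in>C. inv c \<otimes> x \<in> D" by auto
  have yc: "y \<in> carrier K" "y \<noteq> \<zero>" "c \<in> carrier K" "c \<noteq> \<zero>" using insert c by auto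
  have yc': "inv y \<in> carrier K" "inv y \<otimes> y = \<one>" "inv c \<in> carrier K" "inv c \<otimes> c = \<one>"
    using yc field_Units by auto
  consider "inv c \<otimes> y \<in> D" | "inv y \<otimes> c \<in> D" using valuation_total yc by blast
  then show ?case
  proof cases
    case 1 then show ?thesis using c by auto
  next
    case 2
    have "inv y \<otimes> x \<in> D" if "x \<in> insert y C" for x
    proof (cases "x = y")
      case True then show ?thesis using yc' by simp
    next
      case False
      then have x: "x \<in> C" "x \<in> carrier K" using that insert.prems by auto
      have "inv y \<otimes> x = (inv y \<otimes> c) \<otimes> (inv c \<otimes> x)"
      proof -
        have "(inv y \<otimes> c) \<otimes> (inv c \<otimes> x) = inv y \<otimes> (inv c \<otimes> c) \<otimes> x"
          using yc(1,3) yc'(1,3) x by (simp add: m_ac)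
        then show ?thesis using yc' by simp
      qed
      then show ?thesis using D_mult[OF 2] c x by simp
    qed
    then show ?thesis by blast
  qed
qed

end

definition linear_functional :: "'a ring \<Rightarrow> ('a, 'm) module \<Rightarrow> ('m \<Rightarrow> 'a) \<Rightarrow> bool" where
  "linear_functional K M l \<longleftrightarrow> (\<forall>x\<in>carrier M. l x \<in> carrier K) \<and>
     (\<forall>x\<in>carrier M. \<forall>y\<in>carrier M. l (x \<oplus>\<^bsub>M\<^esub> y) = l x \<oplus>\<^bsub>K\<^esub> l y) \<and>
     (\<forall>a\<in>carrier K. \<forall>x\<in>carrier M. l (a \<odot>\<^bsub>M\<^esub> x) = a \<otimes>\<^bsub>K\<^esub> l x)"

context dvr_module
begin

text \<open>
  A lattice is free: the functionals \<open>l\<close> are the coordinates with respect to the basis vectors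
  \<open>e\<close>, obtained from a generating set of minimal size. The last clause is the expansion
  \<open>y = \<Sum> l(y) e\<close> in a form that needs no sums.
\<close>

lemma lattice_coordinates:
  assumes L: "L \<in> Lat"
  shows "\<exists>I. finite I \<and> (\<forall>(l, e)\<in>I. e \<in> L \<and> linear_functional K M l \<and> (\<forall>x\<in>L. l x \<in> D)) \<and>
    (\<forall>V y. additive M V \<longrightarrow> y \<in> carrier M \<longrightarrow> (\<forall>(l, e)\<in>I. l y \<odot>\<^bsub>M\<^esub> e \<in> V) \<longrightarrow> y \<in> V)"
proof -
  let ?KD = "K\<lparr>carrier := D\<rparr>"
  let ?P = "\<lambda>S. finite S \<and> S \<subseteq> carrier M \<and> L = D_span S"
  have "\<exists>S. ?P S" using L unfolding lattices_def fg_submodule_def by auto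
  then obtain S0 where "?P S0" by (elim exE)
  then have "\<exists>S. ?P S \<and> (\<forall>S'. ?P S' \<longrightarrow> card S \<le> card S')" by (rule ex_has_least_nat)
  then obtain S where Smin: "?P S \<and> (\<forall>S'. ?P S' \<longrightarrow> card S \<le> card S')" by (elim exE)
  have S: "?P S" by (rule conjunct1[OF Smin])
  have min: "\<forall>S'. ?P S' \<longrightarrow> card S \<le> card S'" by (rule conjunct2[OF Smin])
  have fin: "finite S" and SM: "S \<subseteq> carrier M" and LS: "L = D_span S" using S by auto
  define comb where "comb c = (\<Oplus>\<^bsub>M\<^esub>x\<in>S. c x \<odot>\<^bsub>M\<^esub> x)" for c
  have f: "(\<lambda>x. c x \<odot>\<^bsub>M\<^esub> x) \<in> S \<rightarrow> carrier M" if "c \<in> S \<rightarrow> carrier K" for c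
    using that SM by (auto simp: Pi_def)
  have comb_closed: "comb c \<in> carrier M" if "c \<in> S \<rightarrow> carrier K" for c
    unfolding comb_def using f[OF that] by (rule M.M.finsum_closed)
  have SL: "S \<subseteq> L" using LS mspan_superset[of S] by simp
  have M_span: "mspan K M S = carrier M"
  proof
    show "mspan K M S \<subseteq> carrier M" by (rule mspan_least[OF M.carrier_is_submodule SM])
    have K: "submodule (mspan K M S) K M" by (rule mspan_submodule[OF M.module_axioms SM])
    then have "submodule (mspan K M S) ?KD M"
      unfolding D_submodule_iff K_submodule_iff using D_sub by blast
    then have "L \<subseteq> mspan K M S" unfolding LS by (rule mspan_least) (rule mspan_superset)
    then have "mspan K M L \<subseteq> mspan K M S" by (rule mspan_least[OF K])
    then show "carrier M \<subseteq> mspan K M S" using L unfolding lattices_def by auto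
  qed
  have ex: "\<exists>c. c \<in> S \<rightarrow> carrier K \<and> y = comb c" if "y \<in> carrier M" for y
  proof -
    have "y \<in> mspan K M S" using that M_span by simp
    then show ?thesis unfolding mspan_eq_combinations[OF M.module_axioms fin SM] comb_def by blast
  qed
  have exD: "\<exists>c. c \<in> S \<rightarrow> D \<and> y = comb c" if "y \<in> L" for y
    using that LS mspan_eq_combinations[OF D_module fin SM] unfolding comb_def by auto
  have comb_add: "comb (\<lambda>x. c x \<oplus> d x) = comb c \<oplus>\<^bsub>M\<^esub> comb d"
    if c: "c \<in> S \<rightarrow> carrier K" and d: "d \<in> S \<rightarrow> carrier K" for c d
  proof -
    have "comb (\<lambda>x. c x \<oplus> d x) = (\<Oplus>\<^bsub>M\<^esub>x\<in>S. c x \<odot>\<^bsub>M\<^esub> x \<oplus>\<^bsub>M\<^esub> d x \<odot>\<^bsub>M\<^esub> x)"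
      unfolding comb_def
      by (rule M.M.finsum_cong') (use c d SM in \<open>auto simp: M.smult_l_distr Pi_def subset_eq\<close>)
    then show ?thesis unfolding comb_def using M.M.finsum_addf[OF f[OF c] f[OF d]] by simp
  qed
  have comb_smult: "comb (\<lambda>x. a \<otimes> c x) = a \<odot>\<^bsub>M\<^esub> comb c"
    if c: "c \<in> S \<rightarrow> carrier K" and a: "a \<in> carrier K" for a c
  proof -
    have "comb (\<lambda>x. a \<otimes> c x) = (\<Oplus>\<^bsub>M\<^esub>x\<in>S. a \<odot>\<^bsub>M\<^esub> (c x \<odot>\<^bsub>M\<^esub> x))"
      unfolding comb_def
      by (rule M.M.finsum_cong') (use c a SM in \<open>auto simp: M.smult_assoc1 Pi_def subset_eq\<close>)
    then show ?thesis unfolding comb_def using M.finsum_smult_ldistr[OF fin a f[OF c]] by simp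
  qed
  \<comment> \<open>A nontrivial relation over \<open>K\<close>, divided by a coefficient of least
    valuation, expresses one generator \<open>t\<close> through the others with coefficients in
    \<open>D\<close>. Then \<open>S - {t}\<close> still generates \<open>L\<close>, against the
    minimality of \<open>S\<close>.\<close>
  have indep: "c x = \<zero>" if c: "c \<in> S \<rightarrow> carrier K" and z: "comb c = \<zero>\<^bsub>M\<^esub>" and x: "x \<in> S" for c x
  proof (rule ccontr)
    assume "c x \<noteq> \<zero>"
    let ?C = "c ` S - {\<zero>}"
    have "?C \<noteq> {}" "finite ?C" "?C \<subseteq> carrier K - {\<zero>}" using \<open>c x \<noteq> \<zero>\<close> x fin c by auto
    then obtain d where d: "d \<in> ?C" "\<forall>y\<in>?C. inv d \<otimes> y \<in> D" using valuation_dominant by blast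
    then obtain t where t: "t \<in> S" "d = c t" by auto
    have dK: "d \<in> carrier K" "d \<noteq> \<zero>" using d t c by auto
    then have idK: "inv d \<in> carrier K" "inv d \<otimes> d = \<one>" using field_Units by auto
    define b where "b = (\<lambda>y. inv d \<otimes> c y)"
    have bD: "b y \<in> D" if "y \<in> S" for y
    proof (cases "c y = \<zero>")
      case True then show ?thesis using idK by (simp add: b_def)
    next
      case False then show ?thesis using d that by (simp add: b_def)
    qed
    have bt: "b t = \<one>" using t idK by (simp add: b_def)
    have "comb b = \<zero>\<^bsub>M\<^esub>" using comb_smult[OF c idK(1)] z idK by (simp add: b_def)
    moreover have "comb b = b t \<odot>\<^bsub>M\<^esub> t \<oplus>\<^bsub>M\<^esub> (\<Oplus>\<^bsub>M\<^esub>x\<in>S - {t}. b x \<odot>\<^bsub>M\<^esub> x)"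
    proof -
      have "S = insert t (S - {t})" using t by auto
      then have "comb b = (\<Oplus>\<^bsub>M\<^esub>x\<in>insert t (S - {t}). b x \<odot>\<^bsub>M\<^esub> x)" unfolding comb_def by simp
      also have "\<dots> = b t \<odot>\<^bsub>M\<^esub> t \<oplus>\<^bsub>M\<^esub> (\<Oplus>\<^bsub>M\<^esub>x\<in>S - {t}. b x \<odot>\<^bsub>M\<^esub> x)"
        by (rule M.M.finsum_insert) (use fin t bD D_sub SM in auto)
      finally show ?thesis .
    qed
    moreover define z where "z = (\<Oplus>\<^bsub>M\<^esub>x\<in>S - {t}. b x \<odot>\<^bsub>M\<^esub> x)"
    ultimately have tz: "t \<oplus>\<^bsub>M\<^esub> z = \<zero>\<^bsub>M\<^esub>" using bt t SM by auto
    let ?S' = "S - {t}"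
    have S': "finite ?S'" "?S' \<subseteq> carrier M" using fin SM by auto
    have subS': "submodule (D_span ?S') ?KD M" by (rule mspan_submodule[OF D_module S'(2)])
    have "z \<in> D_span ?S'"
      unfolding mspan_eq_combinations[OF D_module S'] z_def using bD by auto
    then have "\<ominus>\<^bsub>M\<^esub> z \<in> D_span ?S'" using subS' unfolding D_submodule_iff additive_def by blast
    moreover have "z \<in> carrier M" using \<open>z \<in> D_span ?S'\<close> subS' unfolding D_submodule_iff additive_def by blast
    then have "t = \<ominus>\<^bsub>M\<^esub> z" using M.M.minus_equality[OF tz] t SM by auto
    ultimately have "t \<in> D_span ?S'" by simp
    then have "S \<subseteq> D_span ?S'" using mspan_superset[of ?S' ?KD M] by auto
    then have "D_span S \<subseteq> D_span ?S'" by (rule mspan_least[OF subS'])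
    moreover have "D_span ?S' \<subseteq> D_span S" by (rule mspan_mono) auto
    ultimately have "card S \<le> card ?S'" using LS S' by (intro min[rule_format]) auto
    then show False using card_Diff1_less[OF fin t(1)] by linarith
  qed
  have unique: "c x = d x"
    if c: "c \<in> S \<rightarrow> carrier K" and d: "d \<in> S \<rightarrow> carrier K" and e: "comb c = comb d" and x: "x \<in> S" for c d x
  proof -
    have d': "(\<lambda>x. \<ominus> \<one> \<otimes> d x) \<in> S \<rightarrow> carrier K" using d by auto
    have "comb (\<lambda>x. c x \<oplus> \<ominus> \<one> \<otimes> d x) = comb d \<oplus>\<^bsub>M\<^esub> (\<ominus> \<one>) \<odot>\<^bsub>M\<^esub> comb d"
      using comb_add[OF c d'] comb_smult[OF d, of "\<ominus> \<one>"] e by simp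
    also have "\<dots> = \<zero>\<^bsub>M\<^esub>" using comb_closed[OF d] by (simp add: M.smult_l_minus M.M.r_neg)
    finally have "comb (\<lambda>x. c x \<oplus> \<ominus> \<one> \<otimes> d x) = \<zero>\<^bsub>M\<^esub>" .
    then have "c x \<oplus> \<ominus> \<one> \<otimes> d x = \<zero>" by (rule indep[OF _ _ x, rotated]) (use c d in auto)
    moreover have "c x \<in> carrier K" "d x \<in> carrier K" using c d x by auto
    ultimately show ?thesis by (simp add: l_minus) (metis a_minus_def r_right_minus_eq)
  qed
  \<comment> \<open>The coefficients are picked by choice; \<open>unique\<close> turns the picked
    functions into linear ones, and shows that they take values in \<open>D\<close> on
    \<open>L\<close>.\<close>
  define l where "l x y = (SOME c. c \<in> S \<rightarrow> carrier K \<and> y = comb c) x" for x y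
  have l: "(\<lambda>x. l x y) \<in> S \<rightarrow> carrier K" "y = comb (\<lambda>x. l x y)" if "y \<in> carrier M" for y
    using someI_ex[OF ex[OF that]] unfolding l_def by auto
  have lin: "linear_functional K M (l x)" if x: "x \<in> S" for x
    unfolding linear_functional_def
  proof (intro conjI ballI)
    fix y assume y: "y \<in> carrier M"
    show "l x y \<in> carrier K" using l(1)[OF y] x by auto
    show "l x (y \<oplus>\<^bsub>M\<^esub> z) = l x y \<oplus> l x z" if z: "z \<in> carrier M" for z
    proof (rule unique[OF _ _ _ x])
      show "(\<lambda>x. l x (y \<oplus>\<^bsub>M\<^esub> z)) \<in> S \<rightarrow> carrier K" using l(1) y z by simp
      show "(\<lambda>x. l x y \<oplus> l x z) \<in> S \<rightarrow> carrier K" using l(1)[OF y] l(1)[OF z] by auto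
      show "comb (\<lambda>x. l x (y \<oplus>\<^bsub>M\<^esub> z)) = comb (\<lambda>x. l x y \<oplus> l x z)"
        using comb_add[OF l(1)[OF y] l(1)[OF z]] l(2)[OF y] l(2)[OF z] l(2)[of "y \<oplus>\<^bsub>M\<^esub> z"] y z by simp
    qed
  next
    fix a y assume a: "a \<in> carrier K" and y: "y \<in> carrier M"
    show "l x (a \<odot>\<^bsub>M\<^esub> y) = a \<otimes> l x y"
    proof (rule unique[OF _ _ _ x])
      show "(\<lambda>x. l x (a \<odot>\<^bsub>M\<^esub> y)) \<in> S \<rightarrow> carrier K" using l(1) y a by simp
      show "(\<lambda>x. a \<otimes> l x y) \<in> S \<rightarrow> carrier K" using l(1)[OF y] a by auto
      show "comb (\<lambda>x. l x (a \<odot>\<^bsub>M\<^esub> y)) = comb (\<lambda>x. a \<otimes> l x y)"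
        using comb_smult[OF l(1)[OF y] a] l(2)[OF y] l(2)[of "a \<odot>\<^bsub>M\<^esub> y"] y a by simp
    qed
  qed
  have lD: "l x y \<in> D" if x: "x \<in> S" and y: "y \<in> L" for x y
  proof -
    obtain c where c: "c \<in> S \<rightarrow> D" "y = comb c" using exD y by blast
    have yM: "y \<in> carrier M" using lattice_sub[OF L y] .
    have "c \<in> S \<rightarrow> carrier K" using c D_sub by auto
    then have "l x y = c x" using unique[OF l(1)[OF yM] _ _ x] l(2)[OF yM] c(2) by simp
    then show ?thesis using c x by auto
  qed
  let ?I = "(\<lambda>x. (l x, x)) ` S"
  have "y \<in> V" if V: "additive M V" and y: "y \<in> carrier M" and h: "\<forall>(l, e)\<in>?I. l y \<odot>\<^bsub>M\<^esub> e \<in> V" for V y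
  proof -
    have "comb (\<lambda>x. l x y) \<in> V" unfolding comb_def
      by (rule finsum_in_additive[OF M.M.abelian_group_axioms V fin]) (use h in auto)
    then show ?thesis using l(2)[OF y] by simp
  qed
  then show ?thesis using fin SL lin lD by (intro exI[of _ ?I]) auto
qed

end

section \<open>Differential operators that pull back good subgroups\<close>

text \<open>Takes the place of continuity for maps between modules without a topology. Only
  \<open>k\<close>-subspaces are tested, as it is these that form a basis at zero of a
  \<open>k\<close>-linear topology.\<close>

definition pulls_back_good ::
  "'k ring \<Rightarrow> ('k \<Rightarrow> 'a) \<Rightarrow> 'a ring \<Rightarrow> 'a set list \<Rightarrow> ('a \<Rightarrow> 'a) list \<Rightarrow>
     ('a, 'm) module \<Rightarrow> ('a, 'n) module \<Rightarrow> ('m \<Rightarrow> 'n) \<Rightarrow> bool" where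
  "pulls_back_good k \<iota> K Ds ss M1 M2 \<phi> \<longleftrightarrow>
     (\<forall>W. subspace k \<iota> M2 W \<longrightarrow> mgood K Ds ss M2 W \<longrightarrow> mgood K Ds ss M1 {x \<in> carrier M1. \<phi> x \<in> W})"

lemma subspace_vimage:
  assumes "abelian_group M1" "abelian_group M2"
    and "\<phi> \<in> linear_maps k (restrict_scalars \<iota> M1) (restrict_scalars \<iota> M2)"
    and "subspace k \<iota> M2 W" "\<And>c x. c \<in> carrier k \<Longrightarrow> x \<in> carrier M1 \<Longrightarrow> \<iota> c \<odot>\<^bsub>M1\<^esub> x \<in> carrier M1"
  shows "subspace k \<iota> M1 {x \<in> carrier M1. \<phi> x \<in> W}"
proof -
  note lin = assms(3)[unfolded linear_maps_iff]
  have "additive M1 {x \<in> carrier M1. \<phi> x \<in> W}"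
    by (rule additive_vimage(4)[OF assms(1,2)]) (use lin assms(4) in \<open>auto simp: subspace_def\<close>)
  then show ?thesis using lin assms(4,5) by (auto simp: subspace_def)
qed

lemma mgood_vimage:
  assumes "module K M1"
    and "\<And>x. x \<in> carrier M1 \<Longrightarrow> \<phi> x \<in> carrier M2"
    and "\<And>a x. a \<in> carrier K \<Longrightarrow> x \<in> carrier M1 \<Longrightarrow> \<phi> (a \<odot>\<^bsub>M1\<^esub> x) = a \<odot>\<^bsub>M2\<^esub> \<phi> x"
    and "mgood K Ds ss M2 W"
  shows "mgood K Ds ss M1 {x \<in> carrier M1. \<phi> x \<in> W}"
  unfolding mgood_def
proof
  interpret module K M1 by fact
  fix m assume m: "m \<in> carrier M1"
  have "good K Ds ss {a \<in> carrier K. a \<odot>\<^bsub>M2\<^esub> \<phi> m \<in> W}" using assms(2,4) m unfolding mgood_def by blast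
  then show "good K Ds ss {a \<in> carrier K. a \<odot>\<^bsub>M1\<^esub> m \<in> {x \<in> carrier M1. \<phi> x \<in> W}}"
    by (rule good_mono) (use m assms(3) in auto)
qed

text \<open>Converts a good subspace of \<open>K\<close> into one of \<open>M\<close> that
  prescribes a single coordinate.\<close>

lemma functional_vimage:
  assumes "lifted k \<iota> K Ds ss" "module K M" "linear_functional K M l"
    and W: "subspace k \<iota> (self_module K) W" "good K Ds ss W"
  shows "subspace k \<iota> M {x \<in> carrier M. l x \<in> W}" "mgood K Ds ss M {x \<in> carrier M. l x \<in> W}"
proof -
  interpret module K M by fact
  have sm: "module K (self_module K)" by (rule module_self) (rule R.is_cring)
  have i: "\<iota> c \<in> carrier K" if "c \<in> carrier k" for c
    using lifted_field(2)[OF assms(1)] that by (auto simp: ring_hom_def)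
  have "l \<in> linear_maps k (restrict_scalars \<iota> M) (restrict_scalars \<iota> (self_module K))"
    unfolding linear_maps_iff using assms(3) i by (auto simp: linear_functional_def)
  then show "subspace k \<iota> M {x \<in> carrier M. l x \<in> W}"
    by (rule subspace_vimage[OF M.abelian_group_axioms module.axioms(2)[OF sm] _ W(1)]) (use i in auto)
  show "mgood K Ds ss M {x \<in> carrier M. l x \<in> W}"
    by (rule mgood_vimage[OF assms(2), where ?M2.0 = "self_module K"])
      (use assms mgood_self[OF assms(1)] in \<open>auto simp: linear_functional_def\<close>)
qed

lemma pulls_back_good_diff:
  assumes l: "lifted k \<iota> K Ds ss" and "abelian_group M2"
    and "pulls_back_good k \<iota> K Ds ss M1 M2 \<phi>" "pulls_back_good k \<iota> K Ds ss M1 M2 \<psi>"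
  shows "pulls_back_good k \<iota> K Ds ss M1 M2 (\<lambda>x. \<phi> x \<ominus>\<^bsub>M2\<^esub> \<psi> x)"
  unfolding pulls_back_good_def
proof (intro allI impI)
  fix W assume W: "subspace k \<iota> M2 W" "mgood K Ds ss M2 W"
  have "mgood K Ds ss M1 ({x \<in> carrier M1. \<phi> x \<in> W} \<inter> {x \<in> carrier M1. \<psi> x \<in> W})"
    using assms W unfolding pulls_back_good_def by (intro mgood_Int[OF l]) auto
  then show "mgood K Ds ss M1 {x \<in> carrier M1. \<phi> x \<ominus>\<^bsub>M2\<^esub> \<psi> x \<in> W}"
    by (rule mgood_mono) (use W additiveD(5)[of M2 W] in \<open>auto simp: subspace_def\<close>)
qed

text \<open>The algebraic content of \<open>diff_filtration\<close>, with the same shifted index, so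
  that \<open>0\<close> stands for the zero operator. Continuity is left out; it is carried
  separately by \<open>pulls_back_good\<close>.\<close>

primrec diffop ::
  "'k ring \<Rightarrow> ('k \<Rightarrow> 'a) \<Rightarrow> 'a ring \<Rightarrow> ('a, 'm) module \<Rightarrow> ('a, 'n) module \<Rightarrow> nat \<Rightarrow> ('m \<Rightarrow> 'n) \<Rightarrow> bool" where
  "diffop k \<iota> K M1 M2 0 \<phi> \<longleftrightarrow> (\<forall>x\<in>carrier M1. \<phi> x = \<zero>\<^bsub>M2\<^esub>)"
| "diffop k \<iota> K M1 M2 (Suc d) \<phi> \<longleftrightarrow>
     \<phi> \<in> linear_maps k (restrict_scalars \<iota> M1) (restrict_scalars \<iota> M2) \<and>
     (\<forall>a\<in>carrier K. diffop k \<iota> K M1 M2 d (\<lambda>x. (a \<odot>\<^bsub>M2\<^esub> \<phi> x) \<ominus>\<^bsub>M2\<^esub> \<phi> (a \<odot>\<^bsub>M1\<^esub> x)))"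

lemma linear_maps_cong:
  assumes "abelian_group M1" "\<And>c x. c \<in> carrier k \<Longrightarrow> x \<in> carrier M1 \<Longrightarrow> \<iota> c \<odot>\<^bsub>M1\<^esub> x \<in> carrier M1"
    "\<And>x. x \<in> carrier M1 \<Longrightarrow> \<phi> x = \<psi> x"
    "\<phi> \<in> linear_maps k (restrict_scalars \<iota> M1) (restrict_scalars \<iota> M2)"
  shows "\<psi> \<in> linear_maps k (restrict_scalars \<iota> M1) (restrict_scalars \<iota> M2)"
proof -
  interpret abelian_group M1 by fact
  have lin: "\<phi> x \<in> carrier M2" "\<phi> (x \<oplus>\<^bsub>M1\<^esub> y) = \<phi> x \<oplus>\<^bsub>M2\<^esub> \<phi> y"
    "\<And>c. c \<in> carrier k \<Longrightarrow> \<phi> (\<iota> c \<odot>\<^bsub>M1\<^esub> x) = \<iota> c \<odot>\<^bsub>M2\<^esub> \<phi> x"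
    if "x \<in> carrier M1" "y \<in> carrier M1" for x y
    using assms(4) that unfolding linear_maps_iff by auto
  show ?thesis unfolding linear_maps_iff
    using lin by (simp add: assms(2) assms(3)[symmetric])
qed

text \<open>Operators are total functions that matter only on the carrier. The commutator of an
  induced map and the map induced by a commutator agree just there.\<close>

lemma diffop_cong:
  assumes "module K M1" "\<iota> \<in> carrier k \<rightarrow> carrier K"
    "\<And>x. x \<in> carrier M1 \<Longrightarrow> \<phi> x = \<psi> x" "diffop k \<iota> K M1 M2 d \<phi>"
  shows "diffop k \<iota> K M1 M2 d \<psi>"
  using assms(3,4)
proof (induction d arbitrary: \<phi> \<psi>)
  case 0 then show ?case by simp
next
  case (Suc d)
  interpret module K M1 by fact
  have i: "\<iota> c \<in> carrier K" if "c \<in> carrier k" for c using assms(2) that by auto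
  have "\<psi> \<in> linear_maps k (restrict_scalars \<iota> M1) (restrict_scalars \<iota> M2)"
    by (rule linear_maps_cong[OF M.abelian_group_axioms _ Suc.prems(1)]) (use Suc.prems i in auto)
  moreover have "diffop k \<iota> K M1 M2 d (\<lambda>x. (a \<odot>\<^bsub>M2\<^esub> \<psi> x) \<ominus>\<^bsub>M2\<^esub> \<psi> (a \<odot>\<^bsub>M1\<^esub> x))" if "a \<in> carrier K" for a
    by (rule Suc.IH[of "\<lambda>x. (a \<odot>\<^bsub>M2\<^esub> \<phi> x) \<ominus>\<^bsub>M2\<^esub> \<phi> (a \<odot>\<^bsub>M1\<^esub> x)"]) (use Suc.prems that in auto)
  ultimately show ?case by simp
qed

locale dvr_lift = dvr_module K D p k1 rm s M
  for K :: "'a ring" (structure) and D p k1 rm s and M :: "('a, 'm) module" +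
  fixes k :: "'k ring" and \<iota> :: "'k \<Rightarrow> 'a" and Ds :: "'a set list" and ss :: "('a \<Rightarrow> 'a) list"
  assumes k1_eq: "k1 = residue_field K D" and rm_eq: "rm = residue_map K D"
    and lift: "lifted k \<iota> K (D # Ds) (s # ss)"
begin

lemma \<iota>_D: "c \<in> carrier k \<Longrightarrow> \<iota> c \<in> D"
  using lift by (auto simp: ring_hom_def)

lemma \<iota>_lift: "c \<in> carrier k \<Longrightarrow> s (rm (\<iota> c)) = \<iota> c"
  using lift rm_eq by simp

lemma self: "module K (self_module K)"
  by (rule module_self) (rule is_cring)

text \<open>The step where continuity produces a bound: a sequence escaping every \<open>p\<^sup>-\<^sup>rD\<close> is avoided
  by some good subspace, whereas \<open>\<psi>\<close> must eventually map into that subspace.\<close>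

lemma pulls_back_good_functional_bounded:
  assumes fg: "fg_submodule (carrier M) K M" and L: "L \<in> Lat"
    and pb: "pulls_back_good k \<iota> K (D # Ds) (s # ss) M (self_module K) \<psi>"
    and \<psi>: "\<And>x. x \<in> carrier M \<Longrightarrow> \<psi> x \<in> carrier K"
      "\<And>x y. x \<in> carrier M \<Longrightarrow> y \<in> carrier M \<Longrightarrow> \<psi> (x \<oplus>\<^bsub>M\<^esub> y) = \<psi> x \<oplus> \<psi> y"
  shows "\<exists>r::nat. \<forall>x\<in>L. zp (int r) \<otimes> \<psi> (zp (int r) \<odot>\<^bsub>M\<^esub> x) \<in> D"
proof (rule ccontr)
  assume "\<not> ?thesis"
  then have "\<forall>r::nat. \<exists>x\<in>L. zp (int r) \<otimes> \<psi> (zp (int r) \<odot>\<^bsub>M\<^esub> x) \<notin> D" by blast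
  then obtain x where x: "\<And>r::nat. x r \<in> L" "\<And>r. zp (int r) \<otimes> \<psi> (zp (int r) \<odot>\<^bsub>M\<^esub> x r) \<notin> D" by metis
  \<comment> \<open>By the choice of \<open>x r\<close> the product \<open>p^r y r\<close> is not in
    \<open>D\<close>, so this sequence escapes every \<open>p^(-r) D\<close>.\<close>
  define y where "y r = \<psi> (zp (int r) \<odot>\<^bsub>M\<^esub> x r)" for r
  have p: "lifted_dvr K D p (residue_field K D) (residue_map K D) s"
    using lifted_dvr_axioms k1_eq rm_eq by simp
  obtain W where W: "subspace k \<iota> (self_module K) W" "good K (D # Ds) (s # ss) W" "\<forall>r. y r \<notin> W"
    using good_avoids_sequence[OF lift p, of y] x \<psi>(1) lattice_sub[OF L] y_def by auto
  have g: "mgood K (D # Ds) (s # ss) M {x \<in> carrier M. \<psi> x \<in> W}"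
    using pb W(1,2) mgood_self[OF lift] unfolding pulls_back_good_def by blast
  have "additive M {x \<in> carrier M. \<psi> x \<in> W}"
    by (rule additive_vimage(4)[OF M.M.abelian_group_axioms module.axioms(2)[OF self]])
      (use \<psi> W(1) in \<open>auto simp: subspace_def\<close>)
  then obtain L' where L': "L' \<in> Lat" "L' \<subseteq> {x \<in> carrier M. \<psi> x \<in> W}"
    using good_contains_lattice[OF fg _ g] by blast
  \<comment> \<open>A single exponent moves all of \<open>L\<close> into \<open>L'\<close>. The
    contradiction comes from the member of the sequence whose own index is this exponent.\<close>
  obtain N where N: "\<forall>x\<in>L. zp N \<odot>\<^bsub>M\<^esub> x \<in> L'" using lattice_bounded[OF L L'(1)] by blast
  have "zp (int (nat N)) \<odot>\<^bsub>M\<^esub> x (nat N) \<in> L'"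
    using zp_smult_mono[OF lattice_smult[OF L'(1)] lattice_sub[OF L x(1)], of N "nat N" "int (nat N)"] N x(1) by auto
  then have "y (nat N) \<in> W" using L'(2) unfolding y_def by blast
  then show False using W(3) by blast
qed

end

locale dvr_lift_pair = M1: dvr_lift K D p k1 rm s M1 k \<iota> Ds ss + M2: dvr_lift K D p k1 rm s M2 k \<iota> Ds ss
  for K :: "'a ring" (structure) and D p k1 rm s and M1 :: "('a, 'm) module" and M2 :: "('a, 'n) module"
    and k :: "'k ring" and \<iota> Ds ss +
  assumes fg1: "fg_submodule (carrier M1) K M1" and fg2: "fg_submodule (carrier M2) K M2"
begin

abbreviation "lin \<equiv> linear_maps k (restrict_scalars \<iota> M1) (restrict_scalars \<iota> M2)"
abbreviation "pb \<equiv> pulls_back_good k \<iota> K (D # Ds) (s # ss) M1 M2"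

text \<open>Coordinates turn membership in \<open>L2\<close> into finitely many memberships in
  \<open>D\<close>, to each of which the bound for functionals applies. The largest of the exponents
  works for all coordinates.\<close>

lemma pulls_back_good_bounded:
  assumes L: "L1 \<in> lattices K D M1" "L2 \<in> lattices K D M2" and \<phi>: "\<phi> \<in> lin" "pb \<phi>"
  shows "\<exists>r::nat. \<forall>x\<in>L1. M1.zp (int r) \<odot>\<^bsub>M2\<^esub> \<phi> (M1.zp (int r) \<odot>\<^bsub>M1\<^esub> x) \<in> L2"
proof -
  note lin = \<phi>(1)[unfolded linear_maps_iff]
  obtain I where I: "finite I" "\<And>l e. (l, e) \<in> I \<Longrightarrow> e \<in> L2 \<and> linear_functional K M2 l \<and> (\<forall>x\<in>L2. l x \<in> D)"
    "\<And>V y. additive M2 V \<Longrightarrow> y \<in> carrier M2 \<Longrightarrow> (\<forall>(l, e)\<in>I. l y \<odot>\<^bsub>M2\<^esub> e \<in> V) \<Longrightarrow> y \<in> V"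
    using M2.lattice_coordinates[OF L(2)] by (auto split: prod.splits)
  have "\<exists>r::nat. \<forall>x\<in>L1. M1.zp (int r) \<otimes> fst i (\<phi> (M1.zp (int r) \<odot>\<^bsub>M1\<^esub> x)) \<in> D" if i: "i \<in> I" for i
  proof (rule M1.pulls_back_good_functional_bounded[OF fg1 L(1)])
    have l: "linear_functional K M2 (fst i)" using I(2)[of "fst i" "snd i"] i by simp
    note l' = l[unfolded linear_functional_def]
    show "fst i (\<phi> x) \<in> carrier K" if "x \<in> carrier M1" for x using that lin l' by blast
    show "fst i (\<phi> (x \<oplus>\<^bsub>M1\<^esub> y)) = fst i (\<phi> x) \<oplus> fst i (\<phi> y)" if "x \<in> carrier M1" "y \<in> carrier M1" for x y
      using that lin l' by simp
    show "pulls_back_good k \<iota> K (D # Ds) (s # ss) M1 (self_module K) (\<lambda>x. fst i (\<phi> x))"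
      unfolding pulls_back_good_def
    proof (intro allI impI)
      fix W assume W: "subspace k \<iota> (self_module K) W" "mgood K (D # Ds) (s # ss) (self_module K) W"
      have W': "good K (D # Ds) (s # ss) W" using W(2) mgood_self[OF M1.lift] by blast
      have "mgood K (D # Ds) (s # ss) M1 {x \<in> carrier M1. \<phi> x \<in> {x \<in> carrier M2. fst i x \<in> W}}"
        using \<phi>(2) functional_vimage[OF M1.lift M2.M.module_axioms l W(1) W']
        unfolding pulls_back_good_def by blast
      then show "mgood K (D # Ds) (s # ss) M1 {x \<in> carrier M1. fst i (\<phi> x) \<in> W}"
        by (rule mgood_mono) auto
    qed
  qed
  then obtain r where r: "\<And>i x. i \<in> I \<Longrightarrow> x \<in> L1 \<Longrightarrow>
      M1.zp (int (r i)) \<otimes> fst i (\<phi> (M1.zp (int (r i)) \<odot>\<^bsub>M1\<^esub> x)) \<in> D" by metis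
  obtain R where R: "\<And>i. i \<in> I \<Longrightarrow> r i \<le> R"
    using finite_nat_set_iff_bounded_le[of "r ` I"] I(1) by auto
  have "M1.zp (int R) \<odot>\<^bsub>M2\<^esub> \<phi> (M1.zp (int R) \<odot>\<^bsub>M1\<^esub> x) \<in> L2" if x: "x \<in> L1" for x
  proof (rule I(3)[OF M2.lattice_additive[OF L(2)]])
    have xM: "x \<in> carrier M1" by (rule M1.lattice_sub[OF L(1) x])
    then have \<phi>M: "\<phi> (M1.zp m \<odot>\<^bsub>M1\<^esub> x) \<in> carrier M2" for m using lin by simp
    then show "M1.zp (int R) \<odot>\<^bsub>M2\<^esub> \<phi> (M1.zp (int R) \<odot>\<^bsub>M1\<^esub> x) \<in> carrier M2" by simp
    show "\<forall>(l, e)\<in>I. l (M1.zp (int R) \<odot>\<^bsub>M2\<^esub> \<phi> (M1.zp (int R) \<odot>\<^bsub>M1\<^esub> x)) \<odot>\<^bsub>M2\<^esub> e \<in> L2"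
    proof clarify
      fix l e assume i: "(l, e) \<in> I"
      let ?r = "r (l, e)"
      \<comment> \<open>The inner exponent is raised from \<open>r\<close> to \<open>R\<close> by
        moving the surplus power of \<open>p\<close> into the vector, which remains in
        \<open>L1\<close>. The outer exponent is raised by multiplying within
        \<open>D\<close>.\<close>
      let ?x = "M1.zp (int R - int ?r) \<odot>\<^bsub>M1\<^esub> x"
      have "?x \<in> L1" using M1.lattice_smult[OF L(1) M1.zp_D x] R[OF i] by simp
      then have "M1.zp (int ?r) \<otimes> l (\<phi> (M1.zp (int ?r) \<odot>\<^bsub>M1\<^esub> ?x)) \<in> D" using r[OF i] by simp
      moreover have "M1.zp (int ?r) \<odot>\<^bsub>M1\<^esub> ?x = M1.zp (int R) \<odot>\<^bsub>M1\<^esub> x" using M1.zp_smult[OF xM] by simp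
      ultimately have "M1.zp (int ?r) \<otimes> l (\<phi> (M1.zp (int R) \<odot>\<^bsub>M1\<^esub> x)) \<in> D" by simp
      moreover have lf: "linear_functional K M2 l" using I(2)[OF i] by simp
      ultimately have "M1.zp (int R) \<otimes> l (\<phi> (M1.zp (int R) \<odot>\<^bsub>M1\<^esub> x)) \<in> D"
        using M1.zp_D_mono[of _ "int ?r" "int R"] R[OF i] \<phi>M unfolding linear_functional_def by auto
      then have "l (M1.zp (int R) \<odot>\<^bsub>M2\<^esub> \<phi> (M1.zp (int R) \<odot>\<^bsub>M1\<^esub> x)) \<in> D"
        using lf \<phi>M unfolding linear_functional_def by simp
      then show "l (M1.zp (int R) \<odot>\<^bsub>M2\<^esub> \<phi> (M1.zp (int R) \<odot>\<^bsub>M1\<^esub> x)) \<odot>\<^bsub>M2\<^esub> e \<in> L2"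
        using M2.lattice_smult[OF L(2)] I(2)[OF i] by blast
    qed
  qed
  then show ?thesis by blast
qed

lemma M2_K_mult_vimage:
  assumes W: "subspace k \<iota> M2 W" "mgood K (D # Ds) (s # ss) M2 W" and a: "a \<in> carrier K"
  shows "subspace k \<iota> M2 {x \<in> carrier M2. a \<odot>\<^bsub>M2\<^esub> x \<in> W}"
    "mgood K (D # Ds) (s # ss) M2 {x \<in> carrier M2. a \<odot>\<^bsub>M2\<^esub> x \<in> W}"
proof -
  have comm: "a \<odot>\<^bsub>M2\<^esub> (b \<odot>\<^bsub>M2\<^esub> x) = b \<odot>\<^bsub>M2\<^esub> (a \<odot>\<^bsub>M2\<^esub> x)" if "b \<in> carrier K" "x \<in> carrier M2" for b x
    using that a by (simp add: M2.M.smult_assoc1[symmetric] M1.m_comm)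
  have i: "\<iota> c \<in> carrier K" if "c \<in> carrier k" for c using M1.\<iota>_D that M1.D_sub by blast
  show "subspace k \<iota> M2 {x \<in> carrier M2. a \<odot>\<^bsub>M2\<^esub> x \<in> W}"
    by (rule subspace_vimage[OF M2.M.M.abelian_group_axioms M2.M.M.abelian_group_axioms _ W(1)])
      (use a i comm in \<open>auto simp: linear_maps_iff M2.M.smult_r_distr\<close>)
  show "mgood K (D # Ds) (s # ss) M2 {x \<in> carrier M2. a \<odot>\<^bsub>M2\<^esub> x \<in> W}"
    by (rule mgood_vimage[OF M2.M.module_axioms _ _ W(2)]) (use a comm in auto)
qed

text \<open>Both terms are composites of \<open>\<phi>\<close> with multiplication by
  \<open>a\<close> on one of the modules. Multiplication is \<open>K\<close>-linear and pulls good
  subsets back to good ones by rescaling the line on which they are tested.\<close>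

lemma pulls_back_good_commutator:
  assumes \<phi>: "pb \<phi>" "\<phi> \<in> lin" and a: "a \<in> carrier K"
  shows "pb (\<lambda>x. (a \<odot>\<^bsub>M2\<^esub> \<phi> x) \<ominus>\<^bsub>M2\<^esub> \<phi> (a \<odot>\<^bsub>M1\<^esub> x))"
proof (rule pulls_back_good_diff[OF M1.lift M2.M.M.abelian_group_axioms])
  show "pb (\<lambda>x. a \<odot>\<^bsub>M2\<^esub> \<phi> x)" unfolding pulls_back_good_def
  proof (intro allI impI)
    fix W assume W: "subspace k \<iota> M2 W" "mgood K (D # Ds) (s # ss) M2 W"
    have "mgood K (D # Ds) (s # ss) M1 {x \<in> carrier M1. \<phi> x \<in> {x \<in> carrier M2. a \<odot>\<^bsub>M2\<^esub> x \<in> W}}"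
      using \<phi>(1) M2_K_mult_vimage[OF W a] unfolding pulls_back_good_def by blast
    then show "mgood K (D # Ds) (s # ss) M1 {x \<in> carrier M1. a \<odot>\<^bsub>M2\<^esub> \<phi> x \<in> W}"
      by (rule mgood_mono) auto
  qed
  show "pb (\<lambda>x. \<phi> (a \<odot>\<^bsub>M1\<^esub> x))" unfolding pulls_back_good_def
  proof (intro allI impI)
    fix W assume W: "subspace k \<iota> M2 W" "mgood K (D # Ds) (s # ss) M2 W"
    have g: "mgood K (D # Ds) (s # ss) M1 {x \<in> carrier M1. \<phi> x \<in> W}"
      using \<phi>(1) W unfolding pulls_back_good_def by blast
    have "mgood K (D # Ds) (s # ss) M1 {x \<in> carrier M1. a \<odot>\<^bsub>M1\<^esub> x \<in> {x \<in> carrier M1. \<phi> x \<in> W}}"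
      by (rule mgood_vimage[OF M1.M.module_axioms _ _ g])
        (use a in \<open>auto simp: M1.M.smult_assoc1[symmetric] M1.m_comm\<close>)
    then show "mgood K (D # Ds) (s # ss) M1 {x \<in> carrier M1. \<phi> (a \<odot>\<^bsub>M1\<^esub> x) \<in> W}"
      by (rule mgood_mono) auto
  qed
qed

lemma diffop_linear: "diffop k \<iota> K M1 M2 d \<phi> \<Longrightarrow> \<phi> \<in> lin"
  using M1.\<iota>_D M1.D_sub by (cases d) (auto simp: linear_maps_iff)

text \<open>
  The bound for one power of \<open>p\<close> propagates to all powers because the commutator with \<open>p\<close>
  has smaller order.
\<close>

lemma diffop_bounded:
  assumes L: "L1 \<in> lattices K D M1" "L2 \<in> lattices K D M2"
    and "diffop k \<iota> K M1 M2 d \<phi>" "pb \<phi>"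
  shows "\<exists>b::int. \<forall>m. \<forall>x\<in>L1. M1.zp (b - m) \<odot>\<^bsub>M2\<^esub> \<phi> (M1.zp m \<odot>\<^bsub>M1\<^esub> x) \<in> L2"
  using assms(3,4)
proof (induction d arbitrary: \<phi>)
  case 0
  then show ?case using M1.lattice_sub[OF L(1)] additiveD(2)[OF M2.lattice_additive[OF L(2)]] by auto
next
  case (Suc d)
  note add2 = additiveD[OF M2.lattice_additive[OF L(2)]]
  have lin: "\<phi> \<in> lin" using diffop_linear Suc.prems(1) by blast
  note lin' = lin[unfolded linear_maps_iff]
  define \<psi> where "\<psi> = (\<lambda>x. (p \<odot>\<^bsub>M2\<^esub> \<phi> x) \<ominus>\<^bsub>M2\<^esub> \<phi> (p \<odot>\<^bsub>M1\<^esub> x))"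
  have "diffop k \<iota> K M1 M2 d \<psi>" using Suc.prems(1) unfolding \<psi>_def by simp
  moreover have "pb \<psi>" unfolding \<psi>_def by (rule pulls_back_good_commutator[OF Suc.prems(2) lin]) simp
  ultimately obtain b' where b': "\<And>m x. x \<in> L1 \<Longrightarrow> M1.zp (b' - m) \<odot>\<^bsub>M2\<^esub> \<psi> (M1.zp m \<odot>\<^bsub>M1\<^esub> x) \<in> L2"
    using Suc.IH by blast
  obtain r :: nat where r: "\<And>x. x \<in> L1 \<Longrightarrow> M1.zp (int r) \<odot>\<^bsub>M2\<^esub> \<phi> (M1.zp (int r) \<odot>\<^bsub>M1\<^esub> x) \<in> L2"
    using pulls_back_good_bounded[OF L lin Suc.prems(2)] by blast
  \<comment> \<open>The bound \<open>2 r\<close> serves the start at \<open>m = r\<close>, where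
    both exponents are at least \<open>r\<close>. The bound \<open>b' + 1\<close> pays for the one
    power of \<open>p\<close> by which the exponents at \<open>\<phi>\<close> and at the commutator
    \<open>\<psi>\<close> differ in either direction.\<close>
  define b where "b = max (2 * int r) (b' + 1)"
  have mono: "M1.zp n \<odot>\<^bsub>M2\<^esub> y \<in> L2" if "M1.zp m \<odot>\<^bsub>M2\<^esub> y \<in> L2" "m \<le> n" "y \<in> carrier M2" for m n y
    by (rule M2.zp_smult_mono[OF M2.lattice_smult[OF L(2)] that(3,1,2)])
  have \<phi>M: "\<phi> x \<in> carrier M2" "\<psi> x \<in> carrier M2" if "x \<in> carrier M1" for x
    using lin' that unfolding \<psi>_def by simp_all
  have L1M: "x \<in> carrier M1" if "x \<in> L1" for x by (rule M1.lattice_sub[OF L(1) that])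
  have pz: "M1.zp i \<odot>\<^bsub>M2\<^esub> (p \<odot>\<^bsub>M2\<^esub> y) = M1.zp (i + 1) \<odot>\<^bsub>M2\<^esub> y" if "y \<in> carrier M2" for i y
    using M2.zp_smult[OF that, of i 1] by (simp add: M1.zp_1)
  have pz1: "p \<odot>\<^bsub>M1\<^esub> (M1.zp i \<odot>\<^bsub>M1\<^esub> y) = M1.zp (i + 1) \<odot>\<^bsub>M1\<^esub> y" if "y \<in> carrier M1" for i y
    using M1.zp_smult[OF that, of 1 i] by (simp add: M1.zp_1 add.commute)
  \<comment> \<open>An induction in both directions from \<open>m = r\<close>, since negative powers
    of \<open>p\<close> are needed as well: upwards by
    \<open>\<phi>(p z) = p \<phi>(z) - \<psi>(z)\<close>, downwards by solving the same identity for
    \<open>p \<phi>(z)\<close>.\<close>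
  have "\<forall>x\<in>L1. M1.zp (b - m) \<odot>\<^bsub>M2\<^esub> \<phi> (M1.zp m \<odot>\<^bsub>M1\<^esub> x) \<in> L2" for m
  proof (induction m rule: int_induct[where k = "int r"])
    case base
    show ?case using mono[OF r] \<phi>M L1M b_def by auto
  next
    case (step1 m)
    show ?case
    proof
      fix x assume x: "x \<in> L1"
      let ?z = "M1.zp m \<odot>\<^bsub>M1\<^esub> x"
      have z: "?z \<in> carrier M1" using L1M[OF x] by simp
      have "\<phi> (M1.zp (m + 1) \<odot>\<^bsub>M1\<^esub> x) = p \<odot>\<^bsub>M2\<^esub> \<phi> ?z \<ominus>\<^bsub>M2\<^esub> \<psi> ?z"
      proof -
        have c: "p \<odot>\<^bsub>M2\<^esub> \<phi> ?z \<in> carrier M2" "\<phi> (p \<odot>\<^bsub>M1\<^esub> ?z) \<in> carrier M2" using \<phi>M z by auto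
        have "p \<odot>\<^bsub>M2\<^esub> \<phi> ?z \<ominus>\<^bsub>M2\<^esub> \<psi> ?z = \<phi> (p \<odot>\<^bsub>M1\<^esub> ?z)"
          unfolding \<psi>_def using c
          by (simp add: a_minus_def M2.M.M.minus_add M2.M.M.a_assoc[symmetric] M2.M.M.r_neg)
        then show ?thesis using pz1[OF L1M[OF x]] by simp
      qed
      then have "M1.zp (b - (m + 1)) \<odot>\<^bsub>M2\<^esub> \<phi> (M1.zp (m + 1) \<odot>\<^bsub>M1\<^esub> x)
          = M1.zp (b - m) \<odot>\<^bsub>M2\<^esub> \<phi> ?z \<ominus>\<^bsub>M2\<^esub> M1.zp (b - (m + 1)) \<odot>\<^bsub>M2\<^esub> \<psi> ?z"
        using pz[OF \<phi>M(1)[OF z], of "b - (m + 1)"] \<phi>M z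
        by (simp add: a_minus_def M2.M.smult_r_distr M2.M.smult_r_minus)
      moreover have "M1.zp (b - m) \<odot>\<^bsub>M2\<^esub> \<phi> ?z \<in> L2" using step1 x by blast
      moreover have "M1.zp (b - (m + 1)) \<odot>\<^bsub>M2\<^esub> \<psi> ?z \<in> L2"
        using mono[OF b'[OF x], of m] \<phi>M(2)[OF z] b_def by auto
      ultimately show "M1.zp (b - (m + 1)) \<odot>\<^bsub>M2\<^esub> \<phi> (M1.zp (m + 1) \<odot>\<^bsub>M1\<^esub> x) \<in> L2" using add2(5) by simp
    qed
  next
    case (step2 m)
    show ?case
    proof
      fix x assume x: "x \<in> L1"
      let ?z = "M1.zp (m - 1) \<odot>\<^bsub>M1\<^esub> x"
      have z: "?z \<in> carrier M1" using L1M[OF x] by simp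
      \<comment> \<open>Only \<open>p \<phi>(z)\<close> is controlled here. That is sufficient,
        because the exponent in front grows by one when \<open>m\<close> decreases and this absorbs
        the factor \<open>p\<close>.\<close>
      have "p \<odot>\<^bsub>M2\<^esub> \<phi> ?z = \<psi> ?z \<oplus>\<^bsub>M2\<^esub> \<phi> (M1.zp m \<odot>\<^bsub>M1\<^esub> x)"
      proof -
        have c: "p \<odot>\<^bsub>M2\<^esub> \<phi> ?z \<in> carrier M2" "\<phi> (p \<odot>\<^bsub>M1\<^esub> ?z) \<in> carrier M2" using \<phi>M z by auto
        have "p \<odot>\<^bsub>M2\<^esub> \<phi> ?z = \<psi> ?z \<oplus>\<^bsub>M2\<^esub> \<phi> (p \<odot>\<^bsub>M1\<^esub> ?z)"
          unfolding \<psi>_def using c by (simp add: a_minus_def M2.M.M.a_assoc M2.M.M.l_neg)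
        then show ?thesis using pz1[OF L1M[OF x], of "m - 1"] by simp
      qed
      then have "M1.zp (b - (m - 1)) \<odot>\<^bsub>M2\<^esub> \<phi> ?z
          = M1.zp (b - m) \<odot>\<^bsub>M2\<^esub> \<psi> ?z \<oplus>\<^bsub>M2\<^esub> M1.zp (b - m) \<odot>\<^bsub>M2\<^esub> \<phi> (M1.zp m \<odot>\<^bsub>M1\<^esub> x)"
        using pz[OF \<phi>M(1)[OF z], of "b - m"] \<phi>M z L1M[OF x]
        by (simp add: M2.M.smult_r_distr algebra_simps)
      moreover have "M1.zp (b - m) \<odot>\<^bsub>M2\<^esub> \<phi> (M1.zp m \<odot>\<^bsub>M1\<^esub> x) \<in> L2" using step2 x by blast
      moreover have "M1.zp (b - m) \<odot>\<^bsub>M2\<^esub> \<psi> ?z \<in> L2"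
        using mono[OF b'[OF x], of "m - 1"] \<phi>M(2)[OF z] b_def by auto
      ultimately show "M1.zp (b - (m - 1)) \<odot>\<^bsub>M2\<^esub> \<phi> ?z \<in> L2" using add2(3) by simp
    qed
  qed
  then show ?case by blast
qed

lemma diffop_refinement:
  assumes L: "L1 \<in> lattices K D M1" "L2 \<in> lattices K D M2"
    and \<phi>: "diffop k \<iota> K M1 M2 d \<phi>" "pb \<phi>"
  shows "\<exists>P'\<in>lattices K D M1 \<times> lattices K D M2. refinement \<phi> P' (L1, L2)"
proof -
  obtain b where b: "\<And>m x. x \<in> L1 \<Longrightarrow> M1.zp (b - m) \<odot>\<^bsub>M2\<^esub> \<phi> (M1.zp m \<odot>\<^bsub>M1\<^esub> x) \<in> L2"
    using diffop_bounded[OF L \<phi>] by blast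
  note lin = diffop_linear[OF \<phi>(1), unfolded linear_maps_iff]
  \<comment> \<open>Nonnegativity gives \<open>p^n L1 \<subseteq> L1\<close> and
    \<open>L2 \<subseteq> p^(-n) L2\<close>. With \<open>n \<ge> b\<close> the bound at
    \<open>m = n\<close> gives \<open>\<phi>(p^n L1) \<subseteq> L2\<close>, and the bound at
    \<open>m = 0\<close> gives \<open>\<phi>(L1) \<subseteq> p^(-n) L2\<close>.\<close>
  define n where "n = max b 0"
  have L1M: "x \<in> carrier M1" if "x \<in> L1" for x by (rule M1.lattice_sub[OF L(1) that])
  have L2M: "x \<in> carrier M2" if "x \<in> L2" for x by (rule M2.lattice_sub[OF L(2) that])
  have mono: "M1.zp j \<odot>\<^bsub>M2\<^esub> y \<in> L2" if "M1.zp i \<odot>\<^bsub>M2\<^esub> y \<in> L2" "i \<le> j" "y \<in> carrier M2" for i j y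
    by (rule M2.zp_smult_mono[OF M2.lattice_smult[OF L(2)] that(3,1,2)])
  have "refinement \<phi> (M1.scale n L1, M2.scale (- n) L2) (L1, L2)"
    unfolding refinement_def prod.case
  proof (intro conjI subsetI)
    fix x assume x: "x \<in> M1.scale n L1"
    then have "M1.zp (- n) \<odot>\<^bsub>M1\<^esub> x \<in> L1" "x \<in> carrier M1" by (auto simp: M1.scale_def)
    then show "x \<in> L1"
      using M1.zp_smult_mono[OF M1.lattice_smult[OF L(1)], of x "- n" 0] n_def by simp
  next
    fix y assume y: "y \<in> L2"
    then show "y \<in> M2.scale (- n) L2"
      using mono[of 0 y n] L2M n_def by (simp add: M2.scale_def)
  next
    fix y assume "y \<in> \<phi> ` M1.scale n L1"
    then obtain x where x: "x \<in> carrier M1" "M1.zp (- n) \<odot>\<^bsub>M1\<^esub> x \<in> L1" "y = \<phi> x"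
      by (auto simp: M1.scale_def)
    have "M1.zp (b - n) \<odot>\<^bsub>M2\<^esub> \<phi> x \<in> L2"
      using b[OF x(2), of n] M1.zp_smult_cancel(2)[OF x(1)] by simp
    then show "y \<in> L2" using mono[of "b - n" y 0] x lin n_def by simp
  next
    fix y assume "y \<in> \<phi> ` L1"
    then obtain x where x: "x \<in> L1" "y = \<phi> x" by auto
    have "M1.zp b \<odot>\<^bsub>M2\<^esub> y \<in> L2" using b[OF x(1), of 0] x L1M by simp
    then show "y \<in> M2.scale (- n) L2"
      using mono[of b y n] x L1M lin n_def by (simp add: M2.scale_def)
  qed
  then show ?thesis using M1.lattice_scale[OF L(1)] M2.lattice_scale[OF L(2)] by blast
qed

text \<open>Well-definedness on classes: a change of representative in \<open>L1\<close> is an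
  element of \<open>L1'\<close>, and \<open>\<phi>\<close> sends it into \<open>L2\<close>.\<close>

lemma induced_map:
  assumes L: "L1 \<in> lattices K D M1" "L2 \<in> lattices K D M2" "L1' \<in> lattices K D M1" "L2' \<in> lattices K D M2"
    and r: "refinement \<phi> (L1', L2') (L1, L2)" and \<phi>: "\<phi> \<in> lin"
  shows "lattice_pair K D p k1 rm s M1 L1 L1'" "lattice_pair K D p k1 rm s M2 L2' L2"
    and "x \<in> L1 \<Longrightarrow> \<phi> x \<in> L2'"
    and "x \<in> L1 \<Longrightarrow> quot_map M2 L2 (\<phi> (quot_map M1 L1' x)) = quot_map M2 L2 (\<phi> x)"
proof -
  have r': "L1' \<subseteq> L1" "L2 \<subseteq> L2'" "\<And>x. x \<in> L1' \<Longrightarrow> \<phi> x \<in> L2" "\<And>x. x \<in> L1 \<Longrightarrow> \<phi> x \<in> L2'"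
    using r by (auto simp: refinement_def)
  show Q1: "lattice_pair K D p k1 rm s M1 L1 L1'" by unfold_locales (use L r' in auto)
  show Q2: "lattice_pair K D p k1 rm s M2 L2' L2" by unfold_locales (use L r' in auto)
  interpret Q1: lattice_pair K D p k1 rm s M1 L1 L1' by fact
  interpret Q2: lattice_pair K D p k1 rm s M2 L2' L2 by fact
  show "\<phi> x \<in> L2'" if "x \<in> L1" for x using r' that by blast
  assume x: "x \<in> L1"
  obtain l where l: "l \<in> L1'" "Q1.q x = l \<oplus>\<^bsub>M1\<^esub> x" using Q1.q_coset[OF x] by blast
  have "\<phi> (Q1.q x) = \<phi> l \<oplus>\<^bsub>M2\<^esub> \<phi> x"
    using l \<phi> Q1.L_add(1)[OF x] Q1.L'_add(1) unfolding linear_maps_iff by simp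
  then show "quot_map M2 L2 (\<phi> (quot_map M1 L1' x)) = quot_map M2 L2 (\<phi> x)"
    using Q2.q_absorb[OF r'(3)[OF l(1)] r'(4)[OF x]] by simp
qed

lemma induced_linear:
  assumes L: "L1 \<in> lattices K D M1" "L2 \<in> lattices K D M2" "L1' \<in> lattices K D M1" "L2' \<in> lattices K D M2"
    and r: "refinement \<phi> (L1', L2') (L1, L2)" and \<phi>: "\<phi> \<in> lin"
  shows "(\<lambda>x. quot_map M2 L2 (\<phi> x)) \<in> linear_maps k (restrict_scalars (rm \<circ> \<iota>) (rest_quot s M1 L1 L1'))
    (restrict_scalars (rm \<circ> \<iota>) (rest_quot s M2 L2' L2))"
proof -
  note ind = induced_map[OF assms]
  interpret Q1: lattice_pair K D p k1 rm s M1 L1 L1' by (rule ind(1))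
  interpret Q2: lattice_pair K D p k1 rm s M2 L2' L2 by (rule ind(2))
  note lin = \<phi>[unfolded linear_maps_iff]
  show ?thesis unfolding linear_maps_iff
  proof (intro conjI ballI)
    fix x assume "x \<in> carrier Q1.Q"
    then obtain u where u: "u \<in> L1" "x = Q1.q u" by auto
    have uM: "u \<in> carrier M1" using Q1.L_add(1) u by blast
    show "quot_map M2 L2 (\<phi> x) \<in> carrier Q2.Q" using ind(3,4)[OF u(1)] u(2) by simp
    show "quot_map M2 L2 (\<phi> (x \<oplus>\<^bsub>Q1.Q\<^esub> y)) = quot_map M2 L2 (\<phi> x) \<oplus>\<^bsub>Q2.Q\<^esub> quot_map M2 L2 (\<phi> y)"
      if y: "y \<in> carrier Q1.Q" for y
    proof -
      obtain v where v: "v \<in> L1" "y = Q1.q v" using y by auto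
      have vM: "v \<in> carrier M1" using Q1.L_add(1) v by blast
      have "quot_map M2 L2 (\<phi> (x \<oplus>\<^bsub>Q1.Q\<^esub> y)) = quot_map M2 L2 (\<phi> u \<oplus>\<^bsub>M2\<^esub> \<phi> v)"
        using Q1.Q_add[OF u(1) v(1)] ind(4)[OF Q1.L_add(3)[OF u(1) v(1)]] u(2) v(2) lin uM vM by simp
      then show ?thesis
        using Q2.Q_add[OF ind(3)[OF u(1)] ind(3)[OF v(1)]] ind(4)[OF u(1)] ind(4)[OF v(1)] u(2) v(2) by simp
    qed
    fix c assume c: "c \<in> carrier k"
    have rc: "rm (\<iota> c) \<in> carrier k1" "s (rm (\<iota> c)) = \<iota> c" using M1.\<iota>_D[OF c] M1.\<iota>_lift[OF c] M1.rm_closed by auto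
    have cu: "\<iota> c \<odot>\<^bsub>M1\<^esub> u \<in> L1" using M1.lattice_smult[OF L(1) M1.\<iota>_D[OF c] u(1)] .
    have "quot_map M2 L2 (\<phi> (rm (\<iota> c) \<odot>\<^bsub>Q1.Q\<^esub> x)) = quot_map M2 L2 (\<iota> c \<odot>\<^bsub>M2\<^esub> \<phi> u)"
      using Q1.Q_smult[OF rc(1) u(1)] ind(4)[OF cu] u(2) rc(2) lin uM c by simp
    also have "\<dots> = rm (\<iota> c) \<odot>\<^bsub>Q2.Q\<^esub> quot_map M2 L2 (\<phi> x)"
      using Q2.Q_smult[OF rc(1) ind(3)[OF u(1)]] ind(4)[OF u(1)] u(2) rc(2) by simp
    finally show "quot_map M2 L2 (\<phi> ((rm \<circ> \<iota>) c \<odot>\<^bsub>Q1.Q\<^esub> x)) = (rm \<circ> \<iota>) c \<odot>\<^bsub>Q2.Q\<^esub> quot_map M2 L2 (\<phi> x)"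
      by (simp only: comp_apply)
  qed
qed

text \<open>The commutator of the induced map with \<open>b\<close> is induced by the commutator of
  \<open>\<phi>\<close> with the lift \<open>s b\<close>. As \<open>s b\<close> lies in
  \<open>D\<close>, it preserves all four lattices, so the same pair is a refinement for the
  commutator and the induction on the order can go on.\<close>

lemma induced_diffop:
  assumes L: "L1 \<in> lattices K D M1" "L2 \<in> lattices K D M2" "L1' \<in> lattices K D M1" "L2' \<in> lattices K D M2"
    and "refinement \<phi> (L1', L2') (L1, L2)" "diffop k \<iota> K M1 M2 d \<phi>"
  shows "diffop k (rm \<circ> \<iota>) k1 (rest_quot s M1 L1 L1') (rest_quot s M2 L2' L2) d (\<lambda>x. quot_map M2 L2 (\<phi> x))"
  using assms(5,6)
proof (induction d arbitrary: \<phi>)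
  case 0
  note ind = induced_map[OF L 0(1) diffop_linear[OF 0(2)]]
  interpret Q1: lattice_pair K D p k1 rm s M1 L1 L1' by (rule ind(1))
  show ?case using 0(2) Q1.q_in Q1.L_add(1) by auto
next
  case (Suc d)
  note lin = diffop_linear[OF Suc.prems(2)]
  note lin' = lin[unfolded linear_maps_iff]
  note ind = induced_map[OF L Suc.prems(1) lin]
  interpret Q1: lattice_pair K D p k1 rm s M1 L1 L1' by (rule ind(1))
  interpret Q2: lattice_pair K D p k1 rm s M2 L2' L2 by (rule ind(2))
  have r: "\<And>x. x \<in> L1' \<Longrightarrow> \<phi> x \<in> L2" "L1' \<subseteq> L1" "L2 \<subseteq> L2'"
    using Suc.prems(1) by (auto simp: refinement_def)
  have "diffop k (rm \<circ> \<iota>) k1 Q1.Q Q2.Q d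
      (\<lambda>x. (b \<odot>\<^bsub>Q2.Q\<^esub> Q2.q (\<phi> x)) \<ominus>\<^bsub>Q2.Q\<^esub> Q2.q (\<phi> (b \<odot>\<^bsub>Q1.Q\<^esub> x)))" if b: "b \<in> carrier k1" for b
  proof -
    have sb: "s b \<in> D" by (rule M1.s_D[OF b])
    define \<psi> where "\<psi> = (\<lambda>x. (s b \<odot>\<^bsub>M2\<^esub> \<phi> x) \<ominus>\<^bsub>M2\<^esub> \<phi> (s b \<odot>\<^bsub>M1\<^esub> x))"
    have \<psi>d: "diffop k \<iota> K M1 M2 d \<psi>" using Suc.prems(2) M1.D_sub[OF sb] unfolding \<psi>_def by simp
    have "refinement \<psi> (L1', L2') (L1, L2)"
    proof -
      have "\<psi> x \<in> L2" if "x \<in> L1'" for x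
        unfolding \<psi>_def
        by (rule Q2.L'_add(5)[OF M2.lattice_smult[OF L(2) sb r(1)[OF that]]
              r(1)[OF M1.lattice_smult[OF L(3) sb that]]])
      moreover have "\<psi> x \<in> L2'" if "x \<in> L1" for x
        unfolding \<psi>_def
        by (rule Q2.L_add(5)[OF M2.lattice_smult[OF L(4) sb ind(3)[OF that]]
              ind(3)[OF M1.lattice_smult[OF L(1) sb that]]])
      ultimately show ?thesis using r by (auto simp: refinement_def)
    qed
    then have d: "diffop k (rm \<circ> \<iota>) k1 Q1.Q Q2.Q d (\<lambda>x. Q2.q (\<psi> x))" using \<psi>d by (rule Suc.IH)
    show ?thesis
    proof (rule diffop_cong[OF Q1.Q_module _ _ d])
      show "rm \<circ> \<iota> \<in> carrier k \<rightarrow> carrier k1" using M1.\<iota>_D M1.rm_closed by auto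
      fix x assume "x \<in> carrier Q1.Q"
      then obtain u where u: "u \<in> L1" "x = Q1.q u" by auto
      have x: "x \<in> L1" using Q1.q_in u by simp
      have bx: "s b \<odot>\<^bsub>M1\<^esub> x \<in> L1" by (rule Q1.s_smult_L[OF b x])
      have 1: "b \<odot>\<^bsub>Q2.Q\<^esub> Q2.q (\<phi> x) = Q2.q (s b \<odot>\<^bsub>M2\<^esub> \<phi> x)" by (rule Q2.Q_smult[OF b ind(3)[OF x]])
      have 2: "Q2.q (\<phi> (b \<odot>\<^bsub>Q1.Q\<^esub> x)) = Q2.q (\<phi> (s b \<odot>\<^bsub>M1\<^esub> x))" using ind(4)[OF bx] by simp
      have y: "s b \<odot>\<^bsub>M2\<^esub> \<phi> x \<in> L2'" by (rule M2.lattice_smult[OF L(4) sb ind(3)[OF x]])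
      have z: "\<phi> (s b \<odot>\<^bsub>M1\<^esub> x) \<in> L2'" by (rule ind(3)[OF bx])
      show "Q2.q (\<psi> x) = (b \<odot>\<^bsub>Q2.Q\<^esub> Q2.q (\<phi> x)) \<ominus>\<^bsub>Q2.Q\<^esub> Q2.q (\<phi> (b \<odot>\<^bsub>Q1.Q\<^esub> x))"
        unfolding 1 2 \<psi>_def a_minus_def Q2.Q_minus[OF z] by (rule Q2.Q_add[OF y Q2.L_add(4)[OF z], symmetric])
    qed
  qed
  then show ?case using induced_linear[OF L Suc.prems(1) lin] unfolding diffop.simps by blast
qed

text \<open>A good subspace of the quotient has to be reached from one of the whole module
  \<open>M2\<close>, since the hypothesis on \<open>\<phi>\<close> concerns nothing else.
  Coordinates on \<open>L2'\<close> reduce this to \<open>D \<subseteq> K\<close>, where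
  \<open>good_extension\<close> applies.\<close>

lemma induced_pulls_back_good:
  assumes L: "L1 \<in> lattices K D M1" "L2 \<in> lattices K D M2" "L1' \<in> lattices K D M1" "L2' \<in> lattices K D M2"
    and r: "refinement \<phi> (L1', L2') (L1, L2)" and \<phi>: "\<phi> \<in> lin" "pb \<phi>"
  shows "pulls_back_good k (rm \<circ> \<iota>) k1 Ds ss (rest_quot s M1 L1 L1') (rest_quot s M2 L2' L2)
    (\<lambda>x. quot_map M2 L2 (\<phi> x))"
  unfolding pulls_back_good_def
proof (intro allI impI)
  note ind = induced_map[OF L r \<phi>(1)]
  interpret Q1: lattice_pair K D p k1 rm s M1 L1 L1' by (rule ind(1))
  interpret Q2: lattice_pair K D p k1 rm s M2 L2' L2 by (rule ind(2))
  fix Wb assume Wb: "subspace k (rm \<circ> \<iota>) Q2.Q Wb" "mgood k1 Ds ss Q2.Q Wb"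
  have Wb_add: "additive Q2.Q Wb" using Wb(1) by (simp add: subspace_def)
  note Wb' = additiveD[OF Wb_add]
  \<comment> \<open>The preimage of the given subspace in \<open>L2'\<close>. It contains
    \<open>L2\<close> but is confined to a lattice, so it need not be good in
    \<open>M2\<close>.\<close>
  define V where "V = {y \<in> L2'. Q2.q y \<in> Wb}"
  have V_add: "additive M2 V"
    unfolding additive_def
  proof (intro conjI ballI)
    show "V \<subseteq> carrier M2" using Q2.L_add(1) by (auto simp: V_def)
    show "\<zero>\<^bsub>M2\<^esub> \<in> V" using Wb'(2) Q2.L_add(2) by (simp add: V_def)
    fix x assume x: "x \<in> V"
    have xL: "x \<in> L2'" "Q2.q x \<in> Wb" using x by (auto simp: V_def)
    show "\<ominus>\<^bsub>M2\<^esub> x \<in> V"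
      using Wb'(4)[OF xL(2)] Q2.L_add(4)[OF xL(1)] unfolding Q2.Q_minus[OF xL(1)] by (simp add: V_def)
    fix y assume y: "y \<in> V"
    show "x \<oplus>\<^bsub>M2\<^esub> y \<in> V"
      using x y Wb'(3)[of "Q2.q x" "Q2.q y"] Q2.Q_add[of x y] Q2.L_add(3) by (auto simp: V_def simp del: rest_quot_simps)
  qed
  have V_k: "\<iota> c \<odot>\<^bsub>M2\<^esub> y \<in> V" if c: "c \<in> carrier k" and y: "y \<in> V" for c y
  proof -
    have rc: "rm (\<iota> c) \<in> carrier k1" "s (rm (\<iota> c)) = \<iota> c" using M1.\<iota>_D[OF c] M1.\<iota>_lift[OF c] M1.rm_closed by auto
    have "(rm \<circ> \<iota>) c \<odot>\<^bsub>Q2.Q\<^esub> Q2.q y \<in> Wb" using Wb(1) c y unfolding subspace_def V_def by blast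
    then have "Q2.q (\<iota> c \<odot>\<^bsub>M2\<^esub> y) \<in> Wb" using Q2.Q_smult[OF rc(1), of y] y rc(2) by (simp add: V_def)
    then show ?thesis using M2.lattice_smult[OF L(4) M1.\<iota>_D[OF c]] y by (simp add: V_def)
  qed
  have L2V: "L2 \<subseteq> V"
    using Q2.q_absorb[OF _ Q2.L_add(2)] Wb'(2) Q2.L'_add(1) Q2.incl by (auto simp: V_def)
  obtain I where I: "finite I" "\<And>l e. (l, e) \<in> I \<Longrightarrow> e \<in> L2' \<and> linear_functional K M2 l \<and> (\<forall>x\<in>L2'. l x \<in> D)"
    "\<And>V y. additive M2 V \<Longrightarrow> y \<in> carrier M2 \<Longrightarrow> (\<forall>(l, e)\<in>I. l y \<odot>\<^bsub>M2\<^esub> e \<in> V) \<Longrightarrow> y \<in> V"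
    using M2.lattice_coordinates[OF L(4)] by (auto split: prod.splits)
  obtain N where N: "\<forall>x\<in>L2'. M1.zp N \<odot>\<^bsub>M2\<^esub> x \<in> L2" using M2.lattice_bounded[OF L(4,2)] by blast
  define n where "n = nat N"
  have n: "M1.zp (int n) \<odot>\<^bsub>M2\<^esub> x \<in> L2" if "x \<in> L2'" for x
    using M2.zp_smult_mono[OF M2.lattice_smult[OF L(2)] Q2.L_add(1)[OF that], of N "int n"] N that n_def by auto
  \<comment> \<open>Along a fixed \<open>e\<close> the scalars \<open>a\<close> in \<open>D\<close>
    with \<open>a e\<close> in \<open>V\<close> include \<open>p^n D\<close>, because
    \<open>p^n L2' \<subseteq> L2\<close>. Their condition on the digit at \<open>p^i\<close> is
    good by the goodness of \<open>Wb\<close> on the line through the class of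
    \<open>p^i e\<close>.\<close>
  have "\<exists>W. subspace k \<iota> (self_module K) W \<and> good K (D # Ds) (s # ss) W \<and> W \<inter> D \<subseteq> {a \<in> D. a \<odot>\<^bsub>M2\<^esub> e \<in> V}"
    if e: "e \<in> L2'" for e
  proof (rule good_extension[OF M1.lift])
    show "lifted_dvr K D p (residue_field K D) (residue_map K D) s"
      using M1.lifted_dvr_axioms M1.k1_eq M1.rm_eq by simp
    have eM: "e \<in> carrier M2" using Q2.L_add(1) e by blast
    note Va = additiveD[OF V_add]
    show "subspace k \<iota> (self_module K) {a \<in> D. a \<odot>\<^bsub>M2\<^esub> e \<in> V}"
      using eM Va(2-4) V_k
      by (auto simp: subspace_def additive_def M1.D_sub M1.D_closed M2.M.smult_l_distr M2.M.smult_l_minus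
          M2.M.smult_assoc1 M1.\<iota>_D)
    show "M1.zp (int n) \<otimes> d \<in> {a \<in> D. a \<odot>\<^bsub>M2\<^esub> e \<in> V}" if d: "d \<in> D" for d
      using M1.D_mult[OF M1.zp_D d] n[OF M2.lattice_smult[OF L(4) d e]] L2V M1.D_sub[OF d] eM
      by (auto simp: M2.M.smult_assoc1)
    show "good (residue_field K D) Ds ss
        {b \<in> carrier (residue_field K D). s b \<otimes> M1.zp (int i) \<in> {a \<in> D. a \<odot>\<^bsub>M2\<^esub> e \<in> V}}" for i
    proof -
      have ie: "M1.zp (int i) \<odot>\<^bsub>M2\<^esub> e \<in> L2'" using M2.lattice_smult[OF L(4) M1.zp_D e] by simp
      then have "good k1 Ds ss {b \<in> carrier k1. b \<odot>\<^bsub>Q2.Q\<^esub> Q2.q (M1.zp (int i) \<odot>\<^bsub>M2\<^esub> e) \<in> Wb}"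
        using Wb(2) unfolding mgood_def by (simp del: rest_quot_simps(4))
      then show ?thesis unfolding M1.k1_eq[symmetric]
      proof (rule good_mono, intro subsetI)
        fix b assume "b \<in> {b \<in> carrier k1. b \<odot>\<^bsub>Q2.Q\<^esub> Q2.q (M1.zp (int i) \<odot>\<^bsub>M2\<^esub> e) \<in> Wb}"
        then have b: "b \<in> carrier k1" "b \<odot>\<^bsub>Q2.Q\<^esub> Q2.q (M1.zp (int i) \<odot>\<^bsub>M2\<^esub> e) \<in> Wb" by blast+
        have "(s b \<otimes> M1.zp (int i)) \<odot>\<^bsub>M2\<^esub> e = s b \<odot>\<^bsub>M2\<^esub> (M1.zp (int i) \<odot>\<^bsub>M2\<^esub> e)"
          using b(1) eM by (simp add: M2.M.smult_assoc1)
        then have "(s b \<otimes> M1.zp (int i)) \<odot>\<^bsub>M2\<^esub> e \<in> V"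
          using b(2) Q2.Q_smult[OF b(1) ie] Q2.s_smult_L[OF b(1) ie] by (simp add: V_def)
        then show "b \<in> {b \<in> carrier k1. s b \<otimes> M1.zp (int i) \<in> {a \<in> D. a \<odot>\<^bsub>M2\<^esub> e \<in> V}}"
          using b(1) M1.D_mult[OF M1.s_D[OF b(1)] M1.zp_D] by simp
      qed
    qed
  qed
  then have "\<forall>e\<in>L2'. \<exists>W. subspace k \<iota> (self_module K) W \<and> good K (D # Ds) (s # ss) W \<and>
      W \<inter> D \<subseteq> {a \<in> D. a \<odot>\<^bsub>M2\<^esub> e \<in> V}" by blast
  from bchoice[OF this] obtain We where We: "\<And>e. e \<in> L2' \<Longrightarrow> subspace k \<iota> (self_module K) (We e)"
    "\<And>e. e \<in> L2' \<Longrightarrow> good K (D # Ds) (s # ss) (We e)"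
    "\<And>e. e \<in> L2' \<Longrightarrow> We e \<inter> D \<subseteq> {a \<in> D. a \<odot>\<^bsub>M2\<^esub> e \<in> V}" by blast
  \<comment> \<open>One condition per coordinate, hence a finite intersection of good subspaces. On
    \<open>L2'\<close> all coordinates lie in \<open>D\<close>, where the conditions imply that each
    term \<open>l y e\<close> is in \<open>V\<close>, and so is \<open>y\<close>.\<close>
  define W where "W = {y \<in> carrier M2. \<forall>i\<in>I. fst i y \<in> We (snd i)}"
  have comp: "subspace k \<iota> M2 {y \<in> carrier M2. fst i y \<in> We (snd i)}"
    "mgood K (D # Ds) (s # ss) M2 {y \<in> carrier M2. fst i y \<in> We (snd i)}" if "i \<in> I" for i
  proof -
    have i: "snd i \<in> L2'" "linear_functional K M2 (fst i)" using I(2)[of "fst i" "snd i"] that by auto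
    show "subspace k \<iota> M2 {y \<in> carrier M2. fst i y \<in> We (snd i)}"
      "mgood K (D # Ds) (s # ss) M2 {y \<in> carrier M2. fst i y \<in> We (snd i)}"
      by (rule functional_vimage[OF M1.lift M2.M.module_axioms i(2) We(1)[OF i(1)] We(2)[OF i(1)]])+
  qed
  have iM: "\<iota> c \<odot>\<^bsub>M2\<^esub> y \<in> carrier M2" if "c \<in> carrier k" "y \<in> carrier M2" for c y
    using that M1.\<iota>_D M1.D_sub by simp
  have W_sub: "subspace k \<iota> M2 W"
    using comp(1) iM unfolding W_def subspace_def additive_def by simp
  have W_good: "mgood K (D # Ds) (s # ss) M2 W"
    unfolding mgood_def
  proof
    fix m assume m: "m \<in> carrier M2"
    have "good K (D # Ds) (s # ss) {a \<in> carrier K. \<forall>i\<in>I. a \<in> {a \<in> carrier K. a \<odot>\<^bsub>M2\<^esub> m \<in>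
        {y \<in> carrier M2. fst i y \<in> We (snd i)}}}"
      by (rule good_finite_Inter[OF M1.lift I(1)]) (use comp(2) m in \<open>auto simp: mgood_def\<close>)
    then show "good K (D # Ds) (s # ss) {a \<in> carrier K. a \<odot>\<^bsub>M2\<^esub> m \<in> W}"
      by (rule good_mono) (use m in \<open>auto simp: W_def\<close>)
  qed
  have WV: "y \<in> V" if y: "y \<in> W" "y \<in> L2'" for y
  proof (rule I(3)[OF V_add Q2.L_add(1)[OF y(2)]], clarify)
    fix l e assume i: "(l, e) \<in> I"
    have "l y \<in> We e" "l y \<in> D" using y I(2)[OF i] i by (auto simp: W_def)
    then show "l y \<odot>\<^bsub>M2\<^esub> e \<in> V" using We(3)[of e] I(2)[OF i] by blast
  qed
  have gW: "mgood K (D # Ds) (s # ss) M1 {x \<in> carrier M1. \<phi> x \<in> W}"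
    using \<phi>(2) W_sub W_good unfolding pulls_back_good_def by blast
  show "mgood k1 Ds ss Q1.Q {x \<in> carrier Q1.Q. Q2.q (\<phi> x) \<in> Wb}"
    unfolding mgood_def
  proof
    fix y assume "y \<in> carrier Q1.Q"
    then obtain x where x: "x \<in> L1" "y = Q1.q x" by auto
    have "good K (D # Ds) (s # ss) {a \<in> carrier K. a \<odot>\<^bsub>M1\<^esub> x \<in> {x \<in> carrier M1. \<phi> x \<in> W}}"
      using gW Q1.L_add(1)[OF x(1)] unfolding mgood_def by blast
    then have "good k1 Ds ss {b \<in> carrier k1. s b \<otimes> \<one> \<in> {a \<in> carrier K. a \<odot>\<^bsub>M1\<^esub> x \<in> {x \<in> carrier M1. \<phi> x \<in> W}}}"
      unfolding good.simps M1.k1_eq using M1.one_closed by blast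
    then show "good k1 Ds ss {b \<in> carrier k1. b \<odot>\<^bsub>Q1.Q\<^esub> y \<in> {x \<in> carrier Q1.Q. Q2.q (\<phi> x) \<in> Wb}}"
    proof (rule good_mono, intro subsetI)
      fix b assume "b \<in> {b \<in> carrier k1. s b \<otimes> \<one> \<in> {a \<in> carrier K. a \<odot>\<^bsub>M1\<^esub> x \<in> {x \<in> carrier M1. \<phi> x \<in> W}}}"
      then have b: "b \<in> carrier k1" "\<phi> (s b \<odot>\<^bsub>M1\<^esub> x) \<in> W" by auto
      have sx: "s b \<odot>\<^bsub>M1\<^esub> x \<in> L1" by (rule Q1.s_smult_L[OF b(1) x(1)])
      have "\<phi> (s b \<odot>\<^bsub>M1\<^esub> x) \<in> V" by (rule WV[OF b(2) ind(3)[OF sx]])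
      then have "Q2.q (\<phi> (Q1.q (s b \<odot>\<^bsub>M1\<^esub> x))) \<in> Wb" using ind(4)[OF sx] by (simp add: V_def)
      then show "b \<in> {b \<in> carrier k1. b \<odot>\<^bsub>Q1.Q\<^esub> y \<in> {x \<in> carrier Q1.Q. Q2.q (\<phi> x) \<in> Wb}}"
        using b(1) Q1.Q_smult[OF b(1) x(1)] x(2) sx by (simp del: rest_quot_simps(4))
    qed
  qed
qed

end

theorem diffop_BT_operators:
  assumes "lifted k \<iota> K Ds ss" "module K M1" "module K M2"
    "fg_submodule (carrier M1) K M1" "fg_submodule (carrier M2) K M2"
    "diffop k \<iota> K M1 M2 d \<phi>" "pulls_back_good k \<iota> K Ds ss M1 M2 \<phi>"
  shows "\<phi> \<in> BT_operators k \<iota> K Ds ss M1 M2"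
  using assms
proof (induction k \<iota> K Ds ss arbitrary: M1 M2 \<phi> rule: lifted.induct)
  case (1 k \<iota> K)
  interpret M1: module K M1 by (rule "1.prems"(2))
  interpret M2: module K M2 by (rule "1.prems"(3))
  have "\<iota> c \<in> carrier K" if "c \<in> carrier k" for c
    using lifted_field(2)[OF "1.prems"(1)] that by (auto simp: ring_hom_def)
  then have "\<phi> \<in> linear_maps k (restrict_scalars \<iota> M1) (restrict_scalars \<iota> M2)"
    using "1.prems"(6) by (cases d) (auto simp: linear_maps_iff)
  then show ?case by simp
next
  case (2 k \<iota> K D Ds s ss)
  let ?k1 = "residue_field K D" let ?rm = "residue_map K D"
  obtain p where p: "lifted_dvr K D p ?k1 ?rm s" using "2.prems"(1) by auto
  have lift: "lifted k (?rm \<circ> \<iota>) ?k1 Ds ss" using "2.prems"(1) by simp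
  interpret dvr_lift_pair K D p ?k1 ?rm s M1 M2 k \<iota> Ds ss
    using p "2.prems"(1-5)
    by (auto simp: dvr_lift_pair_def dvr_lift_def dvr_lift_axioms_def dvr_lift_pair_axioms_def dvr_module_def)
  have lin: "\<phi> \<in> lin" by (rule diffop_linear[OF "2.prems"(6)])
  have "(\<lambda>x. quot_map M2 L2 (\<phi> x)) \<in> BT_operators k (?rm \<circ> \<iota>) ?k1 Ds ss
      (rest_quot s M1 L1 L1') (rest_quot s M2 L2' L2)"
    if L: "L1 \<in> lattices K D M1" "L2 \<in> lattices K D M2" "L1' \<in> lattices K D M1" "L2' \<in> lattices K D M2"
      and r: "refinement \<phi> (L1', L2') (L1, L2)" for L1 L2 L1' L2'
  proof -
    interpret Q1: lattice_pair K D p ?k1 ?rm s M1 L1 L1' by (rule induced_map(1)[OF L r lin])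
    interpret Q2: lattice_pair K D p ?k1 ?rm s M2 L2' L2 by (rule induced_map(2)[OF L r lin])
    show ?thesis
      by (rule "2.IH"[OF lift Q1.Q_module Q2.Q_module Q1.Q_finite Q2.Q_finite
            induced_diffop[OF L r "2.prems"(6)] induced_pulls_back_good[OF L r lin "2.prems"(7)]])
  qed
  then show ?case
    using lin diffop_refinement[OF _ _ "2.prems"(6,7)] by auto
qed auto

section \<open>From complete discrete valuation rings to uniformizers and digits\<close>

lemma coset_rep_inj_on:
  assumes "ideal I R"
  shows "inj_on coset_rep (carrier (R Quot I))"
proof (rule inj_onI)
  interpret ideal I R by fact
  fix A B assume "A \<in> carrier (R Quot I)" "B \<in> carrier (R Quot I)" and e: "coset_rep A = coset_rep B"
  then obtain a b where a: "a \<in> carrier R" "A = I +>\<^bsub>R\<^esub> a" and b: "b \<in> carrier R" "B = I +>\<^bsub>R\<^esub> b"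
    unfolding FactRing_def A_RCOSETS_def' by auto
  have "coset_rep A \<in> A" "coset_rep B \<in> B"
    unfolding coset_rep_def a(2) b(2) by (rule someI, rule a_rcos_self, rule a b)+
  then have "A = I +>\<^bsub>R\<^esub> coset_rep A" "B = I +>\<^bsub>R\<^esub> coset_rep B"
    using a_repr_independence' a b by auto
  then show "A = B" using e by simp
qed

lemma dvr_max_ideal:
  assumes "dvr R"
  shows "maximalideal (max_ideal R) R" "maximalideal m R \<Longrightarrow> m = max_ideal R"
proof -
  have ex: "\<exists>!m. maximalideal m R" using assms unfolding dvr_def by blast
  show 1: "maximalideal (max_ideal R) R" unfolding max_ideal_def by (rule theI'[OF ex])
  show "maximalideal m R \<Longrightarrow> m = max_ideal R" using ex 1 by blast
qed

text \<open>In a principal ideal domain a nonzero non-unit has an irreducible divisor, and this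
  generates a maximal ideal. There is just one maximal ideal, so every non-unit lies in it.\<close>

lemma dvr_unit:
  assumes R: "dvr R" and y: "y \<in> carrier R" "y \<notin> max_ideal R"
  shows "y \<in> Units R"
proof (rule ccontr)
  assume n: "y \<notin> Units R"
  interpret principal_domain R using R unfolding dvr_def by blast
  have "\<zero>\<^bsub>R\<^esub> \<in> max_ideal R"
    using additive_subgroup.zero_closed[OF ideal.axioms(1)[OF maximalideal.axioms(1)[OF dvr_max_ideal(1)[OF R]]]] .
  then have "y \<in> carrier R - {\<zero>\<^bsub>R\<^esub>}" using y by auto
  then obtain b where b: "b \<in> carrier R" "ring_irreducible\<^bsub>R\<^esub> b" "b divides\<^bsub>R\<^esub> y"
    using exists_irreducible_divisor n by blast
  have "PIdl\<^bsub>R\<^esub> b = max_ideal R" by (rule dvr_max_ideal(2)[OF R irreducible_imp_maximalideal[OF b(1,2)]])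
  moreover have "y \<in> PIdl\<^bsub>R\<^esub> b"
    using b(1,3) unfolding factor_def cgenideal_def by (auto simp: m_comm)
  ultimately show False using y by simp
qed

lemma residue_map_props:
  assumes "dvr (K\<lparr>carrier := D\<rparr>)"
  shows "field (residue_field K D)"
    and "residue_map K D \<in> ring_hom (K\<lparr>carrier := D\<rparr>) (residue_field K D)"
    and "x \<in> D \<Longrightarrow> residue_map K D x = \<zero>\<^bsub>residue_field K D\<^esub> \<longleftrightarrow> x \<in> max_ideal (K\<lparr>carrier := D\<rparr>)"
    and "carrier (residue_field K D) = residue_map K D ` D"
proof -
  let ?R = "K\<lparr>carrier := D\<rparr>" let ?m = "max_ideal ?R"
  interpret principal_domain ?R using assms unfolding dvr_def by blast
  interpret m: maximalideal ?m ?R by (rule dvr_max_ideal(1)[OF assms])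
  have inj: "inj_on coset_rep (carrier (?R Quot ?m))" by (rule coset_rep_inj_on[OF m.is_ideal])
  have "field (?R Quot ?m)" by (rule m.quotient_is_field) (rule is_cring)
  then show "field (residue_field K D)"
    unfolding residue_field_def by (rule field.inj_imp_image_ring_is_field[OF _ inj])
  have rep: "coset_rep \<in> ring_hom (?R Quot ?m) (residue_field K D)"
    using inj_imp_image_ring_iso[OF inj] unfolding residue_field_def ring_iso_def by blast
  have "(\<lambda>x. coset_rep (?m +>\<^bsub>?R\<^esub> x)) \<in> ring_hom ?R (residue_field K D)"
    using ring_hom_trans[OF m.rcos_ring_hom rep] by (simp add: comp_def)
  then show "residue_map K D \<in> ring_hom ?R (residue_field K D)"
    unfolding residue_map_def[abs_def] .
  have z: "\<zero>\<^bsub>residue_field K D\<^esub> = coset_rep ?m"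
    unfolding residue_field_def image_ring_zero by (simp add: FactRing_def)
  show "residue_map K D x = \<zero>\<^bsub>residue_field K D\<^esub> \<longleftrightarrow> x \<in> ?m" if x: "x \<in> D"
  proof
    assume "residue_map K D x = \<zero>\<^bsub>residue_field K D\<^esub>"
    moreover have mem: "?m +>\<^bsub>?R\<^esub> y \<in> carrier (?R Quot ?m)" if "y \<in> carrier ?R" for y
      using that unfolding FactRing_def A_RCOSETS_def' by auto
    have "?m \<in> carrier (?R Quot ?m)"
      using mem[OF zero_closed] m.a_rcos_const[OF m.zero_closed] by simp
    moreover have "?m +>\<^bsub>?R\<^esub> x \<in> carrier (?R Quot ?m)" by (rule mem) (simp add: x)
    ultimately have "?m +>\<^bsub>?R\<^esub> x = ?m" using inj unfolding z residue_map_def by (auto dest: inj_onD)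
    then show "x \<in> ?m" using m.rcos_const_imp_mem x by simp
  next
    assume "x \<in> ?m"
    then show "residue_map K D x = \<zero>\<^bsub>residue_field K D\<^esub>" unfolding z residue_map_def by (simp add: m.a_rcos_const)
  qed
  show "carrier (residue_field K D) = residue_map K D ` D"
    unfolding residue_field_def image_ring_carrier by (auto simp: FactRing_def A_RCOSETS_def' residue_map_def)
qed

text \<open>The uniformizer is a generator of the maximal ideal. Completeness is used in the form of
  uniqueness of limits: it excludes nonzero elements divisible by every power of \<open>p\<close>,
  which gives a nonzero element of \<open>D\<close> its valuation.\<close>

lemma local_field_lifted_dvr:
  assumes frac: "is_fraction_field K D" and cdvr: "complete_dvr (K\<lparr>carrier := D\<rparr>)"
    and \<sigma>: "\<sigma> \<in> ring_hom (residue_field K D) (K\<lparr>carrier := D\<rparr>)"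
    and sec: "\<And>x. x \<in> carrier (residue_field K D) \<Longrightarrow> residue_map K D (\<sigma> x) = x"
  shows "\<exists>p. lifted_dvr K D p (residue_field K D) (residue_map K D) \<sigma>"
proof -
  let ?R = "K\<lparr>carrier := D\<rparr>" let ?m = "max_ideal ?R"
  interpret K: field K using frac unfolding is_fraction_field_def by blast
  have D: "subring D K" using frac unfolding is_fraction_field_def by blast
  have dvr: "dvr ?R" and compl: "adically_complete ?R ?m" using cdvr unfolding complete_dvr_def by auto
  interpret R: principal_domain ?R using dvr unfolding dvr_def by blast
  interpret m: maximalideal ?m ?R by (rule dvr_max_ideal(1)[OF dvr])
  have DK: "x \<in> carrier K" if "x \<in> D" for x using subringE(1)[OF D] that by auto
  obtain p where p: "p \<in> D" "?m = PIdl\<^bsub>?R\<^esub> p" using R.exists_gen[OF m.is_ideal] by auto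
  have m_iff: "x \<in> ?m \<longleftrightarrow> (\<exists>y\<in>D. x = p \<otimes>\<^bsub>K\<^esub> y)" for x
    using p DK K.m_comm unfolding p(2) cgenideal_def by auto
  \<comment> \<open>If \<open>p\<close> were zero, so would be the maximal ideal, and
    \<open>D\<close> would be a field, contrary to the definition of a discrete valuation
    ring.\<close>
  have p0: "p \<noteq> \<zero>\<^bsub>K\<^esub>"
  proof
    assume "p = \<zero>\<^bsub>K\<^esub>"
    then have "?m = {\<zero>\<^bsub>K\<^esub>}"
      using m_iff DK subringE(2)[OF D] by (auto intro!: bexI[of _ "\<zero>\<^bsub>K\<^esub>"])
    then have "Units ?R = carrier ?R - {\<zero>\<^bsub>?R\<^esub>}"
      using dvr_unit[OF dvr] R.zero_not_one unfolding Units_def by (auto simp: DK)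
    then have "field ?R" by (rule R.cring_fieldI)
    then show False using dvr unfolding dvr_def by blast
  qed
  have unit: "inv\<^bsub>K\<^esub> u \<in> D \<and> u \<noteq> \<zero>\<^bsub>K\<^esub>" if u: "u \<in> D" "u \<notin> ?m" for u
  proof -
    have "u \<in> Units ?R" using dvr_unit[OF dvr] u by simp
    then obtain v where v: "v \<in> D" "v \<otimes>\<^bsub>K\<^esub> u = \<one>\<^bsub>K\<^esub>" "u \<otimes>\<^bsub>K\<^esub> v = \<one>\<^bsub>K\<^esub>" unfolding Units_def by auto
    have "inv\<^bsub>K\<^esub> u = v" using K.comm_inv_char[of u v] v u DK by simp
    then show ?thesis using v u DK by auto
  qed
  have pow: "p [^]\<^bsub>K\<^esub> i \<otimes>\<^bsub>K\<^esub> y \<in> ideal_power ?R ?m i" if "y \<in> D" for i :: nat and y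
  proof (induction i)
    case 0 then show ?case using that DK by simp
  next
    case (Suc i)
    have "p \<in> ?m" using m_iff p(1) DK subringE(3)[OF D] by (auto intro!: bexI[of _ "\<one>\<^bsub>K\<^esub>"])
    then have "p \<otimes>\<^bsub>?R\<^esub> (p [^]\<^bsub>K\<^esub> i \<otimes>\<^bsub>K\<^esub> y) \<in> ideal_prod ?R ?m (ideal_power ?R ?m i)"
      using Suc by (rule ideal_prod.prod)
    moreover have "p \<otimes>\<^bsub>K\<^esub> (p [^]\<^bsub>K\<^esub> i \<otimes>\<^bsub>K\<^esub> y) = p [^]\<^bsub>K\<^esub> Suc i \<otimes>\<^bsub>K\<^esub> y"
      using p(1) DK that by (simp add: K.m_ac)
    ultimately show ?case by simp
  qed
  have p_pow: "p [^]\<^bsub>K\<^esub> (i::nat) \<in> D" for i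
    by (induction i) (use p subringE(3,6)[OF D] in auto)
  have uniformizer: "\<exists>i::nat. \<exists>u\<in>D. u \<noteq> \<zero>\<^bsub>K\<^esub> \<and> inv\<^bsub>K\<^esub> u \<in> D \<and> x = p [^]\<^bsub>K\<^esub> i \<otimes>\<^bsub>K\<^esub> u"
    if x: "x \<in> D" "x \<noteq> \<zero>\<^bsub>K\<^esub>" for x
  proof -
    have zero_power: "\<zero>\<^bsub>K\<^esub> \<in> ideal_power ?R ?m i" for i
      using pow[of "\<zero>\<^bsub>K\<^esub>" i] subringE(2)[OF D] p(1) DK by simp
    have minus0: "y \<ominus>\<^bsub>?R\<^esub> \<zero>\<^bsub>K\<^esub> = y" if "y \<in> D" for y
      using R.minus_zero that DK by (simp add: a_minus_def)
    \<comment> \<open>Were \<open>x\<close> divisible by every \<open>p^i\<close>, then both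
      \<open>x\<close> and zero would be limits of the constant sequence zero. The least exponent at
      which divisibility fails is positive, and its predecessor is the valuation of
      \<open>x\<close>.\<close>
    have "\<exists>i::nat. \<not> (\<exists>y\<in>D. x = p [^]\<^bsub>K\<^esub> i \<otimes>\<^bsub>K\<^esub> y)"
    proof (rule ccontr)
      assume "\<not> ?thesis"
      then have xi: "x \<in> ideal_power ?R ?m i" for i using pow by metis
      have "\<exists>!y. y \<in> carrier ?R \<and> (\<forall>i. y \<ominus>\<^bsub>?R\<^esub> \<zero>\<^bsub>K\<^esub> \<in> ideal_power ?R ?m i)"
        using compl[unfolded adically_complete_def, rule_format, of "\<lambda>i. \<zero>\<^bsub>K\<^esub>"] zero_power
          minus0[OF subringE(2)[OF D]] subringE(2)[OF D] by simp
      then obtain y0 where y0: "\<And>y. y \<in> carrier ?R \<and> (\<forall>i. y \<ominus>\<^bsub>?R\<^esub> \<zero>\<^bsub>K\<^esub> \<in> ideal_power ?R ?m i) \<Longrightarrow> y = y0"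
        by (elim ex1E) (rule that, blast)
      have "x = y0" by (rule y0) (use xi minus0[OF x(1)] x(1) in simp)
      moreover have "\<zero>\<^bsub>K\<^esub> = y0"
        by (rule y0) (use zero_power minus0[OF subringE(2)[OF D]] subringE(2)[OF D] in simp)
      ultimately show False using x(2) by simp
    qed
    then obtain i :: nat where i: "\<not> (\<exists>y\<in>D. x = p [^]\<^bsub>K\<^esub> i \<otimes>\<^bsub>K\<^esub> y)"
      and least: "\<And>j. j < i \<Longrightarrow> \<exists>y\<in>D. x = p [^]\<^bsub>K\<^esub> j \<otimes>\<^bsub>K\<^esub> y"
      using exists_least_iff[of "\<lambda>i::nat. \<not> (\<exists>y\<in>D. x = p [^]\<^bsub>K\<^esub> i \<otimes>\<^bsub>K\<^esub> y)"] by auto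
    have "x = p [^]\<^bsub>K\<^esub> (0::nat) \<otimes>\<^bsub>K\<^esub> x" using x(1) DK by simp
    then have "i \<noteq> 0" using i x(1) by metis
    then obtain j where j: "i = Suc j" by (cases i) auto
    then obtain u where u: "u \<in> D" "x = p [^]\<^bsub>K\<^esub> j \<otimes>\<^bsub>K\<^esub> u" using least by blast
    have "u \<notin> ?m"
    proof
      assume "u \<in> ?m"
      then obtain y where y: "y \<in> D" "u = p \<otimes>\<^bsub>K\<^esub> y" using m_iff by blast
      then have "x = p [^]\<^bsub>K\<^esub> i \<otimes>\<^bsub>K\<^esub> y" using u j p DK by (simp add: K.m_assoc)
      then show False using i y by blast
    qed
    then show ?thesis using unit u by blast
  qed
  have "lifted_dvr K D p (residue_field K D) (residue_map K D) \<sigma>"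
  proof (rule lifted_dvr.intro[OF K.field_axioms lifted_dvr_axioms.intro])
    show "subring D K" by (rule D)
    show "p \<in> D" by (rule p(1))
    show "p \<noteq> \<zero>\<^bsub>K\<^esub>" by (rule p0)
    show "field (residue_field K D)" by (rule residue_map_props(1)[OF dvr])
    show "residue_map K D \<in> ring_hom ?R (residue_field K D)" by (rule residue_map_props(2)[OF dvr])
    show "\<sigma> \<in> ring_hom (residue_field K D) ?R" by (rule \<sigma>)
    show "residue_map K D (\<sigma> b) = b" if "b \<in> carrier (residue_field K D)" for b by (rule sec[OF that])
    show "residue_map K D x = \<zero>\<^bsub>residue_field K D\<^esub> \<longleftrightarrow> (\<exists>y\<in>D. x = p \<otimes>\<^bsub>K\<^esub> y)" if "x \<in> D" for x
      using residue_map_props(3)[OF dvr that] m_iff by blast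
    show "\<exists>i::nat. \<exists>u\<in>D. u \<noteq> \<zero>\<^bsub>K\<^esub> \<and> inv\<^bsub>K\<^esub> u \<in> D \<and> x = p [^]\<^bsub>K\<^esub> i \<otimes>\<^bsub>K\<^esub> u"
      if "x \<in> D" "x \<noteq> \<zero>\<^bsub>K\<^esub>" for x by (rule uniformizer[OF that])
    fix x assume "x \<in> carrier K"
    then obtain a b where ab: "a \<in> D" "b \<in> D" "b \<noteq> \<zero>\<^bsub>K\<^esub>" "x = a \<otimes>\<^bsub>K\<^esub> inv\<^bsub>K\<^esub> b"
      using frac unfolding is_fraction_field_def by blast
    obtain i :: nat and u where u: "u \<in> D" "u \<noteq> \<zero>\<^bsub>K\<^esub>" "inv\<^bsub>K\<^esub> u \<in> D" "b = p [^]\<^bsub>K\<^esub> i \<otimes>\<^bsub>K\<^esub> u"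
      using uniformizer[OF ab(2,3)] by blast
    have c: "a \<in> carrier K" "b \<in> carrier K" "u \<in> carrier K" "p [^]\<^bsub>K\<^esub> i \<in> carrier K"
      "inv\<^bsub>K\<^esub> b \<in> carrier K" "inv\<^bsub>K\<^esub> b \<otimes>\<^bsub>K\<^esub> b = \<one>\<^bsub>K\<^esub>" "inv\<^bsub>K\<^esub> u \<in> carrier K" "u \<otimes>\<^bsub>K\<^esub> inv\<^bsub>K\<^esub> u = \<one>\<^bsub>K\<^esub>"
      using ab u DK p_pow K.field_Units by auto
    have "p [^]\<^bsub>K\<^esub> i \<otimes>\<^bsub>K\<^esub> x = (p [^]\<^bsub>K\<^esub> i \<otimes>\<^bsub>K\<^esub> x) \<otimes>\<^bsub>K\<^esub> (u \<otimes>\<^bsub>K\<^esub> inv\<^bsub>K\<^esub> u)" using ab(4) c by simp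
    also have "\<dots> = a \<otimes>\<^bsub>K\<^esub> (inv\<^bsub>K\<^esub> b \<otimes>\<^bsub>K\<^esub> (p [^]\<^bsub>K\<^esub> i \<otimes>\<^bsub>K\<^esub> u)) \<otimes>\<^bsub>K\<^esub> inv\<^bsub>K\<^esub> u"
      unfolding ab(4) using c(1,3-5,7) by (simp add: K.m_ac)
    also have "\<dots> = a \<otimes>\<^bsub>K\<^esub> inv\<^bsub>K\<^esub> u" unfolding u(4)[symmetric] c(6) using c by simp
    also have "\<dots> \<in> D" by (rule subringE(6)[OF D ab(1) u(3)])
    finally show "\<exists>N::nat. p [^]\<^bsub>K\<^esub> N \<otimes>\<^bsub>K\<^esub> x \<in> D" by blast
  qed
  then show ?thesis by blast
qed

text \<open>That \<open>k\<close> maps into the ring of integers is used at each layer: its image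
  lies in the current valuation ring, and the residues lie in the ring of integers of the next
  layer.\<close>

lemma local_field_lifted:
  assumes "local_field Ds K" "system_of_liftings k \<iota> K Ds T ss" "cring k"
    "\<iota> \<in> ring_hom k (K\<lparr>carrier := ring_of_integers Ds K\<rparr>)"
  shows "lifted k \<iota> K Ds ss"
  using assms
proof (induction k \<iota> K Ds ss arbitrary: T rule: lifted.induct)
  case (1 k \<iota> K)
  then show ?case by simp
next
  case (2 k \<iota> K D Ds s ss)
  let ?R = "K\<lparr>carrier := D\<rparr>"
  have lf: "is_fraction_field K D" "complete_dvr ?R" "local_field Ds (residue_field K D)"
    using "2.prems"(1) by auto
  then have dvr: "dvr ?R" by (simp add: complete_dvr_def)
  have sys: "s \<in> ring_hom (residue_field K D) ?R" "\<forall>c\<in>carrier k. s (residue_map K D (\<iota> c)) = \<iota> c"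
    "\<forall>x\<in>carrier (residue_field K D). residue_map K D (s x) = x"
    "system_of_liftings k (residue_map K D \<circ> \<iota>) (residue_field K D) Ds (residue_topology K D T) ss"
    using "2.prems"(2) by auto
  have i: "\<iota> \<in> ring_hom k ?R" using "2.prems"(4) by (auto simp: ring_hom_def)
  note rm = residue_map_props(2)[OF dvr]
  have "residue_map K D \<circ> \<iota> \<in> ring_hom k (residue_field K D)" by (rule ring_hom_trans[OF i rm])
  moreover have "residue_map K D (\<iota> c) \<in> ring_of_integers Ds (residue_field K D)" if "c \<in> carrier k" for c
    using "2.prems"(4) that by (auto simp: ring_hom_def)
  ultimately have "residue_map K D \<circ> \<iota>
      \<in> ring_hom k ((residue_field K D)\<lparr>carrier := ring_of_integers Ds (residue_field K D)\<rparr>)"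
    by (auto simp: ring_hom_def)
  then have "lifted k (residue_map K D \<circ> \<iota>) (residue_field K D) Ds ss"
    by (rule "2.IH"[OF lf(3) sys(4) "2.prems"(3)])
  moreover have "\<exists>p. lifted_dvr K D p (residue_field K D) (residue_map K D) s"
    by (rule local_field_lifted_dvr[OF lf(1,2) sys(1)]) (use sys(3) in blast)
  ultimately show ?case using sys(2) i "2.prems"(3) by simp
qed auto

section \<open>Linear topologies\<close>

lemma openin_translate:
  assumes "linear_topology k M Y" "openin Y U" "x \<in> carrier M"
  shows "openin Y {y \<in> carrier M. x \<oplus>\<^bsub>M\<^esub> y \<in> U}"
proof -
  have top: "topspace Y = carrier M" and add: "continuous_map (prod_topology Y Y) Y (\<lambda>(x, y). x \<oplus>\<^bsub>M\<^esub> y)"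
    using assms(1) by (auto simp: linear_topology_def)
  have "continuous_map Y (prod_topology Y Y) (\<lambda>y. (x, y))"
    by (intro continuous_map_pairedI) (use assms(3) top in \<open>auto\<close>)
  from continuous_map_compose[OF this add] have "continuous_map Y Y (\<lambda>y. x \<oplus>\<^bsub>M\<^esub> y)"
    by (simp add: comp_def)
  from openin_continuous_map_preimage[OF this assms(2)] show ?thesis by (simp add: top)
qed

lemma additive_openI:
  assumes "abelian_group M" "additive M N" "topspace Y = carrier M"
    and tr: "\<And>x U. x \<in> carrier M \<Longrightarrow> openin Y U \<Longrightarrow> openin Y {y \<in> carrier M. x \<oplus>\<^bsub>M\<^esub> y \<in> U}"
    and U: "openin Y U" "\<zero>\<^bsub>M\<^esub> \<in> U" "U \<subseteq> N"
  shows "openin Y N"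
proof (subst openin_subopen, intro ballI)
  interpret abelian_group M by fact
  note N = additiveD[OF assms(2)]
  fix x assume x: "x \<in> N"
  let ?V = "{y \<in> carrier M. \<ominus>\<^bsub>M\<^esub> x \<oplus>\<^bsub>M\<^esub> y \<in> U}"
  have "openin Y ?V" using tr[OF _ U(1), of "\<ominus>\<^bsub>M\<^esub> x"] N x by simp
  moreover have "x \<in> ?V" using N x U(2) by (simp add: l_neg)
  moreover have "?V \<subseteq> N"
  proof
    fix y assume y: "y \<in> ?V"
    then have "\<ominus>\<^bsub>M\<^esub> x \<oplus>\<^bsub>M\<^esub> y \<in> N" using U(3) by blast
    then have "x \<oplus>\<^bsub>M\<^esub> (\<ominus>\<^bsub>M\<^esub> x \<oplus>\<^bsub>M\<^esub> y) \<in> N" using N x by blast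
    then show "y \<in> N" using y r_neg2[of x y] N(1)[OF x] by simp
  qed
  ultimately show "\<exists>T. openin Y T \<and> x \<in> T \<and> T \<subseteq> N" by blast
qed

text \<open>The part of \<open>linear_topology\<close> on which the continuity criterion below
  rests. It is phrased for the action of \<open>k\<close> through \<open>\<iota>\<close>, so that
  the same module record can be used over the big ring.\<close>

definition k_linear_topology ::
  "'k ring \<Rightarrow> ('k \<Rightarrow> 'a) \<Rightarrow> ('a, 'm) module \<Rightarrow> 'm topology \<Rightarrow> bool" where
  "k_linear_topology k \<iota> M Y \<longleftrightarrow> topspace Y = carrier M \<and>
     (\<forall>x\<in>carrier M. \<forall>U. openin Y U \<longrightarrow> openin Y {y \<in> carrier M. x \<oplus>\<^bsub>M\<^esub> y \<in> U}) \<and>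
     (\<forall>U. openin Y U \<and> \<zero>\<^bsub>M\<^esub> \<in> U \<longrightarrow> (\<exists>N. subspace k \<iota> M N \<and> openin Y N \<and> N \<subseteq> U))"

text \<open>Translations reduce continuity to a neighbourhood of zero, where open
  \<open>k\<close>-subspaces form a basis.\<close>

lemma additive_continuousI:
  fixes M1 :: "('r, 'm) module"
  assumes "abelian_group M1" "abelian_group M2" "topspace Y1 = carrier M1" "k_linear_topology k \<iota> M2 Y2"
    and tr: "\<And>x U. x \<in> carrier M1 \<Longrightarrow> openin Y1 U \<Longrightarrow> openin Y1 {y \<in> carrier M1. x \<oplus>\<^bsub>M1\<^esub> y \<in> U}"
    and \<phi>: "\<And>x. x \<in> carrier M1 \<Longrightarrow> \<phi> x \<in> carrier M2"
      "\<And>x y. x \<in> carrier M1 \<Longrightarrow> y \<in> carrier M1 \<Longrightarrow> \<phi> (x \<oplus>\<^bsub>M1\<^esub> y) = \<phi> x \<oplus>\<^bsub>M2\<^esub> \<phi> y"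
    and op: "\<And>N. subspace k \<iota> M2 N \<Longrightarrow> openin Y2 N \<Longrightarrow> openin Y1 {x \<in> carrier M1. \<phi> x \<in> N}"
  shows "continuous_map Y1 Y2 \<phi>"
proof -
  interpret M1: abelian_group M1 by fact
  interpret M2: abelian_group M2 by fact
  have top2: "topspace Y2 = carrier M2" using assms(4) by (simp add: k_linear_topology_def)
  have "openin Y1 {x \<in> carrier M1. \<phi> x \<in> U}" if U: "openin Y2 U" for U
  proof (subst openin_subopen, intro ballI)
    fix x assume "x \<in> {x \<in> carrier M1. \<phi> x \<in> U}"
    then have x: "x \<in> carrier M1" "\<phi> x \<in> U" by auto
    have "openin Y2 {y \<in> carrier M2. \<phi> x \<oplus>\<^bsub>M2\<^esub> y \<in> U}" 
      using assms(4) U \<phi>(1)[OF x(1)] by (simp add: k_linear_topology_def)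
    moreover have "\<zero>\<^bsub>M2\<^esub> \<in> {y \<in> carrier M2. \<phi> x \<oplus>\<^bsub>M2\<^esub> y \<in> U}" using x \<phi>(1) by simp
    ultimately obtain N where N: "subspace k \<iota> M2 N" "openin Y2 N" "N \<subseteq> {y \<in> carrier M2. \<phi> x \<oplus>\<^bsub>M2\<^esub> y \<in> U}"
      using assms(4) unfolding k_linear_topology_def by blast
    let ?V = "{z \<in> carrier M1. \<ominus>\<^bsub>M1\<^esub> x \<oplus>\<^bsub>M1\<^esub> z \<in> {x \<in> carrier M1. \<phi> x \<in> N}}"
    have "openin Y1 ?V" by (rule tr[OF _ op[OF N(1,2)]]) (use x in simp)
    moreover have "\<zero>\<^bsub>M2\<^esub> \<in> N"
      using N(1) by (simp add: subspace_def additive_def)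
    then have "x \<in> ?V" using x additive_map_zero[OF assms(1,2), of \<phi>] \<phi> by (simp add: M1.l_neg)
    moreover have "?V \<subseteq> {x \<in> carrier M1. \<phi> x \<in> U}"
    proof
      fix z assume z: "z \<in> ?V"
      let ?d = "\<ominus>\<^bsub>M1\<^esub> x \<oplus>\<^bsub>M1\<^esub> z"
      have "z = x \<oplus>\<^bsub>M1\<^esub> ?d" using z x M1.r_neg2[of x z] by simp
      moreover have "?d \<in> carrier M1" using z x by simp
      ultimately have "\<phi> z = \<phi> x \<oplus>\<^bsub>M2\<^esub> \<phi> ?d" using \<phi>(2)[OF x(1), of ?d] by simp
      moreover have "\<phi> ?d \<in> N" using z by blast
      ultimately show "z \<in> {x \<in> carrier M1. \<phi> x \<in> U}" using N(3) z by auto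
    qed
    ultimately show "\<exists>T. openin Y1 T \<and> x \<in> T \<and> T \<subseteq> {x \<in> carrier M1. \<phi> x \<in> U}" by blast
  qed
  then show ?thesis unfolding continuous_map_def using assms(3) top2 \<phi>(1) by auto
qed

lemma module_restrict_scalars:
  assumes "module A M" "cring k" "\<iota> \<in> ring_hom k A"
  shows "module k (restrict_scalars \<iota> M)"
proof -
  interpret module A M by fact
  interpret k: cring k by fact
  have i: "\<iota> c \<in> carrier A" if "c \<in> carrier k" for c using assms(3) that by (auto simp: ring_hom_def)
  have "abelian_group (restrict_scalars \<iota> M)"
    by (rule abelian_groupI) (auto simp: M.a_assoc intro: M.a_comm intro!: bexI[of _ "\<ominus>\<^bsub>M\<^esub> x" for x] M.l_neg)
  then show ?thesis
    using assms(2) i ring_hom_mult[OF assms(3)] ring_hom_add[OF assms(3)] ring_hom_one[OF assms(3)]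
    by (intro moduleI) (auto simp: smult_assoc1 smult_l_distr smult_r_distr)
qed

lemma submodule_restrict_scalars:
  assumes "module A M" "cring k" "\<iota> \<in> ring_hom k A"
  shows "submodule N k (restrict_scalars \<iota> M) \<longleftrightarrow> subspace k \<iota> M N"
  unfolding submodule_iff[OF module_restrict_scalars[OF assms]] subspace_def additive_def by simp

lemma k_linear_topologyI:
  assumes "module A M" "cring k" "\<iota> \<in> ring_hom k A" "linear_topology k (restrict_scalars \<iota> M) Y"
  shows "k_linear_topology k \<iota> M Y"
  using assms(4) openin_translate[OF assms(4)]
  unfolding linear_topology_def k_linear_topology_def submodule_restrict_scalars[OF assms(1-3)] by simp

locale fine_module = module A M
  for A :: "'a ring" and M :: "('a, 'm) module" +
  fixes k :: "'k ring" and \<iota> :: "'k \<Rightarrow> 'a" and T :: "'a topology"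
  assumes k: "cring k" and \<iota>: "\<iota> \<in> ring_hom k A" and T_top: "topspace T = carrier A"
    and T_translate: "x \<in> carrier A \<Longrightarrow> openin T U \<Longrightarrow> openin T {a \<in> carrier A. x \<oplus>\<^bsub>A\<^esub> a \<in> U}"
begin

text \<open>In any ST module topology the open \<open>k\<close>-subspaces have this property, since
  the maps \<open>a |-> a m\<close> are continuous. Conversely all subspaces with this property
  together define an ST module topology. They are therefore a basis at zero of the fine one.\<close>

definition nbhd :: "'m set \<Rightarrow> bool" where
  "nbhd N \<longleftrightarrow> subspace k \<iota> M N \<and> (\<forall>m\<in>carrier M. openin T {a \<in> carrier A. a \<odot>\<^bsub>M\<^esub> m \<in> N})"

definition linear_open :: "'m set \<Rightarrow> bool" where
  "linear_open U \<longleftrightarrow> U \<subseteq> carrier M \<and> (\<forall>x\<in>U. \<exists>N. nbhd N \<and> (\<forall>y\<in>N. x \<oplus>\<^bsub>M\<^esub> y \<in> U))"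

lemma \<iota>_closed: "c \<in> carrier k \<Longrightarrow> \<iota> c \<in> carrier A"
  using \<iota> by (auto simp: ring_hom_def)

lemma nbhdD:
  assumes "nbhd N"
  shows "x \<in> N \<Longrightarrow> x \<in> carrier M" "\<zero>\<^bsub>M\<^esub> \<in> N" "x \<in> N \<Longrightarrow> y \<in> N \<Longrightarrow> x \<oplus>\<^bsub>M\<^esub> y \<in> N"
    "x \<in> N \<Longrightarrow> \<ominus>\<^bsub>M\<^esub> x \<in> N" "x \<in> N \<Longrightarrow> c \<in> carrier k \<Longrightarrow> \<iota> c \<odot>\<^bsub>M\<^esub> x \<in> N"
  using assms by (auto simp: nbhd_def subspace_def additive_def)

lemma nbhd_Int: "nbhd N \<Longrightarrow> nbhd N' \<Longrightarrow> nbhd (N \<inter> N')"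
proof -
  assume h: "nbhd N" "nbhd N'"
  have "{a \<in> carrier A. a \<odot>\<^bsub>M\<^esub> m \<in> N \<inter> N'} = {a \<in> carrier A. a \<odot>\<^bsub>M\<^esub> m \<in> N} \<inter> {a \<in> carrier A. a \<odot>\<^bsub>M\<^esub> m \<in> N'}"
    for m by auto
  then show ?thesis using h by (auto simp: nbhd_def subspace_def additive_def)
qed

lemma nbhd_carrier: "nbhd (carrier M)"
proof -
  have "{a \<in> carrier A. a \<odot>\<^bsub>M\<^esub> m \<in> carrier M} = topspace T" if "m \<in> carrier M" for m using that T_top by auto
  then show ?thesis using \<iota>_closed by (auto simp: nbhd_def subspace_def additive_def)
qed

text \<open>Commutativity of \<open>A\<close> enters here: the line through \<open>m\<close>,
  multiplied by \<open>a\<close>, is the line through \<open>a m\<close>. Continuity of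
  multiplication by \<open>a\<close> in the fine topology follows.\<close>

lemma nbhd_vimage:
  assumes N: "nbhd N" and a: "a \<in> carrier A"
  shows "nbhd {m \<in> carrier M. a \<odot>\<^bsub>M\<^esub> m \<in> N}"
  unfolding nbhd_def
proof (intro conjI ballI)
  have "a \<odot>\<^bsub>M\<^esub> (\<iota> c \<odot>\<^bsub>M\<^esub> m) = \<iota> c \<odot>\<^bsub>M\<^esub> (a \<odot>\<^bsub>M\<^esub> m)" if "c \<in> carrier k" "m \<in> carrier M" for c m
    using that a \<iota>_closed by (simp add: smult_assoc1[symmetric] R.m_comm)
  then show "subspace k \<iota> M {m \<in> carrier M. a \<odot>\<^bsub>M\<^esub> m \<in> N}"
    using nbhdD[OF N] a \<iota>_closed by (auto simp: subspace_def additive_def smult_r_distr smult_r_minus)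
  fix m assume m: "m \<in> carrier M"
  have "{b \<in> carrier A. b \<odot>\<^bsub>M\<^esub> m \<in> {m \<in> carrier M. a \<odot>\<^bsub>M\<^esub> m \<in> N}} = {b \<in> carrier A. b \<odot>\<^bsub>M\<^esub> (a \<odot>\<^bsub>M\<^esub> m) \<in> N}"
    using a m by (auto simp: smult_assoc1[symmetric] R.m_comm)
  then show "openin T {b \<in> carrier A. b \<odot>\<^bsub>M\<^esub> m \<in> {m \<in> carrier M. a \<odot>\<^bsub>M\<^esub> m \<in> N}}"
    using N a m by (simp add: nbhd_def)
qed

definition ftop :: "'m topology" where "ftop = topology linear_open"

lemma openin_fine: "openin ftop U \<longleftrightarrow> linear_open U"
proof -
  have "istopology linear_open"
    unfolding istopology_def
  proof (intro conjI allI impI)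
    fix S V assume S: "linear_open S" and V: "linear_open V"
    show "linear_open (S \<inter> V)" unfolding linear_open_def
    proof (intro conjI ballI)
      show "S \<inter> V \<subseteq> carrier M" using S by (auto simp: linear_open_def)
      fix x assume "x \<in> S \<inter> V"
      then obtain N N' where "nbhd N" "\<forall>y\<in>N. x \<oplus>\<^bsub>M\<^esub> y \<in> S" "nbhd N'" "\<forall>y\<in>N'. x \<oplus>\<^bsub>M\<^esub> y \<in> V"
        using S V unfolding linear_open_def by blast
      then show "\<exists>N. nbhd N \<and> (\<forall>y\<in>N. x \<oplus>\<^bsub>M\<^esub> y \<in> S \<inter> V)"
        using nbhd_Int by (intro exI[of _ "N \<inter> N'"]) auto
    qed
  next
    fix \<K> assume K: "\<forall>S\<in>\<K>. linear_open S"
    show "linear_open (\<Union>\<K>)" unfolding linear_open_def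
    proof (intro conjI ballI)
      show "\<Union>\<K> \<subseteq> carrier M" using K by (auto simp: linear_open_def)
      fix x assume "x \<in> \<Union>\<K>"
      then obtain S where S: "S \<in> \<K>" "x \<in> S" by blast
      then obtain N where "nbhd N" "\<forall>y\<in>N. x \<oplus>\<^bsub>M\<^esub> y \<in> S" using K unfolding linear_open_def by blast
      then show "\<exists>N. nbhd N \<and> (\<forall>y\<in>N. x \<oplus>\<^bsub>M\<^esub> y \<in> \<Union>\<K>)" using S by blast
    qed
  qed
  then show ?thesis unfolding ftop_def by (simp only: topology_inverse')
qed

lemma topspace_fine: "topspace ftop = carrier M"
proof
  show "topspace ftop \<subseteq> carrier M"
    using openin_topspace[of ftop] unfolding openin_fine linear_open_def by blast
  have "linear_open (carrier M)" using nbhd_carrier unfolding linear_open_def by (auto intro!: exI[of _ "carrier M"])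
  then show "carrier M \<subseteq> topspace ftop" by (intro openin_subset) (simp add: openin_fine)
qed

lemma nbhd_coset_open: "nbhd N \<Longrightarrow> x \<in> carrier M \<Longrightarrow> openin ftop {z. \<exists>y\<in>N. z = x \<oplus>\<^bsub>M\<^esub> y}"
  unfolding openin_fine linear_open_def
proof (intro conjI ballI)
  assume N: "nbhd N" and x: "x \<in> carrier M"
  show "{z. \<exists>y\<in>N. z = x \<oplus>\<^bsub>M\<^esub> y} \<subseteq> carrier M" using nbhdD[OF N] x by auto
  fix z assume "z \<in> {z. \<exists>y\<in>N. z = x \<oplus>\<^bsub>M\<^esub> y}"
  then obtain y where y: "y \<in> N" "z = x \<oplus>\<^bsub>M\<^esub> y" by blast
  have "\<exists>y'\<in>N. z \<oplus>\<^bsub>M\<^esub> w = x \<oplus>\<^bsub>M\<^esub> y'" if "w \<in> N" for w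
    using y x that nbhdD[OF N] by (intro bexI[of _ "y \<oplus>\<^bsub>M\<^esub> w"]) (auto simp: M.a_assoc)
  then show "\<exists>N'. nbhd N' \<and> (\<forall>w\<in>N'. z \<oplus>\<^bsub>M\<^esub> w \<in> {z. \<exists>y\<in>N. z = x \<oplus>\<^bsub>M\<^esub> y})" using N by blast
qed

lemma nbhd_open: "nbhd N \<Longrightarrow> openin ftop N"
  unfolding openin_fine linear_open_def using nbhdD by blast

lemma st_module_fine: "st_module k \<iota> A T M ftop"
proof -
  let ?M = "restrict_scalars \<iota> M"
  note coset = nbhd_coset_open
  have add: "continuous_map (prod_topology ftop ftop) ftop (\<lambda>(x, y). x \<oplus>\<^bsub>M\<^esub> y)"
    unfolding continuous_map_def
  proof (intro conjI allI impI)
    show "(\<lambda>(x, y). x \<oplus>\<^bsub>M\<^esub> y) \<in> topspace (prod_topology ftop ftop) \<rightarrow> topspace ftop"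
      by (auto simp: topspace_fine)
    fix U assume U: "openin ftop U"
    show "openin (prod_topology ftop ftop) {x \<in> topspace (prod_topology ftop ftop). (case x of (x, y) \<Rightarrow> x \<oplus>\<^bsub>M\<^esub> y) \<in> U}"
      unfolding openin_prod_topology_alt
    proof (intro allI impI)
      fix x y assume "(x, y) \<in> {x \<in> topspace (prod_topology ftop ftop). (case x of (x, y) \<Rightarrow> x \<oplus>\<^bsub>M\<^esub> y) \<in> U}"
      then have xy: "x \<in> carrier M" "y \<in> carrier M" "x \<oplus>\<^bsub>M\<^esub> y \<in> U" by (auto simp: topspace_fine)
      then obtain N where N: "nbhd N" "\<forall>z\<in>N. x \<oplus>\<^bsub>M\<^esub> y \<oplus>\<^bsub>M\<^esub> z \<in> U"
        using U unfolding openin_fine linear_open_def by blast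
      have "x \<oplus>\<^bsub>M\<^esub> a \<oplus>\<^bsub>M\<^esub> (y \<oplus>\<^bsub>M\<^esub> b) \<in> U" if "a \<in> N" "b \<in> N" for a b
      proof -
        have "a \<in> carrier M" "b \<in> carrier M" using nbhdD(1)[OF N(1)] that by auto
        then have "x \<oplus>\<^bsub>M\<^esub> a \<oplus>\<^bsub>M\<^esub> (y \<oplus>\<^bsub>M\<^esub> b) = x \<oplus>\<^bsub>M\<^esub> y \<oplus>\<^bsub>M\<^esub> (a \<oplus>\<^bsub>M\<^esub> b)" using xy by (simp add: M.a_ac)
        then show ?thesis using N nbhdD(3)[OF N(1)] that by simp
      qed
      then have "{z. \<exists>w\<in>N. z = x \<oplus>\<^bsub>M\<^esub> w} \<times> {z. \<exists>w\<in>N. z = y \<oplus>\<^bsub>M\<^esub> w} \<subseteq>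
          {x \<in> topspace (prod_topology ftop ftop). (case x of (x, y) \<Rightarrow> x \<oplus>\<^bsub>M\<^esub> y) \<in> U}"
        using xy nbhdD(1)[OF N(1)] by (auto simp: topspace_fine)
      moreover have "x \<in> {z. \<exists>w\<in>N. z = x \<oplus>\<^bsub>M\<^esub> w}" "y \<in> {z. \<exists>w\<in>N. z = y \<oplus>\<^bsub>M\<^esub> w}"
        using xy nbhdD(2)[OF N(1)] by (auto intro!: bexI[of _ "\<zero>\<^bsub>M\<^esub>"])
      ultimately show "\<exists>U' V. openin ftop U' \<and> openin ftop V \<and> x \<in> U' \<and> y \<in> V \<and> U' \<times> V \<subseteq>
          {x \<in> topspace (prod_topology ftop ftop). (case x of (x, y) \<Rightarrow> x \<oplus>\<^bsub>M\<^esub> y) \<in> U}"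
        using coset[OF N(1)] xy by blast
    qed
  qed
  have neg: "continuous_map ftop ftop (\<lambda>x. \<ominus>\<^bsub>M\<^esub> x)"
    unfolding continuous_map_def
  proof (intro conjI allI impI)
    show "a_inv M \<in> topspace ftop \<rightarrow> topspace ftop" by (auto simp: topspace_fine)
    fix U assume U: "openin ftop U"
    show "openin ftop {x \<in> topspace ftop. \<ominus>\<^bsub>M\<^esub> x \<in> U}"
      unfolding openin_fine linear_open_def topspace_fine
    proof (intro conjI ballI)
      fix x assume x: "x \<in> {x \<in> carrier M. \<ominus>\<^bsub>M\<^esub> x \<in> U}"
      then obtain N where N: "nbhd N" "\<forall>z\<in>N. \<ominus>\<^bsub>M\<^esub> x \<oplus>\<^bsub>M\<^esub> z \<in> U"
        using U unfolding openin_fine linear_open_def by blast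
      have "\<ominus>\<^bsub>M\<^esub> (x \<oplus>\<^bsub>M\<^esub> y) \<in> U" if "y \<in> N" for y
        using N(2) nbhdD(4)[OF N(1) that] x nbhdD(1)[OF N(1) that] by (simp add: M.minus_add)
      then show "\<exists>N. nbhd N \<and> (\<forall>y\<in>N. x \<oplus>\<^bsub>M\<^esub> y \<in> {x \<in> carrier M. \<ominus>\<^bsub>M\<^esub> x \<in> U})"
        using N(1) nbhdD(1)[OF N(1)] x by (intro exI[of _ N]) auto
    qed auto
  qed
  have sm: "continuous_map ftop ftop (\<lambda>m. a \<odot>\<^bsub>M\<^esub> m)" if a: "a \<in> carrier A" for a
    unfolding continuous_map_def
  proof (intro conjI allI impI)
    show "(\<lambda>m. a \<odot>\<^bsub>M\<^esub> m) \<in> topspace ftop \<rightarrow> topspace ftop" using a by (auto simp: topspace_fine)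
    fix U assume U: "openin ftop U"
    show "openin ftop {x \<in> topspace ftop. a \<odot>\<^bsub>M\<^esub> x \<in> U}"
      unfolding openin_fine linear_open_def topspace_fine
    proof (intro conjI ballI)
      fix x assume x: "x \<in> {x \<in> carrier M. a \<odot>\<^bsub>M\<^esub> x \<in> U}"
      then obtain N where N: "nbhd N" "\<forall>z\<in>N. a \<odot>\<^bsub>M\<^esub> x \<oplus>\<^bsub>M\<^esub> z \<in> U"
        using U unfolding openin_fine linear_open_def by blast
      show "\<exists>N. nbhd N \<and> (\<forall>y\<in>N. x \<oplus>\<^bsub>M\<^esub> y \<in> {x \<in> carrier M. a \<odot>\<^bsub>M\<^esub> x \<in> U})"
        using nbhd_vimage[OF N(1) a] N(2) x a
        by (intro exI[of _ "{m \<in> carrier M. a \<odot>\<^bsub>M\<^esub> m \<in> N}"]) (auto simp: smult_r_distr)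
    qed auto
  qed
  \<comment> \<open>As \<open>k\<close> is discrete, joint continuity follows from continuity for
    each fixed scalar: the open rectangle has the single point \<open>c\<close> as its first
    side.\<close>
  have ksm: "continuous_map (prod_topology (discrete_topology (carrier k)) ftop) ftop (\<lambda>(c, x). \<iota> c \<odot>\<^bsub>M\<^esub> x)"
    unfolding continuous_map_def
  proof (intro conjI allI impI)
    let ?P = "prod_topology (discrete_topology (carrier k)) ftop"
    show "(\<lambda>(c, x). \<iota> c \<odot>\<^bsub>M\<^esub> x) \<in> topspace ?P \<rightarrow> topspace ftop" using \<iota>_closed by (auto simp: topspace_fine)
    fix U assume U: "openin ftop U"
    show "openin ?P {x \<in> topspace ?P. (case x of (c, x) \<Rightarrow> \<iota> c \<odot>\<^bsub>M\<^esub> x) \<in> U}"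
      unfolding openin_prod_topology_alt
    proof (intro allI impI)
      fix c x assume "(c, x) \<in> {x \<in> topspace ?P. (case x of (c, x) \<Rightarrow> \<iota> c \<odot>\<^bsub>M\<^esub> x) \<in> U}"
      then have c: "c \<in> carrier k" "x \<in> carrier M" "\<iota> c \<odot>\<^bsub>M\<^esub> x \<in> U" by (auto simp: topspace_fine)
      let ?V = "{m \<in> topspace ftop. \<iota> c \<odot>\<^bsub>M\<^esub> m \<in> U}"
      have "openin ftop ?V" using sm[OF \<iota>_closed[OF c(1)]] U by (rule openin_continuous_map_preimage)
      moreover have "{c} \<times> ?V \<subseteq> {x \<in> topspace ?P. (case x of (c, x) \<Rightarrow> \<iota> c \<odot>\<^bsub>M\<^esub> x) \<in> U}" using c by auto
      moreover have "x \<in> ?V" using c by (simp add: topspace_fine)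
      ultimately show "\<exists>U' V. openin (discrete_topology (carrier k)) U' \<and> openin ftop V \<and> c \<in> U' \<and> x \<in> V \<and>
          U' \<times> V \<subseteq> {x \<in> topspace ?P. (case x of (c, x) \<Rightarrow> \<iota> c \<odot>\<^bsub>M\<^esub> x) \<in> U}"
        using c by (intro exI[of _ "{c}"] exI[of _ ?V]) auto
    qed
  qed
  have basis: "\<exists>N. submodule N k ?M \<and> openin ftop N \<and> N \<subseteq> U" if U: "openin ftop U" "\<zero>\<^bsub>M\<^esub> \<in> U" for U
  proof -
    obtain N where N: "nbhd N" "\<forall>y\<in>N. \<zero>\<^bsub>M\<^esub> \<oplus>\<^bsub>M\<^esub> y \<in> U" using U unfolding openin_fine linear_open_def by blast
    have "submodule N k ?M"
      using N(1) unfolding submodule_restrict_scalars[OF module_axioms k \<iota>] by (simp add: nbhd_def)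
    moreover have "N \<subseteq> U" using N(2) nbhdD(1)[OF N(1)] by auto
    ultimately show ?thesis using nbhd_open N(1) by blast
  qed
  have ev: "continuous_map T ftop (\<lambda>a. a \<odot>\<^bsub>M\<^esub> m)" if m: "m \<in> carrier M" for m
    unfolding continuous_map_def
  proof (intro conjI allI impI)
    show "(\<lambda>a. a \<odot>\<^bsub>M\<^esub> m) \<in> topspace T \<rightarrow> topspace ftop" using m by (auto simp: topspace_fine T_top)
    fix U assume U: "openin ftop U"
    show "openin T {a \<in> topspace T. a \<odot>\<^bsub>M\<^esub> m \<in> U}"
    proof (subst openin_subopen, intro ballI)
      fix a assume "a \<in> {a \<in> topspace T. a \<odot>\<^bsub>M\<^esub> m \<in> U}"
      then have a: "a \<in> carrier A" "a \<odot>\<^bsub>M\<^esub> m \<in> U" by (auto simp: T_top)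
      then obtain N where N: "nbhd N" "\<forall>z\<in>N. a \<odot>\<^bsub>M\<^esub> m \<oplus>\<^bsub>M\<^esub> z \<in> U"
        using U unfolding openin_fine linear_open_def by blast
      let ?V = "{b \<in> carrier A. \<ominus>\<^bsub>A\<^esub> a \<oplus>\<^bsub>A\<^esub> b \<in> {b \<in> carrier A. b \<odot>\<^bsub>M\<^esub> m \<in> N}}"
      have "openin T ?V" using N(1) m a by (intro T_translate) (auto simp: nbhd_def)
      moreover have "a \<in> ?V" using a m nbhdD(2)[OF N(1)] by (simp add: R.l_neg)
      moreover have "?V \<subseteq> {a \<in> topspace T. a \<odot>\<^bsub>M\<^esub> m \<in> U}"
      proof
        fix b assume b: "b \<in> ?V"
        let ?d = "\<ominus>\<^bsub>A\<^esub> a \<oplus>\<^bsub>A\<^esub> b"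
        have d: "?d \<in> carrier A" "a \<oplus>\<^bsub>A\<^esub> ?d = b" using a b R.r_neg2[of a b] by auto
        have "b \<odot>\<^bsub>M\<^esub> m = a \<odot>\<^bsub>M\<^esub> m \<oplus>\<^bsub>M\<^esub> ?d \<odot>\<^bsub>M\<^esub> m"
          using smult_l_distr[OF a(1) d(1) m] d(2) by simp
        then show "b \<in> {a \<in> topspace T. a \<odot>\<^bsub>M\<^esub> m \<in> U}" using N(2) b by (auto simp: T_top)
      qed
      ultimately show "\<exists>V. openin T V \<and> a \<in> V \<and> V \<subseteq> {a \<in> topspace T. a \<odot>\<^bsub>M\<^esub> m \<in> U}" by blast
    qed
  qed
  have "linear_topology k ?M ftop"
    unfolding linear_topology_def using add neg ksm basis by (simp add: topspace_fine)
  then show ?thesis unfolding st_module_def using module_axioms sm ev by simp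
qed

lemma fine_finest:
  assumes Y: "st_module k \<iota> A T M Y" and U: "openin Y U"
  shows "openin ftop U"
  unfolding openin_fine linear_open_def
proof (intro conjI ballI)
  let ?M = "restrict_scalars \<iota> M"
  have lin: "linear_topology k ?M Y" using Y by (simp add: st_module_def)
  have top: "topspace Y = carrier M" using lin by (simp add: linear_topology_def)
  show "U \<subseteq> carrier M" using openin_subset[OF U] top by simp
  fix x assume x: "x \<in> U"
  then have xM: "x \<in> carrier M" using openin_subset[OF U] top by blast
  have "openin Y {y \<in> carrier ?M. x \<oplus>\<^bsub>?M\<^esub> y \<in> U}" by (rule openin_translate[OF lin U]) (simp add: xM)
  moreover have "\<zero>\<^bsub>?M\<^esub> \<in> {y \<in> carrier ?M. x \<oplus>\<^bsub>?M\<^esub> y \<in> U}" using x xM by simp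
  ultimately obtain N where N: "submodule N k ?M" "openin Y N" "N \<subseteq> {y \<in> carrier ?M. x \<oplus>\<^bsub>?M\<^esub> y \<in> U}"
    using lin unfolding linear_topology_def by blast
  have "openin T {a \<in> carrier A. a \<odot>\<^bsub>M\<^esub> m \<in> N}" if "m \<in> carrier M" for m
  proof -
    have "continuous_map T Y (\<lambda>a. a \<odot>\<^bsub>M\<^esub> m)" using Y that by (simp add: st_module_def)
    from openin_continuous_map_preimage[OF this N(2)] show ?thesis by (simp add: T_top)
  qed
  then have "nbhd N" using N(1) unfolding nbhd_def submodule_restrict_scalars[OF module_axioms k \<iota>] by simp
  then show "\<exists>N. nbhd N \<and> (\<forall>y\<in>N. x \<oplus>\<^bsub>M\<^esub> y \<in> U)" using N(3) by auto
qed

text \<open>The definite description in \<open>fine_topology\<close> denotes: two finest topologies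
  would have the same open sets, and \<open>ftop\<close> is one.\<close>

lemma fine_topology_eq: "fine_topology k \<iota> A T M = ftop"
  unfolding fine_topology_def
proof (rule the_equality)
  show "st_module k \<iota> A T M ftop \<and> (\<forall>Y'. st_module k \<iota> A T M Y' \<longrightarrow> (\<forall>U. openin Y' U \<longrightarrow> openin ftop U))"
    using st_module_fine fine_finest by blast
  fix Y assume "st_module k \<iota> A T M Y \<and> (\<forall>Y'. st_module k \<iota> A T M Y' \<longrightarrow> (\<forall>U. openin Y' U \<longrightarrow> openin Y U))"
  then show "Y = ftop" using st_module_fine fine_finest by (intro topology_eq[THEN iffD2]) blast
qed

lemma fine_linear: "k_linear_topology k \<iota> M ftop"
  using st_module_fine by (intro k_linear_topologyI[OF module_axioms k \<iota>]) (simp add: st_module_def)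

lemma subspace_open_fine_iff:
  assumes "subspace k \<iota> M N"
  shows "openin ftop N \<longleftrightarrow> (\<forall>m\<in>carrier M. openin T {a \<in> carrier A. a \<odot>\<^bsub>M\<^esub> m \<in> N})"
proof
  assume N: "openin ftop N"
  have "continuous_map T ftop (\<lambda>a. a \<odot>\<^bsub>M\<^esub> m)" if "m \<in> carrier M" for m
    using st_module_fine that by (simp add: st_module_def)
  from openin_continuous_map_preimage[OF this N]
  show "\<forall>m\<in>carrier M. openin T {a \<in> carrier A. a \<odot>\<^bsub>M\<^esub> m \<in> N}" by (simp add: T_top)
qed (use assms nbhd_open in \<open>simp add: nbhd_def\<close>)

end

section \<open>Rings of Laurent series\<close>

text \<open>
  The closure properties that pass from \<open>A\<close> to \<open>laurent A\<close> without any computation with products.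
  The remaining ring axioms are pulled back from the local field later.
\<close>

definition near_ring :: "('a, 'b) ring_scheme \<Rightarrow> bool" where
  "near_ring A \<longleftrightarrow> abelian_group A \<and> \<one>\<^bsub>A\<^esub> \<in> carrier A \<and>
     (\<forall>x\<in>carrier A. \<forall>y\<in>carrier A. x \<otimes>\<^bsub>A\<^esub> y \<in> carrier A) \<and>
     (\<forall>x\<in>carrier A. \<zero>\<^bsub>A\<^esub> \<otimes>\<^bsub>A\<^esub> x = \<zero>\<^bsub>A\<^esub> \<and> x \<otimes>\<^bsub>A\<^esub> \<zero>\<^bsub>A\<^esub> = \<zero>\<^bsub>A\<^esub>)"

lemma cring_near_ring: "cring A \<Longrightarrow> near_ring A"
proof -
  assume "cring A"
  then interpret cring A .
  show ?thesis by (simp add: near_ring_def abelian_group_axioms)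
qed

lemma image_ring_near_ring:
  assumes "near_ring A" "inj_on h (carrier A)"
  shows "near_ring (image_ring h A)"
proof -
  interpret abelian_group A using assms(1) by (simp add: near_ring_def)
  let ?B = "image_ring h A"
  have inv: "inv_into (carrier A) h (h x) = x" if "x \<in> carrier A" for x
    using assms(2) that by simp
  have carr: "carrier ?B = h ` carrier A" by (rule image_ring_carrier)
  have add: "h x \<oplus>\<^bsub>?B\<^esub> h y = h (x \<oplus>\<^bsub>A\<^esub> y)" "h x \<otimes>\<^bsub>?B\<^esub> h y = h (x \<otimes>\<^bsub>A\<^esub> y)"
    if "x \<in> carrier A" "y \<in> carrier A" for x y
    using that inv by (auto simp: image_ring_def image_group_def monoid.defs)
  have "abelian_group ?B"
    by (rule abelian_groupI)
      (auto simp: carr add image_ring_zero a_assoc intro!: bexI[of _ "\<ominus>\<^bsub>A\<^esub> x" for x] l_neg a_comm arg_cong[of _ _ h])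
  then show ?thesis
    using assms(1) unfolding near_ring_def by (auto simp: carr add image_ring_zero image_ring_one)
qed

lemma laurent_simps [simp]:
  "\<zero>\<^bsub>laurent A\<^esub> = (\<lambda>j. \<zero>\<^bsub>A\<^esub>)"
  "\<one>\<^bsub>laurent A\<^esub> = (\<lambda>j. if j = 0 then \<one>\<^bsub>A\<^esub> else \<zero>\<^bsub>A\<^esub>)"
  "f \<oplus>\<^bsub>laurent A\<^esub> g = (\<lambda>j. f j \<oplus>\<^bsub>A\<^esub> g j)"
  by (simp_all add: laurent_def)

lemma laurent_carrier_iff:
  "f \<in> carrier (laurent A) \<longleftrightarrow> (\<forall>j. f j \<in> carrier A) \<and> (\<exists>N. \<forall>j<N. f j = \<zero>\<^bsub>A\<^esub>)"
  by (simp add: laurent_def)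

lemma laurent_mult:
  "f \<otimes>\<^bsub>laurent A\<^esub> g = (\<lambda>j. \<Oplus>\<^bsub>A\<^esub>i\<in>{i. f i \<noteq> \<zero>\<^bsub>A\<^esub> \<and> g (j - i) \<noteq> \<zero>\<^bsub>A\<^esub>}. f i \<otimes>\<^bsub>A\<^esub> g (j - i))"
  by (simp add: laurent_def)

lemma laurent_abelian_group:
  assumes "abelian_group A"
  shows "abelian_group (laurent A)"
proof (rule abelian_groupI)
  interpret abelian_group A by fact
  fix f g assume f: "f \<in> carrier (laurent A)" and g: "g \<in> carrier (laurent A)"
  obtain N N' where N: "\<forall>j<N. f j = \<zero>\<^bsub>A\<^esub>" "\<forall>j<N'. g j = \<zero>\<^bsub>A\<^esub>"
    using f g by (auto simp: laurent_carrier_iff)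
  then have "\<forall>j<min N N'. f j \<oplus>\<^bsub>A\<^esub> g j = \<zero>\<^bsub>A\<^esub>" by simp
  then show "f \<oplus>\<^bsub>laurent A\<^esub> g \<in> carrier (laurent A)"
    using f g unfolding laurent_carrier_iff laurent_simps by (intro conjI exI[of _ "min N N'"]) auto
  show "f \<oplus>\<^bsub>laurent A\<^esub> g = g \<oplus>\<^bsub>laurent A\<^esub> f"
    using f g by (auto simp: laurent_carrier_iff intro!: ext a_comm)
  fix h assume "h \<in> carrier (laurent A)"
  then show "f \<oplus>\<^bsub>laurent A\<^esub> g \<oplus>\<^bsub>laurent A\<^esub> h = f \<oplus>\<^bsub>laurent A\<^esub> (g \<oplus>\<^bsub>laurent A\<^esub> h)"
    using f g by (auto simp: laurent_carrier_iff intro!: ext a_assoc)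
next
  interpret abelian_group A by fact
  show "\<zero>\<^bsub>laurent A\<^esub> \<in> carrier (laurent A)" by (simp add: laurent_carrier_iff)
  fix f assume f: "f \<in> carrier (laurent A)"
  then show "\<zero>\<^bsub>laurent A\<^esub> \<oplus>\<^bsub>laurent A\<^esub> f = f" by (auto simp: laurent_carrier_iff intro!: ext)
  have "(\<lambda>j. \<ominus>\<^bsub>A\<^esub> f j) \<in> carrier (laurent A)" using f by (force simp: laurent_carrier_iff)
  moreover have "(\<lambda>j. \<ominus>\<^bsub>A\<^esub> f j) \<oplus>\<^bsub>laurent A\<^esub> f = \<zero>\<^bsub>laurent A\<^esub>"
    using f by (auto simp: laurent_carrier_iff l_neg)
  ultimately show "\<exists>g\<in>carrier (laurent A). g \<oplus>\<^bsub>laurent A\<^esub> f = \<zero>\<^bsub>laurent A\<^esub>" by blast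
qed

lemma laurent_mult_low:
  assumes "abelian_group A" "\<forall>j<N. f j = \<zero>\<^bsub>A\<^esub>" "\<forall>j<N'. g j = \<zero>\<^bsub>A\<^esub>" "j < N + N'"
  shows "(f \<otimes>\<^bsub>laurent A\<^esub> g) j = \<zero>\<^bsub>A\<^esub>"
proof -
  interpret abelian_group A by fact
  have "i < N \<or> j - i < N'" for i using assms(4) by linarith
  then have "{i. f i \<noteq> \<zero>\<^bsub>A\<^esub> \<and> g (j - i) \<noteq> \<zero>\<^bsub>A\<^esub>} = {}" using assms(2,3) by blast
  then show ?thesis unfolding laurent_mult by (simp only: finsum_empty)
qed

lemma laurent_near_ring:
  assumes "near_ring A"
  shows "near_ring (laurent A)"
proof -
  interpret abelian_group A using assms by (simp add: near_ring_def)
  have "f \<otimes>\<^bsub>laurent A\<^esub> g \<in> carrier (laurent A)" if fg: "f \<in> carrier (laurent A)" "g \<in> carrier (laurent A)" for f g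
  proof -
    obtain N N' where N: "\<forall>j<N. f j = \<zero>\<^bsub>A\<^esub>" "\<forall>j<N'. g j = \<zero>\<^bsub>A\<^esub>"
      using fg by (auto simp: laurent_carrier_iff)
    have "\<forall>j<N + N'. (f \<otimes>\<^bsub>laurent A\<^esub> g) j = \<zero>\<^bsub>A\<^esub>"
      using laurent_mult_low[OF abelian_group_axioms N] by blast
    moreover have "(f \<otimes>\<^bsub>laurent A\<^esub> g) j \<in> carrier A" for j
      unfolding laurent_mult using fg assms by (intro finsum_closed) (auto simp: laurent_carrier_iff near_ring_def)
    ultimately show ?thesis by (auto simp: laurent_carrier_iff)
  qed
  moreover have "\<one>\<^bsub>laurent A\<^esub> \<in> carrier (laurent A)"
    using assms by (auto simp: laurent_carrier_iff near_ring_def intro!: exI[of _ 0])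
  moreover have "\<zero>\<^bsub>laurent A\<^esub> \<otimes>\<^bsub>laurent A\<^esub> f = \<zero>\<^bsub>laurent A\<^esub>" "f \<otimes>\<^bsub>laurent A\<^esub> \<zero>\<^bsub>laurent A\<^esub> = \<zero>\<^bsub>laurent A\<^esub>" for f
    by (simp_all add: laurent_mult)
  ultimately show ?thesis
    unfolding near_ring_def using laurent_abelian_group[OF abelian_group_axioms] by blast
qed

lemma near_ring_std_field: "field F \<Longrightarrow> near_ring (std_field n F)"
proof (induction n)
  case 0
  then interpret field F by simp
  show ?case using image_ring_near_ring[OF cring_near_ring[OF is_cring], of Coeff] by (simp add: inj_on_def)
next
  case (Suc n)
  then show ?case using image_ring_near_ring[OF laurent_near_ring, of _ Series] by (simp add: inj_on_def)
qed

text \<open>Associativity, commutativity and distributivity are checked after applying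
  \<open>h\<close>. The ring laws of Laurent series are thus inherited from the local field instead
  of being derived from the Cauchy product.\<close>

lemma cring_transfer:
  assumes A: "near_ring A" and h: "h \<in> ring_hom A B" "inj_on h (carrier A)" and B: "cring B"
  shows "cring A"
proof -
  interpret abelian_group A using A by (simp add: near_ring_def)
  interpret B: cring B by fact
  have cl: "x \<otimes>\<^bsub>A\<^esub> y \<in> carrier A" "\<one>\<^bsub>A\<^esub> \<in> carrier A" if "x \<in> carrier A" "y \<in> carrier A" for x y
    using A that by (auto simp: near_ring_def)
  have one: "\<one>\<^bsub>A\<^esub> \<in> carrier A" using A by (simp add: near_ring_def)
  note hom = ring_hom_mult[OF h(1)] ring_hom_add[OF h(1)] ring_hom_one[OF h(1)] ring_hom_closed[OF h(1)]
  note eqI = inj_onD[OF h(2)]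
  have "comm_monoid A"
    by (rule comm_monoidI; (rule eqI)?) (simp_all add: cl one hom B.m_ac)
  moreover have "(x \<oplus>\<^bsub>A\<^esub> y) \<otimes>\<^bsub>A\<^esub> z = x \<otimes>\<^bsub>A\<^esub> z \<oplus>\<^bsub>A\<^esub> y \<otimes>\<^bsub>A\<^esub> z"
    if "x \<in> carrier A" "y \<in> carrier A" "z \<in> carrier A" for x y z
    by (rule eqI) (simp_all add: that cl one hom B.l_distr)
  ultimately show ?thesis by (intro cringI abelian_group_axioms) auto
qed

lemma field_transfer:
  assumes A: "near_ring A" and h: "h \<in> ring_iso A B" and B: "field B"
  shows "field A"
proof -
  interpret B: field B by fact
  have hom: "h \<in> ring_hom A B" and bij: "bij_betw h (carrier A) (carrier B)" using h by (auto simp: ring_iso_def)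
  have inj: "inj_on h (carrier A)" using bij by (simp add: bij_betw_def)
  interpret cring A by (rule cring_transfer[OF A hom inj B.is_cring])
  have z: "h \<zero>\<^bsub>A\<^esub> = \<zero>\<^bsub>B\<^esub>"
    by (rule ring_hom_zero[OF hom]) (rule ring_axioms, rule B.ring_axioms)
  show ?thesis
  proof (rule cring_fieldI2)
    show "\<zero>\<^bsub>A\<^esub> \<noteq> \<one>\<^bsub>A\<^esub>" using z ring_hom_one[OF hom] B.zero_not_one by metis
    fix a assume a: "a \<in> carrier A" "a \<noteq> \<zero>\<^bsub>A\<^esub>"
    then have ha: "h a \<in> carrier B" "h a \<noteq> \<zero>\<^bsub>B\<^esub>"
      using ring_hom_closed[OF hom] inj_onD[OF inj, of a "\<zero>\<^bsub>A\<^esub>"] z by auto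
    then obtain b where b: "b \<in> carrier B" "h a \<otimes>\<^bsub>B\<^esub> b = \<one>\<^bsub>B\<^esub>"
      using B.field_Units by (metis B.Units_inv_closed B.Units_r_inv DiffI empty_iff insert_iff)
    then obtain c where c: "c \<in> carrier A" "b = h c" using bij by (auto simp: bij_betw_def)
    have "h (a \<otimes>\<^bsub>A\<^esub> c) = h \<one>\<^bsub>A\<^esub>" using b c a ring_hom_mult[OF hom] ring_hom_one[OF hom] by simp
    then have "a \<otimes>\<^bsub>A\<^esub> c = \<one>\<^bsub>A\<^esub>" using inj_onD[OF inj] a c by simp
    then show "\<exists>b\<in>carrier A. a \<otimes>\<^bsub>A\<^esub> b = \<one>\<^bsub>A\<^esub>" using c by blast
  qed
qed

lemma const_series_closed: "near_ring A \<Longrightarrow> a \<in> carrier A \<Longrightarrow> const_series A a \<in> carrier (laurent A)"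
proof -
  assume h: "near_ring A" "a \<in> carrier A"
  then interpret abelian_group A by (simp add: near_ring_def)
  show ?thesis using h by (auto simp: laurent_carrier_iff const_series_def intro!: exI[of _ 0])
qed

text \<open>For a monomial \<open>a t^r\<close> the Cauchy sum has at most one nonzero term. The
  cases split because the summation set in \<open>laurent_mult\<close> leaves out indices where a
  factor vanishes.\<close>

lemma laurent_single_mult:
  assumes A: "near_ring A" and a: "a \<in> carrier A" and g: "g \<in> carrier (laurent A)"
  shows "(\<lambda>j. if j = r then a else \<zero>\<^bsub>A\<^esub>) \<otimes>\<^bsub>laurent A\<^esub> g = (\<lambda>j. a \<otimes>\<^bsub>A\<^esub> g (j - r))"
proof
  fix j
  interpret abelian_group A using A by (simp add: near_ring_def)
  have gj: "g (j - r) \<in> carrier A" using g by (simp add: laurent_carrier_iff)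
  let ?I = "{i. (if i = r then a else \<zero>\<^bsub>A\<^esub>) \<noteq> \<zero>\<^bsub>A\<^esub> \<and> g (j - i) \<noteq> \<zero>\<^bsub>A\<^esub>}"
  let ?f = "\<lambda>i. (if i = r then a else \<zero>\<^bsub>A\<^esub>) \<otimes>\<^bsub>A\<^esub> g (j - i)"
  show "((\<lambda>j. if j = r then a else \<zero>\<^bsub>A\<^esub>) \<otimes>\<^bsub>laurent A\<^esub> g) j = a \<otimes>\<^bsub>A\<^esub> g (j - r)"
  proof (cases "a = \<zero>\<^bsub>A\<^esub> \<or> g (j - r) = \<zero>\<^bsub>A\<^esub>")
    case True
    then have "?I = {}" by auto
    then have "finsum A ?f ?I = \<zero>\<^bsub>A\<^esub>" by (simp only: finsum_empty)
    then show ?thesis unfolding laurent_mult using True A a gj by (auto simp: near_ring_def)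
  next
    case False
    then have "?I = {r}" by auto
    then have "finsum A ?f ?I = finsum A ?f {r}" by simp
    also have "\<dots> = ?f r"
      using finsum_insert[of "{}" r ?f] A a gj by (simp add: near_ring_def)
    finally show ?thesis unfolding laurent_mult by simp
  qed
qed

lemma const_series_mult:
  assumes "near_ring A" "a \<in> carrier A" "g \<in> carrier (laurent A)"
  shows "const_series A a \<otimes>\<^bsub>laurent A\<^esub> g = (\<lambda>j. a \<otimes>\<^bsub>A\<^esub> g j)"
  using laurent_single_mult[OF assms, of 0] by (simp add: const_series_def)

lemma const_series_hom:
  assumes A: "near_ring A"
  shows "const_series A \<in> ring_hom A (laurent A)"
proof (rule ring_hom_memI)
  interpret abelian_group A using A by (simp add: near_ring_def)
  fix a b assume a: "a \<in> carrier A" and b: "b \<in> carrier A"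
  show "const_series A a \<in> carrier (laurent A)" by (rule const_series_closed[OF A a])
  show "const_series A (a \<otimes>\<^bsub>A\<^esub> b) = const_series A a \<otimes>\<^bsub>laurent A\<^esub> const_series A b"
    unfolding const_series_mult[OF A a const_series_closed[OF A b]]
    using A a b by (auto simp: const_series_def near_ring_def)
  show "const_series A (a \<oplus>\<^bsub>A\<^esub> b) = const_series A a \<oplus>\<^bsub>laurent A\<^esub> const_series A b"
    by (auto simp: const_series_def)
qed (auto simp: const_series_def)

lemma const_series_inj: "inj_on (const_series A) S"
  by (rule inj_onI) (metis const_series_def)

text \<open>The inverse of a constant series has the inverse of the constant as its coefficient at
  zero. The implication goes inwards because it is the outermost Laurent ring that is known to be a
  field, through its isomorphism with \<open>K\<close>.\<close>

lemma field_laurent_imp_field: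
  assumes A: "near_ring A" and L: "field (laurent A)"
  shows "field A"
proof -
  interpret L: field "laurent A" by fact
  interpret cring A
    by (rule cring_transfer[OF A const_series_hom[OF A] const_series_inj L.is_cring])
  show ?thesis
  proof (rule cring_fieldI2)
    show "\<zero>\<^bsub>A\<^esub> \<noteq> \<one>\<^bsub>A\<^esub>"
    proof
      assume "\<zero>\<^bsub>A\<^esub> = \<one>\<^bsub>A\<^esub>"
      then have "\<zero>\<^bsub>laurent A\<^esub> = \<one>\<^bsub>laurent A\<^esub>" by auto
      then show False using L.zero_not_one by blast
    qed
    fix a assume a: "a \<in> carrier A" "a \<noteq> \<zero>\<^bsub>A\<^esub>"
    have ca: "const_series A a \<in> carrier (laurent A)" by (rule const_series_closed[OF A a(1)])
    have "const_series A a 0 \<noteq> \<zero>\<^bsub>laurent A\<^esub> 0" using a(2) by (simp add: const_series_def)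
    then have "const_series A a \<noteq> \<zero>\<^bsub>laurent A\<^esub>" by auto
    then have "const_series A a \<in> Units (laurent A)" using L.field_Units ca by simp
    then have y: "inv\<^bsub>laurent A\<^esub> const_series A a \<in> carrier (laurent A)"
      "const_series A a \<otimes>\<^bsub>laurent A\<^esub> inv\<^bsub>laurent A\<^esub> const_series A a = \<one>\<^bsub>laurent A\<^esub>" by auto
    let ?y = "inv\<^bsub>laurent A\<^esub> const_series A a"
    have "a \<otimes>\<^bsub>A\<^esub> ?y 0 = \<one>\<^bsub>A\<^esub>"
      using fun_cong[OF y(2), of 0] const_series_mult[OF A a(1) y(1)] by simp
    moreover have "?y 0 \<in> carrier A" using y(1) by (simp add: laurent_carrier_iff)
    ultimately show "\<exists>b\<in>carrier A. a \<otimes>\<^bsub>A\<^esub> b = \<one>\<^bsub>A\<^esub>" by blast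
  qed
qed

text \<open>If \<open>g\<close> starts in degree \<open>N\<close>, the terms of the Cauchy sum at
  \<open>j\<close> with index above \<open>j - N\<close> contain a vanishing coefficient of
  \<open>g\<close>.\<close>

lemma laurent_mult_cong:
  assumes A: "near_ring A" and f: "f \<in> carrier (laurent A)" "f' \<in> carrier (laurent A)" "g \<in> carrier (laurent A)"
    and g: "\<forall>i<N. g i = \<zero>\<^bsub>A\<^esub>" and e: "\<And>i. i \<le> j - N \<Longrightarrow> f i = f' i"
  shows "(f \<otimes>\<^bsub>laurent A\<^esub> g) j = (f' \<otimes>\<^bsub>laurent A\<^esub> g) j"
proof -
  interpret abelian_group A using A by (simp add: near_ring_def)
  have c: "f i \<in> carrier A" "f' i \<in> carrier A" "g i \<in> carrier A" for i using f by (auto simp: laurent_carrier_iff)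
  have z: "g (j - i) = \<zero>\<^bsub>A\<^esub>" if "\<not> i \<le> j - N" for i using g that by auto
  show ?thesis unfolding laurent_mult
  proof (rule finsum_cong')
    show "{i. f i \<noteq> \<zero>\<^bsub>A\<^esub> \<and> g (j - i) \<noteq> \<zero>\<^bsub>A\<^esub>} = {i. f' i \<noteq> \<zero>\<^bsub>A\<^esub> \<and> g (j - i) \<noteq> \<zero>\<^bsub>A\<^esub>}"
      using e z by metis
    show "(\<lambda>i. f' i \<otimes>\<^bsub>A\<^esub> g (j - i)) \<in> {i. f' i \<noteq> \<zero>\<^bsub>A\<^esub> \<and> g (j - i) \<noteq> \<zero>\<^bsub>A\<^esub>} \<rightarrow> carrier A"
      using A c by (auto simp: near_ring_def)
    show "f i \<otimes>\<^bsub>A\<^esub> g (j - i) = f' i \<otimes>\<^bsub>A\<^esub> g (j - i)"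
      if "i \<in> {i. f' i \<noteq> \<zero>\<^bsub>A\<^esub> \<and> g (j - i) \<noteq> \<zero>\<^bsub>A\<^esub>}" for i
      using e[of i] z[of i] that by (cases "i \<le> j - N") auto
  qed
qed

text \<open>That \<open>laurent A\<close> is a field is an assumption here; it will be supplied by
  the isomorphism with the local field. The last two assumptions are what the construction returns
  for \<open>laurent A\<close>, so the locale can be iterated.\<close>

locale laurent_top =
  fixes k :: "'k ring" and \<iota> :: "'k \<Rightarrow> 'a" and A :: "'a ring" and T :: "'a topology"
  assumes k: "cring k" and A_field: "field A" and L_field: "field (laurent A)"
    and \<iota>: "\<iota> \<in> ring_hom k A"
    and T_linear: "k_linear_topology k \<iota> (self_module A) T"
    and T_mult: "a \<in> carrier A \<Longrightarrow> openin T U \<Longrightarrow> openin T {b \<in> carrier A. b \<otimes>\<^bsub>A\<^esub> a \<in> U}"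
begin

abbreviation "L \<equiv> laurent A"
abbreviation "PS \<equiv> power_series A"
abbreviation "P \<equiv> L\<lparr>carrier := PS\<rparr>"
abbreviation "\<kappa> \<equiv> const_series A"
abbreviation "Ltop \<equiv> laurent_topology k \<iota> A T"
abbreviation "PT \<equiv> power_series_topology k \<iota> A T"

interpretation A: field A by (rule A_field)
interpretation L: field L by (rule L_field)

lemma A_near: "near_ring A" by (rule cring_near_ring) (rule A.is_cring)

lemma A_ring: "ring A" by (rule A.ring_axioms)

lemma A_abelian_group: "abelian_group A" by (rule A.abelian_group_axioms)

lemma A_r_neg: "a \<in> carrier A \<Longrightarrow> a \<oplus>\<^bsub>A\<^esub> \<ominus>\<^bsub>A\<^esub> a = \<zero>\<^bsub>A\<^esub>" by (rule A.r_neg)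

lemma \<iota>_closed: "c \<in> carrier k \<Longrightarrow> \<iota> c \<in> carrier A"
  using \<iota> by (auto simp: ring_hom_def)

lemma L_coeff: "f \<in> carrier L \<Longrightarrow> f j \<in> carrier A"
  by (simp add: laurent_carrier_iff)

lemma L_bounded: "f \<in> carrier L \<Longrightarrow> \<exists>N. \<forall>j<N. f j = \<zero>\<^bsub>A\<^esub>"
  by (simp add: laurent_carrier_iff)

lemma PS_iff: "f \<in> PS \<longleftrightarrow> f \<in> carrier L \<and> (\<forall>j<0. f j = \<zero>\<^bsub>A\<^esub>)"
  by (simp add: power_series_def)

lemma PS_L: "f \<in> PS \<Longrightarrow> f \<in> carrier L" by (simp add: PS_iff)

lemma \<kappa>_closed: "a \<in> carrier A \<Longrightarrow> \<kappa> a \<in> carrier L"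
  by (rule const_series_closed[OF A_near])

lemma \<kappa>_PS: "a \<in> carrier A \<Longrightarrow> \<kappa> a \<in> PS"
  using \<kappa>_closed by (simp add: PS_iff const_series_def)

lemma \<kappa>_mult: "a \<in> carrier A \<Longrightarrow> g \<in> carrier L \<Longrightarrow> \<kappa> a \<otimes>\<^bsub>L\<^esub> g = (\<lambda>j. a \<otimes>\<^bsub>A\<^esub> g j)"
  by (rule const_series_mult[OF A_near])

lemma \<kappa>_mult_coeff: "a \<in> carrier A \<Longrightarrow> g \<in> carrier L \<Longrightarrow> (\<kappa> a \<otimes>\<^bsub>L\<^esub> g) j = a \<otimes>\<^bsub>A\<^esub> g j"
  by (simp add: \<kappa>_mult)

lemma L_minus: "f \<in> carrier L \<Longrightarrow> \<ominus>\<^bsub>L\<^esub> f = (\<lambda>j. \<ominus>\<^bsub>A\<^esub> f j)"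
proof (rule L.minus_equality)
  assume f: "f \<in> carrier L"
  then show "(\<lambda>j. \<ominus>\<^bsub>A\<^esub> f j) \<oplus>\<^bsub>L\<^esub> f = \<zero>\<^bsub>L\<^esub>" using L_coeff by (auto simp: A.l_neg)
  obtain N where "\<forall>j<N. f j = \<zero>\<^bsub>A\<^esub>" using L_bounded f by blast
  then show "(\<lambda>j. \<ominus>\<^bsub>A\<^esub> f j) \<in> carrier L"
    using L_coeff[OF f] unfolding laurent_carrier_iff by (intro conjI exI[of _ N]) auto
qed

lemma L_diff: "f \<in> carrier L \<Longrightarrow> g \<in> carrier L \<Longrightarrow> (f \<ominus>\<^bsub>L\<^esub> g) j = f j \<ominus>\<^bsub>A\<^esub> g j"
  by (simp add: a_minus_def L_minus)

text \<open>The monomial \<open>t^r\<close>; negative exponents provide division by powers of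
  \<open>t\<close>.\<close>

definition tt :: "int \<Rightarrow> int \<Rightarrow> 'a" where "tt r = (\<lambda>j. if j = r then \<one>\<^bsub>A\<^esub> else \<zero>\<^bsub>A\<^esub>)"

lemma tt_closed: "tt r \<in> carrier L"
  unfolding laurent_carrier_iff tt_def by (auto intro!: exI[of _ r])

lemma tt_mult: "g \<in> carrier L \<Longrightarrow> tt r \<otimes>\<^bsub>L\<^esub> g = (\<lambda>j. g (j - r))"
  using laurent_single_mult[OF A_near A.one_closed, of g r] L_coeff by (simp add: tt_def)

lemma tt_cancel: "g \<in> carrier L \<Longrightarrow> tt r \<otimes>\<^bsub>L\<^esub> (tt (- r) \<otimes>\<^bsub>L\<^esub> g) = g"
proof -
  assume g: "g \<in> carrier L"
  have c: "tt (- r) \<otimes>\<^bsub>L\<^esub> g \<in> carrier L" by (rule L.m_closed[OF tt_closed g])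
  show ?thesis unfolding tt_mult[OF c] unfolding tt_mult[OF g] by simp
qed

lemma tt_nonzero: "tt r \<noteq> \<zero>\<^bsub>L\<^esub>"
proof
  assume "tt r = \<zero>\<^bsub>L\<^esub>"
  then have "tt r r = \<zero>\<^bsub>A\<^esub>" by simp
  then show False by (simp add: tt_def)
qed

lemma tt_PS: "0 \<le> r \<Longrightarrow> tt r \<in> PS" using tt_closed by (simp add: PS_iff tt_def)

lemma tt_factor:
  assumes u: "u \<in> carrier L" "\<forall>i<r. u i = \<zero>\<^bsub>A\<^esub>"
  shows "tt (- r) \<otimes>\<^bsub>L\<^esub> u \<in> PS" "u = tt r \<otimes>\<^bsub>L\<^esub> (tt (- r) \<otimes>\<^bsub>L\<^esub> u)"
  using tt_cancel[OF u(1)] tt_mult[OF u(1)] u L.m_closed[OF tt_closed u(1), of "- r"] by (auto simp: PS_iff)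

lemma PS_subring: "subring PS L"
proof (rule L.subringI)
  show "PS \<subseteq> carrier L" using PS_L by blast
  show "\<one>\<^bsub>L\<^esub> \<in> PS" using L.one_closed by (simp add: PS_iff)
  show "\<ominus>\<^bsub>L\<^esub> h \<in> PS" if "h \<in> PS" for h
    using that L.a_inv_closed[of h] by (auto simp: PS_iff L_minus)
  fix f g assume f: "f \<in> PS" and g: "g \<in> PS"
  show "f \<oplus>\<^bsub>L\<^esub> g \<in> PS" using f g L.a_closed[of f g] by (auto simp: PS_iff)
  show "f \<otimes>\<^bsub>L\<^esub> g \<in> PS"
    using f g L.m_closed[of f g] laurent_mult_low[OF A.abelian_group_axioms, of 0 f 0 g] by (auto simp: PS_iff)
qed

lemma P_cring: "cring P"
  using L.subcring_iff[of PS] L.subcringI'[OF PS_subring] PS_L by blast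

lemma \<kappa>_hom: "\<kappa> \<in> ring_hom A L"
  by (rule const_series_hom[OF A_near])

lemma \<kappa>\<iota>_hom: "(\<lambda>c. \<kappa> (\<iota> c)) \<in> ring_hom k L"
  using ring_hom_trans[OF \<iota> \<kappa>_hom] by (simp add: comp_def)

lemma \<kappa>\<iota>_hom_PS: "(\<lambda>c. \<kappa> (\<iota> c)) \<in> ring_hom k P"
  using \<kappa>\<iota>_hom \<kappa>_PS \<iota>_closed by (auto simp: ring_hom_def)

lemma L_module: "module P (self_module L)"
proof -
  have "module L (self_module L)" by (rule module_self[OF L.is_cring])
  then interpret m: module L "self_module L" .
  show ?thesis
    by (rule moduleI[OF P_cring m.M.abelian_group_axioms])
      (auto simp: PS_L L.l_distr L.r_distr L.m_assoc simp del: laurent_simps)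
qed

lemma T_top: "topspace T = carrier A"
  using T_linear by (simp add: k_linear_topology_def)

lemma T_translate: "x \<in> carrier A \<Longrightarrow> openin T U \<Longrightarrow> openin T {a \<in> carrier A. x \<oplus>\<^bsub>A\<^esub> a \<in> U}"
  using T_linear by (simp add: k_linear_topology_def)

abbreviation "TP i \<equiv> truncated_polys A i"
abbreviation "tr i \<equiv> truncate_series A i"

lemma TP_simps [simp]:
  "carrier (TP i) = {f \<in> PS. \<forall>j>int i. f j = \<zero>\<^bsub>A\<^esub>}" "\<zero>\<^bsub>TP i\<^esub> = \<zero>\<^bsub>L\<^esub>" "add (TP i) = add L"
  "smult (TP i) = (\<lambda>a f j. a \<otimes>\<^bsub>A\<^esub> f j)"
  by (simp_all add: truncated_polys_def with_smult_def)

lemma TP_smult: "a \<in> carrier A \<Longrightarrow> f \<in> PS \<Longrightarrow> (\<lambda>j. a \<otimes>\<^bsub>A\<^esub> f j) = \<kappa> a \<otimes>\<^bsub>L\<^esub> f"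
  using \<kappa>_mult PS_L by simp

lemma TP_abelian: "abelian_group (TP i)"
proof (rule abelian_groupI)
  note s = subringE[OF PS_subring]
  fix f g h assume f: "f \<in> carrier (TP i)" and g: "g \<in> carrier (TP i)" and h: "h \<in> carrier (TP i)"
  show "f \<oplus>\<^bsub>TP i\<^esub> g \<in> carrier (TP i)" using f g s(7)[of f g] by simp
  show "f \<oplus>\<^bsub>TP i\<^esub> g = g \<oplus>\<^bsub>TP i\<^esub> f" using f g L.a_comm[of f g] PS_L by simp
  show "f \<oplus>\<^bsub>TP i\<^esub> g \<oplus>\<^bsub>TP i\<^esub> h = f \<oplus>\<^bsub>TP i\<^esub> (g \<oplus>\<^bsub>TP i\<^esub> h)" using f g h L.a_assoc[of f g h] PS_L by simp
next
  note s = subringE[OF PS_subring]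
  show "\<zero>\<^bsub>TP i\<^esub> \<in> carrier (TP i)" using s(2) by simp
  fix f assume f: "f \<in> carrier (TP i)"
  show "\<zero>\<^bsub>TP i\<^esub> \<oplus>\<^bsub>TP i\<^esub> f = f" using f L.l_zero[of f] PS_L by simp
  have "\<ominus>\<^bsub>L\<^esub> f \<in> carrier (TP i)" using f s(5)[of f] PS_L by (auto simp: L_minus)
  moreover have "\<ominus>\<^bsub>L\<^esub> f \<oplus>\<^bsub>TP i\<^esub> f = \<zero>\<^bsub>TP i\<^esub>" using f L.l_neg[of f] PS_L by simp
  ultimately show "\<exists>g\<in>carrier (TP i). g \<oplus>\<^bsub>TP i\<^esub> f = \<zero>\<^bsub>TP i\<^esub>" by blast
qed

lemma TP_module: "module A (TP i)"
proof (rule moduleI[OF A.is_cring TP_abelian])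
  note s = subringE[OF PS_subring]
  fix a f assume a: "a \<in> carrier A" and f: "f \<in> carrier (TP i)"
  have fc: "f j \<in> carrier A" for j using f L_coeff PS_L by auto
  have "(\<lambda>j. a \<otimes>\<^bsub>A\<^esub> f j) \<in> PS" using a f s(6)[OF \<kappa>_PS[OF a], of f] TP_smult[of a f] by simp
  then show "a \<odot>\<^bsub>TP i\<^esub> f \<in> carrier (TP i)" using a f by simp
  show "(a \<oplus>\<^bsub>A\<^esub> b) \<odot>\<^bsub>TP i\<^esub> f = a \<odot>\<^bsub>TP i\<^esub> f \<oplus>\<^bsub>TP i\<^esub> b \<odot>\<^bsub>TP i\<^esub> f" if "b \<in> carrier A" for b
    using a that fc by (auto simp: A.l_distr)
  show "(a \<otimes>\<^bsub>A\<^esub> b) \<odot>\<^bsub>TP i\<^esub> f = a \<odot>\<^bsub>TP i\<^esub> (b \<odot>\<^bsub>TP i\<^esub> f)" if "b \<in> carrier A" for b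
    using a that fc by (auto simp: A.m_assoc)
  show "a \<odot>\<^bsub>TP i\<^esub> (f \<oplus>\<^bsub>TP i\<^esub> g) = a \<odot>\<^bsub>TP i\<^esub> f \<oplus>\<^bsub>TP i\<^esub> a \<odot>\<^bsub>TP i\<^esub> g" if "g \<in> carrier (TP i)" for g
    using a that fc L_coeff[of g] PS_L by (auto simp: A.r_distr)
next
  fix f assume "f \<in> carrier (TP i)"
  then show "\<one>\<^bsub>A\<^esub> \<odot>\<^bsub>TP i\<^esub> f = f" using L_coeff PS_L by auto
qed

sublocale tp: fine_module A "TP i" k \<iota> T for i
  by (rule fine_module.intro[OF TP_module fine_module_axioms.intro[OF k \<iota> T_top T_translate]])

lemma PT_eq: "PT = topology_generated_by {{f \<in> PS. tr i f \<in> U} |i U. openin (tp.ftop i) U}"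
  unfolding power_series_topology_def tp.fine_topology_eq ..

lemma PT_basic: "openin (tp.ftop i) U \<Longrightarrow> openin PT {f \<in> PS. tr i f \<in> U}"
  unfolding PT_eq by (rule topology_generated_by_Basis) blast

lemma tr_TP: "f \<in> PS \<Longrightarrow> tr i f \<in> carrier (TP i)"
proof -
  assume f: "f \<in> PS"
  then have "tr i f \<in> carrier L"
    unfolding laurent_carrier_iff truncate_series_def using L_coeff PS_L by (auto simp: PS_iff intro!: exI[of _ 0])
  then show ?thesis using f by (auto simp: PS_iff truncate_series_def)
qed

lemma PT_topspace: "topspace PT = PS"
proof
  show "topspace PT \<subseteq> PS" unfolding PT_eq topology_generated_by_topspace by auto
  have "openin PT {f \<in> PS. tr 0 f \<in> carrier (TP 0)}"
    using openin_topspace[of "tp.ftop 0"] by (intro PT_basic) (simp only: tp.topspace_fine)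
  moreover have "{f \<in> PS. tr 0 f \<in> carrier (TP 0)} = PS" using tr_TP by blast
  ultimately show "PS \<subseteq> topspace PT" using openin_subset by metis
qed

lemma PT_translate:
  assumes h: "h \<in> PS" and U: "openin PT U"
  shows "openin PT {f \<in> PS. h \<oplus>\<^bsub>L\<^esub> f \<in> U}"
proof -
  note s = subringE[OF PS_subring]
  have "continuous_map PT PT (\<lambda>f. h \<oplus>\<^bsub>L\<^esub> f)"
    unfolding PT_eq
  proof (rule continuous_on_generated_topo, unfold PT_eq[symmetric] PT_topspace)
    fix V assume "V \<in> {{f \<in> PS. tr i f \<in> U} |i U. openin (tp.ftop i) U}"
    then obtain i W where V: "V = {f \<in> PS. tr i f \<in> W}" "openin (tp.ftop i) W" by blast
    have hT: "tr i h \<in> carrier (TP i)" by (rule tr_TP[OF h])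
    have op: "openin (tp.ftop i) {y \<in> carrier (TP i). tr i h \<oplus>\<^bsub>TP i\<^esub> y \<in> W}"
      using tp.fine_linear[of i] V(2) hT unfolding k_linear_topology_def by blast
    have "(\<lambda>f. h \<oplus>\<^bsub>L\<^esub> f) -` V \<inter> PS = {f \<in> PS. tr i f \<in> {y \<in> carrier (TP i). tr i h \<oplus>\<^bsub>TP i\<^esub> y \<in> W}}"
    proof -
      have "tr i (h \<oplus>\<^bsub>L\<^esub> f) = tr i h \<oplus>\<^bsub>TP i\<^esub> tr i f" for f
        by (auto simp: truncate_series_def)
      then show ?thesis using s(7)[OF h] tr_TP unfolding V(1) by (auto simp del: TP_simps laurent_simps)
    qed
    then show "openin PT ((\<lambda>f. h \<oplus>\<^bsub>L\<^esub> f) -` V \<inter> PS)" using PT_basic[OF op] by simp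
  next
    have "\<Union>{{f \<in> PS. tr i f \<in> U} |i U. openin (tp.ftop i) U} = PS"
      using PT_topspace unfolding PT_eq topology_generated_by_topspace .
    then show "(\<lambda>f. h \<oplus>\<^bsub>L\<^esub> f) ` PS \<subseteq> \<Union>{{f \<in> PS. tr i f \<in> U} |i U. openin (tp.ftop i) U}"
      using s(7)[OF h] by auto
  qed
  from openin_continuous_map_preimage[OF this U] show ?thesis unfolding PT_topspace .
qed

text \<open>A basic open set of the inverse limit sees one truncation only, and finite intersections
  and unions preserve the property. Around zero it says that an open set contains all power series
  divisible by some \<open>t^r\<close>.\<close>

lemma PT_agree:
  assumes U: "openin PT U" and f: "f \<in> U"
  shows "\<exists>r. \<forall>g\<in>PS. (\<forall>i<r. g i = f i) \<longrightarrow> g \<in> U"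
proof -
  have "generate_topology_on {{f \<in> PS. tr i f \<in> U} |i U. openin (tp.ftop i) U} U"
    using U unfolding PT_eq openin_topology_generated_by_iff .
  then show ?thesis using f
  proof (induction rule: generate_topology_on.induct)
    case (Int a b)
    then obtain r r' where r: "\<forall>g\<in>PS. (\<forall>i<r. g i = f i) \<longrightarrow> g \<in> a" "\<forall>g\<in>PS. (\<forall>i<r'. g i = f i) \<longrightarrow> g \<in> b" by blast
    have "g \<in> a \<inter> b" if g: "g \<in> PS" "\<forall>i<max r r'. g i = f i" for g
      using r[THEN bspec, OF g(1)] g(2) by auto
    then show ?case by blast
  next
    case (UN K)
    then obtain a where a: "a \<in> K" "f \<in> a" by blast
    obtain r where "\<forall>g\<in>PS. (\<forall>i<r. g i = f i) \<longrightarrow> g \<in> a" using UN.IH[OF a] by (elim exE)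
    then show ?case using a(1) by (intro exI[of _ r]) blast
  next
    case (Basis b)
    then obtain i V where b: "b = {f \<in> PS. tr i f \<in> V}" by blast
    have "g \<in> b" if g: "g \<in> PS" "\<forall>j<int i + 1. g j = f j" for g
    proof -
      have "tr i g = tr i f" using g(2) by (auto simp: truncate_series_def)
      then show ?thesis using Basis b g by simp
    qed
    then show ?case by blast
  qed auto
qed

sublocale fl: fine_module P "self_module L" k "\<lambda>c. \<kappa> (\<iota> c)" PT
  by (rule fine_module.intro[OF L_module fine_module_axioms.intro[OF k \<kappa>\<iota>_hom_PS]])
    (use PT_topspace PT_translate in auto)

lemma LT_eq: "Ltop = fl.ftop"
  unfolding laurent_topology_def using fl.fine_topology_eq by simp

lemma LT_topspace: "topspace Ltop = carrier L"
  unfolding LT_eq using fl.topspace_fine by simp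

lemma LT_linear: "k_linear_topology k (\<lambda>c. \<kappa> (\<iota> c)) (self_module L) Ltop"
  unfolding LT_eq by (rule fl.fine_linear)

abbreviation "Lsub \<equiv> subspace k (\<lambda>c. \<kappa> (\<iota> c)) (self_module L)"

lemma LT_open_iff: "Lsub N \<Longrightarrow> openin Ltop N \<longleftrightarrow> (\<forall>g\<in>carrier L. openin PT {f \<in> PS. f \<otimes>\<^bsub>L\<^esub> g \<in> N})"
  unfolding LT_eq using fl.subspace_open_fine_iff by simp

lemma LsubD:
  assumes "Lsub N"
  shows "f \<in> N \<Longrightarrow> f \<in> carrier L" "\<zero>\<^bsub>L\<^esub> \<in> N" "f \<in> N \<Longrightarrow> g \<in> N \<Longrightarrow> f \<oplus>\<^bsub>L\<^esub> g \<in> N"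
    "f \<in> N \<Longrightarrow> \<ominus>\<^bsub>L\<^esub> f \<in> N" "f \<in> N \<Longrightarrow> c \<in> carrier k \<Longrightarrow> \<kappa> (\<iota> c) \<otimes>\<^bsub>L\<^esub> f \<in> N"
  using assms by (auto simp: subspace_def additive_def)

text \<open>The inclusion of power series into Laurent series is the map \<open>a |-> a m\<close> at
  \<open>m = 1\<close>, which an ST module topology makes continuous.\<close>

lemma PS_LT: "openin Ltop U \<Longrightarrow> openin PT {f \<in> PS. f \<in> U}"
proof -
  assume U: "openin Ltop U"
  have "continuous_map PT Ltop (\<lambda>a. a \<odot>\<^bsub>self_module L\<^esub> \<one>\<^bsub>L\<^esub>)"
    using fl.st_module_fine L.one_closed unfolding LT_eq st_module_def by simp
  from openin_continuous_map_preimage[OF this U]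
  have "openin PT {f \<in> PS. f \<otimes>\<^bsub>L\<^esub> \<one>\<^bsub>L\<^esub> \<in> U}" unfolding PT_topspace by simp
  moreover have "{f \<in> PS. f \<otimes>\<^bsub>L\<^esub> \<one>\<^bsub>L\<^esub> \<in> U} = {f \<in> PS. f \<in> U}" using PS_L L.r_one by metis
  ultimately show ?thesis by simp
qed

text \<open>Into each truncation the map sends \<open>a\<close> to \<open>a\<close> times the class
  of \<open>1\<close>, which is continuous because the truncation is an ST module.\<close>

lemma const_continuous: "continuous_map T Ltop \<kappa>"
proof -
  have "continuous_map T PT \<kappa>"
    unfolding PT_eq
  proof (rule continuous_on_generated_topo, unfold T_top)
    fix V assume "V \<in> {{f \<in> PS. tr i f \<in> U} |i U. openin (tp.ftop i) U}"
    then obtain i W where V: "V = {f \<in> PS. tr i f \<in> W}" "openin (tp.ftop i) W" by blast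
    have 1: "\<kappa> \<one>\<^bsub>A\<^esub> \<in> carrier (TP i)" using \<kappa>_PS by (simp add: const_series_def)
    have "continuous_map T (tp.ftop i) (\<lambda>a. a \<odot>\<^bsub>TP i\<^esub> \<kappa> \<one>\<^bsub>A\<^esub>)"
      using tp.st_module_fine[of i] 1 unfolding st_module_def by blast
    from openin_continuous_map_preimage[OF this V(2)]
    have "openin T {a \<in> carrier A. a \<odot>\<^bsub>TP i\<^esub> \<kappa> \<one>\<^bsub>A\<^esub> \<in> W}" unfolding T_top .
    moreover have "a \<odot>\<^bsub>TP i\<^esub> \<kappa> \<one>\<^bsub>A\<^esub> = tr i (\<kappa> a)" if "a \<in> carrier A" for a
      using that by (auto simp: const_series_def truncate_series_def)
    then have "\<kappa> -` V \<inter> carrier A = {a \<in> carrier A. a \<odot>\<^bsub>TP i\<^esub> \<kappa> \<one>\<^bsub>A\<^esub> \<in> W}"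
      using \<kappa>_PS unfolding V(1) by (auto simp del: TP_simps)
    ultimately show "openin T (\<kappa> -` V \<inter> carrier A)" by simp
  next
    have "\<Union>{{f \<in> PS. tr i f \<in> U} |i U. openin (tp.ftop i) U} = PS"
      using PT_topspace unfolding PT_eq topology_generated_by_topspace .
    then show "\<kappa> ` carrier A \<subseteq> \<Union>{{f \<in> PS. tr i f \<in> U} |i U. openin (tp.ftop i) U}" using \<kappa>_PS by auto
  qed
  moreover have "continuous_map PT Ltop (\<lambda>f. f)"
    unfolding continuous_map_def PT_topspace LT_topspace using PS_LT PS_L by auto
  ultimately show ?thesis using continuous_map_compose[of T PT \<kappa> Ltop "\<lambda>f. f"] by (simp add: comp_def)
qed

lemma LT_mult_subspace:
  assumes N: "Lsub N" "openin Ltop N" and a: "a \<in> carrier L"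
  shows "Lsub {h \<in> carrier L. a \<otimes>\<^bsub>L\<^esub> h \<in> N}" "openin Ltop {h \<in> carrier L. a \<otimes>\<^bsub>L\<^esub> h \<in> N}"
proof -
  note Nd = LsubD[OF N(1)]
  have "a \<otimes>\<^bsub>L\<^esub> (\<kappa> (\<iota> c) \<otimes>\<^bsub>L\<^esub> h) = \<kappa> (\<iota> c) \<otimes>\<^bsub>L\<^esub> (a \<otimes>\<^bsub>L\<^esub> h)" if "c \<in> carrier k" "h \<in> carrier L" for c h
    using that a \<kappa>_closed \<iota>_closed L.m_lcomm by simp
  then show sub: "Lsub {h \<in> carrier L. a \<otimes>\<^bsub>L\<^esub> h \<in> N}"
    using Nd a \<kappa>_closed \<iota>_closed L.zero_closed L.r_null[OF a] unfolding subspace_def additive_def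
    by (auto simp: L.r_distr L.r_minus simp del: laurent_simps)
  have "{f \<in> PS. f \<otimes>\<^bsub>L\<^esub> g \<in> {h \<in> carrier L. a \<otimes>\<^bsub>L\<^esub> h \<in> N}} = {f \<in> PS. f \<otimes>\<^bsub>L\<^esub> (a \<otimes>\<^bsub>L\<^esub> g) \<in> N}"
    if "g \<in> carrier L" for g
    using that a PS_L by (auto simp: L.m_lcomm)
  then show "openin Ltop {h \<in> carrier L. a \<otimes>\<^bsub>L\<^esub> h \<in> N}"
    unfolding LT_open_iff[OF sub] using N(2) a unfolding LT_open_iff[OF N(1)] by simp
qed

lemma LT_mult:
  assumes a: "a \<in> carrier L" and U: "openin Ltop U"
  shows "openin Ltop {b \<in> carrier L. b \<otimes>\<^bsub>L\<^esub> a \<in> U}"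
proof -
  have ab: "abelian_group (self_module L)" using module_self[OF L.is_cring] by (simp add: module_def)
  have "continuous_map Ltop Ltop (\<lambda>b. b \<otimes>\<^bsub>L\<^esub> a)"
  proof (rule additive_continuousI[OF ab ab _ LT_linear])
    show "openin Ltop {x \<in> carrier (self_module L). x \<otimes>\<^bsub>L\<^esub> a \<in> N}" if "Lsub N" "openin Ltop N" for N
    proof -
      have "{x \<in> carrier (self_module L). x \<otimes>\<^bsub>L\<^esub> a \<in> N} = {h \<in> carrier L. a \<otimes>\<^bsub>L\<^esub> h \<in> N}"
        using a by (auto simp: L.m_comm)
      then show ?thesis using LT_mult_subspace(2)[OF that a] by simp
    qed
  qed (use LT_topspace LT_linear a in \<open>auto simp: k_linear_topology_def L.l_distr simp del: laurent_simps\<close>)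
  from openin_continuous_map_preimage[OF this U] show ?thesis unfolding LT_topspace .
qed

abbreviation "Asub \<equiv> subspace k \<iota> (self_module A)"

lemma AsubD:
  assumes "Asub N"
  shows "a \<in> N \<Longrightarrow> a \<in> carrier A" "\<zero>\<^bsub>A\<^esub> \<in> N" "a \<in> N \<Longrightarrow> b \<in> N \<Longrightarrow> a \<oplus>\<^bsub>A\<^esub> b \<in> N"
    "a \<in> N \<Longrightarrow> \<ominus>\<^bsub>A\<^esub> a \<in> N" "a \<in> N \<Longrightarrow> c \<in> carrier k \<Longrightarrow> \<iota> c \<otimes>\<^bsub>A\<^esub> a \<in> N"
  using assms by (auto simp: subspace_def additive_def)

text \<open>When membership of \<open>f g\<close> in \<open>N\<close> depends on a truncation of
  \<open>f\<close>, the set is the preimage of a subspace of \<open>A[t]/(t^(i+1))\<close>. The fine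
  topology there asks for openness along lines, and on these the scalars act as constant
  series.\<close>

lemma TP_preimage_open:
  assumes N: "Lsub N" and g: "g \<in> carrier L"
    and A_open: "\<And>m. m \<in> carrier L \<Longrightarrow> openin T {a \<in> carrier A. \<kappa> a \<otimes>\<^bsub>L\<^esub> m \<in> N}"
    and trunc: "\<And>f. f \<in> PS \<Longrightarrow> f \<otimes>\<^bsub>L\<^esub> g \<in> N \<longleftrightarrow> tr i f \<otimes>\<^bsub>L\<^esub> g \<in> N"
  shows "openin PT {f \<in> PS. f \<otimes>\<^bsub>L\<^esub> g \<in> N}"
proof -
  note Nd = LsubD[OF N]
  let ?V = "{v \<in> carrier (TP i). v \<otimes>\<^bsub>L\<^esub> g \<in> N}"
  have assoc: "(\<lambda>j. a \<otimes>\<^bsub>A\<^esub> v j) \<otimes>\<^bsub>L\<^esub> g = \<kappa> a \<otimes>\<^bsub>L\<^esub> (v \<otimes>\<^bsub>L\<^esub> g)" if "a \<in> carrier A" "v \<in> PS" for a v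
    using TP_smult[OF that] that \<kappa>_closed PS_L g by (simp add: L.m_assoc)
  have minus: "\<ominus>\<^bsub>TP i\<^esub> v = \<ominus>\<^bsub>L\<^esub> v" if "v \<in> carrier (TP i)" for v
  proof -
    have "\<ominus>\<^bsub>L\<^esub> v \<in> carrier (TP i)"
      using that subringE(5)[OF PS_subring, of v] PS_L by (auto simp: L_minus)
    then show ?thesis using that PS_L L.l_neg[of v] by (intro abelian_group.minus_equality[OF TP_abelian]) auto
  qed
  have "subspace k \<iota> (TP i) ?V"
    unfolding subspace_def additive_def
  proof (intro conjI ballI)
    show "\<zero>\<^bsub>TP i\<^esub> \<in> ?V" using tp.M.zero_closed Nd(2) L.l_null[OF g] by simp
    fix x assume x: "x \<in> ?V"
    then have xL: "x \<in> carrier L" "x \<in> carrier (TP i)" using PS_L by auto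
    show "\<ominus>\<^bsub>TP i\<^esub> x \<in> ?V"
      using x Nd(4)[of "x \<otimes>\<^bsub>L\<^esub> g"] tp.M.a_inv_closed[OF xL(2)] minus[OF xL(2)] L.l_minus[OF xL(1) g] by simp
    show "x \<oplus>\<^bsub>TP i\<^esub> y \<in> ?V" if y: "y \<in> ?V" for y
    proof -
      have yL: "y \<in> carrier L" "y \<in> carrier (TP i)" using y PS_L by auto
      show ?thesis
        using x y Nd(3)[of "x \<otimes>\<^bsub>L\<^esub> g" "y \<otimes>\<^bsub>L\<^esub> g"] tp.M.a_closed[OF xL(2) yL(2)] L.l_distr[OF xL(1) yL(1) g]
        by (simp del: laurent_simps)
    qed
    fix c assume c: "c \<in> carrier k"
    show "\<iota> c \<odot>\<^bsub>TP i\<^esub> x \<in> ?V"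
      using x assoc[OF \<iota>_closed[OF c], of x] Nd(5)[OF _ c, of "x \<otimes>\<^bsub>L\<^esub> g"] tp.smult_closed[OF \<iota>_closed[OF c] xL(2)] by simp
  qed auto
  moreover have "openin T {a \<in> carrier A. a \<odot>\<^bsub>TP i\<^esub> m \<in> ?V}" if m: "m \<in> carrier (TP i)" for m
  proof -
    have "m \<otimes>\<^bsub>L\<^esub> g \<in> carrier L" using m g PS_L by auto
    moreover have "{a \<in> carrier A. a \<odot>\<^bsub>TP i\<^esub> m \<in> ?V} = {a \<in> carrier A. \<kappa> a \<otimes>\<^bsub>L\<^esub> (m \<otimes>\<^bsub>L\<^esub> g) \<in> N}"
      using assoc[of _ m] tp.smult_closed[OF _ m] m by auto
    ultimately show ?thesis using A_open by simp
  qed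
  ultimately have "openin (tp.ftop i) ?V" using tp.subspace_open_fine_iff[of i ?V] by blast
  then have "openin PT {f \<in> PS. tr i f \<in> ?V}" by (rule PT_basic)
  moreover have "{f \<in> PS. tr i f \<in> ?V} = {f \<in> PS. f \<otimes>\<^bsub>L\<^esub> g \<in> N}" using trunc tr_TP by blast
  ultimately show ?thesis by simp
qed

text \<open>Continuity of the coefficient maps, tested on subspaces. At \<open>j = 0\<close> it
  allows the constant term to be split off continuously.\<close>

lemma coefficient_subspace_open:
  assumes N: "Asub N" "openin T N"
  shows "Lsub {h \<in> carrier L. h j \<in> N}" "openin Ltop {h \<in> carrier L. h j \<in> N}"
proof -
  note Nd = AsubD[OF N(1)]
  show sub: "Lsub {h \<in> carrier L. h j \<in> N}"
    unfolding subspace_def additive_def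
  proof (intro conjI ballI)
    show "\<zero>\<^bsub>self_module L\<^esub> \<in> {h \<in> carrier L. h j \<in> N}" using L.zero_closed Nd(2) by simp
    fix x assume x: "x \<in> {h \<in> carrier L. h j \<in> N}"
    show "\<ominus>\<^bsub>self_module L\<^esub> x \<in> {h \<in> carrier L. h j \<in> N}" using x L.a_inv_closed[of x] Nd(4) by (auto simp: L_minus)
    show "x \<oplus>\<^bsub>self_module L\<^esub> y \<in> {h \<in> carrier L. h j \<in> N}" if "y \<in> {h \<in> carrier L. h j \<in> N}" for y
      using x that L.a_closed[of x y] Nd(3) by auto
    fix c assume c: "c \<in> carrier k"
    show "\<kappa> (\<iota> c) \<odot>\<^bsub>self_module L\<^esub> x \<in> {h \<in> carrier L. h j \<in> N}"
      using x L.m_closed[OF \<kappa>_closed[OF \<iota>_closed[OF c]], of x] \<kappa>_mult_coeff[OF \<iota>_closed[OF c], of x j] Nd(5)[OF _ c] by simp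
  qed auto
  show "openin Ltop {h \<in> carrier L. h j \<in> N}"
    unfolding LT_open_iff[OF sub]
  proof
    fix g assume g: "g \<in> carrier L"
    \<comment> \<open>Since \<open>g\<close> has no terms below degree \<open>M\<close>, coefficient
      \<open>j\<close> of \<open>f g\<close> involves \<open>f\<close> only up to degree
      \<open>j - M\<close>. This fixes the truncation.\<close>
    obtain M where M: "\<forall>i<M. g i = \<zero>\<^bsub>A\<^esub>" using L_bounded g by blast
    show "openin PT {f \<in> PS. f \<otimes>\<^bsub>L\<^esub> g \<in> {h \<in> carrier L. h j \<in> N}}"
    proof (rule TP_preimage_open[OF sub g, of "nat (j - M)"])
      fix m assume m: "m \<in> carrier L"
      have "{a \<in> carrier A. \<kappa> a \<otimes>\<^bsub>L\<^esub> m \<in> {h \<in> carrier L. h j \<in> N}} = {a \<in> carrier A. a \<otimes>\<^bsub>A\<^esub> m j \<in> N}"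
        using m \<kappa>_mult_coeff[OF _ m, of _ j] L.m_closed[OF \<kappa>_closed m] by auto
      then show "openin T {a \<in> carrier A. \<kappa> a \<otimes>\<^bsub>L\<^esub> m \<in> {h \<in> carrier L. h j \<in> N}}"
        using T_mult[OF L_coeff[OF m] N(2)] by simp
    next
      fix f assume f: "f \<in> PS"
      have tL: "tr (nat (j - M)) f \<in> carrier L" using tr_TP[OF f, of "nat (j - M)"] PS_L by auto
      have "(f \<otimes>\<^bsub>L\<^esub> g) j = (tr (nat (j - M)) f \<otimes>\<^bsub>L\<^esub> g) j"
        by (rule laurent_mult_cong[OF A_near PS_L[OF f] tL g M]) (auto simp: truncate_series_def)
      then show "f \<otimes>\<^bsub>L\<^esub> g \<in> {h \<in> carrier L. h j \<in> N} \<longleftrightarrow>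
          tr (nat (j - M)) f \<otimes>\<^bsub>L\<^esub> g \<in> {h \<in> carrier L. h j \<in> N}"
        using L.m_closed[OF PS_L[OF f] g] L.m_closed[OF tL g] by simp
    qed
  qed
qed

lemma coefficient_open:
  assumes "openin T U"
  shows "openin Ltop {h \<in> carrier L. h j \<in> U}"
proof -
  have ab: "abelian_group (self_module L)" "abelian_group (self_module A)"
    using module_self[OF L.is_cring] module_self[OF A.is_cring] by (simp_all add: module_def)
  have "continuous_map Ltop T (\<lambda>h. h j)"
  proof (rule additive_continuousI[OF ab _ T_linear])
    show "openin Ltop {x \<in> carrier (self_module L). x j \<in> N}" if "Asub N" "openin T N" for N
      using coefficient_subspace_open(2)[OF that] by simp
  qed (use LT_topspace LT_linear L_coeff in \<open>auto simp: k_linear_topology_def\<close>)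
  from openin_continuous_map_preimage[OF this assms] show ?thesis unfolding LT_topspace .
qed

text \<open>
  Changing the lifting: a power series \<open>u(a)\<close> depending continuously on \<open>a\<close> splits as
  \<open>s(u(a)\<^sub>0) + t u'(a)\<close>, so what is known about \<open>s\<close> passes to \<open>u\<close> modulo every power of \<open>t\<close>.
\<close>

context
  fixes s :: "'a \<Rightarrow> int \<Rightarrow> 'a" and W
  assumes s_PS: "a \<in> carrier A \<Longrightarrow> s a \<in> PS" and s_0: "a \<in> carrier A \<Longrightarrow> s a 0 = a"
    and s_add: "a \<in> carrier A \<Longrightarrow> b \<in> carrier A \<Longrightarrow> s (a \<oplus>\<^bsub>A\<^esub> b) = s a \<oplus>\<^bsub>L\<^esub> s b"
    and s_k: "a \<in> carrier A \<Longrightarrow> c \<in> carrier k \<Longrightarrow> s (\<iota> c \<otimes>\<^bsub>A\<^esub> a) = \<kappa> (\<iota> c) \<otimes>\<^bsub>L\<^esub> s a"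
    and s_cont: "\<And>N. Lsub N \<Longrightarrow> openin Ltop N \<Longrightarrow> openin T {a \<in> carrier A. s a \<in> N}"
    and W: "Lsub W"
    and W_bounded: "m \<in> carrier L \<Longrightarrow> \<exists>r::nat. \<forall>u\<in>PS. (\<forall>i<int r. u i = \<zero>\<^bsub>A\<^esub>) \<longrightarrow> u \<otimes>\<^bsub>L\<^esub> m \<in> W"
    and W_s: "m \<in> carrier L \<Longrightarrow> openin T {a \<in> carrier A. s a \<otimes>\<^bsub>L\<^esub> m \<in> W}"
begin

lemma A_abelian: "abelian_group (self_module A)"
  using module_self[OF A.is_cring] by (simp add: module_def)

lemma additive_L_vimage:
  assumes "\<And>a. a \<in> carrier A \<Longrightarrow> u a \<in> carrier L"
    "\<And>a b. a \<in> carrier A \<Longrightarrow> b \<in> carrier A \<Longrightarrow> u (a \<oplus>\<^bsub>A\<^esub> b) = u a \<oplus>\<^bsub>L\<^esub> u b" "additive (self_module L) N"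
  shows "additive (self_module A) {a \<in> carrier A. u a \<in> N}"
proof -
  have "abelian_group (self_module L)" using module_self[OF L.is_cring] by (simp add: module_def)
  from additive_vimage(4)[OF A_abelian this, of u N] assms show ?thesis by simp
qed

lemma additive_A_openI:
  assumes "additive (self_module A) N" "openin T U" "\<zero>\<^bsub>A\<^esub> \<in> U" "U \<subseteq> N"
  shows "openin T N"
  by (rule additive_openI[OF A_abelian assms(1), of T U]) (use T_top T_translate assms in auto)

lemma s_zero: "s \<zero>\<^bsub>A\<^esub> = \<zero>\<^bsub>L\<^esub>"
proof -
  have c: "s \<zero>\<^bsub>A\<^esub> \<in> carrier L" using s_PS PS_L by simp
  have "s \<zero>\<^bsub>A\<^esub> \<oplus>\<^bsub>L\<^esub> s \<zero>\<^bsub>A\<^esub> = s \<zero>\<^bsub>A\<^esub>" using s_add[of "\<zero>\<^bsub>A\<^esub>" "\<zero>\<^bsub>A\<^esub>"] by (simp del: laurent_simps)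
  then show ?thesis using c L.add.r_cancel_one' by metis
qed

lemma s_sub:
  assumes m: "m \<in> carrier L" and N: "Lsub N"
  shows "Asub {a \<in> carrier A. s a \<otimes>\<^bsub>L\<^esub> m \<in> N}"
  unfolding subspace_def
proof (intro conjI ballI)
  note Nd = LsubD[OF N]
  have sL: "s a \<in> carrier L" if "a \<in> carrier A" for a using s_PS PS_L that by blast
  show "additive (self_module A) {a \<in> carrier A. s a \<otimes>\<^bsub>L\<^esub> m \<in> N}"
    by (rule additive_L_vimage) (use sL m N s_add L.l_distr in \<open>auto simp: subspace_def simp del: laurent_simps\<close>)
  fix c a assume c: "c \<in> carrier k" and a: "a \<in> {a \<in> carrier A. s a \<otimes>\<^bsub>L\<^esub> m \<in> N}"
  have "s (\<iota> c \<otimes>\<^bsub>A\<^esub> a) \<otimes>\<^bsub>L\<^esub> m = \<kappa> (\<iota> c) \<otimes>\<^bsub>L\<^esub> (s a \<otimes>\<^bsub>L\<^esub> m)"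
    using a c s_k sL m \<kappa>_closed \<iota>_closed by (simp add: L.m_assoc)
  then show "\<iota> c \<odot>\<^bsub>self_module A\<^esub> a \<in> {a \<in> carrier A. s a \<otimes>\<^bsub>L\<^esub> m \<in> N}"
    using a c Nd(5) \<iota>_closed by simp
qed

lemma lifting_change:
  assumes u_PS: "\<And>a. a \<in> carrier A \<Longrightarrow> u a \<in> PS"
    and u_add: "\<And>a b. a \<in> carrier A \<Longrightarrow> b \<in> carrier A \<Longrightarrow> u (a \<oplus>\<^bsub>A\<^esub> b) = u a \<oplus>\<^bsub>L\<^esub> u b"
    and u_cont: "\<And>N. Lsub N \<Longrightarrow> openin Ltop N \<Longrightarrow> openin T {a \<in> carrier A. u a \<in> N}"
    and m: "m \<in> carrier L" and r: "\<forall>v\<in>PS. (\<forall>i<int r. v i = \<zero>\<^bsub>A\<^esub>) \<longrightarrow> v \<otimes>\<^bsub>L\<^esub> m \<in> W"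
  shows "openin T {a \<in> carrier A. u a \<otimes>\<^bsub>L\<^esub> m \<in> W}"
  using assms
proof (induction r arbitrary: u m)
  case 0
  have "u a \<otimes>\<^bsub>L\<^esub> m \<in> W" if "a \<in> carrier A" for a
    using "0.prems"(5) "0.prems"(1)[OF that] by (simp add: PS_iff)
  then have "{a \<in> carrier A. u a \<otimes>\<^bsub>L\<^esub> m \<in> W} = topspace T" using T_top by auto
  then show ?case by (simp only: openin_topspace)
next
  case (Suc r)
  note Wd = LsubD[OF W]
  note u_PS = Suc.prems(1) and u_add = Suc.prems(2) and u_cont = Suc.prems(3) and m = Suc.prems(4)
  have sL: "s a \<in> carrier L" if "a \<in> carrier A" for a using s_PS PS_L that by blast
  have uL: "u a \<in> carrier L" "u a 0 \<in> carrier A" if "a \<in> carrier A" for a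
    using u_PS[OF that] PS_L L_coeff by auto
  \<comment> \<open>The remainder after subtracting the lifted constant term, divided by
    \<open>t\<close>. It is again an additive continuous family of power series, so the induction
    hypothesis applies to it.\<close>
  define u' where "u' a = tt (- 1) \<otimes>\<^bsub>L\<^esub> (u a \<ominus>\<^bsub>L\<^esub> s (u a 0))" for a
  have dL: "u a \<ominus>\<^bsub>L\<^esub> s (u a 0) \<in> carrier L" if "a \<in> carrier A" for a using uL[OF that] sL by simp
  have u'_PS: "u' a \<in> PS" if a: "a \<in> carrier A" for a
    unfolding u'_def
  proof (rule tt_factor(1)[OF dL[OF a]], intro allI impI)
    fix i :: int assume "i < 1"
    then show "(u a \<ominus>\<^bsub>L\<^esub> s (u a 0)) i = \<zero>\<^bsub>A\<^esub>"
      using L_diff[OF uL(1)[OF a] sL[OF uL(2)[OF a]], of i] s_0[OF uL(2)[OF a]] uL[OF a] u_PS[OF a] s_PS[OF uL(2)[OF a]]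
      by (cases "i = 0") (auto simp: PS_iff a_minus_def A.r_neg)
  qed
  have split: "u a = s (u a 0) \<oplus>\<^bsub>L\<^esub> tt 1 \<otimes>\<^bsub>L\<^esub> u' a" if a: "a \<in> carrier A" for a
  proof -
    have "tt 1 \<otimes>\<^bsub>L\<^esub> u' a = u a \<ominus>\<^bsub>L\<^esub> s (u a 0)" unfolding u'_def using tt_cancel[OF dL[OF a], of 1] by simp
    then show ?thesis
      using uL(1)[OF a] sL[OF uL(2)[OF a]] L.a_lcomm[of "s (u a 0)" "u a" "\<ominus>\<^bsub>L\<^esub> s (u a 0)"]
      by (simp add: a_minus_def L.r_neg del: laurent_simps)
  qed
  have su_add: "s (u (a \<oplus>\<^bsub>A\<^esub> b) 0) = s (u a 0) \<oplus>\<^bsub>L\<^esub> s (u b 0)" if "a \<in> carrier A" "b \<in> carrier A" for a b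
    using u_add[OF that] s_add[OF uL(2)[OF that(1)] uL(2)[OF that(2)]] by simp
  have u'_add: "u' (a \<oplus>\<^bsub>A\<^esub> b) = u' a \<oplus>\<^bsub>L\<^esub> u' b" if ab: "a \<in> carrier A" "b \<in> carrier A" for a b
  proof -
    have "u (a \<oplus>\<^bsub>A\<^esub> b) \<ominus>\<^bsub>L\<^esub> s (u (a \<oplus>\<^bsub>A\<^esub> b) 0) = (u a \<ominus>\<^bsub>L\<^esub> s (u a 0)) \<oplus>\<^bsub>L\<^esub> (u b \<ominus>\<^bsub>L\<^esub> s (u b 0))"
      unfolding su_add[OF ab] a_minus_def unfolding u_add[OF ab]
      using uL(1)[OF ab(1)] uL(1)[OF ab(2)] sL[OF uL(2)[OF ab(1)]] sL[OF uL(2)[OF ab(2)]]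
      by (simp add: L.minus_add L.a_ac del: laurent_simps)
    then show ?thesis unfolding u'_def using L.r_distr[OF dL[OF ab(1)] dL[OF ab(2)] tt_closed] by (simp del: laurent_simps)
  qed
  \<comment> \<open>The map \<open>a |-> u a 0\<close> is continuous, being \<open>u\<close>
    followed by a coefficient map. An open condition on \<open>s\<close> at a point therefore stays
    open with \<open>u a 0\<close> as that point.\<close>
  have su_open: "openin T {a \<in> carrier A. s (u a 0) \<otimes>\<^bsub>L\<^esub> m' \<in> N}"
    if N: "Lsub N" and m': "m' \<in> carrier L" and op: "openin T {a \<in> carrier A. s a \<otimes>\<^bsub>L\<^esub> m' \<in> N}" for N m'
  proof -
    note B = coefficient_subspace_open[OF s_sub[OF m' N] op, of 0]
    have "{a \<in> carrier A. u a \<in> {h \<in> carrier L. h 0 \<in> {a \<in> carrier A. s a \<otimes>\<^bsub>L\<^esub> m' \<in> N}}}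
        = {a \<in> carrier A. s (u a 0) \<otimes>\<^bsub>L\<^esub> m' \<in> N}" using uL by auto
    then show ?thesis using u_cont[OF B] by simp
  qed
  have u'_cont: "openin T {a \<in> carrier A. u' a \<in> N}" if N: "Lsub N" "openin Ltop N" for N
  proof -
    let ?N = "{h \<in> carrier L. tt (- 1) \<otimes>\<^bsub>L\<^esub> h \<in> N}"
    note N' = LT_mult_subspace[OF N tt_closed, of "- 1"]
    note Nd = LsubD[OF N'(1)]
    have "openin T {a \<in> carrier A. s (u a 0) \<otimes>\<^bsub>L\<^esub> \<one>\<^bsub>L\<^esub> \<in> ?N}"
    proof (rule su_open[OF N'(1) L.one_closed])
      have "{a \<in> carrier A. s a \<otimes>\<^bsub>L\<^esub> \<one>\<^bsub>L\<^esub> \<in> ?N} = {a \<in> carrier A. s a \<in> ?N}"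
        by (intro Collect_cong conj_cong refl) (simp only: L.r_one[OF sL])
      then show "openin T {a \<in> carrier A. s a \<otimes>\<^bsub>L\<^esub> \<one>\<^bsub>L\<^esub> \<in> ?N}" using s_cont[OF N'] by simp
    qed
    moreover have "{a \<in> carrier A. s (u a 0) \<otimes>\<^bsub>L\<^esub> \<one>\<^bsub>L\<^esub> \<in> ?N} = {a \<in> carrier A. s (u a 0) \<in> ?N}"
      by (intro Collect_cong conj_cong refl) (simp only: L.r_one[OF sL[OF uL(2)]])
    ultimately have su: "openin T {a \<in> carrier A. s (u a 0) \<in> ?N}" by (simp only:)
    have op: "openin T ({a \<in> carrier A. u a \<in> ?N} \<inter> {a \<in> carrier A. s (u a 0) \<in> ?N})"
      by (rule openin_Int[OF u_cont[OF N'] su])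
    have ad: "additive (self_module A) {a \<in> carrier A. u' a \<in> N}"
      by (rule additive_L_vimage) (use u'_PS PS_L u'_add N(1) in \<open>auto simp: subspace_def simp del: laurent_simps\<close>)
    have sb: "u' a \<in> N" if "a \<in> carrier A" "u a \<in> ?N" "s (u a 0) \<in> ?N" for a
      using Nd(3)[OF that(2) Nd(4)[OF that(3)]] unfolding u'_def a_minus_def by blast
    have z0: "\<zero>\<^bsub>A\<^esub> \<in> {a \<in> carrier A. u a \<in> ?N} \<inter> {a \<in> carrier A. s (u a 0) \<in> ?N}"
    proof -
      have c: "u \<zero>\<^bsub>A\<^esub> \<in> carrier L" using uL by simp
      have "u \<zero>\<^bsub>A\<^esub> \<oplus>\<^bsub>L\<^esub> u \<zero>\<^bsub>A\<^esub> = u \<zero>\<^bsub>A\<^esub>" using u_add[of "\<zero>\<^bsub>A\<^esub>" "\<zero>\<^bsub>A\<^esub>"] by (simp del: laurent_simps)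
      then have z: "u \<zero>\<^bsub>A\<^esub> = \<zero>\<^bsub>L\<^esub>" using c L.add.r_cancel_one' by metis
      then have "s (u \<zero>\<^bsub>A\<^esub> 0) = \<zero>\<^bsub>L\<^esub>" using s_zero by simp
      then show ?thesis using z Nd(2) by (simp del: laurent_simps)
    qed
    show ?thesis by (rule additive_A_openI[OF ad op z0]) (use sb in blast)
  qed
  \<comment> \<open>The factor \<open>t\<close> is moved from the series to the vector. For
    \<open>t m\<close> one power of \<open>t\<close> less is needed to land in \<open>W\<close>,
    which lowers \<open>r\<close>.\<close>
  have "openin T {a \<in> carrier A. u' a \<otimes>\<^bsub>L\<^esub> (tt 1 \<otimes>\<^bsub>L\<^esub> m) \<in> W}"
  proof (rule Suc.IH[OF u'_PS u'_add u'_cont])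
    show "tt 1 \<otimes>\<^bsub>L\<^esub> m \<in> carrier L" using tt_closed m by simp
    show "\<forall>v\<in>PS. (\<forall>i<int r. v i = \<zero>\<^bsub>A\<^esub>) \<longrightarrow> v \<otimes>\<^bsub>L\<^esub> (tt 1 \<otimes>\<^bsub>L\<^esub> m) \<in> W"
    proof (intro ballI impI)
      fix v assume v: "v \<in> PS" "\<forall>i<int r. v i = \<zero>\<^bsub>A\<^esub>"
      have vL: "v \<in> carrier L" using v PS_L by blast
      have tv: "tt 1 \<otimes>\<^bsub>L\<^esub> v \<in> PS" using subringE(6)[OF PS_subring tt_PS v(1)] by simp
      have "(tt 1 \<otimes>\<^bsub>L\<^esub> v) \<otimes>\<^bsub>L\<^esub> m \<in> W"
        using Suc.prems(5) tv v(2) by (auto simp: tt_mult[OF vL])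
      then show "v \<otimes>\<^bsub>L\<^esub> (tt 1 \<otimes>\<^bsub>L\<^esub> m) \<in> W" using vL m tt_closed by (simp add: L.m_ac)
    qed
  qed
  then have op: "openin T ({a \<in> carrier A. s (u a 0) \<otimes>\<^bsub>L\<^esub> m \<in> W} \<inter> {a \<in> carrier A. u' a \<otimes>\<^bsub>L\<^esub> (tt 1 \<otimes>\<^bsub>L\<^esub> m) \<in> W})"
    by (intro openin_Int su_open[OF W m W_s[OF m]])
  have ad: "additive (self_module A) {a \<in> carrier A. u a \<otimes>\<^bsub>L\<^esub> m \<in> W}"
    by (rule additive_L_vimage) (use uL m u_add W L.l_distr in \<open>auto simp: subspace_def simp del: laurent_simps\<close>)
  have sb: "u a \<otimes>\<^bsub>L\<^esub> m \<in> W"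
    if "a \<in> carrier A" "s (u a 0) \<otimes>\<^bsub>L\<^esub> m \<in> W" "u' a \<otimes>\<^bsub>L\<^esub> (tt 1 \<otimes>\<^bsub>L\<^esub> m) \<in> W" for a
  proof -
    have c: "s (u a 0) \<in> carrier L" "u' a \<in> carrier L" using that(1) uL sL u'_PS PS_L by auto
    have "u a \<otimes>\<^bsub>L\<^esub> m = (s (u a 0) \<oplus>\<^bsub>L\<^esub> tt 1 \<otimes>\<^bsub>L\<^esub> u' a) \<otimes>\<^bsub>L\<^esub> m" using split[OF that(1)] by simp
    also have "\<dots> = s (u a 0) \<otimes>\<^bsub>L\<^esub> m \<oplus>\<^bsub>L\<^esub> u' a \<otimes>\<^bsub>L\<^esub> (tt 1 \<otimes>\<^bsub>L\<^esub> m)"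
    proof -
      have "tt 1 \<otimes>\<^bsub>L\<^esub> u' a \<otimes>\<^bsub>L\<^esub> m = u' a \<otimes>\<^bsub>L\<^esub> (tt 1 \<otimes>\<^bsub>L\<^esub> m)"
        using c(2) m tt_closed by (simp add: L.m_ac)
      then show ?thesis using c m tt_closed by (simp add: L.l_distr del: laurent_simps)
    qed
    finally show ?thesis using Wd(3)[OF that(2,3)] by simp
  qed
  have z0: "\<zero>\<^bsub>A\<^esub> \<in> {a \<in> carrier A. s (u a 0) \<otimes>\<^bsub>L\<^esub> m \<in> W} \<inter> {a \<in> carrier A. u' a \<otimes>\<^bsub>L\<^esub> (tt 1 \<otimes>\<^bsub>L\<^esub> m) \<in> W}"
  proof -
    have c: "u \<zero>\<^bsub>A\<^esub> \<in> carrier L" "u' \<zero>\<^bsub>A\<^esub> \<in> carrier L" using uL u'_PS PS_L by auto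
    have "u \<zero>\<^bsub>A\<^esub> \<oplus>\<^bsub>L\<^esub> u \<zero>\<^bsub>A\<^esub> = u \<zero>\<^bsub>A\<^esub>" "u' \<zero>\<^bsub>A\<^esub> \<oplus>\<^bsub>L\<^esub> u' \<zero>\<^bsub>A\<^esub> = u' \<zero>\<^bsub>A\<^esub>"
      using u_add[of "\<zero>\<^bsub>A\<^esub>" "\<zero>\<^bsub>A\<^esub>"] u'_add[of "\<zero>\<^bsub>A\<^esub>" "\<zero>\<^bsub>A\<^esub>"] by (simp_all del: laurent_simps)
    then have z: "u \<zero>\<^bsub>A\<^esub> = \<zero>\<^bsub>L\<^esub>" "u' \<zero>\<^bsub>A\<^esub> = \<zero>\<^bsub>L\<^esub>" using c L.add.r_cancel_one' by metis+
    then have "s (u \<zero>\<^bsub>A\<^esub> 0) = \<zero>\<^bsub>L\<^esub>" using s_zero by simp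
    moreover have "tt 1 \<otimes>\<^bsub>L\<^esub> m \<in> carrier L" using tt_closed m by simp
    ultimately show ?thesis using z Wd(2) L.l_null m by (simp del: laurent_simps)
  qed
  show ?case by (rule additive_A_openI[OF ad op z0]) (use sb in blast)
qed

text \<open>Here the given lifting \<open>s\<close> is exchanged for the constant series:
  \<open>lifting_change\<close> with \<open>u = \<kappa>\<close> makes \<open>W\<close> open along
  lines of constants. As \<open>W\<close> contains the products with \<open>g\<close> of all series
  divisible by \<open>t^r\<close>, membership of \<open>f g\<close> depends on a truncation of
  \<open>f\<close>.\<close>

lemma lifting_open: "openin Ltop W"
  unfolding LT_open_iff[OF W]
proof
  fix g assume g: "g \<in> carrier L"
  obtain r :: nat where r: "\<forall>u\<in>PS. (\<forall>i<int r. u i = \<zero>\<^bsub>A\<^esub>) \<longrightarrow> u \<otimes>\<^bsub>L\<^esub> g \<in> W" using W_bounded[OF g] by blast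
  note Wd = LsubD[OF W]
  show "openin PT {f \<in> PS. f \<otimes>\<^bsub>L\<^esub> g \<in> W}"
  proof (rule TP_preimage_open[OF W g, of r])
    fix m assume m: "m \<in> carrier L"
    obtain r' :: nat where r': "\<forall>u\<in>PS. (\<forall>i<int r'. u i = \<zero>\<^bsub>A\<^esub>) \<longrightarrow> u \<otimes>\<^bsub>L\<^esub> m \<in> W" using W_bounded[OF m] by blast
    show "openin T {a \<in> carrier A. \<kappa> a \<otimes>\<^bsub>L\<^esub> m \<in> W}"
    proof (rule lifting_change[OF \<kappa>_PS ring_hom_add[OF \<kappa>_hom] _ m r'])
      show "openin T {a \<in> carrier A. \<kappa> a \<in> N}" if "openin Ltop N" for N
        using openin_continuous_map_preimage[OF const_continuous that] by (simp add: T_top)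
    qed
  next
    fix f assume f: "f \<in> PS"
    have c: "f \<in> carrier L" "tr r f \<in> PS" "tr r f \<in> carrier L" using f tr_TP[OF f, of r] PS_L by auto
    have "f \<ominus>\<^bsub>L\<^esub> tr r f \<in> PS" using subringE(5,7)[OF PS_subring] f c(2) unfolding a_minus_def by blast
    moreover have "(f \<ominus>\<^bsub>L\<^esub> tr r f) i = \<zero>\<^bsub>A\<^esub>" if "i < int r" for i
      using that L_coeff[OF c(1)] unfolding L_diff[OF c(1,3)] by (simp add: truncate_series_def a_minus_def A.r_neg)
    ultimately have d: "(f \<ominus>\<^bsub>L\<^esub> tr r f) \<otimes>\<^bsub>L\<^esub> g \<in> W" using r by blast
    have e: "(f \<ominus>\<^bsub>L\<^esub> tr r f) \<otimes>\<^bsub>L\<^esub> g = f \<otimes>\<^bsub>L\<^esub> g \<ominus>\<^bsub>L\<^esub> tr r f \<otimes>\<^bsub>L\<^esub> g"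
      using c(1,3) g by (simp add: a_minus_def L.l_distr L.l_minus del: laurent_simps)
    have x: "f \<otimes>\<^bsub>L\<^esub> g \<in> carrier L" and y: "tr r f \<otimes>\<^bsub>L\<^esub> g \<in> carrier L" using c g by auto
    show "f \<otimes>\<^bsub>L\<^esub> g \<in> W \<longleftrightarrow> tr r f \<otimes>\<^bsub>L\<^esub> g \<in> W"
    proof
      assume h: "tr r f \<otimes>\<^bsub>L\<^esub> g \<in> W"
      have "(f \<otimes>\<^bsub>L\<^esub> g \<ominus>\<^bsub>L\<^esub> tr r f \<otimes>\<^bsub>L\<^esub> g) \<oplus>\<^bsub>L\<^esub> tr r f \<otimes>\<^bsub>L\<^esub> g = f \<otimes>\<^bsub>L\<^esub> g"
        using L.add.inv_solve_right[of "f \<otimes>\<^bsub>L\<^esub> g"] x y unfolding a_minus_def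
        by (metis L.a_assoc L.add.inv_closed L.l_neg L.r_zero)
      then show "f \<otimes>\<^bsub>L\<^esub> g \<in> W" using Wd(3)[OF d[unfolded e] h] by simp
    next
      assume h: "f \<otimes>\<^bsub>L\<^esub> g \<in> W"
      have "f \<otimes>\<^bsub>L\<^esub> g \<ominus>\<^bsub>L\<^esub> (f \<otimes>\<^bsub>L\<^esub> g \<ominus>\<^bsub>L\<^esub> tr r f \<otimes>\<^bsub>L\<^esub> g) = tr r f \<otimes>\<^bsub>L\<^esub> g"
        using x y unfolding a_minus_def by (metis L.a_assoc L.add.inv_closed L.l_zero L.minus_add L.minus_minus L.r_neg)
      moreover have "f \<otimes>\<^bsub>L\<^esub> g \<ominus>\<^bsub>L\<^esub> (f \<otimes>\<^bsub>L\<^esub> g \<ominus>\<^bsub>L\<^esub> tr r f \<otimes>\<^bsub>L\<^esub> g) \<in> W"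
        using Wd(3)[OF h Wd(4)[OF d[unfolded e]]] unfolding a_minus_def .
      ultimately show "tr r f \<otimes>\<^bsub>L\<^esub> g \<in> W" by simp
    qed
  qed
qed

end

end

section \<open>Topologies on the iterated Laurent series rings\<close>

lemma topspace_quotient_topology: "topspace (quotient_topology h Y) = h ` topspace Y"
proof
  show "topspace (quotient_topology h Y) \<subseteq> h ` topspace Y"
    using openin_topspace[of "quotient_topology h Y"] unfolding openin_quotient_topology by blast
  have "{x \<in> topspace Y. h x \<in> h ` topspace Y} = topspace Y" by auto
  then have "openin (quotient_topology h Y) (h ` topspace Y)" unfolding openin_quotient_topology by simp
  then show "h ` topspace Y \<subseteq> topspace (quotient_topology h Y)" by (rule openin_subset)
qed

lemma quotient_topology_homeomorphic:
  assumes "inj_on h (topspace Y)"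
  shows "homeomorphic_map Y (quotient_topology h Y) h"
proof (rule bijective_open_imp_homeomorphic_map)
  show "continuous_map Y (quotient_topology h Y) h"
    unfolding continuous_map_def topspace_quotient_topology openin_quotient_topology by auto
  show "open_map Y (quotient_topology h Y) h"
    unfolding open_map_def openin_quotient_topology
  proof (intro allI impI conjI)
    fix U assume U: "openin Y U"
    then have "U \<subseteq> topspace Y" by (rule openin_subset)
    then have "{x \<in> topspace Y. h x \<in> h ` U} = U" using assms by (auto dest: inj_onD)
    then show "openin Y {x \<in> topspace Y. h x \<in> h ` U}" using U by simp
    show "h ` U \<subseteq> h ` topspace Y" using \<open>U \<subseteq> topspace Y\<close> by blast
  qed
qed (simp_all add: assms topspace_quotient_topology)

text \<open>What the Laurent construction needs of the coefficient ring and gives back for the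
  series ring; the invariant of its iteration.\<close>

definition st_topology :: "'k ring \<Rightarrow> ('k \<Rightarrow> 'a) \<Rightarrow> 'a ring \<Rightarrow> 'a topology \<Rightarrow> bool" where
  "st_topology k \<iota> A T \<longleftrightarrow> k_linear_topology k \<iota> (self_module A) T \<and>
     (\<forall>a\<in>carrier A. \<forall>U. openin T U \<longrightarrow> openin T {b \<in> carrier A. b \<otimes>\<^bsub>A\<^esub> a \<in> U})"

lemma st_topology_image_ring:
  assumes R: "cring R" and inj: "inj_on h (carrier R)" and st: "st_topology k i R Y"
    and i: "\<And>c. c \<in> carrier k \<Longrightarrow> i c \<in> carrier R"
  shows "st_topology k (\<lambda>c. h (i c)) (image_ring h R) (quotient_topology h Y)"
proof -
  interpret cring R by fact
  let ?B = "image_ring h R" let ?Q = "quotient_topology h Y"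
  have inv: "inv_into (carrier R) h (h x) = x" if "x \<in> carrier R" for x using inj that by simp
  have carr: "carrier ?B = h ` carrier R" by (rule image_ring_carrier)
  have zero: "\<zero>\<^bsub>?B\<^esub> = h \<zero>\<^bsub>R\<^esub>" by (rule image_ring_zero)
  have add: "h x \<oplus>\<^bsub>?B\<^esub> h y = h (x \<oplus>\<^bsub>R\<^esub> y)" "h x \<otimes>\<^bsub>?B\<^esub> h y = h (x \<otimes>\<^bsub>R\<^esub> y)"
    if "x \<in> carrier R" "y \<in> carrier R" for x y
    using that inv by (auto simp: image_ring_def image_group_def monoid.defs)
  interpret B: ring ?B by (rule inj_imp_image_ring_is_ring[OF inj])
  have minus: "\<ominus>\<^bsub>?B\<^esub> h x = h (\<ominus>\<^bsub>R\<^esub> x)" if "x \<in> carrier R" for x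
    by (rule B.minus_equality) (use that add[of "\<ominus>\<^bsub>R\<^esub> x" x] carr zero in \<open>auto simp: l_neg\<close>)
  have top: "topspace Y = carrier R" using st by (simp add: st_topology_def k_linear_topology_def)
  have op: "openin ?Q U \<longleftrightarrow> U \<subseteq> carrier ?B \<and> openin Y {x \<in> carrier R. h x \<in> U}" for U
    unfolding openin_quotient_topology top carr ..
  have tr: "openin Y {y \<in> carrier R. x \<oplus>\<^bsub>R\<^esub> y \<in> U}" if "x \<in> carrier R" "openin Y U" for x U
    using st that by (simp add: st_topology_def k_linear_topology_def)
  have mu: "openin Y {b \<in> carrier R. b \<otimes>\<^bsub>R\<^esub> x \<in> U}" if "x \<in> carrier R" "openin Y U" for x U
    using st that by (simp add: st_topology_def)
  have basis: "\<exists>N. subspace k i (self_module R) N \<and> openin Y N \<and> N \<subseteq> U" if "openin Y U" "\<zero>\<^bsub>R\<^esub> \<in> U" for U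
    using st that by (simp add: st_topology_def k_linear_topology_def)
  have "openin ?Q {y \<in> carrier ?B. x \<oplus>\<^bsub>?B\<^esub> y \<in> U}" if x: "x \<in> carrier ?B" and U: "openin ?Q U" for x U
  proof -
    obtain x0 where x0: "x0 \<in> carrier R" "x = h x0" using x carr by auto
    have "{z \<in> carrier R. h z \<in> {y \<in> carrier ?B. x \<oplus>\<^bsub>?B\<^esub> y \<in> U}} =
        {z \<in> carrier R. x0 \<oplus>\<^bsub>R\<^esub> z \<in> {w \<in> carrier R. h w \<in> U}}"
      using x0 by (auto simp: carr add dest!: inj_onD[OF inj])
    then show ?thesis using tr[OF x0(1), of "{w \<in> carrier R. h w \<in> U}"] U unfolding op by auto
  qed
  moreover have "openin ?Q {y \<in> carrier ?B. y \<otimes>\<^bsub>?B\<^esub> x \<in> U}" if x: "x \<in> carrier ?B" and U: "openin ?Q U" for x U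
  proof -
    obtain x0 where x0: "x0 \<in> carrier R" "x = h x0" using x carr by auto
    have "{z \<in> carrier R. h z \<in> {y \<in> carrier ?B. y \<otimes>\<^bsub>?B\<^esub> x \<in> U}} =
        {z \<in> carrier R. z \<otimes>\<^bsub>R\<^esub> x0 \<in> {w \<in> carrier R. h w \<in> U}}"
      using x0 by (auto simp: carr add dest!: inj_onD[OF inj])
    then show ?thesis using mu[OF x0(1), of "{w \<in> carrier R. h w \<in> U}"] U unfolding op by auto
  qed
  moreover have "\<exists>N. subspace k (\<lambda>c. h (i c)) (self_module ?B) N \<and> openin ?Q N \<and> N \<subseteq> U"
    if U: "openin ?Q U" "\<zero>\<^bsub>?B\<^esub> \<in> U" for U
  proof -
    obtain N where N: "subspace k i (self_module R) N" "openin Y N" "N \<subseteq> {x \<in> carrier R. h x \<in> U}"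
      using basis[of "{x \<in> carrier R. h x \<in> U}"] U zero unfolding op by auto
    have NR: "N \<subseteq> carrier R" using N(3) by auto
    have "subspace k (\<lambda>c. h (i c)) (self_module ?B) (h ` N)"
      using N(1) i NR unfolding subspace_def additive_def
      by (auto simp: carr zero add minus subset_eq)
    moreover have "{x \<in> carrier R. h x \<in> h ` N} = N" using NR inj by (auto dest: inj_onD)
    then have "openin ?Q (h ` N)" using N(2) NR unfolding op carr by auto
    ultimately show ?thesis using N(3) by blast
  qed
  moreover have "topspace ?Q = carrier ?B" by (simp add: topspace_quotient_topology top carr)
  ultimately show ?thesis unfolding st_topology_def k_linear_topology_def by simp
qed

lemma st_topology_discrete:
  assumes "cring R" "\<And>c. c \<in> carrier k \<Longrightarrow> i c \<in> carrier R"
  shows "st_topology k i R (discrete_topology (carrier R))"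
proof -
  interpret cring R by fact
  have "subspace k i (self_module R) {\<zero>\<^bsub>R\<^esub>}" using assms(2) by (auto simp: subspace_def additive_def)
  then show ?thesis
    unfolding st_topology_def k_linear_topology_def by (auto intro!: exI[of _ "{\<zero>\<^bsub>R\<^esub>}"])
qed

context laurent_top
begin

lemma st_topology_laurent: "st_topology k (\<lambda>c. \<kappa> (\<iota> c)) L Ltop"
  unfolding st_topology_def using LT_linear LT_mult by blast

end

lemma laurent_std_field: "field F \<Longrightarrow> field (std_field (Suc n) F) \<Longrightarrow> field (laurent (std_field n F))"
  by (rule field_transfer[OF laurent_near_ring[OF near_ring_std_field], where B = "std_field (Suc n) F" and h = Series])
    (auto intro!: inj_imp_image_ring_iso simp: inj_on_def)

text \<open>The field property is handed inwards layer by layer, starting from the outermost ring,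
  which is isomorphic to the local field.\<close>

lemma std_field_step:
  assumes "field F" "field (std_field (Suc n) F)"
  shows "field (std_field n F)"
  by (rule field_laurent_imp_field[OF near_ring_std_field[OF assms(1)] laurent_std_field[OF assms]])

lemma std_st_topology:
  assumes "cring k" "field F" "i \<in> ring_hom k F" "field (std_field n F)"
  shows "std_structure n F i \<in> ring_hom k (std_field n F) \<and>
    st_topology k (std_structure n F i) (std_field n F) (std_topology n k F i)"
  using assms(4)
proof (induction n)
  case 0
  interpret F: field F by fact
  have inj: "inj_on Coeff (carrier F)" by (simp add: inj_on_def)
  have ic: "i c \<in> carrier F" if "c \<in> carrier k" for c using assms(3) that by (auto simp: ring_hom_def)
  have C: "Coeff \<in> ring_hom F (image_ring Coeff F)"
    using inj_imp_image_ring_iso[OF inj] by (simp add: ring_iso_def)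
  have "(\<lambda>c. Coeff (i c)) \<in> ring_hom k (image_ring Coeff F)"
    using ring_hom_trans[OF assms(3) C] by (simp add: comp_def)
  then show ?case
    using st_topology_image_ring[OF F.is_cring inj st_topology_discrete[where k = k and i = i, OF F.is_cring ic]] ic by simp
next
  case (Suc n)
  let ?A = "std_field n F"
  have L: "field (laurent ?A)" by (rule laurent_std_field[OF assms(2) Suc.prems])
  have A: "field ?A" by (rule std_field_step[OF assms(2) Suc.prems])
  note IH = Suc.IH[OF A]
  interpret laurent_top k "std_structure n F i" ?A "std_topology n k F i"
    by (rule laurent_top.intro) (use assms(1) A L IH in \<open>auto simp: st_topology_def\<close>)
  interpret L: field "laurent ?A" by (rule L)
  have inj: "inj_on Series (carrier (laurent ?A))" by (simp add: inj_on_def)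
  have S: "Series \<in> ring_hom (laurent ?A) (image_ring Series (laurent ?A))"
    using inj_imp_image_ring_iso[OF inj] by (simp add: ring_iso_def)
  have "(\<lambda>c. Series (\<kappa> (std_structure n F i c))) \<in> ring_hom k (image_ring Series (laurent ?A))"
    using ring_hom_trans[OF \<kappa>\<iota>_hom S] by (simp add: comp_def)
  then show ?case
    using st_topology_image_ring[OF L.is_cring inj st_topology_laurent] \<kappa>_closed \<iota>_closed by simp
qed

section \<open>One layer of a local field parametrized by Laurent series\<close>

locale laurent_chart = lifted_dvr K D p k1 rm s + lt: laurent_top k j A TA
  for K :: "'a ring" (structure) and D p k1 rm s and k :: "'k ring" and j :: "'k \<Rightarrow> 'c" and A :: "'c ring" and TA +
  fixes \<iota> :: "'k \<Rightarrow> 'a" and T :: "'a topology" and h :: "(int \<Rightarrow> 'c) \<Rightarrow> 'a"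
  assumes h_iso: "h \<in> ring_iso (laurent A) K"
    and h_homeo: "homeomorphic_map (laurent_topology k j A TA) T h"
    and h_D: "h ` power_series A = D"
    and h_k: "c \<in> carrier k \<Longrightarrow> h (const_series A (j c)) = \<iota> c"
    and \<iota>_D: "c \<in> carrier k \<Longrightarrow> \<iota> c \<in> D"
    and s_k: "c \<in> carrier k \<Longrightarrow> s (rm (\<iota> c)) = \<iota> c"
begin

abbreviation "L \<equiv> laurent A"
abbreviation "PS \<equiv> power_series A"
abbreviation "\<kappa> \<equiv> const_series A"
abbreviation "Ltop \<equiv> laurent_topology k j A TA"
abbreviation "Tr \<equiv> quotient_topology rm (subtopology T D)"

interpretation A: field A by (rule lt.A_field)
interpretation L: field L by (rule lt.L_field)
interpretation k1: field k1 by (rule residue_is_field)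

lemma h_hom: "h \<in> ring_hom L K" using h_iso by (simp add: ring_iso_def)
lemma h_bij: "bij_betw h (carrier L) (carrier K)" using h_iso by (simp add: ring_iso_def)
lemma h_inj: "u \<in> carrier L \<Longrightarrow> v \<in> carrier L \<Longrightarrow> h u = h v \<Longrightarrow> u = v"
  using h_bij by (auto simp: bij_betw_def dest: inj_onD)
lemmas h_simps = ring_hom_closed[OF h_hom] ring_hom_mult[OF h_hom] ring_hom_add[OF h_hom] ring_hom_one[OF h_hom]
lemma h_surj: "x \<in> carrier K \<Longrightarrow> \<exists>u\<in>carrier L. x = h u"
  using h_bij by (auto simp: bij_betw_def)
lemma h_zero: "h \<zero>\<^bsub>L\<^esub> = \<zero>"
  by (rule ring_hom_zero[OF h_hom L.ring_axioms]) (rule ring_axioms)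
lemma h_mem_D: "u \<in> carrier L \<Longrightarrow> h u \<in> D \<longleftrightarrow> u \<in> PS"
  using h_D h_inj lt.PS_L by blast

lemma T_top: "topspace T = carrier K"
  using homeomorphic_imp_surjective_map[OF h_homeo] h_bij lt.LT_topspace by (simp add: bij_betw_def)

lemma h_vimage_open: "openin T U \<Longrightarrow> openin Ltop {u \<in> carrier L. h u \<in> U}"
  using openin_continuous_map_preimage[OF homeomorphic_imp_continuous_map[OF h_homeo]] lt.LT_topspace by simp

lemma h_image_open: "openin Ltop U \<Longrightarrow> openin T (h ` U)"
  using homeomorphic_imp_open_map[OF h_homeo] by (simp add: open_map_def)

text \<open>The map on residue fields induced by \<open>h\<close>, with \<open>A\<close> embedded as
  constants. It is the map that \<open>respects_valuation_rings\<close> uses at the next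
  layer.\<close>

definition g :: "'c \<Rightarrow> 'a" where "g a = rm (h (\<kappa> a))"

lemma h\<kappa>_D: "a \<in> carrier A \<Longrightarrow> h (\<kappa> a) \<in> D"
  using lt.\<kappa>_PS h_D by blast

lemma g_hom: "g \<in> ring_hom A k1"
proof -
  note \<kappa> = ring_hom_mult[OF lt.\<kappa>_hom] ring_hom_add[OF lt.\<kappa>_hom] ring_hom_one[OF lt.\<kappa>_hom]
  show ?thesis
    unfolding g_def[abs_def]
    by (rule ring_hom_memI)
      (simp_all add: h\<kappa>_D rm_closed \<kappa> h_simps lt.\<kappa>_closed rm_mult rm_add rm_one del: laurent_simps)
qed

text \<open>The variable \<open>t\<close> is not assumed to become a uniformizer. If its image were
  a unit of \<open>D\<close>, the inverse would come from a power series \<open>w\<close> with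
  \<open>t w = 1\<close>, whose coefficient at \<open>-1\<close> would have to be
  \<open>1\<close>.\<close>

lemma rm_ht: "rm (h (lt.tt 1)) = \<zero>\<^bsub>k1\<^esub>"
proof (rule ccontr)
  assume n: "rm (h (lt.tt 1)) \<noteq> \<zero>\<^bsub>k1\<^esub>"
  have tL: "lt.tt 1 \<in> carrier L" by (rule lt.tt_closed)
  have t: "h (lt.tt 1) \<in> D" using lt.tt_PS[of 1] h_D by auto
  have "h (lt.tt 1) \<noteq> \<zero>" using n rm_zero by auto
  then obtain i :: nat and u where u: "u \<in> D" "u \<noteq> \<zero>" "inv u \<in> D" "h (lt.tt 1) = p [^] i \<otimes> u"
    using uniformizer[OF t] by blast
  have "i = 0"
  proof (rule ccontr)
    assume "i \<noteq> 0"
    then obtain i' where i: "i = Suc i'" by (cases i) auto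
    have "h (lt.tt 1) = p \<otimes> (p [^] i' \<otimes> u)" using u(1,4) D_sub i by (simp add: m_ac)
    then show False using n rm_p_mult[of "p [^] i' \<otimes> u"] D_mult[OF p_pow_D u(1)] by simp
  qed
  then have hu: "h (lt.tt 1) = u" using u D_sub by simp
  obtain w where w: "w \<in> PS" "inv u = h w" using u(3) h_D by blast
  have "u \<in> Units K" using u(1,2) D_sub by (simp add: field_Units)
  then have uu: "u \<otimes> inv u = \<one>" by (rule Units_r_inv)
  have wL: "w \<in> carrier L" by (rule lt.PS_L[OF w(1)])
  have "h (lt.tt 1 \<otimes>\<^bsub>L\<^esub> w) = h (lt.tt 1) \<otimes> h w" by (rule h_simps(2)[OF tL wL])
  also have "\<dots> = u \<otimes> inv u" unfolding hu w(2) ..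
  also have "\<dots> = h \<one>\<^bsub>L\<^esub>" unfolding uu by (rule h_simps(4)[symmetric])
  finally have "lt.tt 1 \<otimes>\<^bsub>L\<^esub> w = \<one>\<^bsub>L\<^esub>" by (rule h_inj[OF L.m_closed[OF tL wL] L.one_closed])
  then have "w (- 1) = \<one>\<^bsub>A\<^esub>" 
    using fun_cong[OF lt.tt_mult[OF wL, of 1], of 0] by simp
  then show False using w(1) lt.PS_iff A.zero_not_one by auto
qed

text \<open>A power series is its constant term plus a multiple of \<open>t\<close>, and the image
  of \<open>t\<close> has residue zero.\<close>

lemma rm_h: "u \<in> PS \<Longrightarrow> rm (h u) = g (u 0)"
proof -
  assume u: "u \<in> PS"
  have uL: "u \<in> carrier L" and u0: "u 0 \<in> carrier A" using u lt.PS_L lt.L_coeff by auto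
  have \<kappa>: "\<kappa> (u 0) \<in> carrier L" by (rule lt.\<kappa>_closed[OF u0])
  let ?d = "u \<ominus>\<^bsub>L\<^esub> \<kappa> (u 0)"
  let ?w = "lt.tt (- 1) \<otimes>\<^bsub>L\<^esub> ?d"
  have d: "?d \<in> carrier L" using uL \<kappa> by simp
  have "?d i = \<zero>\<^bsub>A\<^esub>" if "i < 1" for i
    unfolding lt.L_diff[OF uL \<kappa>] using that u u0 by (cases "i = 0") (auto simp: const_series_def lt.PS_iff a_minus_def lt.A_r_neg)
  then have w: "?w \<in> PS" "?d = lt.tt 1 \<otimes>\<^bsub>L\<^esub> ?w" using lt.tt_factor[OF d, of 1] by auto
  have "u = \<kappa> (u 0) \<oplus>\<^bsub>L\<^esub> ?d"
    using uL \<kappa> L.a_lcomm[of "\<kappa> (u 0)" u "\<ominus>\<^bsub>L\<^esub> \<kappa> (u 0)"] by (simp add: a_minus_def L.r_neg del: laurent_simps)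
  then have "h u = h (\<kappa> (u 0)) \<oplus> h (lt.tt 1) \<otimes> h ?w"
    using w uL \<kappa> d lt.PS_L[OF w(1)] lt.tt_closed[of 1] h_simps by metis
  moreover have "h (lt.tt 1) \<in> D" "h ?w \<in> D" using lt.tt_PS[of 1] w(1) h_D by auto
  ultimately have "rm (h u) = g (u 0) \<oplus>\<^bsub>k1\<^esub> \<zero>\<^bsub>k1\<^esub> \<otimes>\<^bsub>k1\<^esub> rm (h ?w)"
    using h\<kappa>_D[OF u0] D_mult by (simp add: rm_add rm_mult rm_ht g_def)
  then show ?thesis using rm_closed \<open>h ?w \<in> D\<close> ring_hom_closed[OF g_hom u0] by simp
qed

lemma rm_surj: "b \<in> carrier k1 \<Longrightarrow> \<exists>u\<in>PS. b = rm (h u)"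
  using s_section s_D h_D by (metis imageE)

lemma g_iso: "g \<in> ring_iso A k1"
proof -
  have "inj_on g (carrier A)"
  proof (rule inj_onI)
    fix a b assume ab: "a \<in> carrier A" "b \<in> carrier A" "g a = g b"
    interpret g: ring_hom_ring A k1 g
      by (rule ring_hom_ringI2[OF lt.A_ring k1.ring_axioms g_hom])
    let ?c = "a \<ominus>\<^bsub>A\<^esub> b"
    have c: "?c \<in> carrier A" using ab by simp
    have gc: "g ?c = \<zero>\<^bsub>k1\<^esub>" using ab by (simp add: a_minus_def k1.r_neg)
    have "?c = \<zero>\<^bsub>A\<^esub>"
    proof (rule ccontr)
      assume "?c \<noteq> \<zero>\<^bsub>A\<^esub>"
      then have i: "inv\<^bsub>A\<^esub> ?c \<in> carrier A" "?c \<otimes>\<^bsub>A\<^esub> inv\<^bsub>A\<^esub> ?c = \<one>\<^bsub>A\<^esub>" using c A.field_Units by auto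
      then have "g ?c \<otimes>\<^bsub>k1\<^esub> g (inv\<^bsub>A\<^esub> ?c) = \<one>\<^bsub>k1\<^esub>" using g.hom_mult[OF c i(1)] g.hom_one by simp
      then show False using gc g.hom_closed[OF i(1)] k1.zero_not_one by simp
    qed
    then show "a = b" using ab by simp
  qed
  moreover have "g ` carrier A = carrier k1"
  proof
    show "g ` carrier A \<subseteq> carrier k1" using ring_hom_closed[OF g_hom] by blast
    show "carrier k1 \<subseteq> g ` carrier A"
    proof
      fix b assume "b \<in> carrier k1"
      then obtain u where u: "u \<in> PS" "b = rm (h u)" using rm_surj by blast
      then show "b \<in> g ` carrier A" using rm_h[OF u(1)] lt.L_coeff lt.PS_L by blast
    qed
  qed
  ultimately show ?thesis using g_hom by (simp add: ring_iso_def bij_betw_def)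
qed

lemma D_top: "topspace (subtopology T D) = D"
  using T_top D_sub by auto

lemma Tr_top: "topspace Tr = carrier k1"
  unfolding topspace_quotient_topology D_top using rm_closed s_section s_D by (metis image_subsetI subsetI subset_antisym imageI)

lemma openin_Tr: "openin Tr U \<longleftrightarrow> U \<subseteq> carrier k1 \<and> (\<exists>W. openin T W \<and> {x \<in> D. rm x \<in> U} = W \<inter> D)"
  unfolding openin_quotient_topology D_top Tr_top[unfolded topspace_quotient_topology D_top] openin_subtopology by auto

lemma TA_top: "topspace TA = carrier A" by (rule lt.T_top)

lemma g_homeo: "homeomorphic_map TA Tr g"
proof (rule bijective_open_imp_homeomorphic_map)
  have g: "inj_on g (carrier A)" "g ` carrier A = carrier k1" using g_iso by (auto simp: ring_iso_def bij_betw_def)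
  then show "g ` topspace TA = topspace Tr" "inj_on g (topspace TA)" by (simp_all add: TA_top Tr_top)
  show "continuous_map TA Tr g"
    unfolding continuous_map_def TA_top Tr_top
  proof (intro conjI allI impI)
    show "g \<in> carrier A \<rightarrow> carrier k1" using ring_hom_closed[OF g_hom] by blast
    fix U assume "openin Tr U"
    then obtain W where W: "openin T W" "{x \<in> D. rm x \<in> U} = W \<inter> D" unfolding openin_Tr by blast
    have "openin TA {a \<in> carrier A. \<kappa> a \<in> {u \<in> carrier L. h u \<in> W}}"
      using openin_continuous_map_preimage[OF lt.const_continuous h_vimage_open[OF W(1)]] by (simp add: TA_top)
    moreover have "{a \<in> carrier A. \<kappa> a \<in> {u \<in> carrier L. h u \<in> W}} = {a \<in> carrier A. g a \<in> U}"
      using W(2) h\<kappa>_D lt.\<kappa>_closed by (auto simp: g_def)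
    ultimately show "openin TA {a \<in> carrier A. g a \<in> U}" by simp
  qed
  show "open_map TA Tr g"
    unfolding open_map_def
  proof (intro allI impI)
    fix V assume V: "openin TA V"
    have VA: "V \<subseteq> carrier A" using openin_subset[OF V] TA_top by simp
    let ?W = "h ` {u \<in> carrier L. u 0 \<in> V}"
    have "openin T ?W" by (rule h_image_open[OF lt.coefficient_open[OF V]])
    moreover have "{x \<in> D. rm x \<in> g ` V} = ?W \<inter> D"
    proof (intro subset_antisym subsetI)
      fix x assume x: "x \<in> {x \<in> D. rm x \<in> g ` V}"
      then obtain u where u: "u \<in> PS" "x = h u" using h_D by blast
      then have "g (u 0) \<in> g ` V" using x rm_h by simp
      then have "u 0 \<in> V" using g(1) VA lt.L_coeff lt.PS_L u(1) by (auto dest!: inj_onD)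
      then show "x \<in> ?W \<inter> D" using x u lt.PS_L by blast
    next
      fix x assume x: "x \<in> ?W \<inter> D"
      then obtain u where u: "u \<in> carrier L" "u 0 \<in> V" "x = h u" by blast
      then have "u \<in> PS" using x h_mem_D by blast
      then show "x \<in> {x \<in> D. rm x \<in> g ` V}" using u x rm_h by auto
    qed
    ultimately show "openin Tr (g ` V)" unfolding openin_Tr using VA ring_hom_closed[OF g_hom] by blast
  qed
qed

lemma open_zero_nbhd:
  assumes W: "openin T W" "\<zero> \<in> W"
  shows "\<exists>c\<in>D - {\<zero>}. \<forall>x\<in>D. c \<otimes> x \<in> W"
proof -
  have "openin (power_series_topology k j A TA) {f \<in> PS. f \<in> {u \<in> carrier L. h u \<in> W}}"
    by (rule lt.PS_LT[OF h_vimage_open[OF W(1)]])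
  moreover have "\<zero>\<^bsub>L\<^esub> \<in> {f \<in> PS. f \<in> {u \<in> carrier L. h u \<in> W}}"
    using subringE(2)[OF lt.PS_subring] L.zero_closed h_zero W(2) by (simp del: laurent_simps)
  ultimately obtain r where r: "\<And>f. f \<in> PS \<Longrightarrow> (\<forall>i<r. f i = \<zero>\<^bsub>A\<^esub>) \<Longrightarrow> h f \<in> W"
    using lt.PT_agree by (metis (no_types, lifting) laurent_simps(1) mem_Collect_eq)
  \<comment> \<open>The exponent from \<open>PT_agree\<close> may be negative; the maximum with
    \<open>0\<close> keeps \<open>t^n\<close> a power series.\<close>
  define n where "n = max r 0"
  have tn: "lt.tt n \<in> carrier L" "lt.tt n \<in> PS" using lt.tt_closed lt.tt_PS n_def by auto
  show ?thesis
  proof (intro bexI ballI)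
    have "h (lt.tt n) \<noteq> \<zero>" using lt.tt_nonzero h_inj[OF tn(1) L.zero_closed] h_zero by metis
    then show "h (lt.tt n) \<in> D - {\<zero>}" using tn h_D by blast
    fix x assume "x \<in> D"
    then obtain v where v: "v \<in> PS" "x = h v" using h_D by blast
    have "lt.tt n \<otimes>\<^bsub>L\<^esub> v \<in> PS" by (rule subringE(6)[OF lt.PS_subring tn(2) v(1)])
    moreover have "(lt.tt n \<otimes>\<^bsub>L\<^esub> v) i = \<zero>\<^bsub>A\<^esub>" if "i < r" for i
      using that v(1) n_def by (simp add: lt.tt_mult[OF lt.PS_L[OF v(1)]] lt.PS_iff)
    ultimately have "h (lt.tt n \<otimes>\<^bsub>L\<^esub> v) \<in> W" using r by blast
    then show "h (lt.tt n) \<otimes> x \<in> W" using v tn lt.PS_L by (simp add: h_simps)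
  qed
qed

lemma section_open:
  assumes s_cont: "continuous_map Tr (subtopology T D) s"
    and W: "subspace k \<iota> (self_module K) W"
    and W_bounded: "\<And>m. m \<in> carrier K \<Longrightarrow> \<exists>c\<in>D - {\<zero>}. \<forall>x\<in>D. c \<otimes> x \<otimes> m \<in> W"
    and W_s: "\<And>m. m \<in> carrier K \<Longrightarrow> openin TA {a \<in> carrier A. s (g a) \<otimes> m \<in> W}"
  shows "openin T W"
proof -
  let ?hi = "inv_into (carrier L) h"
  have hi: "?hi x \<in> carrier L" "h (?hi x) = x" if "x \<in> carrier K" for x
    using h_bij that by (auto simp: bij_betw_def inv_into_into f_inv_into_f)
  have hi_h: "?hi (h u) = u" if "u \<in> carrier L" for u using h_bij that by (simp add: bij_betw_def)
  \<comment> \<open>The lifting written in the chart: a coefficient goes to the residue field by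
    \<open>g\<close>, is lifted by \<open>s\<close>, and is expanded as a series.\<close>
  define \<sigma> where "\<sigma> a = ?hi (s (g a))" for a
  have gk: "g a \<in> carrier k1" if "a \<in> carrier A" for a using ring_hom_closed[OF g_hom that] .
  have \<sigma>L: "\<sigma> a \<in> carrier L" "h (\<sigma> a) = s (g a)" if "a \<in> carrier A" for a
    using hi[of "s (g a)"] gk[OF that] by (auto simp: \<sigma>_def)
  have \<sigma>PS: "\<sigma> a \<in> PS" if "a \<in> carrier A" for a
    using h_mem_D[OF \<sigma>L(1)[OF that]] \<sigma>L(2)[OF that] s_D[OF gk[OF that]] by simp
  have Wc: "\<zero> \<in> W" "\<And>x. x \<in> W \<Longrightarrow> x \<in> carrier K" "\<And>x y. x \<in> W \<Longrightarrow> y \<in> W \<Longrightarrow> x \<oplus> y \<in> W" "\<And>x. x \<in> W \<Longrightarrow> \<ominus> x \<in> W"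
    "\<And>x c. x \<in> W \<Longrightarrow> c \<in> carrier k \<Longrightarrow> \<iota> c \<otimes> x \<in> W"
    using W by (auto simp: subspace_def additive_def)
  let ?W = "{u \<in> carrier L. h u \<in> W}"
  have h_minus: "h (\<ominus>\<^bsub>L\<^esub> u) = \<ominus> h u" if "u \<in> carrier L" for u
  proof -
    have "h (\<ominus>\<^bsub>L\<^esub> u) \<oplus> h u = \<zero>"
      using that h_zero h_simps(3)[of "\<ominus>\<^bsub>L\<^esub> u" u] by (simp add: L.l_neg del: laurent_simps)
    then show ?thesis using that h_simps(1) minus_equality by simp
  qed
  have jL: "\<kappa> (j c) \<in> carrier L" if "c \<in> carrier k" for c using lt.\<kappa>_closed lt.\<iota>_closed that by blast
  have sub: "lt.Lsub ?W"
    unfolding subspace_def additive_def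
    using Wc L.zero_closed h_zero h_minus jL
    by (auto simp: h_simps h_k simp del: laurent_simps)
  have "openin Ltop ?W"
  proof (rule lt.lifting_open[of \<sigma>])
    fix a assume a: "a \<in> carrier A"
    show "\<sigma> a \<in> PS" by (rule \<sigma>PS[OF a])
    have "g (\<sigma> a 0) = g a" using rm_h[OF \<sigma>PS[OF a]] \<sigma>L(2)[OF a] s_section[OF gk[OF a]] by simp
    then show "\<sigma> a 0 = a"
      using g_iso a lt.L_coeff[OF \<sigma>L(1)[OF a]] by (auto simp: ring_iso_def bij_betw_def dest: inj_onD)
    show "\<sigma> (a \<oplus>\<^bsub>A\<^esub> b) = \<sigma> a \<oplus>\<^bsub>L\<^esub> \<sigma> b" if b: "b \<in> carrier A" for b
      by (rule h_inj)
        (use a b \<sigma>L gk ring_hom_add[OF g_hom a b] in \<open>simp_all add: h_simps s_add del: laurent_simps\<close>)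
    show "\<sigma> (j c \<otimes>\<^bsub>A\<^esub> a) = \<kappa> (j c) \<otimes>\<^bsub>L\<^esub> \<sigma> a" if c: "c \<in> carrier k" for c
    proof (rule h_inj)
      have jc: "j c \<in> carrier A" by (rule lt.\<iota>_closed[OF c])
      have "g (j c) = rm (\<iota> c)" using h_k[OF c] by (simp add: g_def)
      then have "s (g (j c \<otimes>\<^bsub>A\<^esub> a)) = \<iota> c \<otimes> s (g a)"
        using ring_hom_mult[OF g_hom jc a] s_mult[OF gk[OF jc] gk[OF a]] s_k[OF c] by simp
      then show "h (\<sigma> (j c \<otimes>\<^bsub>A\<^esub> a)) = h (\<kappa> (j c) \<otimes>\<^bsub>L\<^esub> \<sigma> a)"
        using \<sigma>L(2)[of "j c \<otimes>\<^bsub>A\<^esub> a"] jc a jL[OF c] \<sigma>L[OF a] h_k[OF c] by (simp add: h_simps)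
      show "\<sigma> (j c \<otimes>\<^bsub>A\<^esub> a) \<in> carrier L" "\<kappa> (j c) \<otimes>\<^bsub>L\<^esub> \<sigma> a \<in> carrier L"
        using \<sigma>L(1) jc a jL[OF c] by auto
    qed
  next
    fix N assume N: "lt.Lsub N" "openin Ltop N"
    have "openin (subtopology T D) (h ` N \<inter> D)"
      using h_image_open[OF N(2)] by (auto simp: openin_subtopology)
    then have "openin Tr {b \<in> carrier k1. s b \<in> h ` N \<inter> D}"
      using openin_continuous_map_preimage[OF s_cont] unfolding Tr_top by blast
    then have "openin TA {a \<in> carrier A. g a \<in> {b \<in> carrier k1. s b \<in> h ` N \<inter> D}}"
      using openin_continuous_map_preimage[OF homeomorphic_imp_continuous_map[OF g_homeo]] unfolding TA_top by blast
    moreover have "\<sigma> a \<in> N \<longleftrightarrow> s (g a) \<in> h ` N" if a: "a \<in> carrier A" for a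
    proof
      assume "s (g a) \<in> h ` N"
      then obtain u where u: "u \<in> N" "h (\<sigma> a) = h u" using \<sigma>L(2)[OF a] by auto
      then have "\<sigma> a = u" using h_inj[OF \<sigma>L(1)[OF a]] lt.LsubD(1)[OF N(1)] by blast
      then show "\<sigma> a \<in> N" using u by simp
    qed (use \<sigma>L(2)[OF a] in force)
    then have "{a \<in> carrier A. g a \<in> {b \<in> carrier k1. s b \<in> h ` N \<inter> D}} = {a \<in> carrier A. \<sigma> a \<in> N}"
      using gk s_D by auto
    ultimately show "openin TA {a \<in> carrier A. \<sigma> a \<in> N}" by simp
  next
    show "lt.Lsub ?W" by (rule sub)
  next
    fix m assume m: "m \<in> carrier L"
    have hm: "h m \<in> carrier K" using m h_simps by simp
    have "{a \<in> carrier A. \<sigma> a \<otimes>\<^bsub>L\<^esub> m \<in> ?W} = {a \<in> carrier A. s (g a) \<otimes> h m \<in> W}"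
      using m \<sigma>L by (auto simp: h_simps)
    then show "openin TA {a \<in> carrier A. \<sigma> a \<otimes>\<^bsub>L\<^esub> m \<in> ?W}" using W_s[OF hm] by simp
    obtain c where c: "c \<in> D - {\<zero>}" "\<And>x. x \<in> D \<Longrightarrow> c \<otimes> x \<otimes> h m \<in> W" using W_bounded[OF hm] by blast
    then obtain w where w: "w \<in> PS" "c = h w" using h_D by blast
    have wL: "w \<in> carrier L" by (rule lt.PS_L[OF w(1)])
    have "w \<noteq> \<zero>\<^bsub>L\<^esub>" using c w h_zero by auto
    then have iw: "inv\<^bsub>L\<^esub> w \<in> carrier L" "w \<otimes>\<^bsub>L\<^esub> inv\<^bsub>L\<^esub> w = \<one>\<^bsub>L\<^esub>" using wL L.field_Units by auto
    obtain N where N: "\<forall>i<N. (inv\<^bsub>L\<^esub> w) i = \<zero>\<^bsub>A\<^esub>" using lt.L_bounded[OF iw(1)] by blast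
    \<comment> \<open>A bound given by an element \<open>c = h w\<close> of \<open>D\<close> becomes
      a bound by a power of \<open>t\<close>. Since the inverse of \<open>w\<close> has no terms
      below degree \<open>N\<close>, a power series divisible by \<open>t^r\<close> is
      \<open>w\<close> times a power series.\<close>
    define r where "r = nat (- N)"
    have "u \<otimes>\<^bsub>L\<^esub> m \<in> ?W" if u: "u \<in> PS" "\<forall>i<int r. u i = \<zero>\<^bsub>A\<^esub>" for u
    proof -
      have uL: "u \<in> carrier L" by (rule lt.PS_L[OF u(1)])
      let ?x = "u \<otimes>\<^bsub>L\<^esub> inv\<^bsub>L\<^esub> w"
      have x: "?x \<in> PS"
        unfolding lt.PS_iff
      proof (intro conjI allI impI)
        show "?x \<in> carrier L" using uL iw by simp
        show "?x i = \<zero>\<^bsub>A\<^esub>" if "i < 0" for i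
          by (rule laurent_mult_low[OF lt.A_abelian_group u(2) N]) (use that r_def in simp)
      qed
      have "w \<otimes>\<^bsub>L\<^esub> ?x = u"
      proof -
        have "w \<otimes>\<^bsub>L\<^esub> ?x = u \<otimes>\<^bsub>L\<^esub> (w \<otimes>\<^bsub>L\<^esub> inv\<^bsub>L\<^esub> w)" using wL uL iw(1) by (rule L.m_lcomm)
        then show ?thesis unfolding iw(2) using uL L.r_one by (simp del: laurent_simps)
      qed
      then have "h u = c \<otimes> h ?x" using h_simps(2)[OF wL lt.PS_L[OF x]] w(2) by simp
      moreover have "h ?x \<in> D" using x h_D by blast
      ultimately have "h u \<otimes> h m \<in> W" using c(2) by simp
      then show ?thesis using uL m by (simp add: h_simps)
    qed
    then show "\<exists>r::nat. \<forall>u\<in>PS. (\<forall>i<int r. u i = \<zero>\<^bsub>A\<^esub>) \<longrightarrow> u \<otimes>\<^bsub>L\<^esub> m \<in> ?W" by blast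
  qed
  from h_image_open[OF this] have "openin T (h ` ?W)" .
  moreover have "h ` ?W = W" using h_surj Wc(2) by blast
  ultimately show ?thesis by simp
qed

end

section \<open>Open subspaces of a topological local field\<close>

text \<open>The data from the definition of a topological local field, with the coefficient field
  and its structure map as free parameters. They stay the same when the chart is passed down to the
  residue field.\<close>

definition std_chart ::
  "'k ring \<Rightarrow> ('k \<Rightarrow> 'a) \<Rightarrow> 'a ring \<Rightarrow> 'a set list \<Rightarrow> 'a topology \<Rightarrow>
     'c ring \<Rightarrow> ('k \<Rightarrow> 'c) \<Rightarrow> ('c iterated \<Rightarrow> 'a) \<Rightarrow> bool" where
  "std_chart k \<iota> K Ds T F j f \<longleftrightarrow>
     f \<in> ring_iso (std_field (length Ds) F) K \<and>
     (\<forall>c\<in>carrier k. f (std_structure (length Ds) F j c) = \<iota> c) \<and>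
     homeomorphic_map (std_topology (length Ds) k F j) T f \<and> respects_valuation_rings Ds F K f"

lemma std_chart_laurent:
  assumes lift: "lifted k \<iota> K (D # Ds) (s # ss)" and F: "field F" "j \<in> ring_hom k F"
    and f: "std_chart k \<iota> K (D # Ds) T F j f"
    and p: "lifted_dvr K D p (residue_field K D) (residue_map K D) s"
  shows "laurent_chart K D p (residue_field K D) (residue_map K D) s k
    (std_structure (length Ds) F j) (std_field (length Ds) F) (std_topology (length Ds) k F j) \<iota> T (\<lambda>u. f (Series u))"
proof -
  let ?A = "std_field (length Ds) F"
  interpret lifted_dvr K D p "residue_field K D" "residue_map K D" s by (rule p)
  have K: "field K" and k: "cring k" using lifted_field[OF lift] by auto
  have f_iso: "f \<in> ring_iso (std_field (Suc (length Ds)) F) K" using f by (simp add: std_chart_def)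
  have std: "field (std_field (Suc (length Ds)) F)"
    by (rule field_transfer[OF near_ring_std_field[OF F(1)] f_iso K])
  have A: "field ?A" and L: "field (laurent ?A)"
    using std_field_step[OF F(1) std] laurent_std_field[OF F(1) std] by auto
  have st: "std_structure (length Ds) F j \<in> ring_hom k ?A"
    "st_topology k (std_structure (length Ds) F j) ?A (std_topology (length Ds) k F j)"
    using std_st_topology[OF k F A] by auto
  interpret lt: laurent_top k "std_structure (length Ds) F j" ?A "std_topology (length Ds) k F j"
    by (rule laurent_top.intro) (use k A L st in \<open>auto simp: st_topology_def\<close>)
  have inj: "inj_on Series (carrier (laurent ?A))" by (simp add: inj_on_def)
  have iso: "Series \<in> ring_iso (laurent ?A) (std_field (Suc (length Ds)) F)"
    using inj_imp_image_ring_iso[OF inj] by simp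
  have "f \<circ> Series \<in> ring_iso (laurent ?A) K"
    using iso f_iso by (auto simp: ring_iso_def intro: ring_hom_trans bij_betw_trans)
  moreover have "homeomorphic_map lt.Ltop T (f \<circ> Series)"
    by (rule homeomorphic_map_compose[OF quotient_topology_homeomorphic[of Series]])
      (use f in \<open>auto simp: std_chart_def inj_on_def\<close>)
  moreover have "(f \<circ> Series) ` power_series ?A = D"
    using f by (auto simp: std_chart_def Let_def image_comp)
  moreover have "(f \<circ> Series) (const_series ?A (std_structure (length Ds) F j c)) = \<iota> c" if "c \<in> carrier k" for c
    using f that by (simp add: std_chart_def)
  moreover have "\<iota> c \<in> D" "s (residue_map K D (\<iota> c)) = \<iota> c" if "c \<in> carrier k" for c
    using lift that by (auto simp: ring_hom_def)
  ultimately show ?thesis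
    using p lt.laurent_top_axioms by (simp add: laurent_chart_def laurent_chart_axioms_def comp_def)
qed

lemma std_chart_residue:
  assumes lift: "lifted k \<iota> K (D # Ds) (s # ss)" and F: "field F" "j \<in> ring_hom k F"
    and f: "std_chart k \<iota> K (D # Ds) T F j f"
  shows "std_chart k (residue_map K D \<circ> \<iota>) (residue_field K D) Ds (residue_topology K D T) F j
    (\<lambda>a. residue_map K D (f (Series (const_series (std_field (length Ds) F) a))))"
proof -
  obtain p where p: "lifted_dvr K D p (residue_field K D) (residue_map K D) s" using lift by auto
  interpret laurent_chart K D p "residue_field K D" "residue_map K D" s k
    "std_structure (length Ds) F j" "std_field (length Ds) F" "std_topology (length Ds) k F j" \<iota> T "\<lambda>u. f (Series u)"
    by (rule std_chart_laurent[OF assms p])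
  have g: "g = (\<lambda>a. residue_map K D (f (Series (const_series (std_field (length Ds) F) a))))"
    by (simp add: g_def[abs_def])
  have "g (std_structure (length Ds) F j c) = residue_map K D (\<iota> c)" if "c \<in> carrier k" for c
    using h_k[OF that] by (simp add: g_def)
  then show ?thesis
    using g_iso g_homeo f unfolding std_chart_def residue_topology_def g by (simp add: Let_def)
qed

text \<open>The hypothesis asks for openness along every \<open>g\<close> because in this form it
  descends: for the set of all \<open>b\<close> with \<open>s(b) x\<close> in \<open>W\<close>, the
  condition at \<open>c\<close> is the condition on \<open>W\<close> at \<open>s(c) x\<close>,
  pulled back along the continuous lifting.\<close>

lemma open_imp_good:
  assumes "lifted k \<iota> K Ds ss" "system_of_liftings k \<iota> K Ds T ss" "std_chart k \<iota> K Ds T F j f"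
    "field F" "j \<in> ring_hom k F" "\<zero>\<^bsub>K\<^esub> \<in> W"
    "\<And>g. g \<in> carrier K \<Longrightarrow> openin T {a \<in> carrier K. a \<otimes>\<^bsub>K\<^esub> g \<in> W}"
  shows "good K Ds ss W"
  using assms
proof (induction k \<iota> K Ds ss arbitrary: T f W rule: lifted.induct)
  case (2 k \<iota> K D Ds s ss)
  let ?k1 = "residue_field K D" let ?rm = "residue_map K D" let ?Tr = "residue_topology K D T"
  obtain p where p: "lifted_dvr K D p ?k1 ?rm s" using "2.prems"(1) by auto
  interpret laurent_chart K D p ?k1 ?rm s k
    "std_structure (length Ds) F j" "std_field (length Ds) F" "std_topology (length Ds) k F j" \<iota> T "\<lambda>u. f (Series u)"
    by (rule std_chart_laurent[OF "2.prems"(1,4,5,3) p])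
  interpret k1: field ?k1 by (rule residue_is_field)
  have lift: "lifted k (?rm \<circ> \<iota>) ?k1 Ds ss" using "2.prems"(1) by simp
  have sys: "system_of_liftings k (?rm \<circ> \<iota>) ?k1 Ds ?Tr ss"
    and s_cont: "continuous_map ?Tr (subtopology T D) s" using "2.prems"(2) by auto
  note chart = std_chart_residue[OF "2.prems"(1,4,5,3)]
  have top: "topspace ?Tr = carrier ?k1" unfolding residue_topology_def by (rule Tr_top)
  show ?case unfolding good.simps
  proof (intro ballI conjI)
    fix x assume x: "x \<in> carrier K"
    have "\<zero>\<^bsub>K\<^esub> \<in> {a \<in> carrier K. a \<otimes>\<^bsub>K\<^esub> x \<in> W}" using x "2.prems"(6) by simp
    from open_zero_nbhd[OF "2.prems"(7)[OF x] this]
    show "\<exists>c\<in>D - {\<zero>\<^bsub>K\<^esub>}. \<forall>y\<in>D. c \<otimes>\<^bsub>K\<^esub> y \<otimes>\<^bsub>K\<^esub> x \<in> W" by blast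
    show "good ?k1 Ds ss {b \<in> carrier ?k1. s b \<otimes>\<^bsub>K\<^esub> x \<in> W}"
    proof (rule "2.IH"[OF lift sys chart "2.prems"(4,5)])
      show "\<zero>\<^bsub>?k1\<^esub> \<in> {b \<in> carrier ?k1. s b \<otimes>\<^bsub>K\<^esub> x \<in> W}" using x "2.prems"(6) s_zero by simp
      fix c assume c: "c \<in> carrier ?k1"
      let ?U = "{a \<in> carrier K. a \<otimes>\<^bsub>K\<^esub> (s c \<otimes>\<^bsub>K\<^esub> x) \<in> W}"
      have "openin T ?U" using "2.prems"(7) c x by simp
      then have "openin (subtopology T D) (?U \<inter> D)" by (auto simp: openin_subtopology)
      from openin_continuous_map_preimage[OF s_cont this]
      have "openin ?Tr {b \<in> carrier ?k1. s b \<in> ?U \<inter> D}" unfolding top .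
      moreover have "{b \<in> carrier ?k1. s b \<in> ?U \<inter> D}
          = {b \<in> carrier ?k1. b \<otimes>\<^bsub>?k1\<^esub> c \<in> {b \<in> carrier ?k1. s b \<otimes>\<^bsub>K\<^esub> x \<in> W}}"
        using c x s_D by (auto simp: s_mult m_assoc)
      ultimately show "openin ?Tr {b \<in> carrier ?k1. b \<otimes>\<^bsub>?k1\<^esub> c \<in> {b \<in> carrier ?k1. s b \<otimes>\<^bsub>K\<^esub> x \<in> W}}" by simp
    qed
  qed
qed auto

text \<open>In dimension zero the topology is discrete. Otherwise the residual sets are good
  subspaces of the residue field, open by induction, and \<open>g\<close> carries this to the
  coefficient field, where \<open>section_open\<close> asks for it.\<close>

lemma good_imp_open:
  assumes "lifted k \<iota> K Ds ss" "system_of_liftings k \<iota> K Ds T ss" "std_chart k \<iota> K Ds T F j f"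
    "field F" "j \<in> ring_hom k F" "subspace k \<iota> (self_module K) W" "good K Ds ss W"
  shows "openin T W"
  using assms
proof (induction k \<iota> K Ds ss arbitrary: T f W rule: lifted.induct)
  case (1 k \<iota> K)
  have f: "f \<in> ring_iso (std_field 0 F) K" "homeomorphic_map (std_topology 0 k F j) T f"
    using "1.prems"(3) by (auto simp: std_chart_def)
  have "carrier K = f ` carrier (std_field 0 F)" using f(1) by (simp add: ring_iso_def bij_betw_def)
  then have W: "W \<subseteq> f ` Coeff ` carrier F"
    using "1.prems"(6) by (simp add: subspace_def additive_def image_ring_carrier)
  let ?U = "{x \<in> Coeff ` carrier F. f x \<in> W}"
  have "openin (std_topology 0 k F j) ?U" by (auto simp: openin_quotient_topology)
  then have "openin T (f ` ?U)" using homeomorphic_imp_open_map[OF f(2)] by (simp add: open_map_def)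
  moreover have "f ` ?U = W" using W by auto
  ultimately show ?case by simp
next
  case (2 k \<iota> K D Ds s ss)
  let ?k1 = "residue_field K D" let ?rm = "residue_map K D" let ?Tr = "residue_topology K D T"
  obtain p where p: "lifted_dvr K D p ?k1 ?rm s" using "2.prems"(1) by auto
  interpret laurent_chart K D p ?k1 ?rm s k
    "std_structure (length Ds) F j" "std_field (length Ds) F" "std_topology (length Ds) k F j" \<iota> T "\<lambda>u. f (Series u)"
    by (rule std_chart_laurent[OF "2.prems"(1,4,5,3) p])
  interpret k1: field ?k1 by (rule residue_is_field)
  have lift: "lifted k (?rm \<circ> \<iota>) ?k1 Ds ss" using "2.prems"(1) by simp
  have sys: "system_of_liftings k (?rm \<circ> \<iota>) ?k1 Ds ?Tr ss"
    and s_cont: "continuous_map ?Tr (subtopology T D) s" using "2.prems"(2) by auto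
  note chart = std_chart_residue[OF "2.prems"(1,4,5,3)]
  show ?case
  proof (rule section_open[OF s_cont[unfolded residue_topology_def] "2.prems"(6)])
    fix m assume m: "m \<in> carrier K"
    show "\<exists>c\<in>D - {\<zero>\<^bsub>K\<^esub>}. \<forall>x\<in>D. c \<otimes>\<^bsub>K\<^esub> x \<otimes>\<^bsub>K\<^esub> m \<in> W" using "2.prems"(7) m by simp
    let ?V = "{b \<in> carrier ?k1. s b \<otimes>\<^bsub>K\<^esub> m \<in> W}"
    have Wc: "\<zero>\<^bsub>K\<^esub> \<in> W" "\<And>x y. x \<in> W \<Longrightarrow> y \<in> W \<Longrightarrow> x \<oplus>\<^bsub>K\<^esub> y \<in> W" "\<And>x. x \<in> W \<Longrightarrow> \<ominus>\<^bsub>K\<^esub> x \<in> W"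
      "\<And>x c. x \<in> W \<Longrightarrow> c \<in> carrier k \<Longrightarrow> \<iota> c \<otimes>\<^bsub>K\<^esub> x \<in> W"
      using "2.prems"(6) by (auto simp: subspace_def additive_def)
    have neg: "s (\<ominus>\<^bsub>?k1\<^esub> b) = \<ominus>\<^bsub>K\<^esub> s b" if "b \<in> carrier ?k1" for b
      using s_add[of "\<ominus>\<^bsub>?k1\<^esub> b" b] that s_zero minus_equality[of "s (\<ominus>\<^bsub>?k1\<^esub> b)" "s b"]
      by (simp add: k1.l_neg)
    have "subspace k (?rm \<circ> \<iota>) (self_module ?k1) ?V"
      unfolding subspace_def additive_def
    proof (intro conjI ballI)
      fix b assume b: "b \<in> ?V"
      show "\<ominus>\<^bsub>self_module ?k1\<^esub> b \<in> ?V" using b m Wc(3) by (auto simp: neg l_minus)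
      show "b \<oplus>\<^bsub>self_module ?k1\<^esub> c \<in> ?V" if "c \<in> ?V" for c
        using b that m Wc(2) by (auto simp: s_add l_distr)
      fix c assume c: "c \<in> carrier k"
      have "s (?rm (\<iota> c) \<otimes>\<^bsub>?k1\<^esub> b) \<otimes>\<^bsub>K\<^esub> m = \<iota> c \<otimes>\<^bsub>K\<^esub> (s b \<otimes>\<^bsub>K\<^esub> m)"
        using b m s_k[OF c] D_sub[OF \<iota>_D[OF c]] rm_closed[OF \<iota>_D[OF c]] by (simp add: s_mult m_assoc)
      then show "(?rm \<circ> \<iota>) c \<odot>\<^bsub>self_module ?k1\<^esub> b \<in> ?V"
        using b c Wc(4) rm_closed[OF \<iota>_D[OF c]] by simp
    qed (use m Wc(1) s_zero in auto)
    moreover have "good ?k1 Ds ss ?V" using "2.prems"(7) m by simp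
    ultimately have "openin ?Tr ?V" by (rule "2.IH"[OF lift sys chart "2.prems"(4,5)])
    from openin_continuous_map_preimage[OF homeomorphic_imp_continuous_map[OF g_homeo]
        this[unfolded residue_topology_def]]
    have "openin (std_topology (length Ds) k F j) {a \<in> carrier (std_field (length Ds) F). g a \<in> ?V}"
      unfolding TA_top .
    moreover have "{a \<in> carrier (std_field (length Ds) F). g a \<in> ?V}
        = {a \<in> carrier (std_field (length Ds) F). s (g a) \<otimes>\<^bsub>K\<^esub> m \<in> W}"
      using ring_hom_closed[OF g_hom] by blast
    ultimately show "openin (std_topology (length Ds) k F j)
        {a \<in> carrier (std_field (length Ds) F). s (g a) \<otimes>\<^bsub>K\<^esub> m \<in> W}" by simp
  qed
qed auto

lemma last_residue_structure_hom:
  assumes "local_field Ds K" "\<iota> \<in> ring_hom k (K\<lparr>carrier := ring_of_integers Ds K\<rparr>)"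
  shows "field (last_residue_field Ds K)"
    "last_residue_structure Ds K \<iota> \<in> ring_hom k (last_residue_field Ds K)"
proof -
  have "field (last_residue_field Ds K) \<and> last_residue_structure Ds K \<iota> \<in> ring_hom k (last_residue_field Ds K)"
    using assms
  proof (induction Ds arbitrary: K \<iota>)
    case Nil then show ?case by simp
  next
    case (Cons D Ds)
    have dvr: "dvr (K\<lparr>carrier := D\<rparr>)" using Cons.prems(1) by (simp add: complete_dvr_def)
    have i: "\<iota> \<in> ring_hom k (K\<lparr>carrier := D\<rparr>)" using Cons.prems(2) by (auto simp: ring_hom_def)
    have "residue_map K D \<circ> \<iota> \<in> ring_hom k (residue_field K D)"
      by (rule ring_hom_trans[OF i residue_map_props(2)[OF dvr]])
    moreover have "residue_map K D (\<iota> c) \<in> ring_of_integers Ds (residue_field K D)" if "c \<in> carrier k" for c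
      using Cons.prems(2) that by (auto simp: ring_hom_def)
    ultimately have "residue_map K D \<circ> \<iota>
        \<in> ring_hom k ((residue_field K D)\<lparr>carrier := ring_of_integers Ds (residue_field K D)\<rparr>)"
      by (auto simp: ring_hom_def)
    then have "field (last_residue_field Ds (residue_field K D)) \<and>
        last_residue_structure Ds (residue_field K D) (residue_map K D \<circ> \<iota>)
          \<in> ring_hom k (last_residue_field Ds (residue_field K D))"
      by (rule Cons.IH[rotated]) (use Cons.prems(1) in simp)
    then show ?case by (simp only: last_residue_field.simps last_residue_structure.simps)
  qed
  then show "field (last_residue_field Ds K)"
    "last_residue_structure Ds K \<iota> \<in> ring_hom k (last_residue_field Ds K)" by auto
qed

lemma diff_filtration_diffop:
  assumes "\<phi> \<in> diff_filtration k \<iota> K T d"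
  shows "diffop k \<iota> K (self_module K) (self_module K) d \<phi>"
  using assms by (induction d arbitrary: \<phi>) (auto simp: End_cont_def)

theorem theorem0p5:
  fixes n :: nat
    and k :: "'k ring"
    and \<iota> :: "'k \<Rightarrow> 'a"
    and K :: "'a ring"
    and Ds :: "'a set list"
    and T :: "'a topology"
    and \<sigma>s :: "('a \<Rightarrow> 'a) list"
  assumes "perfect_field k"
    and "topological_local_field n k \<iota> K Ds T"
    and "system_of_liftings k \<iota> K Ds T \<sigma>s"
  shows "D_cont k \<iota> K T \<subseteq> BT_ring k \<iota> K Ds \<sigma>s \<and> BT_ring k \<iota> K Ds \<sigma>s \<subseteq> End_cont k \<iota> K T"
proof -
  let ?F = "last_residue_field Ds K" and ?j = "last_residue_structure Ds K \<iota>"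
  let ?S = "self_module K"
  have k: "cring k" using assms(1) fieldE(1) unfolding perfect_field_def by blast
  have lf: "length Ds = n" "local_field Ds K" "\<iota> \<in> ring_hom k (K\<lparr>carrier := ring_of_integers Ds K\<rparr>)"
    "st_ring k \<iota> K T"
    and "\<exists>f\<in>ring_iso (std_field n ?F) K. (\<forall>c\<in>carrier k. f (std_structure n ?F ?j c) = \<iota> c) \<and>
      homeomorphic_map (std_topology n k ?F ?j) T f \<and> respects_valuation_rings Ds ?F K f"
    using assms(2) unfolding topological_local_field_def Let_def by auto
  then obtain f where f: "std_chart k \<iota> K Ds T ?F ?j f" unfolding std_chart_def by blast
  have lift: "lifted k \<iota> K Ds \<sigma>s" by (rule local_field_lifted[OF lf(2) assms(3) k lf(3)])
  note F = last_residue_structure_hom[OF lf(2,3)]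
  interpret K: field K using lifted_field(1)[OF lift] .
  have S: "module K ?S" by (rule module_self[OF K.is_cring])
  then have ab: "abelian_group ?S" by (simp add: module_def)
  have i: "\<iota> \<in> ring_hom k K" by (rule lifted_field(2)[OF lift])
  have lin_top: "k_linear_topology k \<iota> ?S T"
    using lf(4) by (intro k_linear_topologyI[OF S k i]) (simp add: st_ring_def)
  then have top: "topspace T = carrier K" by (simp add: k_linear_topology_def)
  have mult: "openin T {a \<in> carrier K. a \<otimes>\<^bsub>K\<^esub> g \<in> U}" if "g \<in> carrier K" "openin T U" for g U
  proof -
    have "continuous_map T T (\<lambda>b. g \<otimes>\<^bsub>K\<^esub> b)" using lf(4) that(1) by (simp add: st_ring_def)
    from openin_continuous_map_preimage[OF this that(2)]
    have "openin T {a \<in> carrier K. g \<otimes>\<^bsub>K\<^esub> a \<in> U}" by (simp add: top)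
    moreover have "{a \<in> carrier K. g \<otimes>\<^bsub>K\<^esub> a \<in> U} = {a \<in> carrier K. a \<otimes>\<^bsub>K\<^esub> g \<in> U}"
      using that(1) by (auto simp: K.m_comm)
    ultimately show ?thesis by simp
  qed
  have good_open: "openin T W" if "subspace k \<iota> ?S W" "good K Ds \<sigma>s W" for W
    by (rule good_imp_open[OF lift assms(3) f F that])
  have open_good: "good K Ds \<sigma>s W" if "openin T W" "\<zero>\<^bsub>K\<^esub> \<in> W" for W
    by (rule open_imp_good[OF lift assms(3) f F that(2)]) (rule mult[OF _ that(1)])
  have fg: "fg_submodule (carrier ?S) K ?S"
  proof -
    have "carrier ?S \<subseteq> N" if "submodule N K ?S" "{\<one>\<^bsub>K\<^esub>} \<subseteq> N" for N
    proof
      fix x assume x: "x \<in> carrier ?S"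
      have "\<forall>a\<in>carrier K. \<forall>y\<in>N. a \<odot>\<^bsub>?S\<^esub> y \<in> N"
        using that(1) unfolding submodule_iff[OF S] by blast
      moreover have "x \<in> carrier K" "\<one>\<^bsub>K\<^esub> \<in> N" using x that(2) by auto
      ultimately have "x \<odot>\<^bsub>?S\<^esub> \<one>\<^bsub>K\<^esub> \<in> N" by blast
      then show "x \<in> N" using x by simp
    qed
    then have "carrier ?S \<subseteq> mspan K ?S {\<one>\<^bsub>K\<^esub>}" unfolding mspan_def by blast
    moreover have "mspan K ?S {\<one>\<^bsub>K\<^esub>} \<subseteq> carrier ?S"
      by (rule mspan_least[OF module.carrier_is_submodule[OF S]]) simp
    ultimately show ?thesis unfolding fg_submodule_def by (intro exI[of _ "{\<one>\<^bsub>K\<^esub>}"]) auto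
  qed
  have "\<phi> \<in> BT_ring k \<iota> K Ds \<sigma>s" if in_D: "\<phi> \<in> D_cont k \<iota> K T" for \<phi>
  proof -
    obtain d where d: "\<phi> \<in> diff_filtration k \<iota> K T d" using in_D unfolding D_cont_def by blast
    have dop: "diffop k \<iota> K ?S ?S d \<phi>" by (rule diff_filtration_diffop[OF d])
    have "pulls_back_good k \<iota> K Ds \<sigma>s ?S ?S \<phi>"
      unfolding pulls_back_good_def
    proof (intro allI impI)
      fix W assume W: "subspace k \<iota> ?S W" "mgood K Ds \<sigma>s ?S W"
      have z: "\<zero>\<^bsub>K\<^esub> \<in> W" using W(1) by (simp add: subspace_def additive_def)
      have oW: "openin T W" using good_open[OF W(1)] W(2) mgood_self[OF lift] by blast
      \<comment> \<open>At index \<open>0\<close> the filtration says nothing about continuity, but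
        then \<open>\<phi>\<close> vanishes and the preimage is everything. From index
        \<open>1\<close> on, continuity is part of the filtration.\<close>
      have "openin T {x \<in> carrier K. \<phi> x \<in> W}"
      proof (cases d)
        case 0
        then have "{x \<in> carrier K. \<phi> x \<in> W} = topspace T" using d z top by auto
        then show ?thesis by (simp only: openin_topspace)
      next
        case (Suc d')
        then have "continuous_map T T \<phi>" using d by (simp add: End_cont_def)
        from openin_continuous_map_preimage[OF this oW] show ?thesis by (simp add: top)
      qed
      moreover have "\<phi> \<zero>\<^bsub>K\<^esub> = \<zero>\<^bsub>K\<^esub>"
      proof (cases d)
        case 0 then show ?thesis using d by simp
      next
        case (Suc d')
        then have "\<phi> \<in> linear_maps k (restrict_scalars \<iota> ?S) (restrict_scalars \<iota> ?S)"
          using d by (simp add: End_cont_def)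
        from linear_map_zero[OF ab ab this] show ?thesis by simp
      qed
      ultimately have "good K Ds \<sigma>s {x \<in> carrier K. \<phi> x \<in> W}" using z by (intro open_good) auto
      then show "mgood K Ds \<sigma>s ?S {x \<in> carrier ?S. \<phi> x \<in> W}" using mgood_self[OF lift] by simp
    qed
    then show ?thesis unfolding BT_ring_def by (rule diffop_BT_operators[OF lift S S fg fg dop])
  qed
  moreover have "\<phi> \<in> End_cont k \<iota> K T" if "\<phi> \<in> BT_ring k \<iota> K Ds \<sigma>s" for \<phi>
  proof -
    have \<phi>: "\<phi> \<in> BT_operators k \<iota> K Ds \<sigma>s ?S ?S" using that by (simp add: BT_ring_def)
    have lin: "\<phi> \<in> linear_maps k (restrict_scalars \<iota> ?S) (restrict_scalars \<iota> ?S)"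
      using \<phi> lift by (cases "(k, \<iota>, K, Ds, \<sigma>s)" rule: lifted.cases) auto
    note lin' = lin[unfolded linear_maps_iff]
    \<comment> \<open>Continuity is tested on open subspaces: open gives good, the operator pulls
      good back to good, and a good subspace is open again.\<close>
    have "continuous_map T T \<phi>"
    proof (rule additive_continuousI[OF ab ab _ lin_top])
      fix N assume N: "subspace k \<iota> ?S N" "openin T N"
      have z: "\<zero>\<^bsub>K\<^esub> \<in> N" and add: "additive ?S N" using N(1) by (auto simp: subspace_def additive_def)
      have "mgood K Ds \<sigma>s ?S N" using open_good[OF N(2) z] mgood_self[OF lift] by blast
      then have "mgood K Ds \<sigma>s ?S {x \<in> carrier ?S. \<phi> x \<in> N}"
        by (rule BT_operators_good[OF lift S S fg fg \<phi> add])
      then have "good K Ds \<sigma>s {x \<in> carrier ?S. \<phi> x \<in> N}" using mgood_self[OF lift] by blast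
      moreover have "subspace k \<iota> ?S {x \<in> carrier ?S. \<phi> x \<in> N}"
        by (rule subspace_vimage[OF ab ab lin N(1)]) (use i in \<open>auto simp: ring_hom_def\<close>)
      ultimately show "openin T {x \<in> carrier ?S. \<phi> x \<in> N}" by (intro good_open)
    qed (use top lin_top lin' in \<open>auto simp: k_linear_topology_def\<close>)
    then show ?thesis using lin by (simp add: End_cont_def)
  qed
  ultimately show ?thesis by blast
qed

end
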